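(* Let $X(t)$, $t\in\mathbb{R}$, be a time-dependent Wigner matrix (real symmetric, $\beta=1$, or Hermitian, $\beta=2$) with height function $H$, and let $c(s,t)=\frac{\beta}{2}\,\mathbb{E}\,Y_1(s)Y_1(t)$. For $\tau\in\mathbb{R}$, $y>0$, $k\in\mathbb{Z}_{\ge 0}$ define the random variable (depending on the large parameter $L>0$, with $Ly\ge 1$) $$M_{\tau,y,k}=\int_{-\infty}^{+\infty}x^k\Bigl(H(L^{1/2}x,Ly,\tau)-\mathbb{E}\,H(L^{1/2}x,Ly,\tau)\Bigr)\,dx .$$ Then as $L\to\infty$ the family $\{M_{\tau,y,k}\}_{\tau\in\mathbb{R},\,y>0,\,k\ge 0}$ converges, in the sense of finite-dimensional distributions, to the family of moments of the generalized Gaussian process $\mathcal{G}_{c(s,t)}$ given by $$\mathcal{M}_{\tau,y,k}=\int_{z\in\mathbb{H},\,|z|^2=y}(x(z))^k\,\mathcal{G}_{c(s,t)}(z;\tau)\,\frac{dx(z)}{dz}\,dz,\qquad x(z)=2\,\mathrm{Re}\,z ,$$ that is, to the jointly Gaussian, zero mean family with covariances $$\mathbb{E}\,\mathcal{M}_{\tau_1,y_1,k_1}\mathcal{M}_{\tau_2,y_2,k_2}=\int_{z\in\mathbb{H},\,|z|^2=y_1}\ \int_{w\in\mathbb{H},\,|w|^2=y_2}(x(z))^{k_1}(x(w))^{k_2}\,C(z,\tau_1;w,\tau_2)\,\frac{dx(z)}{dz}\frac{dx(w)}{dw}\,dz\,dw .$$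
   Context: **Time-dependent Wigner matrices.** Let $\{Z_{ij}(t)\}_{j>i\ge1,\,t\in\mathbb{R}}$ and $\{Y_i(t)\}_{i\ge1,\,t\in\mathbb{R}}$ be two families of stochastic processes (not necessarily Markov) indexed by $t\in\mathbb{R}$, all mutually independent; the processes $Z_{ij}$ are identically distributed, and the processes $Y_i$ are identically distributed. All have zero mean at every time, and for every integer $k\ge1$ the moments $\mathbb{E}|Z_{12}(t)|^k$ and $\mathbb{E}|Y_1(t)|^k$ are bounded uniformly in $t\in\mathbb{R}$. The $Y_i$ are real-valued. *Real symmetric case ($\beta=1$).* The $Z_{ij}$ are real-valued. With $c(s,t)=\frac12\mathbb{E}\,Y_1(s)Y_1(t)$ it is assumed that for all $s,t\in\mathbb{R}$: $c(s,t)\ge0$, $c(t,t)=1$, $\mathbb{E}\,Z_{12}(s)Z_{12}(t)=c(s,t)$, $\mathbb{E}\,Z_{12}(s)^2Z_{12}(t)^2=2c(s,t)^2+1$. *Hermitian case ($\beta=2$).* The $Z_{ij}$ are complex-valued. With $c(s,t)=\mathbb{E}\,Y_1(s)Y_1(t)$ it is assumed that for all $s,t\in\mathbb{R}$: $c(s,t)\ge0$, $c(t,t)=1$, $\mathbb{E}\,Z_{12}(s)Z_{12}(t)=0$, $\mathbb{E}\,Z_{12}(s)\overline{Z_{12}(t)}=c(s,t)$, $\mathbb{E}\,|Z_{12}(s)|^2|Z_{12}(t)|^2=c(s,t)^2+1$. The matrix $X(t)=[X(i,j\mid t)]_{i,j\ge1}$ is defined by $X(i,j\mid t)=\overline{X(j,i\mid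 t)}=Z_{ij}(t)$ for $i<j$ and $X(i,i\mid t)=Y_i(t)$. In both cases $c(s,t)=\frac\beta2\,\mathbb{E}\,Y_1(s)Y_1(t)$. **Height function.** For finite $B\subset\{1,2,\dots\}$, $X_B$ is the $|B|\times|B|$ submatrix of $X$ formed by rows and columns with indices in $B$. For $x\in\mathbb{R}$, $y\ge1$, $t\in\mathbb{R}$, with $[y]$ the integer part of $y$, $$H(x,y,t)=\sqrt{\tfrac{\beta\pi}{2}}\,\cdot\#\{\text{eigenvalues of }X_{\{1,\dots,[y]\}}(t)\text{ that are }\ge x\},$$ eigenvalues counted with multiplicity. **Limiting process.** $\mathbb{H}=\{z\in\mathbb{C}:\mathrm{Im}\,z>0\}$, and for $z,w\in\mathbb{H}$, $s,t\in\mathbb{R}$, $$C(z,s;w,t)=\frac1{2\pi}\ln\left|\frac{c(s,t)\min(|z|^2,|w|^2)-zw}{c(s,t)\min(|z|^2,|w|^2)-z\overline w}\right|\in\mathbb{R}\cup\{+\infty\}.$$ $\mathcal{G}_{c(s,t)}$ denotes the zero mean generalized Gaussian process on $\mathbb{H}\times\mathbb{R}$ with covariance kernel $C$; its integrals over semicircles are understood as the zero mean jointly Gaussian variables whose covariances are obtained by integrating $C$. All semicircles $\{z\in\mathbb{H}:|z|^2=y\}$ are oriented so that $x(z)=2\,\mathrm{Re}\,z$ increases from $-2\sqrt y$ to $2\sqrt y$; thus $\int f(z)\frac{dx(z)}{dz}dz$ means $\int_{-2\sqrt y}^{2\sqrt y}f\,dx$ along the semicircle. *)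

theory Defs
  imports "HOL-Probability.Probability" "Jordan_Normal_Form.Char_Poly"
begin

text \<open>The processes are indexed from 1 and take the time as an argument: \<open>Z i j t\<close> (used only
  for \<open>1 \<le> i < j\<close>) and \<open>Y i t\<close> (used only for \<open>1 \<le> i\<close>). The \<open>Z i j t\<close> are complex valued for
  both values of \<open>\<beta>\<close>; for \<open>\<beta> = 1\<close> they are required to be real.\<close>

definition wigner_entry ::
  "(nat \<Rightarrow> nat \<Rightarrow> real \<Rightarrow> 'a \<Rightarrow> complex) \<Rightarrow> (nat \<Rightarrow> real \<Rightarrow> 'a \<Rightarrow> real) \<Rightarrow>
    nat \<Rightarrow> nat \<Rightarrow> real \<Rightarrow> 'a \<Rightarrow> complex" where
  "wigner_entry Z Y i j t \<omega> =
    (if i < j then Z i j t \<omega> else if j < i then cnj (Z j i t \<omega>) else complex_of_real (Y i t \<omega>))"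

definition wigner_cov ::
  "'a measure \<Rightarrow> nat \<Rightarrow> (nat \<Rightarrow> real \<Rightarrow> 'a \<Rightarrow> real) \<Rightarrow> real \<Rightarrow> real \<Rightarrow> real" where
  "wigner_cov M \<beta> Y s t = real \<beta> / 2 * (LINT \<omega>|M. Y 1 s \<omega> * Y 1 t \<omega>)"

text \<open>Independence and equality in law are those of whole processes, that is, of random elements
  of the product space of paths. The path of \<open>wigner_entry Z Y i j\<close> is that of \<open>Z i j\<close> if
  \<open>i < j\<close> and that of \<open>Y i\<close> if \<open>i = j\<close>, so \<open>indep\<close> concerns exactly the two given families.\<close>

locale time_dependent_wigner = prob_space M for M :: "'a measure" +
  fixes \<beta> :: nat
    and Z :: "nat \<Rightarrow> nat \<Rightarrow> real \<Rightarrow> 'a \<Rightarrow> complex"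
    and Y :: "nat \<Rightarrow> real \<Rightarrow> 'a \<Rightarrow> real"
  assumes beta: "\<beta> = 1 \<or> \<beta> = 2"
    and Z_measurable: "\<And>i j t. 1 \<le> i \<Longrightarrow> i < j \<Longrightarrow> random_variable borel (Z i j t)"
    and Y_measurable: "\<And>i t. 1 \<le> i \<Longrightarrow> random_variable borel (Y i t)"
    and indep: "indep_vars (\<lambda>_. \<Pi>\<^sub>M t\<in>(UNIV :: real set). (borel :: complex measure))
        (\<lambda>(i, j) \<omega> t. wigner_entry Z Y i j t \<omega>) {(i, j). 1 \<le> i \<and> i \<le> j}"
    and Z_identically_distributed: "\<And>i j. 1 \<le> i \<Longrightarrow> i < j \<Longrightarrow>
        distr M (\<Pi>\<^sub>M t\<in>(UNIV :: real set). borel) (\<lambda>\<omega> t. Z i j t \<omega>) =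
        distr M (\<Pi>\<^sub>M t\<in>(UNIV :: real set). borel) (\<lambda>\<omega> t. Z 1 2 t \<omega>)"
    and Y_identically_distributed: "\<And>i. 1 \<le> i \<Longrightarrow>
        distr M (\<Pi>\<^sub>M t\<in>(UNIV :: real set). borel) (\<lambda>\<omega> t. Y i t \<omega>) =
        distr M (\<Pi>\<^sub>M t\<in>(UNIV :: real set). borel) (\<lambda>\<omega> t. Y 1 t \<omega>)"
    and Z_mean: "\<And>i j t. 1 \<le> i \<Longrightarrow> i < j \<Longrightarrow> (LINT \<omega>|M. Z i j t \<omega>) = 0"
    and Y_mean: "\<And>i t. 1 \<le> i \<Longrightarrow> (LINT \<omega>|M. Y i t \<omega>) = 0"
    and Z_moments: "\<And>k :: nat. 1 \<le> k \<Longrightarrow> \<exists>b. \<forall>t.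
        integrable M (\<lambda>\<omega>. cmod (Z 1 2 t \<omega>) ^ k) \<and> (LINT \<omega>|M. cmod (Z 1 2 t \<omega>) ^ k) \<le> b"
    and Y_moments: "\<And>k :: nat. 1 \<le> k \<Longrightarrow> \<exists>b. \<forall>t.
        integrable M (\<lambda>\<omega>. \<bar>Y 1 t \<omega>\<bar> ^ k) \<and> (LINT \<omega>|M. \<bar>Y 1 t \<omega>\<bar> ^ k) \<le> b"
    and cov_nonneg: "\<And>s t. 0 \<le> wigner_cov M \<beta> Y s t"
    and cov_diag: "\<And>t. wigner_cov M \<beta> Y t t = 1"
    and symmetric_real: "\<And>i j t \<omega>. \<beta> = 1 \<Longrightarrow> 1 \<le> i \<Longrightarrow> i < j \<Longrightarrow> \<omega> \<in> space M \<Longrightarrow> Z i j t \<omega> \<in> \<real>"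
    and symmetric_cov: "\<And>s t. \<beta> = 1 \<Longrightarrow>
        (LINT \<omega>|M. Z 1 2 s \<omega> * Z 1 2 t \<omega>) = complex_of_real (wigner_cov M \<beta> Y s t)"
    and symmetric_fourth: "\<And>s t. \<beta> = 1 \<Longrightarrow>
        (LINT \<omega>|M. (Z 1 2 s \<omega>)\<^sup>2 * (Z 1 2 t \<omega>)\<^sup>2) =
          complex_of_real (2 * (wigner_cov M \<beta> Y s t)\<^sup>2 + 1)"
    and hermitian_cov_0: "\<And>s t. \<beta> = 2 \<Longrightarrow> (LINT \<omega>|M. Z 1 2 s \<omega> * Z 1 2 t \<omega>) = 0"
    and hermitian_cov: "\<And>s t. \<beta> = 2 \<Longrightarrow>
        (LINT \<omega>|M. Z 1 2 s \<omega> * cnj (Z 1 2 t \<omega>)) = complex_of_real (wigner_cov M \<beta> Y s t)"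
    and hermitian_fourth: "\<And>s t. \<beta> = 2 \<Longrightarrow>
        (LINT \<omega>|M. (cmod (Z 1 2 s \<omega>))\<^sup>2 * (cmod (Z 1 2 t \<omega>))\<^sup>2) =
          (wigner_cov M \<beta> Y s t)\<^sup>2 + 1"

text \<open>The submatrix with row and column indices \<open>{1..n}\<close>; matrix positions start at 0.\<close>

definition wigner_corner ::
  "(nat \<Rightarrow> nat \<Rightarrow> real \<Rightarrow> 'a \<Rightarrow> complex) \<Rightarrow> (nat \<Rightarrow> real \<Rightarrow> 'a \<Rightarrow> real) \<Rightarrow>
    nat \<Rightarrow> real \<Rightarrow> 'a \<Rightarrow> complex mat" where
  "wigner_corner Z Y n t \<omega> = mat n n (\<lambda>(i, j). wigner_entry Z Y (i + 1) (j + 1) t \<omega>)"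

text \<open>Only real eigenvalues are counted; for the Hermitian matrices considered here these are all
  of them, and algebraic and geometric multiplicity agree.\<close>

definition count_eigenvalues_ge :: "complex mat \<Rightarrow> real \<Rightarrow> nat" where
  "count_eigenvalues_ge A x =
    (\<Sum>l | x \<le> l \<and> eigenvalue A (complex_of_real l).
      Polynomial.order (complex_of_real l) (char_poly A))"

definition height ::
  "nat \<Rightarrow> (nat \<Rightarrow> nat \<Rightarrow> real \<Rightarrow> 'a \<Rightarrow> complex) \<Rightarrow> (nat \<Rightarrow> real \<Rightarrow> 'a \<Rightarrow> real) \<Rightarrow>
    real \<Rightarrow> real \<Rightarrow> real \<Rightarrow> 'a \<Rightarrow> real" where
  "height \<beta> Z Y x y t \<omega> =
    sqrt (real \<beta> * pi / 2) * real (count_eigenvalues_ge (wigner_corner Z Y (nat \<lfloor>y\<rfloor>) t \<omega>) x)"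

text \<open>The index \<open>(\<tau>, y, k)\<close> is a triple so that the moments form a family over a single type.\<close>

definition height_moment ::
  "'a measure \<Rightarrow> nat \<Rightarrow> (nat \<Rightarrow> nat \<Rightarrow> real \<Rightarrow> 'a \<Rightarrow> complex) \<Rightarrow> (nat \<Rightarrow> real \<Rightarrow> 'a \<Rightarrow> real) \<Rightarrow>
    real \<Rightarrow> real \<times> real \<times> nat \<Rightarrow> 'a \<Rightarrow> real" where
  "height_moment M \<beta> Z Y L = (\<lambda>(\<tau>, y, k) \<omega>.
    LINT x|lborel. x ^ k * (height \<beta> Z Y (sqrt L * x) (L * y) \<tau> \<omega>
      - (LINT \<omega>'|M. height \<beta> Z Y (sqrt L * x) (L * y) \<tau> \<omega>')))"

text \<open>The argument \<open>c\<close> is the value \<open>c(s,t)\<close>. For \<open>z\<close>, \<open>w\<close> in the upper half plane and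
  \<open>0 \<le> c \<le> 1\<close> the numerator does not vanish, and the denominator vanishes only if \<open>c = 1\<close> and
  \<open>z = w\<close>. There the kernel is \<open>+\<infinity>\<close>, while the formula below gives 0; this affects only a null
  set in the integrals over semicircles.\<close>

definition log_kernel :: "real \<Rightarrow> complex \<Rightarrow> complex \<Rightarrow> real" where
  "log_kernel c z w = 1 / (2 * pi) *
    ln (cmod ((complex_of_real (c * min ((cmod z)\<^sup>2) ((cmod w)\<^sup>2)) - z * w) /
              (complex_of_real (c * min ((cmod z)\<^sup>2) ((cmod w)\<^sup>2)) - z * cnj w)))"

text \<open>Integration of \<open>f(z) (dx(z)/dz) dz\<close> over \<open>|z|\<^sup>2 = y\<close> in the upper half plane, with
  \<open>x(z) = 2 Re z\<close>: the semicircle is parametrized by \<open>x\<close> itself, as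
  \<open>z = x/2 + i sqrt (y - x\<^sup>2/4)\<close>.\<close>

definition semicircle_integral :: "real \<Rightarrow> (complex \<Rightarrow> real) \<Rightarrow> real" where
  "semicircle_integral y f =
    (LBINT x:{- 2 * sqrt y<..<2 * sqrt y}. f (Complex (x / 2) (sqrt (y - x\<^sup>2 / 4))))"

definition moment_cov ::
  "(real \<Rightarrow> real \<Rightarrow> real) \<Rightarrow> real \<times> real \<times> nat \<Rightarrow> real \<times> real \<times> nat \<Rightarrow> real" where
  "moment_cov c = (\<lambda>(\<tau>\<^sub>1, y\<^sub>1, k\<^sub>1) (\<tau>\<^sub>2, y\<^sub>2, k\<^sub>2).
    semicircle_integral y\<^sub>1 (\<lambda>z. semicircle_integral y\<^sub>2 (\<lambda>w.
      (2 * Re z) ^ k\<^sub>1 * (2 * Re w) ^ k\<^sub>2 * log_kernel (c \<tau>\<^sub>1 \<tau>\<^sub>2) z w)))"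

text \<open>Gaussian variables may be degenerate (almost surely constant).\<close>

definition gaussian_variable :: "'b measure \<Rightarrow> ('b \<Rightarrow> real) \<Rightarrow> bool" where
  "gaussian_variable N V \<longleftrightarrow>
    V \<in> borel_measurable N \<and>
    ((\<exists>\<mu>. AE \<omega> in N. V \<omega> = \<mu>) \<or>
     (\<exists>\<mu> \<sigma>. 0 < \<sigma> \<and> distributed N lborel V (normal_density \<mu> \<sigma>)))"

definition centered_gaussian_family ::
  "'b measure \<Rightarrow> 'i set \<Rightarrow> ('i \<Rightarrow> 'b \<Rightarrow> real) \<Rightarrow> ('i \<Rightarrow> 'i \<Rightarrow> real) \<Rightarrow> bool" where
  "centered_gaussian_family N I G K \<longleftrightarrow>
    prob_space N \<and>
    (\<forall>J a. finite J \<and> J \<subseteq> I \<longrightarrow> gaussian_variable N (\<lambda>\<omega>. \<Sum>i\<in>J. a i * G i \<omega>)) \<and>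
    (\<forall>i\<in>I. (LINT \<omega>|N. G i \<omega>) = 0) \<and>
    (\<forall>i\<in>I. \<forall>j\<in>I. (LINT \<omega>|N. G i \<omega> * G j \<omega>) = K i j)"

text \<open>Weak convergence, as \<open>L \<rightarrow> \<infinity>\<close>, of the laws on \<open>\<real>\<^sup>J\<close> (realized as the extensional functions
  on \<open>J\<close>) for every finite set \<open>J\<close> of indices.\<close>

definition fdd_converges ::
  "'a measure \<Rightarrow> 'i set \<Rightarrow> (real \<Rightarrow> 'i \<Rightarrow> 'a \<Rightarrow> real) \<Rightarrow> 'b measure \<Rightarrow> ('i \<Rightarrow> 'b \<Rightarrow> real) \<Rightarrow> bool" where
  "fdd_converges M I V N G \<longleftrightarrow>
    (\<forall>i\<in>I. (\<forall>\<^sub>F L in at_top. V L i \<in> borel_measurable M) \<and> G i \<in> borel_measurable N) \<and>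
    (\<forall>J f. finite J \<and> J \<subseteq> I \<and>
        continuous_map (product_topology (\<lambda>_. euclideanreal) J) euclideanreal f \<and>
        bounded (f ` (\<Pi>\<^sub>E i\<in>J. UNIV)) \<longrightarrow>
      ((\<lambda>L. LINT \<omega>|M. f (\<lambda>i\<in>J. V L i \<omega>)) \<longlongrightarrow> (LINT \<omega>|N. f (\<lambda>i\<in>J. G i \<omega>))) at_top)"

end

theory Submission
  imports Defs "Jordan_Normal_Form.Schur_Decomposition"
begin

text \<open>Each eigenvalue \<open>a\<close> contributes \<open>a ^ (k + 1) / (k + 1)\<close> to \<open>\<integral> x ^ k H dx\<close>, so the moments are centred
  traces of powers. In the Chebyshev polynomials \<open>t_r\<close> rescaled to \<open>[-2 \<surd>n, 2 \<surd>n]\<close> the power \<open>x ^ p\<close> has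
  universal coefficients, and the trace of \<open>t_r(X)\<close> is a sum over closed words of length \<open>r\<close> of cyclic weights
  from which all backtracking has been subtracted. A vertex visited only once by a family of centred
  cyclic weights annihilates their joint expectation, so only families of at most half as many
  vertices as letters matter, and among these a vertex visited three times costs a factor \<open>\<surd>n\<close>. What
  remains are pairs of simple cycles that agree up to a rotation or reflection: the moments
  factorise according to Wick's rule, with covariances \<open>(2 / \<beta>) r (c min(y, y')) ^ r\<close> for equal
  degrees and \<open>0\<close> for different degrees.

  On the other side, in polar coordinates \<open>z = \<surd>y e ^ (i \<theta>)\<close> the logarithmic kernel is
  \<open>\<Sum> a ^ r sin(r \<theta>) sin(r \<phi>) / (\<pi> r)\<close> with \<open>a = c \<surd>(min y y' / max y y')\<close>, and integrating it against powers of
  \<open>2 cos\<close> produces the same sum; the singular case \<open>a = 1\<close> follows by monotone convergence because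
  the kernel increases with \<open>a\<close>.\<close>

text \<open>Replacing a backtrack \<open>a b a\<close> by 1 subtracts the mean of
  \<open>|X a b|^2\<close>; this makes the factor at a vertex visited once centred. The middle
  vertex of a removed backtrack is free, so summing over all words turns the subtraction into the
  factor \<open>n\<close> of the Chebyshev recursion. Three hypotheses feed one covariance formula:
  the variance of \<open>Y\<close> for degree 1, the fourth moment of \<open>Z\<close> for degree 2,
  the second moments of \<open>Z\<close> for all degrees from 3 on. Pairings are never enumerated:
  normality comes from a recursion in which one distinguished factor is paired with each possible
  partner. Eigenvalues are chosen pointwise, without measurability; what is measurable about them is
  recovered from power sums, which are polynomials in the entries. The limit family has to be
  constructed as well: Gaussian vectors are extended by Kolmogorov's theorem, and the covariance is
  seen to be positive semidefinite because it is a limit of second moments.\<close>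

section \<open>Non-backtracking weights of paths and cycles\<close>

fun path_weight :: "(nat \<Rightarrow> nat \<Rightarrow> complex) \<Rightarrow> nat list \<Rightarrow> complex" where
  "path_weight X [] = 1"
| "path_weight X [a] = 1"
| "path_weight X [a, b] = X a b"
| "path_weight X (a # b # c # r) =
    X a b * path_weight X (b # c # r) - (if a = c then path_weight X (c # r) else 0)"

text \<open>The second term removes the one backtrack that \<open>path_weight\<close> cannot see,
  the one whose middle vertex is the base point \<open>hd w\<close>; what remains is the closed path
  \<open>tl w\<close>. With this term the base point is treated like any other letter.\<close>

definition cycle_weight :: "(nat \<Rightarrow> nat \<Rightarrow> complex) \<Rightarrow> nat list \<Rightarrow> complex" where
  "cycle_weight X w = path_weight X (w @ [hd w]) -
    (if 2 \<le> length w \<and> w ! 1 = last w then path_weight X (tl w) else 0)"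

text \<open>The recursion of \<open>path_weight\<close> peels letters off the left end; it also
  holds at the right end because removals of backtracks at the two ends commute. Both forms are
  needed to move the base point of a cycle and to reverse a path.\<close>

lemma path_weight_snoc:
  "path_weight X (u @ [x, y, z]) =
    path_weight X (u @ [x, y]) * X y z - (if x = z then path_weight X (u @ [x]) else 0)"
proof (induction u rule: length_induct)
  case (1 u)
  show ?case
  proof (cases u)
    case Nil
    then show ?thesis by simp
  next
    case (Cons a u1)
    show ?thesis
    proof (cases u1)
      case Nil
      then show ?thesis using Cons by (auto simp: algebra_simps)
    next
      case (Cons b u2)
      have IH1: "path_weight X (u1 @ [x, y, z]) =
        path_weight X (u1 @ [x, y]) * X y z - (if x = z then path_weight X (u1 @ [x]) else 0)"
        using 1 \<open>u = a # u1\<close> by auto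
      have IH2: "path_weight X (u2 @ [x, y, z]) =
        path_weight X (u2 @ [x, y]) * X y z - (if x = z then path_weight X (u2 @ [x]) else 0)"
        using 1 \<open>u = a # u1\<close> Cons by auto
      \<comment> \<open>The third letter is \<open>hd (u2 @ [x])\<close> in all three words, so the
        same expansion at the left end serves them all and the induction hypotheses for
        \<open>u1\<close> and \<open>u2\<close> can be combined.\<close>
      have E: "path_weight X (a # b # u2 @ [x, y, z]) = X a b * path_weight X (u1 @ [x, y, z])
          - (if a = hd (u2 @ [x]) then path_weight X (u2 @ [x, y, z]) else 0)"
        "path_weight X (a # b # u2 @ [x, y]) = X a b * path_weight X (u1 @ [x, y])
          - (if a = hd (u2 @ [x]) then path_weight X (u2 @ [x, y]) else 0)"
        "path_weight X (a # b # u2 @ [x]) = X a b * path_weight X (u1 @ [x])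
          - (if a = hd (u2 @ [x]) then path_weight X (u2 @ [x]) else 0)"
        using Cons by (cases u2; simp)+
      then show ?thesis
      proof -
        have "u @ v = a # b # u2 @ v" for v using \<open>u = a # u1\<close> Cons by simp
        then show ?thesis
          by (simp only: E IH1 IH2) (simp add: algebra_simps)
      qed
    qed
  qed
qed

lemma path_weight_fresh_snoc:
  assumes "v \<notin> set (u @ [x])"
  shows "path_weight X (u @ [x, v]) = path_weight X (u @ [x]) * X x v"
proof (cases u rule: rev_cases)
  case (snoc u' a)
  then show ?thesis using assms path_weight_snoc[of X u' a x v] by auto
qed auto

text \<open>Write \<open>w\<close> as \<open>a b ... z\<close>. The left recursion for
  \<open>w\<close> closed at \<open>a\<close> and the right recursion for the rotated word closed at
  \<open>b\<close> produce the same two corrections with roles exchanged: the seam term of one word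
  is the inner term of the other.\<close>

lemma cycle_weight_rotate1: "cycle_weight X (rotate1 w) = cycle_weight X w"
proof (cases w)
  case (Cons a u)
  show ?thesis
  proof (cases u)
    case Nil
    then show ?thesis using Cons by simp
  next
    case (Cons b u1)
    show ?thesis
    proof (cases u1 rule: rev_cases)
      case Nil
      then show ?thesis using \<open>w = a # u\<close> Cons by (simp add: cycle_weight_def algebra_simps)
    next
      case (snoc u2 z)
      have w: "w = a # b # u2 @ [z]" using \<open>w = a # u\<close> Cons snoc by simp
      have *: "path_weight X ((b # u2) @ [z, a, b]) =
          path_weight X ((b # u2) @ [z, a]) * X a b - (if z = b then path_weight X ((b # u2) @ [z]) else 0)"
        by (rule path_weight_snoc)
      show ?thesis
      proof (cases u2)
        case Nil
        then show ?thesis using w * by (simp add: cycle_weight_def algebra_simps)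
      next
        case (Cons c u3)
        then show ?thesis using w * by (auto simp add: cycle_weight_def algebra_simps)
      qed
    qed
  qed
qed (simp add: cycle_weight_def)

lemma cycle_weight_rotate: "cycle_weight X (rotate k w) = cycle_weight X w"
  by (induction k) (auto simp: cycle_weight_rotate1 rotate_Suc)

lemma cycle_weight_single [simp]: "cycle_weight X [v] = X v v"
  by (simp add: cycle_weight_def)

text \<open>A letter that occurs once can only be the middle of a backtrack, and only if its two
  neighbours coincide; the definition places this backtrack at the seam. For \<open>u\<close> of
  length 1 the cycle backtracks at both letters, which is why \<open>cycle_weight_pair\<close> is
  separate.\<close>

lemma cycle_weight_fresh:
  assumes "v \<notin> set u" "2 \<le> length u"
  shows "cycle_weight X (v # u) =
    (X v (hd u) * X (last u) v - (if hd u = last u then 1 else 0)) * path_weight X u"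
proof -
  obtain x r where u: "u = x # r" "r \<noteq> []" using assms(2) by (cases u; cases "tl u") auto
  then obtain r' y where r: "r = r' @ [y]" by (metis rev_exhaust)
  have "path_weight X (v # u @ [v]) = X v x * path_weight X ((x # r') @ [y, v])"
    using assms u r by (cases r') auto
  also have "path_weight X ((x # r') @ [y, v]) = path_weight X u * X y v"
    using path_weight_fresh_snoc[of v "x # r'" y X] assms u r by auto
  finally show ?thesis using u r by (auto simp: cycle_weight_def algebra_simps)
qed

lemma cycle_weight_pair: "v \<noteq> x \<Longrightarrow> cycle_weight X [v, x] = X v x * X x v - 2"
  by (simp add: cycle_weight_def)

section \<open>Words over the vertices and Chebyshev traces\<close>

abbreviation words :: "nat \<Rightarrow> nat \<Rightarrow> nat list set" where
  "words n p \<equiv> {w. set w \<subseteq> {..<n} \<and> length w = p}"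

lemma words_0: "words n 0 = {[]}" by auto

lemma words_Suc: "words n (Suc p) = (\<lambda>(a, w). a # w) ` ({..<n} \<times> words n p)"
  by (auto simp: image_iff length_Suc_conv)

lemma finite_words [simp]: "finite (words n p)"
  by (rule finite_lists_length_eq) simp

lemma sum_words_Suc:
  "(\<Sum>w\<in>words n (Suc p). f w) = (\<Sum>a<n. \<Sum>w\<in>words n p. f (a # w))" for f :: "nat list \<Rightarrow> complex"
  unfolding words_Suc by (subst sum.reindex) (auto simp: inj_on_def sum.cartesian_product case_prod_beta)

lemma words_Suc_snoc: "words n (Suc p) = (\<lambda>(a, w). w @ [a]) ` ({..<n} \<times> words n p)"
proof safe
  fix w assume w: "length w = Suc p" "set w \<subseteq> {..<n}"
  then obtain v a where "w = v @ [a]" by (metis length_Suc_conv_rev)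
  then show "w \<in> (\<lambda>(a, w). w @ [a]) ` ({..<n} \<times> words n p)"
    using w by (auto intro!: image_eqI[of _ _ "(a, v)"])
qed auto

lemma sum_words_Suc_snoc:
  "(\<Sum>w\<in>words n (Suc p). f w) = (\<Sum>a<n. \<Sum>w\<in>words n p. f (w @ [a]))" for f :: "nat list \<Rightarrow> complex"
  unfolding words_Suc_snoc by (subst sum.reindex) (auto simp: inj_on_def sum.cartesian_product case_prod_beta)

text \<open>The Chebyshev polynomials of the second kind, rescaled to the interval of radius \<open>2 \<surd>n\<close>,
  applied to the matrix \<open>X\<close>.\<close>

fun cheb_matrix :: "(nat \<Rightarrow> nat \<Rightarrow> complex) \<Rightarrow> nat \<Rightarrow> nat \<Rightarrow> nat \<Rightarrow> nat \<Rightarrow> complex" where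
  "cheb_matrix X n 0 i j = (if i = j then 1 else 0)"
| "cheb_matrix X n (Suc 0) i j = X i j"
| "cheb_matrix X n (Suc (Suc r)) i j =
    (\<Sum>k<n. X i k * cheb_matrix X n (Suc r) k j) - of_nat n * cheb_matrix X n r i j"

text \<open>Expand the first step of the path. In the subtracted term the removed vertex
  \<open>a\<close> no longer occurs, so summing over it only multiplies by \<open>n\<close>; this is
  the last term of the three-term recursion.\<close>

lemma cheb_matrix_eq_sum:
  assumes "i < n"
  shows "cheb_matrix X n (Suc r) i j = (\<Sum>u\<in>words n r. path_weight X (i # u @ [j]))"
  using assms
proof (induction r arbitrary: i rule: less_induct)
  case (less r)
  consider "r = 0" | "r = 1" | s where "r = Suc (Suc s)"
    by (metis One_nat_def not0_implies_Suc)
  then show ?case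
  proof cases
    case 1
    then show ?thesis by (simp add: words_0 del: length_0_conv)
  next
    case 2
    have "(\<Sum>u\<in>words n (Suc 0). path_weight X (i # u @ [j])) =
      (\<Sum>a<n. X i a * X a j - (if i = j then 1 else 0))"
      unfolding sum_words_Suc words_0 by simp
    then show ?thesis using 2 less.prems by (simp add: sum_subtractf)
  next
    case 3
    have if_sum: "(\<Sum>w\<in>words n s. if i = b then path_weight X (b # w @ [j]) else 0) =
        (if i = b then (\<Sum>w\<in>words n s. path_weight X (b # w @ [j])) else 0)" for b
      by simp
    have "(\<Sum>u\<in>words n (Suc (Suc s)). path_weight X (i # u @ [j])) =
      (\<Sum>a<n. \<Sum>b<n. \<Sum>w\<in>words n s. X i a * path_weight X (a # b # w @ [j])
         - (if i = b then path_weight X (b # w @ [j]) else 0))"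
      unfolding sum_words_Suc by simp
    also have "\<dots> = (\<Sum>a<n. X i a * (\<Sum>u\<in>words n (Suc s). path_weight X (a # u @ [j])))
      - of_nat n * (\<Sum>b<n. if i = b then (\<Sum>w\<in>words n s. path_weight X (b # w @ [j])) else 0)"
      unfolding sum_words_Suc
      by (simp add: sum_subtractf sum_distrib_left if_sum)
    also have "\<dots> = (\<Sum>a<n. X i a * cheb_matrix X n (Suc (Suc s)) a j)
      - of_nat n * cheb_matrix X n (Suc s) i j"
      using 3 less.IH less.prems by (simp del: cheb_matrix.simps)
    finally show ?thesis using 3 by simp
  qed
qed

text \<open>The seam correction leaves the base point free, so it sums to \<open>n\<close> times the
  trace two degrees lower. The combination \<open>U_p - n U_(p-2)\<close> is the Chebyshev
  polynomial of the first kind.\<close>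

lemma sum_cycle_weight:
  assumes "p \<ge> 1"
  shows "(\<Sum>w\<in>words n p. cycle_weight X w) =
    (\<Sum>i<n. cheb_matrix X n p i i) - (if 2 \<le> p then of_nat n * (\<Sum>i<n. cheb_matrix X n (p - 2) i i) else 0)"
proof -
  obtain q where p: "p = Suc q" using assms by (cases p) auto
  have 1: "(\<Sum>w\<in>words n p. path_weight X (w @ [hd w])) = (\<Sum>i<n. cheb_matrix X n p i i)"
    unfolding p sum_words_Suc by (intro sum.cong) (auto simp: cheb_matrix_eq_sum simp del: cheb_matrix.simps)
  have 2: "(\<Sum>w\<in>words n p. if 2 \<le> length w \<and> w ! 1 = last w then path_weight X (tl w) else 0) =
    (if 2 \<le> p then of_nat n * (\<Sum>i<n. cheb_matrix X n (p - 2) i i) else 0)"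
  proof -
    consider "q = 0" | "q = 1" | s where "q = Suc (Suc s)"
      by (metis One_nat_def not0_implies_Suc)
    then show ?thesis
    proof cases
      case 1
      then show ?thesis unfolding p by (auto intro!: sum.neutral)
    next
      case 2
      then show ?thesis unfolding p 2 One_nat_def sum_words_Suc words_0 by simp
    next
      case 3
      \<comment> \<open>Both end letters of \<open>tl w\<close> are split off, so that the condition
        \<open>w ! 1 = last w\<close> becomes an equation between the summation variables
        \<open>b\<close> and \<open>z\<close>.\<close>
      have "(\<Sum>w\<in>words n p. if 2 \<le> length w \<and> w ! 1 = last w then path_weight X (tl w) else 0) =
        (\<Sum>a<n. \<Sum>b<n. \<Sum>z<n. \<Sum>w\<in>words n s. if b = z then path_weight X (b # w @ [z]) else 0)"
        unfolding p 3 sum_words_Suc[of _ n "Suc (Suc s)"] sum_words_Suc[of _ n "Suc s"] sum_words_Suc_snoc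
        by (intro sum.cong) auto
      also have "\<dots> = (\<Sum>a<n. \<Sum>b<n. \<Sum>z<n. if b = z then (\<Sum>w\<in>words n s. path_weight X (b # w @ [z])) else 0)"
        by (intro sum.cong) auto
      also have "\<dots> = of_nat n * (\<Sum>b<n. cheb_matrix X n (Suc s) b b)"
        by (simp add: cheb_matrix_eq_sum del: cheb_matrix.simps)
      finally show ?thesis unfolding p 3 by simp
    qed
  qed
  show ?thesis unfolding cycle_weight_def sum_subtractf 1 2 ..
qed

section \<open>Neighbourhoods in cyclic words\<close>

text \<open>The graph of the cyclic word around \<open>v\<close>, without orientation or
  multiplicity; the letter of a one-letter word is its own neighbour. This is the datum that decides
  correlations: two factors at a shared vertex are uncorrelated when their neighbour sets
  differ.\<close>

definition nbrs :: "nat list \<Rightarrow> nat \<Rightarrow> nat set" where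
  "nbrs w v = {x. \<exists>i<length w. (w ! i = x \<and> w ! (Suc i mod length w) = v) \<or>
    (w ! i = v \<and> w ! (Suc i mod length w) = x)}"

lemma nbrs_rotate1: "nbrs (rotate1 w) v = nbrs w v"
proof (cases "w = []")
  case False
  let ?p = "length w"
  have p: "0 < ?p" using False by simp
  define P where "P x i \<longleftrightarrow> (w ! i = x \<and> w ! (Suc i mod ?p) = v) \<or>
    (w ! i = v \<and> w ! (Suc i mod ?p) = x)" for x i
  have rot: "rotate1 w ! i = w ! (Suc i mod ?p)" if "i < ?p" for i
    using nth_rotate[OF that, of 1] by simp
  have 1: "x \<in> nbrs (rotate1 w) v \<longleftrightarrow> (\<exists>i<?p. P x (Suc i mod ?p))" for x
    using p by (auto simp: nbrs_def P_def rot mod_Suc_eq)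
  have 2: "x \<in> nbrs w v \<longleftrightarrow> (\<exists>i<?p. P x i)" for x
    by (auto simp: nbrs_def P_def)
  have "(\<exists>i<?p. P x (Suc i mod ?p)) \<longleftrightarrow> (\<exists>i<?p. P x i)" for x
  proof
    assume "\<exists>i<?p. P x i"
    then obtain i where i: "i < ?p" "P x i" by auto
    show "\<exists>i<?p. P x (Suc i mod ?p)"
    proof (cases i)
      case 0
      then show ?thesis using i p by (intro exI[of _ "?p - 1"]) auto
    next
      case (Suc j)
      then show ?thesis using i by (intro exI[of _ j]) auto
    qed
  qed (use p in \<open>auto intro!: mod_less_divisor\<close>)
  then show ?thesis using 1 2 by blast
qed simp

lemma nbrs_rotate: "nbrs (rotate k w) v = nbrs w v"
  by (induction k) (auto simp: nbrs_rotate1 rotate_Suc)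

lemma nbrs_subset_set: "nbrs w v \<subseteq> set w"
proof
  fix x assume "x \<in> nbrs w v"
  then obtain i where i: "i < length w" "w ! i = x \<or> w ! (Suc i mod length w) = x"
    unfolding nbrs_def by blast
  have "Suc i mod length w < length w" using i(1) by (intro mod_less_divisor) linarith
  then have "w ! (Suc i mod length w) \<in> set w" "w ! i \<in> set w" using i(1) nth_mem by blast+
  then show "x \<in> set w" using i(2) by metis
qed

lemma nbrs_fresh:
  assumes "v \<notin> set u" "u \<noteq> []"
  shows "nbrs (v # u) v = {hd u, last u}"
proof -
  have ne: "u ! i \<noteq> v" if "i < length u" for i using assms that by auto
  show ?thesis
  proof (intro equalityI subsetI)
    fix x assume "x \<in> nbrs (v # u) v"
    then obtain i where i: "i \<le> length u"
      "((v # u) ! i = x \<and> (v # u) ! (Suc i mod Suc (length u)) = v) \<or>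
       ((v # u) ! i = v \<and> (v # u) ! (Suc i mod Suc (length u)) = x)"
      by (auto simp: nbrs_def less_Suc_eq_le)
    show "x \<in> {hd u, last u}"
    proof (cases "i = length u")
      case True
      have "(v # u) ! i = last u" "last u \<noteq> v"
        using True assms by (auto simp: last_conv_nth nth_Cons')
      then show ?thesis using i True by auto
    next
      case False
      then have "(v # u) ! (Suc i mod Suc (length u)) = u ! i" "i < length u" using i by auto
      then show ?thesis using i ne assms by (cases i) (auto simp: hd_conv_nth)
    qed
  next
    fix x assume "x \<in> {hd u, last u}"
    then consider "x = hd u" | "x = last u" by auto
    then show "x \<in> nbrs (v # u) v"
    proof cases
      case 1
      then show ?thesis using assms
        by (auto simp: nbrs_def hd_conv_nth intro!: exI[of _ 0])
    next
      case 2
      then show ?thesis using assms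
        by (auto simp: nbrs_def last_conv_nth nth_Cons' intro!: exI[of _ "length u"])
    qed
  qed
qed

lemma nbrs_single: "nbrs [v] v = {v}"
  by (auto simp: nbrs_def)

text \<open>Walking around the cycle from a shared vertex never leaves the shared vertices.\<close>

lemma set_subset_if_nbrs_eq:
  assumes "v \<in> set w" "v \<in> set w'" "\<And>x. x \<in> set w \<Longrightarrow> x \<in> set w' \<Longrightarrow> nbrs w x = nbrs w' x"
  shows "set w \<subseteq> set w'"
proof
  let ?p = "length w"
  obtain i where i: "i < ?p" "w ! i = v" using assms(1) by (auto simp: in_set_conv_nth)
  have p: "0 < ?p" using i(1) by linarith
  have *: "w ! ((i + k) mod ?p) \<in> set w'" for k
  proof (induction k)
    case 0
    then show ?case using i assms by simp
  next
    case (Suc k)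
    let ?x = "w ! ((i + k) mod ?p)" and ?y = "w ! ((i + Suc k) mod ?p)"
    have "?y \<in> nbrs w ?x" unfolding nbrs_def
      using p by (auto intro!: exI[of _ "(i + k) mod ?p"] simp: mod_Suc_eq)
    also have "nbrs w ?x = nbrs w' ?x" using Suc p by (intro assms) auto
    finally show ?case using nbrs_subset_set by blast
  qed
  fix x assume "x \<in> set w"
  then obtain j where j: "j < ?p" "w ! j = x" by (auto simp: in_set_conv_nth)
  have "(i + (j + ?p - i)) mod ?p = j" using i j by simp
  then show "x \<in> set w'" using *[of "j + ?p - i"] j by simp
qed

lemma nbrs_distinct:
  assumes "distinct w" "0 < i" "Suc i < length w"
  shows "nbrs w (w ! i) = {w ! Suc i, w ! (i - 1)}"
proof -
  let ?p = "length w"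
  have eq: "w ! a = w ! b \<longleftrightarrow> a = b" if "a < ?p" "b < ?p" for a b
    using assms(1) that by (simp add: nth_eq_iff_index_eq)
  have p: "Suc a mod ?p < ?p" for a using assms(3) by (intro mod_less_divisor) linarith
  have pred: "a = i - 1" if "a < ?p" "Suc a mod ?p = i" for a
  proof (cases "Suc a = ?p")
    case True
    then show ?thesis using that assms(2) by simp
  next
    case False
    then have "Suc a < ?p" using that by linarith
    then show ?thesis using that(2) by simp
  qed
  have i: "i < ?p" "i - 1 < ?p" "Suc i mod ?p = Suc i" using assms by simp_all
  have i': "Suc (i - 1) mod ?p = i" using assms by simp
  show ?thesis
  proof (intro equalityI subsetI)
    fix x assume "x \<in> nbrs w (w ! i)"
    then obtain a where a: "a < ?p" "(w ! a = x \<and> w ! (Suc a mod ?p) = w ! i) \<or>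
        (w ! a = w ! i \<and> w ! (Suc a mod ?p) = x)"
      by (auto simp: nbrs_def)
    then show "x \<in> {w ! Suc i, w ! (i - 1)}"
      using eq[OF p i(1), of a] eq[OF a(1) i(1)] pred[OF a(1)] i(3) by (metis insertCI)
  next
    fix x assume "x \<in> {w ! Suc i, w ! (i - 1)}"
    then consider "x = w ! Suc i" | "x = w ! (i - 1)" by auto
    then show "x \<in> nbrs w (w ! i)"
    proof cases
      case 1
      then show ?thesis unfolding nbrs_def using i(1,3) by (intro CollectI exI[of _ i]) simp
    next
      case 2
      then show ?thesis unfolding nbrs_def using i(2) i' by (intro CollectI exI[of _ "i - 1"]) simp
    qed
  qed
qed

text \<open>Walking forward, the neighbours of the current letter are the previous and the next one;
  the previous one is known, so the common neighbour set determines the next. The first two letters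
  fix the direction.\<close>

lemma distinct_eq_if_nbrs_eq:
  assumes "distinct w" "distinct u" "length w = length u" "2 \<le> length w"
    and "w ! 0 = u ! 0" "w ! 1 = u ! 1" "\<And>v. v \<in> set w \<Longrightarrow> nbrs w v = nbrs u v"
  shows "w = u"
proof (rule nth_equalityI)
  let ?p = "length w"
  fix i assume "i < ?p"
  then show "w ! i = u ! i"
  proof (induction i rule: less_induct)
    case (less i)
    consider "i = 0" | "i = 1" | j where "i = Suc (Suc j)"
      by (metis One_nat_def not0_implies_Suc)
    then show ?case
    proof cases
      case 3
      have 1: "nbrs w (w ! Suc j) = {w ! i, w ! j}"
        using nbrs_distinct[of w "Suc j"] assms less 3 by simp
      have 2: "nbrs u (u ! Suc j) = {u ! i, u ! j}"
        using nbrs_distinct[of u "Suc j"] assms less 3 by simp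
      have 3: "w ! Suc j = u ! Suc j" "w ! j = u ! j" using less 3 by auto
      have "u ! i \<noteq> u ! j" "w ! i \<noteq> w ! j" using assms less.prems \<open>i = Suc (Suc j)\<close>
        by (auto simp: nth_eq_iff_index_eq)
      moreover have "nbrs w (w ! Suc j) = nbrs u (w ! Suc j)"
        using assms(7) less.prems \<open>i = Suc (Suc j)\<close> by simp
      ultimately show ?thesis using 1 2 3 by (auto simp: doubleton_eq_iff)
    qed (use assms in auto)
  qed
qed (use assms in auto)

lemma nbrs_rev: "nbrs (rev w) v = nbrs w v"
proof -
  have sub: "nbrs (rev w) v \<subseteq> nbrs w v" for w
  proof
    let ?p = "length w"
    fix x assume "x \<in> nbrs (rev w) v"
    then obtain i where i: "i < ?p" "(rev w ! i = x \<and> rev w ! (Suc i mod ?p) = v) \<or>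
       (rev w ! i = v \<and> rev w ! (Suc i mod ?p) = x)"
      by (auto simp: nbrs_def)
    \<comment> \<open>Step \<open>i\<close> of the reversed word is step \<open>?p - 2 - i\<close>
      of \<open>w\<close> taken backwards; the closing step corresponds to the closing step, which
      is the case \<open>Suc i = ?p\<close>.\<close>
    let ?j = "if Suc i = ?p then ?p - 1 else ?p - Suc (Suc i)"
    have p: "0 < ?p" using i by auto
    have "rev w ! i = w ! (?p - Suc i)" using i by (simp add: rev_nth)
    moreover have "rev w ! (Suc i mod ?p) = w ! ?j"
      using i p by (auto simp: rev_nth)
    moreover have "Suc ?j mod ?p = ?p - Suc i" "?j < ?p" using i(1) p by (auto simp: Suc_diff_Suc)
    ultimately show "x \<in> nbrs w v" using i(2) unfolding nbrs_def
      by (auto intro!: exI[of _ ?j])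
  qed
  show ?thesis using sub[of w] sub[of "rev w"] by auto
qed

lemma rotate_to_nth:
  assumes "i < length w"
  shows "rotate i w ! 0 = w ! i"
  using assms nth_rotate[of 0 w i] by (cases w) auto

lemma rotate_inverse:
  assumes "k \<le> length w"
  shows "rotate (length w - k) (rotate k w) = w"
  using assms by (simp add: rotate_rotate)

text \<open>Rotate \<open>u\<close> so that it starts with the first letter of \<open>w\<close>. Its
  second letter is then one of the two neighbours of that letter in \<open>w\<close>, and
  \<open>distinct_eq_if_nbrs_eq\<close> continues from there: one choice gives \<open>w\<close>, the
  other gives \<open>w\<close> read backwards.\<close>

lemma nbrs_eq_imp_dihedral:
  assumes w: "distinct w" "distinct u" "length w = length u" "2 \<le> length w" "set w = set u"
    and nb: "\<And>v. v \<in> set w \<Longrightarrow> nbrs u v = nbrs w v"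
  shows "\<exists>k<length w. u = rotate k w \<or> u = rotate k (rev w)"
proof -
  let ?p = "length w"
  have "w ! 0 \<in> set u" using w by (metis length_greater_0_conv less_le_trans nth_mem pos2)
  then obtain i where i: "i < ?p" "u ! i = w ! 0" using w by (auto simp: in_set_conv_nth)
  define u' where "u' = rotate i u"
  have u': "distinct u'" "length u' = ?p" "set u' = set w" "u' ! 0 = w ! 0"
    using w i by (auto simp: u'_def rotate_to_nth)
  have uu: "u = rotate (?p - i) u'" using i w rotate_inverse[of i u] by (simp add: u'_def)
  obtain a r where ar: "w = a # r" "r \<noteq> []" using w(4) by (cases w; cases "tl w") auto
  obtain b s where bs: "u' = b # s" "s \<noteq> []" using w(4) u'(2) by (cases u'; cases "tl u'") auto
  have ab: "a = b" using ar bs u' by simp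
  have nb': "nbrs u' v = nbrs w v" if "v \<in> set w" for v using nb that by (simp add: u'_def nbrs_rotate)
  have "hd s \<in> {hd r, last r}"
    using nbrs_fresh[of a r] nbrs_fresh[of b s] ar bs ab w u' nb'[of a] by auto
  then consider "u' ! 1 = w ! 1" | "hd s = last r" using ar bs by (auto simp: hd_conv_nth)
  then have "u' = w \<or> u' = rotate (?p - 1) (rev w)"
  proof cases
    case 1
    have "w = u'" by (rule distinct_eq_if_nbrs_eq) (use w u' 1 nb' in auto)
    then show ?thesis by simp
  next
    case 2
    \<comment> \<open>Reversal sends the first letter of \<open>w\<close> to the end; rotating by
      \<open>?p - 1\<close> brings it back to the front.\<close>
    define z where "z = rotate (?p - 1) (rev w)"
    have z: "z = a # rev r" unfolding z_def ar
      using rotate_append[of "rev r" "[a]"] by simp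
    have "z = u'"
    proof (rule distinct_eq_if_nbrs_eq)
      show "z ! 1 = u' ! 1" using 2 ar bs z by (simp add: hd_rev hd_conv_nth[symmetric])
      show "nbrs z v = nbrs u' v" if "v \<in> set z" for v
        using that nb' w by (auto simp: z_def nbrs_rotate nbrs_rev)
    qed (use w u' ar bs ab z in \<open>auto simp: z_def\<close>)
    then show ?thesis by (simp add: z_def)
  qed
  then have "u = rotate (?p - i) w \<or> u = rotate (?p - i + (?p - 1)) (rev w)"
    using uu by (auto simp: rotate_rotate)
  then have "u = rotate ((?p - i) mod ?p) w \<or> u = rotate ((?p - i + (?p - 1)) mod ?p) (rev w)"
    by (metis length_rev rotate_conv_mod)
  moreover have "m mod ?p < ?p" for m using i by (intro mod_less_divisor) auto
  ultimately show ?thesis by blast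
qed

text \<open>For words of at most two letters every reversal is a rotation, hence the bound on the
  length. At the place where the second word shows the last letter of \<open>w\<close>, the first
  word continues with \<open>w ! 0\<close> and the second with \<open>w ! (p - 2)\<close>.\<close>

lemma rotate_neq_rotate_rev:
  assumes "distinct w" "3 \<le> length w"
  shows "rotate k w \<noteq> rotate l (rev w)"
proof
  let ?p = "length w"
  assume eq: "rotate k w = rotate l (rev w)"
  have p: "0 < ?p" using assms by auto
  \<comment> \<open>The offset that makes \<open>l + j\<close> a multiple of \<open>?p\<close>, so
    that the second word shows \<open>rev w ! 0\<close> at position \<open>j\<close>.\<close>
  define j where "j = (?p - l mod ?p) mod ?p"
  have j: "(l + j) mod ?p = 0"
  proof -
    have "(l + j) mod ?p = (l mod ?p + (?p - l mod ?p)) mod ?p"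
      unfolding j_def by (metis mod_add_eq mod_mod_trivial)
    also have "\<dots> = 0" using p by (simp add: less_imp_le)
    finally show ?thesis .
  qed
  have jp: "j < ?p" using p by (simp add: j_def)
  have eq_nth: "w ! ((k + m) mod ?p) = rev w ! ((l + m) mod ?p)" if "m < ?p" for m
    using arg_cong[OF eq, of "\<lambda>x. x ! m"] that by (simp add: nth_rotate)
  have E: "w ! ((k + m mod ?p) mod ?p) = rev w ! ((l + m mod ?p) mod ?p)" for m
    using eq_nth[of "m mod ?p"] p by simp
  have 1: "w ! ((k + j) mod ?p) = w ! (?p - 1)" using eq_nth[OF jp] j p by (simp add: rev_nth)
  then have 1: "(k + j) mod ?p = ?p - 1" using assms p by (simp add: nth_eq_iff_index_eq)
  have "(l + Suc j mod ?p) mod ?p = Suc ((l + j) mod ?p) mod ?p" by (metis add_Suc_right mod_Suc_eq mod_add_right_eq)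
  then have l1: "(l + Suc j mod ?p) mod ?p = 1" using j assms by simp
  have "(k + Suc j mod ?p) mod ?p = Suc ((k + j) mod ?p) mod ?p" by (metis add_Suc_right mod_Suc_eq mod_add_right_eq)
  then have k1: "(k + Suc j mod ?p) mod ?p = 0" using 1 p by simp
  have "w ! 0 = w ! (?p - 2)" using E[of "Suc j"] l1 k1 assms by (simp add: rev_nth numeral_2_eq_2)
  then show False using assms by (subst (asm) nth_eq_iff_index_eq) auto
qed

lemma inj_on_rotate:
  assumes "distinct w"
  shows "inj_on (\<lambda>k. rotate k w) {..<length w}"
proof
  fix k l assume "k \<in> {..<length w}" "l \<in> {..<length w}" "rotate k w = rotate l w"
  then show "k = l" using assms
    by (metis lessThan_iff nth_eq_iff_index_eq rotate_to_nth)
qed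

text \<open>Only the rotations of \<open>w\<close> and of its reversal contribute, and rotations
  leave \<open>f\<close> unchanged. The reversal keeps its own value because in the Hermitian case
  the two orientations have different expectations.\<close>

lemma sum_dihedral:
  fixes f :: "nat list \<Rightarrow> complex"
  assumes w: "distinct w" "3 \<le> length w"
    and rot: "\<And>u k. f (rotate k u) = f u"
    and zero: "\<And>u v. distinct u \<Longrightarrow> set u = set w \<Longrightarrow> v \<in> set w \<Longrightarrow> nbrs u v \<noteq> nbrs w v \<Longrightarrow> f u = 0"
  shows "(\<Sum>u | distinct u \<and> set u = set w. f u) = of_nat (length w) * (f w + f (rev w))"
proof -
  let ?p = "length w"
  let ?S = "{u. distinct u \<and> set u = set w}"
  let ?A = "(\<lambda>k. rotate k w) ` {..<?p}" and ?B = "(\<lambda>k. rotate k (rev w)) ` {..<?p}"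
  have len: "length u = ?p" if "u \<in> ?S" for u
    using that w by (metis (mono_tags, lifting) distinct_card mem_Collect_eq)
  have fin: "finite ?S"
    by (rule finite_subset[OF _ finite_lists_length_eq[OF finite_set, of w ?p]]) (use len in auto)
  have "(\<Sum>u\<in>?S. f u) = (\<Sum>u\<in>?A \<union> ?B. f u)"
  proof (rule sum.mono_neutral_right[OF fin])
    show "?A \<union> ?B \<subseteq> ?S" using w by auto
    show "\<forall>u\<in>?S - (?A \<union> ?B). f u = 0"
    proof
      fix u assume u: "u \<in> ?S - (?A \<union> ?B)"
      show "f u = 0"
      proof (rule ccontr)
        assume "f u \<noteq> 0"
        then have "nbrs u v = nbrs w v" if "v \<in> set w" for v using zero u that by blast
        then have "\<exists>k<?p. u = rotate k w \<or> u = rotate k (rev w)"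
          using u len[of u] w by (intro nbrs_eq_imp_dihedral) auto
        then show False using u by auto
      qed
    qed
  qed
  also have "\<dots> = (\<Sum>u\<in>?A. f u) + (\<Sum>u\<in>?B. f u)"
    using rotate_neq_rotate_rev[OF w] by (intro sum.union_disjoint) auto
  also have "(\<Sum>u\<in>?A. f u) = of_nat ?p * f w"
    using inj_on_rotate[OF w(1)] by (simp add: sum.reindex rot)
  also have "(\<Sum>u\<in>?B. f u) = of_nat ?p * f (rev w)"
    using inj_on_rotate[of "rev w"] w by (simp add: sum.reindex rot)
  finally show ?thesis by (simp add: algebra_simps)
qed

section \<open>Counting tuples of words on few vertices\<close>

definition visits :: "'k set \<Rightarrow> ('k \<Rightarrow> nat list) \<Rightarrow> nat \<Rightarrow> nat" where
  "visits A W v = (\<Sum>a\<in>A. count_list (W a) v)"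

text \<open>A function with at most \<open>k\<close> values factors through \<open>{..<k}\<close>:
  the first power counts the lists of values, the second the ways of distributing them over
  \<open>Q\<close>.\<close>

lemma card_functions_small_image:
  assumes "finite Q" "Q \<noteq> {}"
  shows "card {f \<in> Q \<rightarrow>\<^sub>E {..<N::nat}. card (f ` Q) \<le> k} \<le> N ^ k * k ^ card Q"
proof -
  let ?C = "({..<k} \<rightarrow>\<^sub>E {..<N}) \<times> (Q \<rightarrow>\<^sub>E {..<k})"
  have "{f \<in> Q \<rightarrow>\<^sub>E {..<N}. card (f ` Q) \<le> k} \<subseteq> (\<lambda>(g, h). restrict (g \<circ> h) Q) ` ?C"
  proof
    fix f assume f: "f \<in> {f \<in> Q \<rightarrow>\<^sub>E {..<N}. card (f ` Q) \<le> k}"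
    have ne: "f ` Q \<noteq> {}" "finite (f ` Q)" using assms by auto
    obtain e where e: "bij_betw e {..<card (f ` Q)} (f ` Q)"
      using ex_bij_betw_nat_finite[OF ne(2)] by (auto simp: atLeast0LessThan)
    \<comment> \<open>If fewer than \<open>k\<close> values occur, the list is padded with the first
      of them; this uses that the image is not empty.\<close>
    define g where "g = (\<lambda>i\<in>{..<k}. if i < card (f ` Q) then e i else e 0)"
    define h where "h = (\<lambda>q\<in>Q. inv_into {..<card (f ` Q)} e (f q))"
    have c: "0 < card (f ` Q)" using ne by (simp add: card_gt_0_iff)
    have ein: "e i \<in> f ` Q" if "i < card (f ` Q)" for i
      using e that by (auto simp: bij_betw_def)
    have fN: "f ` Q \<subseteq> {..<N}" using f by auto
    have "g \<in> {..<k} \<rightarrow>\<^sub>E {..<N}"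
      using ein[of 0] ein c fN unfolding g_def by (intro restrict_PiE_iff[THEN iffD2]) auto
    moreover have inv: "inv_into {..<card (f ` Q)} e (f q) < card (f ` Q)" if "q \<in> Q" for q
      using inv_into_into[of "f q" e "{..<card (f ` Q)}"] e that by (auto simp: bij_betw_def)
    have "h \<in> Q \<rightarrow>\<^sub>E {..<k}"
      using inv f unfolding h_def by (intro restrict_PiE_iff[THEN iffD2]) fastforce
    moreover have "restrict (g \<circ> h) Q = f"
    proof
      fix q
      show "restrict (g \<circ> h) Q q = f q"
      proof (cases "q \<in> Q")
        case True
        then show ?thesis using inv[OF True] f e
          by (auto simp: g_def h_def bij_betw_def f_inv_into_f)
      next
        case False
        then show ?thesis using f by (auto simp: PiE_def extensional_def)
      qed
    qed
    ultimately show "f \<in> (\<lambda>(g, h). restrict (g \<circ> h) Q) ` ?C"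
      by (intro image_eqI[of _ _ "(g, h)"]) auto
  qed
  then have "card {f \<in> Q \<rightarrow>\<^sub>E {..<N}. card (f ` Q) \<le> k} \<le> card ((\<lambda>(g, h). restrict (g \<circ> h) Q) ` ?C)"
    using assms by (intro card_mono finite_imageI finite_cartesian_product finite_PiE) auto
  also have "\<dots> \<le> card ?C"
    using assms by (intro card_image_le finite_cartesian_product finite_PiE) auto
  also have "\<dots> = N ^ k * k ^ card Q"
    using assms by (simp add: card_cartesian_product card_PiE)
  finally show ?thesis .
qed

text \<open>If every occurring vertex is visited at least twice and one of them three times, then
  \<open>P\<close> letters accommodate \<open>V\<close> vertices only if
  \<open>2 V + 1 <= P\<close>. The exponent is thus half a power below the order
  \<open>N ^ (P / 2)\<close> which the scaling of the statistics compensates.\<close>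

lemma card_tuples_few_vertices:
  assumes A: "finite A" and N: "\<And>a. a \<in> A \<Longrightarrow> n a \<le> N" and p: "\<And>a. a \<in> A \<Longrightarrow> 1 \<le> p a"
  shows "card {W \<in> \<Pi>\<^sub>E a\<in>A. words (n a) (p a). (\<forall>v. visits A W v \<noteq> 1) \<and> (\<exists>v. 3 \<le> visits A W v)}
    \<le> N ^ ((sum p A - 1) div 2) * sum p A ^ sum p A"
proof -
  define P where "P = sum p A"
  define k where "k = (P - 1) div 2"
  define Q where "Q = (SIGMA a:A. {..<p a})"
  let ?T = "{W \<in> \<Pi>\<^sub>E a\<in>A. words (n a) (p a). (\<forall>v. visits A W v \<noteq> 1) \<and> (\<exists>v. 3 \<le> visits A W v)}"
  let ?F = "{f \<in> Q \<rightarrow>\<^sub>E {..<N}. card (f ` Q) \<le> k}"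
  \<comment> \<open>A tuple of words is read as one function on all letter positions, so that its
    set of vertices is the image of that function.\<close>
  define enc where "enc W = (\<lambda>q\<in>Q. W (fst q) ! snd q)" for W :: "'a \<Rightarrow> nat list"
  have Q: "finite Q" "card Q = P" using A by (auto simp: Q_def P_def)
  have inj: "inj_on enc ?T"
  proof
    fix W W' assume W: "W \<in> ?T" "W' \<in> ?T" "enc W = enc W'"
    have "W a = W' a" if a: "a \<in> A" for a
    proof (rule nth_equalityI)
      show "length (W a) = length (W' a)" using W a by (auto simp: PiE_iff)
      fix i assume "i < length (W a)"
      then have "(a, i) \<in> Q" using W a by (auto simp: PiE_iff Q_def)
      then show "W a ! i = W' a ! i" using fun_cong[OF W(3), of "(a, i)"] by (simp add: enc_def)
    qed
    then show "W = W'" using W by (intro PiE_ext[of W A "\<lambda>a. words (n a) (p a)" W']) auto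
  qed
  have sub: "enc ` ?T \<subseteq> ?F"
  proof (rule image_subsetI)
    fix W assume "W \<in> ?T"
    then obtain x where W: "W \<in> (\<Pi>\<^sub>E a\<in>A. words (n a) (p a))" "\<forall>v. visits A W v \<noteq> 1"
      and x: "3 \<le> visits A W x" by blast
    have encQ: "enc W \<in> Q \<rightarrow>\<^sub>E {..<N}"
    proof -
      have "W a ! i < N" if "a \<in> A" "i < p a" for a i
      proof -
        have "W a ! i \<in> set (W a)" using W that by (auto simp: PiE_iff)
        moreover have "set (W a) \<subseteq> {..<n a}" using W(1) that by (auto simp: PiE_iff)
        ultimately show ?thesis using N[OF that(1)] by auto
      qed
      then show ?thesis by (auto simp: enc_def Q_def)
    qed
    let ?V = "\<Union>a\<in>A. set (W a)"
    have fin: "finite ?V" using A by auto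
    have im: "enc W ` Q = ?V"
    proof -
      have "enc W ` Q = (\<Union>a\<in>A. (\<lambda>i. W a ! i) ` {..<p a})"
        by (force simp: enc_def Q_def)
      also have "\<dots> = ?V"
        using W by (intro SUP_cong refl) (auto simp: PiE_iff set_conv_nth)
      finally show ?thesis .
    qed
    have ge: "2 \<le> visits A W v" if v: "v \<in> ?V" for v
    proof -
      obtain a where a: "a \<in> A" "v \<in> set (W a)" using v by auto
      then have "1 \<le> count_list (W a) v" by (simp add: Suc_le_eq count_list_0_iff zero_less_iff_neq_zero)
      also have "\<dots> \<le> visits A W v" unfolding visits_def using a A by (intro member_le_sum) auto
      finally show ?thesis using W(2)[rule_format, of v] by linarith
    qed
    have xV: "x \<in> ?V"
    proof (rule ccontr)
      assume "x \<notin> ?V"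
      then have "visits A W x = 0" by (auto simp: visits_def count_list_0_iff)
      then show False using x by simp
    qed
    have "P = (\<Sum>a\<in>A. \<Sum>v\<in>?V. count_list (W a) v)"
    proof -
      have "(\<Sum>v\<in>?V. count_list (W a) v) = p a" if "a \<in> A" for a
        using that W fin sum_count_set[of "W a" ?V] by (auto simp: PiE_iff)
      then show ?thesis by (simp add: P_def)
    qed
    also have "\<dots> = (\<Sum>v\<in>?V. visits A W v)"
      unfolding visits_def by (rule sum.swap)
    also have "\<dots> = visits A W x + (\<Sum>v\<in>?V - {x}. visits A W v)"
      using fin xV by (rule sum.remove)
    finally have "P \<ge> 3 + (\<Sum>v\<in>?V - {x}. 2)"
      using x sum_mono[of "?V - {x}" "\<lambda>_. 2" "visits A W"] ge by force
    moreover have "(\<Sum>v\<in>?V - {x}. 2) = 2 * (card ?V - 1)" using fin xV by simp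
    moreover have "card ?V \<ge> 1" using fin xV by (metis card_0_eq empty_iff less_one not_less)
    ultimately have "card ?V \<le> k" unfolding k_def by linarith
    then have "card (enc W ` Q) \<le> k" using im by simp
    with encQ show "enc W \<in> ?F" by simp
  qed
  show ?thesis
  proof (cases "A = {}")
    case True
    then have "?T = {}" by (auto simp: visits_def)
    then show ?thesis by (simp only: card.empty)
  next
    case False
    have "Q \<noteq> {}"
    proof -
      from False obtain a where "a \<in> A" by auto
      then have "(a, 0) \<in> Q" using p[of a] by (auto simp: Q_def)
      then show ?thesis by auto
    qed
    have "card ?T \<le> card ?F"
    using Q by (intro card_inj_on_le[OF inj sub] finite_subset[OF _ finite_PiE[of Q "\<lambda>_. {..<N}"]]) auto
  also have "\<dots> \<le> N ^ k * k ^ card Q" by (rule card_functions_small_image[OF Q(1) \<open>Q \<noteq> {}\<close>])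
  also have "\<dots> \<le> N ^ k * P ^ P" unfolding Q k_def by (intro mult_left_mono power_mono) auto
  finally show ?thesis by (simp add: P_def k_def)
  qed
qed

section \<open>Independence of entries on disjoint sets of edges\<close>

context time_dependent_wigner begin

text \<open>Letters of words start at 0, indices of the processes at 1.\<close>

definition entry :: "real \<Rightarrow> nat \<Rightarrow> nat \<Rightarrow> 'a \<Rightarrow> complex" where
  "entry t i j \<omega> = wigner_entry Z Y (i + 1) (j + 1) t \<omega>"

text \<open>An unordered pair is represented by the index under which its process is given, smaller
  entry first: the entries at \<open>(i, j)\<close> and \<open>(j, i)\<close> are functions of the
  same process.\<close>

definition edge :: "nat \<Rightarrow> nat \<Rightarrow> nat \<times> nat" where
  "edge i j = (min i j + 1, max i j + 1)"

definition edges :: "(nat \<times> nat) set" where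
  "edges = {(i, j). 1 \<le> i \<and> i \<le> j}"

abbreviation paths :: "(real \<Rightarrow> complex) measure" where
  "paths \<equiv> \<Pi>\<^sub>M t\<in>UNIV. borel"

definition entry_path :: "nat \<times> nat \<Rightarrow> 'a \<Rightarrow> real \<Rightarrow> complex" where
  "entry_path = (\<lambda>(i, j) \<omega> t. wigner_entry Z Y i j t \<omega>)"

text \<open>Generated by the paths at all times together, because entries of one edge at different
  times are correlated and only whole paths are independent across edges.\<close>

definition sigma_edges :: "(nat \<times> nat) set \<Rightarrow> 'a measure" where
  "sigma_edges E = vimage_algebra (space M) (\<lambda>\<omega>. \<lambda>e\<in>E. entry_path e \<omega>) (\<Pi>\<^sub>M e\<in>E. paths)"

lemma edge_commute: "edge i j = edge j i"
  by (simp add: edge_def min.commute max.commute)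

lemma edge_in_edges [simp]: "edge i j \<in> edges"
  by (auto simp: edge_def edges_def)

lemma edge_eq_iff: "edge i j = edge k l \<longleftrightarrow> (i = k \<and> j = l) \<or> (i = l \<and> j = k)"
  by (auto simp: edge_def min_def max_def split: if_splits)

lemma indep_paths: "indep_vars (\<lambda>_. paths) entry_path edges"
  using indep unfolding entry_path_def edges_def by simp

lemma entry_path_measurable: "e \<in> edges \<Longrightarrow> random_variable paths (entry_path e)"
  using indep_paths by (auto simp: indep_vars_def)

lemma restrict_paths_measurable:
  "E \<subseteq> edges \<Longrightarrow> (\<lambda>\<omega>. \<lambda>e\<in>E. entry_path e \<omega>) \<in> M \<rightarrow>\<^sub>M (\<Pi>\<^sub>M e\<in>E. paths)"
  using entry_path_measurable by (auto intro!: measurable_restrict)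

lemma space_sigma_edges [simp]: "space (sigma_edges E) = space M"
  by (simp add: sigma_edges_def)

lemma sets_sigma_edges: "E \<subseteq> edges \<Longrightarrow> sets (sigma_edges E) \<subseteq> sets M"
  unfolding sigma_edges_def by (rule sets_image_in_sets[OF refl restrict_paths_measurable])

lemma sigma_edges_mono:
  assumes "E \<subseteq> E'" "E' \<subseteq> edges"
  shows "sets (sigma_edges E) \<subseteq> sets (sigma_edges E')"
proof -
  have "(\<lambda>\<omega>. \<lambda>e\<in>E'. entry_path e \<omega>) \<in> sigma_edges E' \<rightarrow>\<^sub>M (\<Pi>\<^sub>M e\<in>E'. paths)"
    unfolding sigma_edges_def
    using measurable_space[OF restrict_paths_measurable[OF assms(2)]]
    by (intro measurable_vimage_algebra1) auto
  then have "(\<lambda>\<omega>. restrict (\<lambda>e\<in>E'. entry_path e \<omega>) E) \<in> sigma_edges E' \<rightarrow>\<^sub>M (\<Pi>\<^sub>M e\<in>E. paths)"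
    using measurable_compose[OF _ measurable_restrict_subset[OF assms(1)]] by blast
  also have "(\<lambda>\<omega>. restrict (\<lambda>e\<in>E'. entry_path e \<omega>) E) = (\<lambda>\<omega>. \<lambda>e\<in>E. entry_path e \<omega>)"
    using assms by (auto simp: fun_eq_iff restrict_def)
  finally have "(\<lambda>\<omega>. \<lambda>e\<in>E. entry_path e \<omega>) \<in> sigma_edges E' \<rightarrow>\<^sub>M (\<Pi>\<^sub>M e\<in>E. paths)" .
  then show ?thesis unfolding sigma_edges_def[of E] by (rule sets_image_in_sets[OF space_sigma_edges])
qed

lemma measurable_sets_mono:
  assumes "F \<in> N \<rightarrow>\<^sub>M K" "sets N \<subseteq> sets N'" "space N = space N'"
  shows "F \<in> N' \<rightarrow>\<^sub>M K"
  using assms by (auto simp: measurable_def)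

lemma measurable_sigma_edges_mono:
  "F \<in> sigma_edges E \<rightarrow>\<^sub>M K \<Longrightarrow> E \<subseteq> E' \<Longrightarrow> E' \<subseteq> edges \<Longrightarrow> F \<in> sigma_edges E' \<rightarrow>\<^sub>M K"
  by (rule measurable_sets_mono[OF _ sigma_edges_mono]) auto

lemma measurable_sigma_edges:
  "F \<in> sigma_edges E \<rightarrow>\<^sub>M K \<Longrightarrow> E \<subseteq> edges \<Longrightarrow> F \<in> M \<rightarrow>\<^sub>M K"
  by (rule measurable_sets_mono[OF _ sets_sigma_edges]) auto

text \<open>Independence of whole paths, restricted to two disjoint sets of edges and passed on to
  everything measurable for the generated sigma-algebras. Later factorisations of expectations only
  have to exhibit the edges on which each factor depends.\<close>

lemma indep_var_sigma_edges:
  fixes F1 F2 :: "'a \<Rightarrow> complex"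
  assumes F: "F1 \<in> borel_measurable (sigma_edges E1)" "F2 \<in> borel_measurable (sigma_edges E2)"
    and E: "E1 \<inter> E2 = {}" "E1 \<subseteq> edges" "E2 \<subseteq> edges"
  shows "indep_var borel F1 borel F2"
proof -
  let ?R = "\<lambda>E \<omega>. \<lambda>e\<in>E. entry_path e \<omega>"
  let ?S = "\<lambda>E. sigma_sets (space M) {?R E -` A \<inter> space M |A. A \<in> sets (\<Pi>\<^sub>M e\<in>E. paths)}"
  have "indep_var (\<Pi>\<^sub>M e\<in>E1. paths) (?R E1) (\<Pi>\<^sub>M e\<in>E2. paths) (?R E2)"
    using indep_var_restrict[OF indep_paths E] by simp
  then have S: "indep_set (?S E1) (?S E2)" unfolding indep_var_eq by simp
  have sub: "sigma_sets (space M) {F -` A \<inter> space M |A. A \<in> sets borel} \<subseteq> ?S E"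
    if F: "F \<in> borel_measurable (sigma_edges E)" and "E \<subseteq> edges" for F :: "'a \<Rightarrow> complex" and E
  proof (rule sigma_sets_mono)
    have "sets (sigma_edges E) = ?S E"
      unfolding sigma_edges_def sets_vimage_algebra by simp
    then show "{F -` A \<inter> space M |A. A \<in> sets borel} \<subseteq> ?S E"
      using measurable_sets[OF F] by auto
  qed
  have "indep_set (sigma_sets (space M) {F1 -` A \<inter> space M |A. A \<in> sets borel})
      (sigma_sets (space M) {F2 -` A \<inter> space M |A. A \<in> sets borel})"
    using S sub[OF F(1) E(2)] sub[OF F(2) E(3)] unfolding indep_set_def
    by (elim indep_sets_mono_sets) (auto split: bool.split)
  then show ?thesis
    unfolding indep_var_eq
    using measurable_sigma_edges[OF F(1) E(2)] measurable_sigma_edges[OF F(2) E(3)] by simp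
qed

lemma wigner_entry_measurable_sigma:
  assumes "edge i j \<in> E" "E \<subseteq> edges"
  shows "entry t i j \<in> borel_measurable (sigma_edges E)"
proof -
  have R: "(\<lambda>\<omega>. \<lambda>e\<in>E. entry_path e \<omega>) \<in> sigma_edges E \<rightarrow>\<^sub>M (\<Pi>\<^sub>M e\<in>E. paths)"
    unfolding sigma_edges_def
    using measurable_space[OF restrict_paths_measurable[OF assms(2)]]
    by (intro measurable_vimage_algebra1) auto
  have "(\<lambda>\<omega>. (\<lambda>e\<in>E. entry_path e \<omega>) (edge i j)) \<in> sigma_edges E \<rightarrow>\<^sub>M paths"
    using measurable_compose[OF R measurable_component_singleton[OF assms(1)]] .
  then have "(\<lambda>\<omega>. (\<lambda>e\<in>E. entry_path e \<omega>) (edge i j) t) \<in> borel_measurable (sigma_edges E)"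
    using measurable_compose[OF _ measurable_component_singleton[of t UNIV "\<lambda>_. borel"]] by blast
  then have m: "(\<lambda>\<omega>. entry_path (edge i j) \<omega> t) \<in> borel_measurable (sigma_edges E)"
    using assms by simp
  have "entry t i j = (\<lambda>\<omega>. if i \<le> j then entry_path (edge i j) \<omega> t else cnj (entry_path (edge i j) \<omega> t))"
    by (auto simp: fun_eq_iff entry_def entry_path_def edge_def wigner_entry_def)
  moreover have "(cnj :: complex \<Rightarrow> complex) \<in> borel_measurable borel"
    by (intro borel_measurable_continuous_onI continuous_intros)
  ultimately show ?thesis using m measurable_compose[OF m, of cnj borel]
    by (cases "i \<le> j") simp_all
qed

lemma entry_measurable [measurable]: "entry t i j \<in> borel_measurable M"
  using measurable_sigma_edges[OF wigner_entry_measurable_sigma[of i j edges]] by simp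

lemma entry_cnj: "entry t j i \<omega> = cnj (entry t i j \<omega>)"
  by (auto simp: entry_def wigner_entry_def)

section \<open>Uniform moment bounds\<close>

text \<open>The bound for each order is uniform over \<open>I\<close>, which will consist of times
  and words of a fixed length. Uniformity is essential because the number of words grows with the
  dimension.\<close>

definition moment_bounded :: "'x set \<Rightarrow> ('x \<Rightarrow> 'a \<Rightarrow> complex) \<Rightarrow> bool" where
  "moment_bounded I f \<longleftrightarrow> (\<forall>x\<in>I. f x \<in> borel_measurable M) \<and>
    (\<forall>k::nat. \<exists>B. \<forall>x\<in>I. integrable M (\<lambda>\<omega>. cmod (f x \<omega>) ^ k) \<and> (LINT \<omega>|M. cmod (f x \<omega>) ^ k) \<le> B)"

lemma moment_bounded_reindex:
  "moment_bounded I f \<Longrightarrow> (\<And>x. x \<in> J \<Longrightarrow> h x \<in> I) \<Longrightarrow> moment_bounded J (\<lambda>x. f (h x))"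
  unfolding moment_bounded_def by blast

lemma moment_bounded_power_integrable:
  "moment_bounded I f \<Longrightarrow> x \<in> I \<Longrightarrow> integrable M (\<lambda>\<omega>. cmod (f x \<omega>) ^ k)"
  unfolding moment_bounded_def by blast

lemma moment_bounded_dominated:
  assumes meas: "\<And>x. x \<in> I \<Longrightarrow> f x \<in> borel_measurable M"
    and int: "\<And>x k. x \<in> I \<Longrightarrow> integrable M (g k x)"
    and bound: "\<And>k. \<exists>B. \<forall>x\<in>I. (LINT \<omega>|M. g k x \<omega>) \<le> B"
    and le: "\<And>x k \<omega>. x \<in> I \<Longrightarrow> \<omega> \<in> space M \<Longrightarrow> cmod (f x \<omega>) ^ k \<le> g k x \<omega>"
  shows "moment_bounded I f"
  unfolding moment_bounded_def
proof (intro conjI ballI allI)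
  fix k :: nat
  obtain B where B: "\<forall>x\<in>I. (LINT \<omega>|M. g k x \<omega>) \<le> B" using bound by blast
  have i: "integrable M (\<lambda>\<omega>. cmod (f x \<omega>) ^ k)" if x: "x \<in> I" for x
  proof (rule Bochner_Integration.integrable_bound[OF int[OF x, of k]])
    show "(\<lambda>\<omega>. cmod (f x \<omega>) ^ k) \<in> borel_measurable M" using meas[OF x] by measurable
    show "AE \<omega> in M. norm (cmod (f x \<omega>) ^ k) \<le> norm (g k x \<omega>)"
    proof (rule AE_I2)
      fix \<omega> assume "\<omega> \<in> space M"
      from le[OF x this, of k] show "norm (cmod (f x \<omega>) ^ k) \<le> norm (g k x \<omega>)" by simp
    qed
  qed
  show "\<exists>B. \<forall>x\<in>I. integrable M (\<lambda>\<omega>. cmod (f x \<omega>) ^ k) \<and> (LINT \<omega>|M. cmod (f x \<omega>) ^ k) \<le> B"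
  proof (intro exI[of _ B] ballI conjI)
    fix x assume x: "x \<in> I"
    have "(LINT \<omega>|M. cmod (f x \<omega>) ^ k) \<le> (LINT \<omega>|M. g k x \<omega>)"
      using i[OF x] int[OF x] le[OF x] by (intro integral_mono) auto
    then show "(LINT \<omega>|M. cmod (f x \<omega>) ^ k) \<le> B" using B x by force
  qed (rule i)
qed (rule meas)

text \<open>The elementary bound \<open>|f g|^k <= |f|^(2k) + |g|^(2k)\<close> takes the place of
  Hoelder's inequality; asking for moments of all orders is what makes the class closed under
  products.\<close>

lemma moment_bounded_mult:
  assumes f: "moment_bounded I f" and g: "moment_bounded I g"
  shows "moment_bounded I (\<lambda>x \<omega>. f x \<omega> * g x \<omega>)"
proof (rule moment_bounded_dominated)
  show "(\<lambda>\<omega>. f x \<omega> * g x \<omega>) \<in> borel_measurable M" if "x \<in> I" for x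
    using f g that unfolding moment_bounded_def by (intro borel_measurable_times) auto
  show "integrable M (\<lambda>\<omega>. cmod (f x \<omega>) ^ (2 * k) + cmod (g x \<omega>) ^ (2 * k))" if "x \<in> I" for x k
    using f g that by (intro Bochner_Integration.integrable_add moment_bounded_power_integrable)
  show "\<exists>B. \<forall>x\<in>I. (LINT \<omega>|M. cmod (f x \<omega>) ^ (2 * k) + cmod (g x \<omega>) ^ (2 * k)) \<le> B" for k
  proof -
    obtain B1 B2 where "\<forall>x\<in>I. integrable M (\<lambda>\<omega>. cmod (f x \<omega>) ^ (2 * k)) \<and> (LINT \<omega>|M. cmod (f x \<omega>) ^ (2 * k)) \<le> B1"
      "\<forall>x\<in>I. integrable M (\<lambda>\<omega>. cmod (g x \<omega>) ^ (2 * k)) \<and> (LINT \<omega>|M. cmod (g x \<omega>) ^ (2 * k)) \<le> B2"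
      using f g unfolding moment_bounded_def by blast
    then show ?thesis by (intro exI[of _ "B1 + B2"]) (auto intro!: add_mono)
  qed
  show "cmod (f x \<omega> * g x \<omega>) ^ k \<le> cmod (f x \<omega>) ^ (2 * k) + cmod (g x \<omega>) ^ (2 * k)" for x k \<omega>
  proof -
    have "0 \<le> (cmod (f x \<omega>) ^ k - cmod (g x \<omega>) ^ k)\<^sup>2" by simp
    then have "2 * (cmod (f x \<omega>) ^ k * cmod (g x \<omega>) ^ k) \<le> cmod (f x \<omega>) ^ (2 * k) + cmod (g x \<omega>) ^ (2 * k)"
      by (simp add: power2_diff power_mult[symmetric] mult.commute[of _ 2] mult.assoc)
    moreover have "0 \<le> cmod (f x \<omega>) ^ k * cmod (g x \<omega>) ^ k" by simp
    ultimately show ?thesis unfolding norm_mult power_mult_distrib by linarith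
  qed
qed

lemma moment_bounded_add:
  assumes f: "moment_bounded I f" and g: "moment_bounded I g"
  shows "moment_bounded I (\<lambda>x \<omega>. f x \<omega> + g x \<omega>)"
proof (rule moment_bounded_dominated)
  show "(\<lambda>\<omega>. f x \<omega> + g x \<omega>) \<in> borel_measurable M" if "x \<in> I" for x
    using f g that unfolding moment_bounded_def by (intro borel_measurable_add) auto
  show "integrable M (\<lambda>\<omega>. 2 ^ k * (cmod (f x \<omega>) ^ k + cmod (g x \<omega>) ^ k))" if "x \<in> I" for x k
    using f g that
    by (intro integrable_mult_right Bochner_Integration.integrable_add moment_bounded_power_integrable)
  show "\<exists>B. \<forall>x\<in>I. (LINT \<omega>|M. 2 ^ k * (cmod (f x \<omega>) ^ k + cmod (g x \<omega>) ^ k)) \<le> B" for k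
  proof -
    obtain B1 B2 where "\<forall>x\<in>I. integrable M (\<lambda>\<omega>. cmod (f x \<omega>) ^ k) \<and> (LINT \<omega>|M. cmod (f x \<omega>) ^ k) \<le> B1"
      "\<forall>x\<in>I. integrable M (\<lambda>\<omega>. cmod (g x \<omega>) ^ k) \<and> (LINT \<omega>|M. cmod (g x \<omega>) ^ k) \<le> B2"
      using f g unfolding moment_bounded_def by blast
    then show ?thesis by (intro exI[of _ "2 ^ k * (B1 + B2)"]) (auto intro!: add_mono)
  qed
  show "cmod (f x \<omega> + g x \<omega>) ^ k \<le> 2 ^ k * (cmod (f x \<omega>) ^ k + cmod (g x \<omega>) ^ k)" for x k \<omega>
  proof -
    let ?m = "max (cmod (f x \<omega>)) (cmod (g x \<omega>))"
    have "cmod (f x \<omega> + g x \<omega>) \<le> 2 * ?m" using norm_triangle_ineq[of "f x \<omega>" "g x \<omega>"] by simp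
    then have "cmod (f x \<omega> + g x \<omega>) ^ k \<le> (2 * ?m) ^ k" by (intro power_mono) auto
    also have "\<dots> \<le> 2 ^ k * (cmod (f x \<omega>) ^ k + cmod (g x \<omega>) ^ k)"
      by (auto simp: power_mult_distrib max_def)
    finally show ?thesis .
  qed
qed

lemma moment_bounded_const:
  assumes "\<And>x. x \<in> I \<Longrightarrow> cmod (c x) \<le> B"
  shows "moment_bounded I (\<lambda>x \<omega>. c x)"
proof (rule moment_bounded_dominated[where g = "\<lambda>k x \<omega>. cmod (c x) ^ k"])
  show "integrable M (\<lambda>\<omega>. cmod (c x) ^ k)" for x k by simp
  show "\<exists>C. \<forall>x\<in>I. (LINT \<omega>|M. cmod (c x) ^ k) \<le> C" for k
    using assms by (intro exI[of _ "B ^ k"] ballI) (simp add: prob_space power_mono)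
qed simp_all

lemma moment_bounded_diff:
  assumes f: "moment_bounded I f" and g: "moment_bounded I g"
  shows "moment_bounded I (\<lambda>x \<omega>. f x \<omega> - g x \<omega>)"
proof -
  have "moment_bounded I (\<lambda>x \<omega>. (- 1) * g x \<omega>)"
    by (rule moment_bounded_mult[OF moment_bounded_const[of _ _ 1] g]) auto
  from moment_bounded_add[OF f this] show ?thesis by simp
qed

lemma moment_bounded_prod:
  assumes "finite A" "\<And>a. a \<in> A \<Longrightarrow> moment_bounded I (f a)"
  shows "moment_bounded I (\<lambda>x \<omega>. \<Prod>a\<in>A. f a x \<omega>)"
  using assms
proof (induction A rule: finite_induct)
  case empty
  then show ?case using moment_bounded_const[of I "\<lambda>_. 1" 1] by simp
next
  case (insert a A)
  then show ?case using moment_bounded_mult[of I "f a" "\<lambda>x \<omega>. \<Prod>a\<in>A. f a x \<omega>"] by simp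
qed

lemma moment_bounded_integrable:
  assumes "moment_bounded I f" "x \<in> I"
  shows "integrable M (f x)"
proof -
  have "integrable M (\<lambda>\<omega>. cmod (f x \<omega>))"
    using moment_bounded_power_integrable[OF assms, of 1] by simp
  then show ?thesis
    by (rule integrable_norm_cancel) (use assms in \<open>auto simp: moment_bounded_def\<close>)
qed

lemma moment_bounded_integral_bound:
  assumes "moment_bounded I f"
  shows "\<exists>B. \<forall>x\<in>I. cmod (LINT \<omega>|M. f x \<omega>) \<le> B"
proof -
  have "\<exists>B. \<forall>x\<in>I. integrable M (\<lambda>\<omega>. cmod (f x \<omega>) ^ 1) \<and> (LINT \<omega>|M. cmod (f x \<omega>) ^ 1) \<le> B"
    using assms unfolding moment_bounded_def by (elim conjE allE[of _ 1])
  then obtain B where B: "\<And>x. x \<in> I \<Longrightarrow> (LINT \<omega>|M. cmod (f x \<omega>)) \<le> B"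
    unfolding power_one_right by metis
  show ?thesis
    using order_trans[OF integral_norm_bound B] by blast
qed

lemma integral_indep:
  fixes F1 F2 :: "'a \<Rightarrow> complex"
  assumes F: "F1 \<in> borel_measurable (sigma_edges E1)" "F2 \<in> borel_measurable (sigma_edges E2)"
    and E: "E1 \<inter> E2 = {}" "E1 \<subseteq> edges" "E2 \<subseteq> edges"
    and "integrable M F1" "integrable M F2"
  shows "(LINT \<omega>|M. F1 \<omega> * F2 \<omega>) = (LINT \<omega>|M. F1 \<omega>) * (LINT \<omega>|M. F2 \<omega>)"
  using indep_var_lebesgue_integral[OF indep_var_sigma_edges[OF F E]] assms by simp

section \<open>Second and fourth moments of the entries\<close>

abbreviation c :: "real \<Rightarrow> real \<Rightarrow> real" where
  "c \<equiv> wigner_cov M \<beta> Y"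

lemma c_commute: "c s t = c t s"
  by (simp add: wigner_cov_def mult.commute)

lemma beta_cases: obtains "\<beta> = 1" | "\<beta> = 2"
  using beta by blast

lemma entry_diag: "entry t i i \<omega> = complex_of_real (Y (i + 1) t \<omega>)"
  by (simp add: entry_def wigner_entry_def)

lemma entry_off: "i < j \<Longrightarrow> entry t i j \<omega> = Z (i + 1) (j + 1) t \<omega>"
  by (simp add: entry_def wigner_entry_def)

lemma Z_path_measurable:
  "1 \<le> i \<Longrightarrow> i < j \<Longrightarrow> (\<lambda>\<omega> t. Z i j t \<omega>) \<in> M \<rightarrow>\<^sub>M (\<Pi>\<^sub>M t\<in>UNIV. borel)"
  by (intro measurable_abs_UNIV Z_measurable)

lemma Y_path_measurable:
  "1 \<le> i \<Longrightarrow> (\<lambda>\<omega> t. Y i t \<omega>) \<in> M \<rightarrow>\<^sub>M (\<Pi>\<^sub>M t\<in>UNIV. borel)"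
  by (intro measurable_abs_UNIV Y_measurable)

text \<open>Equality in law is used for whole paths, so that joint moments at two times can be
  transferred and not only moments at one time.\<close>

lemma Z_transfer:
  fixes h :: "(real \<Rightarrow> complex) \<Rightarrow> 'b::{banach, second_countable_topology}"
  assumes ij: "1 \<le> i" "i < j" and h: "h \<in> borel_measurable (\<Pi>\<^sub>M t\<in>UNIV. borel)"
  shows "(LINT \<omega>|M. h (\<lambda>t. Z i j t \<omega>)) = (LINT \<omega>|M. h (\<lambda>t. Z 1 2 t \<omega>))"
    and "integrable M (\<lambda>\<omega>. h (\<lambda>t. Z i j t \<omega>)) \<longleftrightarrow> integrable M (\<lambda>\<omega>. h (\<lambda>t. Z 1 2 t \<omega>))"
  using integral_distr[OF Z_path_measurable[OF ij] h] integral_distr[OF Z_path_measurable[of 1 2] h]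
    integrable_distr_eq[OF Z_path_measurable[OF ij] h] integrable_distr_eq[OF Z_path_measurable[of 1 2] h]
    Z_identically_distributed[OF ij] by simp_all

lemma Y_transfer:
  fixes h :: "(real \<Rightarrow> real) \<Rightarrow> 'b::{banach, second_countable_topology}"
  assumes i: "1 \<le> i" and h: "h \<in> borel_measurable (\<Pi>\<^sub>M t\<in>UNIV. borel)"
  shows "(LINT \<omega>|M. h (\<lambda>t. Y i t \<omega>)) = (LINT \<omega>|M. h (\<lambda>t. Y 1 t \<omega>))"
    and "integrable M (\<lambda>\<omega>. h (\<lambda>t. Y i t \<omega>)) \<longleftrightarrow> integrable M (\<lambda>\<omega>. h (\<lambda>t. Y 1 t \<omega>))"
  using integral_distr[OF Y_path_measurable[OF i] h] integral_distr[OF Y_path_measurable[of 1] h]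
    integrable_distr_eq[OF Y_path_measurable[OF i] h] integrable_distr_eq[OF Y_path_measurable[of 1] h]
    Y_identically_distributed[OF i] by simp_all

lemma cmod_entry_power:
  fixes k :: nat
  shows "(LINT \<omega>|M. cmod (entry t i j \<omega>) ^ k) =
      (if i = j then (LINT \<omega>|M. \<bar>Y 1 t \<omega>\<bar> ^ k) else (LINT \<omega>|M. cmod (Z 1 2 t \<omega>) ^ k))"
    and "integrable M (\<lambda>\<omega>. cmod (entry t i j \<omega>) ^ k) \<longleftrightarrow>
      (if i = j then integrable M (\<lambda>\<omega>. \<bar>Y 1 t \<omega>\<bar> ^ k) else integrable M (\<lambda>\<omega>. cmod (Z 1 2 t \<omega>) ^ k))"
proof -
  have mZ: "(\<lambda>f. cmod (f t) ^ k) \<in> borel_measurable (\<Pi>\<^sub>M t\<in>UNIV. borel)" by measurable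
  have mY: "(\<lambda>f. \<bar>f t\<bar> ^ k) \<in> borel_measurable (\<Pi>\<^sub>M t\<in>UNIV. borel :: real measure)" by measurable
  have "(\<lambda>\<omega>. cmod (entry t i j \<omega>) ^ k) = (if i = j then (\<lambda>\<omega>. \<bar>Y (i + 1) t \<omega>\<bar> ^ k)
      else (\<lambda>\<omega>. cmod (Z (min i j + 1) (max i j + 1) t \<omega>) ^ k))"
    by (auto simp: fun_eq_iff entry_def wigner_entry_def min_def max_def)
  moreover have "i \<noteq> j \<Longrightarrow> 1 \<le> min i j + 1 \<and> min i j + 1 < max i j + 1" by auto
  ultimately show "(LINT \<omega>|M. cmod (entry t i j \<omega>) ^ k) =
      (if i = j then (LINT \<omega>|M. \<bar>Y 1 t \<omega>\<bar> ^ k) else (LINT \<omega>|M. cmod (Z 1 2 t \<omega>) ^ k))"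
    "integrable M (\<lambda>\<omega>. cmod (entry t i j \<omega>) ^ k) \<longleftrightarrow>
      (if i = j then integrable M (\<lambda>\<omega>. \<bar>Y 1 t \<omega>\<bar> ^ k) else integrable M (\<lambda>\<omega>. cmod (Z 1 2 t \<omega>) ^ k))"
    using Z_transfer[OF _ _ mZ, of "min i j + 1" "max i j + 1"] Y_transfer[OF _ mY, of "i + 1"]
    by (cases "i = j"; simp)+
qed

lemma moment_bounded_entry: "moment_bounded UNIV (\<lambda>(t, i, j). entry t i j)"
  unfolding moment_bounded_def
proof (intro conjI ballI allI)
  fix x :: "real \<times> nat \<times> nat"
  show "(case x of (t, i, j) \<Rightarrow> entry t i j) \<in> borel_measurable M" by (cases x) simp
next
  fix k :: nat
  show "\<exists>B. \<forall>x\<in>UNIV. integrable M (\<lambda>\<omega>. cmod ((case x of (t, i, j) \<Rightarrow> entry t i j) \<omega>) ^ k) \<and>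
      (LINT \<omega>|M. cmod ((case x of (t, i, j) \<Rightarrow> entry t i j) \<omega>) ^ k) \<le> B"
  proof (cases "k = 0")
    case False
    then obtain b1 b2 where "\<forall>t. integrable M (\<lambda>\<omega>. cmod (Z 1 2 t \<omega>) ^ k) \<and> (LINT \<omega>|M. cmod (Z 1 2 t \<omega>) ^ k) \<le> b1"
      "\<forall>t. integrable M (\<lambda>\<omega>. \<bar>Y 1 t \<omega>\<bar> ^ k) \<and> (LINT \<omega>|M. \<bar>Y 1 t \<omega>\<bar> ^ k) \<le> b2"
      using Z_moments[of k] Y_moments[of k] by auto
    then show ?thesis
      by (intro exI[of _ "max b1 b2"]) (auto simp: cmod_entry_power le_max_iff_disj)
  qed (auto simp: prob_space)
qed

text \<open>A random variable with finite moments of all orders, the one-element case of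
  \<open>moment_bounded\<close>. The class is closed under sums and products, so integrability of a
  polynomial in the entries follows from its shape.\<close>

definition Lp :: "('a \<Rightarrow> complex) \<Rightarrow> bool" where
  "Lp F \<longleftrightarrow> moment_bounded {()} (\<lambda>_. F)"

lemma Lp_mult: "Lp F \<Longrightarrow> Lp G \<Longrightarrow> Lp (\<lambda>\<omega>. F \<omega> * G \<omega>)"
  unfolding Lp_def by (rule moment_bounded_mult)

lemma Lp_diff: "Lp F \<Longrightarrow> Lp G \<Longrightarrow> Lp (\<lambda>\<omega>. F \<omega> - G \<omega>)"
  unfolding Lp_def by (rule moment_bounded_diff)

lemma Lp_const: "Lp (\<lambda>_. k)"
  unfolding Lp_def by (rule moment_bounded_const[of _ _ "cmod k"]) simp

lemma Lp_prod: "finite A \<Longrightarrow> (\<And>a. a \<in> A \<Longrightarrow> Lp (F a)) \<Longrightarrow> Lp (\<lambda>\<omega>. \<Prod>a\<in>A. F a \<omega>)"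
  unfolding Lp_def by (rule moment_bounded_prod)

lemma Lp_integrable: "Lp F \<Longrightarrow> integrable M F"
  unfolding Lp_def by (drule moment_bounded_integrable) auto

lemma Lp_of_moment_bounded: "moment_bounded I f \<Longrightarrow> x \<in> I \<Longrightarrow> Lp (f x)"
  unfolding Lp_def by (rule moment_bounded_reindex)

lemma Lp_entry: "Lp (entry t i j)"
  using Lp_of_moment_bounded[OF moment_bounded_entry, of "(t, i, j)"] by simp

lemma expectation_cnj: "Lp F \<Longrightarrow> (LINT \<omega>|M. cnj (F \<omega>)) = cnj (LINT \<omega>|M. F \<omega>)"
  by (rule integral_bounded_linear[OF bounded_linear_cnj Lp_integrable])

lemma entry_mean: "(LINT \<omega>|M. entry t i j \<omega>) = 0"
proof -
  consider "i = j" | "i < j" | "j < i" by linarith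
  then show ?thesis
  proof cases
    case 1
    then show ?thesis using Y_mean[of "i + 1" t] by (simp add: entry_diag)
  next
    case 2
    then show ?thesis using Z_mean[of "i + 1" "j + 1" t] by (simp add: entry_off)
  next
    case 3
    have "(LINT \<omega>|M. entry t i j \<omega>) = (LINT \<omega>|M. cnj (entry t j i \<omega>))"
      by (intro Bochner_Integration.integral_cong) (simp_all add: entry_cnj[of t i j])
    also have "\<dots> = cnj (LINT \<omega>|M. entry t j i \<omega>)" by (rule expectation_cnj[OF Lp_entry])
    finally show ?thesis using 3 Z_mean[of "j + 1" "i + 1" t] by (simp add: entry_off)
  qed
qed

lemma entry_diag_cov: "(LINT \<omega>|M. entry s i i \<omega> * entry t i i \<omega>) = complex_of_real (2 / \<beta> * c s t)"
proof -
  have m: "(\<lambda>f. f s * f t) \<in> borel_measurable (\<Pi>\<^sub>M t\<in>UNIV. borel :: real measure)" by measurable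
  have "(LINT \<omega>|M. entry s i i \<omega> * entry t i i \<omega>) = complex_of_real (LINT \<omega>|M. Y (i + 1) s \<omega> * Y (i + 1) t \<omega>)"
    by (simp add: entry_diag flip: of_real_mult)
  also have "(LINT \<omega>|M. Y (i + 1) s \<omega> * Y (i + 1) t \<omega>) = (LINT \<omega>|M. Y 1 s \<omega> * Y 1 t \<omega>)"
    using Y_transfer(1)[OF _ m, of "i + 1"] by simp
  also have "\<dots> = 2 / \<beta> * c s t" using beta by (auto simp: wigner_cov_def)
  finally show ?thesis .
qed

lemma off_transfer:
  fixes h :: "(real \<Rightarrow> complex) \<Rightarrow> complex"
  assumes "i < j" and h: "h \<in> borel_measurable (\<Pi>\<^sub>M t\<in>UNIV. borel)"
  shows "(LINT \<omega>|M. h (\<lambda>t. entry t i j \<omega>)) = (LINT \<omega>|M. h (\<lambda>t. Z 1 2 t \<omega>))"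
  using Z_transfer(1)[OF _ _ h, of "i + 1" "j + 1"] assms(1) by (simp add: entry_off)

lemma cnj_measurable [measurable]: "cnj \<in> borel_measurable borel"
  by (intro borel_measurable_continuous_onI continuous_intros)

lemma Z_cov: "(LINT \<omega>|M. Z 1 2 s \<omega> * Z 1 2 t \<omega>) = (if \<beta> = 1 then complex_of_real (c s t) else 0)"
  using beta symmetric_cov hermitian_cov_0 by auto

lemma Z_cov_cnj: "(LINT \<omega>|M. Z 1 2 s \<omega> * cnj (Z 1 2 t \<omega>)) = complex_of_real (c s t)"
proof (cases rule: beta_cases)
  case 1
  have "(LINT \<omega>|M. Z 1 2 s \<omega> * cnj (Z 1 2 t \<omega>)) = (LINT \<omega>|M. Z 1 2 s \<omega> * Z 1 2 t \<omega>)"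
    using symmetric_real[OF 1, of 1 2] by (intro Bochner_Integration.integral_cong) (auto simp: Reals_cnj_iff)
  then show ?thesis using symmetric_cov[OF 1] by simp
qed (rule hermitian_cov)

text \<open>The factor \<open>2 / \<beta>\<close> covers both hypotheses: \<open>2 c^2 + 1\<close>
  in the symmetric case, where the squared modulus is the square, and \<open>c^2 + 1\<close> in the
  Hermitian case.\<close>

lemma Z_fourth: "(LINT \<omega>|M. (Z 1 2 s \<omega> * cnj (Z 1 2 s \<omega>)) * (Z 1 2 t \<omega> * cnj (Z 1 2 t \<omega>))) =
   complex_of_real (2 / \<beta> * (c s t)\<^sup>2 + 1)"
proof (cases rule: beta_cases)
  case 1
  have "(LINT \<omega>|M. (Z 1 2 s \<omega> * cnj (Z 1 2 s \<omega>)) * (Z 1 2 t \<omega> * cnj (Z 1 2 t \<omega>))) =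
      (LINT \<omega>|M. (Z 1 2 s \<omega>)\<^sup>2 * (Z 1 2 t \<omega>)\<^sup>2)"
    using symmetric_real[OF 1, of 1 2]
    by (intro Bochner_Integration.integral_cong) (auto simp: Reals_cnj_iff power2_eq_square)
  then show ?thesis using symmetric_fourth[OF 1, of s t] 1 by simp
next
  case 2
  have "(LINT \<omega>|M. (Z 1 2 s \<omega> * cnj (Z 1 2 s \<omega>)) * (Z 1 2 t \<omega> * cnj (Z 1 2 t \<omega>))) =
      (LINT \<omega>|M. complex_of_real ((cmod (Z 1 2 s \<omega>))\<^sup>2 * (cmod (Z 1 2 t \<omega>))\<^sup>2))"
    by (simp only: complex_norm_square of_real_mult)
  also have "\<dots> = complex_of_real (LINT \<omega>|M. (cmod (Z 1 2 s \<omega>))\<^sup>2 * (cmod (Z 1 2 t \<omega>))\<^sup>2)"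
    by (rule integral_complex_of_real)
  finally show ?thesis using hermitian_fourth[OF 2, of s t] 2 by simp
qed

text \<open>The contribution of an edge traversed twice in the same direction. That it vanishes for
  \<open>\<beta> = 2\<close> is the whole difference between the two symmetry classes for cycles of
  length at least 3.\<close>

lemma entry_off_cov:
  assumes "i \<noteq> j"
  shows "(LINT \<omega>|M. entry s i j \<omega> * entry t i j \<omega>) = (if \<beta> = 1 then complex_of_real (c s t) else 0)"
proof -
  have less: "(LINT \<omega>|M. entry s i j \<omega> * entry t i j \<omega>) = (if \<beta> = 1 then complex_of_real (c s t) else 0)"
    if "i < j" for i j
    using off_transfer[OF that, of "\<lambda>f. f s * f t"] Z_cov[of s t] by simp
  have "(LINT \<omega>|M. entry s i j \<omega> * entry t i j \<omega>) = cnj (LINT \<omega>|M. entry s j i \<omega> * entry t j i \<omega>)"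
    using expectation_cnj[OF Lp_mult[OF Lp_entry[of s j i] Lp_entry[of t j i]]]
    by (simp add: entry_cnj[of s i j] entry_cnj[of t i j])
  then show ?thesis using less[of i j] less[of j i] assms by (cases "i < j") auto
qed

text \<open>The contribution of an edge traversed in opposite directions, the same for both values
  of \<open>\<beta>\<close>.\<close>

lemma entry_off_cov_cnj:
  assumes "i \<noteq> j"
  shows "(LINT \<omega>|M. entry s i j \<omega> * entry t j i \<omega>) = complex_of_real (c s t)"
proof -
  have less: "(LINT \<omega>|M. entry s i j \<omega> * entry t j i \<omega>) = complex_of_real (c s t)" if "i < j" for i j s t
    using off_transfer[OF that, of "\<lambda>f. f s * cnj (f t)"] Z_cov_cnj[of s t] by (simp add: entry_cnj[of t j i])
  have "(LINT \<omega>|M. entry s i j \<omega> * entry t j i \<omega>) = (LINT \<omega>|M. entry t j i \<omega> * entry s i j \<omega>)"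
    by (simp add: mult.commute)
  then show ?thesis using less[of i j s t] less[of j i t s] assms c_commute[of s t] by (cases "i < j") auto
qed

lemma entry_second_moment: "i \<noteq> j \<Longrightarrow> (LINT \<omega>|M. entry t i j \<omega> * entry t j i \<omega>) = 1"
  by (simp add: entry_off_cov_cnj cov_diag)

text \<open>The covariance of the squared moduli on one edge; it supplies the limiting covariance in
  degree 2.\<close>

lemma entry_fourth:
  assumes "i \<noteq> j"
  shows "(LINT \<omega>|M. (entry s i j \<omega> * entry s j i \<omega> - 1) * (entry t i j \<omega> * entry t j i \<omega> - 1)) =
    complex_of_real (2 / \<beta> * (c s t)\<^sup>2)"
proof -
  have less: "(LINT \<omega>|M. (entry s i j \<omega> * entry s j i \<omega>) * (entry t i j \<omega> * entry t j i \<omega>)) =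
    complex_of_real (2 / \<beta> * (c s t)\<^sup>2 + 1)" if "i < j" for i j
    using off_transfer[OF that, of "\<lambda>f. (f s * cnj (f s)) * (f t * cnj (f t))"] Z_fourth[of s t]
    by (simp add: entry_cnj[of _ j i])
  have four: "(LINT \<omega>|M. (entry s i j \<omega> * entry s j i \<omega>) * (entry t i j \<omega> * entry t j i \<omega>)) =
    complex_of_real (2 / \<beta> * (c s t)\<^sup>2 + 1)"
    using less[of i j] less[of j i] assms by (cases "i < j") (auto simp: mult.commute)
  have int: "integrable M (\<lambda>\<omega>. (entry s i j \<omega> * entry s j i \<omega>) * (entry t i j \<omega> * entry t j i \<omega>))"
    "integrable M (\<lambda>\<omega>. entry s i j \<omega> * entry s j i \<omega>)" "integrable M (\<lambda>\<omega>. entry t i j \<omega> * entry t j i \<omega>)"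
    by (intro Lp_integrable Lp_mult Lp_entry)+
  have "(LINT \<omega>|M. (entry s i j \<omega> * entry s j i \<omega> - 1) * (entry t i j \<omega> * entry t j i \<omega> - 1)) =
    (LINT \<omega>|M. (entry s i j \<omega> * entry s j i \<omega>) * (entry t i j \<omega> * entry t j i \<omega>)
      - entry s i j \<omega> * entry s j i \<omega> - entry t i j \<omega> * entry t j i \<omega> + 1)"
    by (simp add: algebra_simps)
  also have "\<dots> = complex_of_real (2 / \<beta> * (c s t)\<^sup>2 + 1) - 1 - 1 + 1"
    using int four entry_second_moment[OF assms] by (simp add: prob_space)
  finally show ?thesis by simp
qed

section \<open>Centred cyclic weights and vertices visited once\<close>

definition cyc :: "real \<Rightarrow> nat list \<Rightarrow> 'a \<Rightarrow> complex" where
  "cyc t w \<omega> = cycle_weight (\<lambda>i j. entry t i j \<omega>) w"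

definition ccyc :: "real \<Rightarrow> nat list \<Rightarrow> 'a \<Rightarrow> complex" where
  "ccyc t w \<omega> = cyc t w \<omega> - (LINT \<omega>|M. cyc t w \<omega>)"

lemma moment_bounded_cong:
  "moment_bounded I f \<Longrightarrow> (\<And>x \<omega>. x \<in> I \<Longrightarrow> f x \<omega> = g x \<omega>) \<Longrightarrow> moment_bounded I g"
proof -
  assume f: "moment_bounded I f" and "\<And>x \<omega>. x \<in> I \<Longrightarrow> f x \<omega> = g x \<omega>"
  then have "f x = g x" if "x \<in> I" for x using that by (simp add: fun_eq_iff)
  with f show ?thesis unfolding moment_bounded_def by simp
qed

text \<open>For each order the bound depends on the length of the word only, by induction along the
  recursion of \<open>path_weight\<close>.\<close>

lemma moment_bounded_path_weight:
  "moment_bounded {(t, w). length w = p} (\<lambda>(t, w) \<omega>. path_weight (\<lambda>i j. entry t i j \<omega>) w)"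
proof (induction p rule: less_induct)
  case (less p)
  let ?I = "\<lambda>p. {(t :: real, w :: nat list). length w = p}"
  consider "p = 0" | "p = 1" | "p = 2" | q where "p = Suc (Suc (Suc q))"
    by (metis One_nat_def Suc_1 not0_implies_Suc)
  then show ?case
  proof cases
    case 3
    have "moment_bounded (?I p) (\<lambda>x. (\<lambda>(t, i, j). entry t i j) (fst x, snd x ! 0, snd x ! 1))"
      by (rule moment_bounded_reindex[OF moment_bounded_entry]) simp
    then show ?thesis
      by (rule moment_bounded_cong) (auto simp: 3 length_Suc_conv numeral_2_eq_2)
  next
    case 4
    let ?P = "\<lambda>(t, w) \<omega>. path_weight (\<lambda>i j. entry t i j \<omega>) w"
    have 1: "moment_bounded (?I p) (\<lambda>x. (\<lambda>(t, i, j). entry t i j) (fst x, snd x ! 0, snd x ! 1))"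
      by (rule moment_bounded_reindex[OF moment_bounded_entry]) simp
    have 2: "moment_bounded (?I p) (\<lambda>x. ?P (fst x, tl (snd x)))"
      by (rule moment_bounded_reindex[OF less.IH[of "p - 1"]]) (auto simp: 4)
    have 3: "moment_bounded (?I p) (\<lambda>x. ?P (fst x, tl (tl (snd x))))"
      by (rule moment_bounded_reindex[OF less.IH[of "p - 2"]]) (auto simp: 4)
    \<comment> \<open>The condition on the letters is a deterministic factor 0 or 1, so the
      subtracted term is a product of two members of the class.\<close>
    have 5: "moment_bounded (?I p) (\<lambda>x \<omega>. if snd x ! 0 = snd x ! 2 then 1 else 0)"
      by (rule moment_bounded_const[of _ _ 1]) auto
    show ?thesis
      by (rule moment_bounded_cong[OF moment_bounded_diff[OF moment_bounded_mult[OF 1 2] moment_bounded_mult[OF 5 3]]])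
        (auto simp: 4 length_Suc_conv)
  qed (rule moment_bounded_cong[OF moment_bounded_const[of _ "\<lambda>_. 1" 1]];
      auto simp: length_Suc_conv)+
qed

lemma moment_bounded_cyc:
  "moment_bounded {(t, w). length w = p} (\<lambda>(t, w). cyc t w)"
proof -
  let ?I = "{(t :: real, w :: nat list). length w = p}"
  let ?P = "\<lambda>(t, w) \<omega>. path_weight (\<lambda>i j. entry t i j \<omega>) w"
  have 1: "moment_bounded ?I (\<lambda>x. ?P (fst x, snd x @ [hd (snd x)]))"
    by (rule moment_bounded_reindex[OF moment_bounded_path_weight[of "p + 1"]]) auto
  have 2: "moment_bounded ?I (\<lambda>x. ?P (fst x, tl (snd x)))"
    by (rule moment_bounded_reindex[OF moment_bounded_path_weight[of "p - 1"]]) auto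
  have 3: "moment_bounded ?I (\<lambda>x \<omega>. if 2 \<le> length (snd x) \<and> snd x ! 1 = last (snd x) then 1 else 0)"
    by (rule moment_bounded_const[of _ _ 1]) auto
  show ?thesis
    by (rule moment_bounded_cong[OF moment_bounded_diff[OF 1 moment_bounded_mult[OF 3 2]]])
      (auto simp: cyc_def cycle_weight_def)
qed

lemma moment_bounded_ccyc:
  "moment_bounded {(t, w). length w = p} (\<lambda>(t, w). ccyc t w)"
proof -
  let ?I = "{(t :: real, w :: nat list). length w = p}"
  obtain B where B: "\<And>x. x \<in> ?I \<Longrightarrow> cmod (LINT \<omega>|M. (case x of (t, w) \<Rightarrow> cyc t w) \<omega>) \<le> B"
    using moment_bounded_integral_bound[OF moment_bounded_cyc[of p]] by metis
  show ?thesis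
    by (rule moment_bounded_cong[OF moment_bounded_diff[OF moment_bounded_cyc moment_bounded_const[OF B]]])
      (auto simp: ccyc_def)
qed

lemma Lp_path_weight: "Lp (\<lambda>\<omega>. path_weight (\<lambda>i j. entry t i j \<omega>) w)"
  using Lp_of_moment_bounded[OF moment_bounded_path_weight[of "length w"], of "(t, w)"] by simp

lemma Lp_cyc: "Lp (cyc t w)"
  using Lp_of_moment_bounded[OF moment_bounded_cyc[of "length w"], of "(t, w)"] by simp

lemma Lp_ccyc: "Lp (ccyc t w)"
  using Lp_of_moment_bounded[OF moment_bounded_ccyc[of "length w"], of "(t, w)"] by simp

lemma expectation_ccyc: "(LINT \<omega>|M. ccyc t w \<omega>) = 0"
  using Lp_integrable[OF Lp_cyc[of t w]] by (simp add: ccyc_def prob_space)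

lemma ccyc_rotate: "ccyc t (rotate k w) = ccyc t w"
  by (simp add: fun_eq_iff ccyc_def cyc_def cycle_weight_rotate)

definition edges_in :: "nat set \<Rightarrow> (nat \<times> nat) set" where
  "edges_in S = (\<lambda>(i, j). edge i j) ` (S \<times> S)"

definition star :: "nat \<Rightarrow> (nat \<times> nat) set" where
  "star v = range (edge v)"

lemma edges_in_subset [simp]: "edges_in S \<subseteq> edges"
  by (auto simp: edges_in_def)

lemma star_subset [simp]: "star v \<subseteq> edges" "star v - E \<subseteq> edges"
  by (auto simp: star_def)

lemma star_disjoint: "v \<notin> S \<Longrightarrow> star v \<inter> edges_in S = {}"
  by (auto simp: star_def edges_in_def edge_eq_iff)

lemma edges_in_disjoint: "S \<inter> T = {} \<Longrightarrow> edges_in S \<inter> edges_in T = {}"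
  by (auto simp: edges_in_def edge_eq_iff)

lemma path_weight_measurable_sigma:
  assumes "set w \<subseteq> S"
  shows "(\<lambda>\<omega>. path_weight (\<lambda>i j. entry t i j \<omega>) w) \<in> borel_measurable (sigma_edges (edges_in S))"
  using assms
\<comment> \<open>The computation induction for \<open>path_weight\<close> carries the matrix along
  unchanged; the zero matrix is a placeholder, and the induction is on the word.\<close>
proof (induction "\<lambda>(i::nat) (j::nat). 0 :: complex" w rule: path_weight.induct)
  case (3 a b)
  then show ?case
    by (auto intro!: wigner_entry_measurable_sigma simp: edges_in_def)
next
  case (4 a b c r)
  have m: "entry t a b \<in> borel_measurable (sigma_edges (edges_in S))"
    using 4 by (intro wigner_entry_measurable_sigma) (auto simp: edges_in_def)
  have IH: "(\<lambda>\<omega>. path_weight (\<lambda>i j. entry t i j \<omega>) (b # c # r)) \<in> borel_measurable (sigma_edges (edges_in S))"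
    using 4 by auto
  show ?case
  proof (cases "a = c")
    case True
    have "(\<lambda>\<omega>. path_weight (\<lambda>i j. entry t i j \<omega>) (c # r)) \<in> borel_measurable (sigma_edges (edges_in S))"
      using 4 True by auto
    with m IH show ?thesis unfolding path_weight.simps if_P[OF True] by measurable
  next
    case False
    with m IH show ?thesis unfolding path_weight.simps if_not_P[OF False] by measurable
  qed
qed auto

lemma ccyc_measurable_sigma:
  assumes "set w \<subseteq> S" "w \<noteq> []"
  shows "ccyc t w \<in> borel_measurable (sigma_edges (edges_in S))"
proof -
  have "set (w @ [hd w]) \<subseteq> S" "set (tl w) \<subseteq> S"
    using assms by (auto dest: list.set_sel)
  from this[THEN path_weight_measurable_sigma, of t] show ?thesis
    unfolding ccyc_def[abs_def] cyc_def cycle_weight_def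
    by (cases "2 \<le> length w \<and> w ! 1 = last w") simp_all
qed

lemma prod_ccyc_measurable_sigma:
  assumes "\<And>a. a \<in> A \<Longrightarrow> set (W a) \<subseteq> S" "\<And>a. a \<in> A \<Longrightarrow> W a \<noteq> []"
  shows "(\<lambda>\<omega>. \<Prod>a\<in>A. ccyc (\<tau> a) (W a) \<omega>) \<in> borel_measurable (sigma_edges (edges_in S))"
  using assms by (intro borel_measurable_prod ccyc_measurable_sigma)

text \<open>A vertex visited once contributes the factor \<open>spoke\<close>, which is centred and independent of all
  entries not meeting that vertex.\<close>

definition spoke :: "real \<Rightarrow> nat \<Rightarrow> nat list \<Rightarrow> 'a \<Rightarrow> complex" where
  "spoke t v u \<omega> = (if u = [] then entry t v v \<omega>
    else entry t v (hd u) \<omega> * entry t (last u) v \<omega> - (if hd u = last u then 1 else 0))"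

definition rim :: "real \<Rightarrow> nat list \<Rightarrow> 'a \<Rightarrow> complex" where
  "rim t u \<omega> = (if 2 \<le> length u then path_weight (\<lambda>i j. entry t i j \<omega>) u else 1)"

lemma Lp_spoke: "Lp (spoke t v u)"
  unfolding spoke_def[abs_def] by (cases "u = []") (auto intro!: Lp_diff Lp_mult Lp_entry Lp_const)

lemma Lp_rim: "Lp (rim t u)"
  unfolding rim_def[abs_def] by (cases "2 \<le> length u") (auto intro!: Lp_path_weight Lp_const)

lemma spoke_measurable_sigma:
  assumes "E \<subseteq> edges" "u = [] \<Longrightarrow> edge v v \<in> E" "u \<noteq> [] \<Longrightarrow> edge v (hd u) \<in> E \<and> edge v (last u) \<in> E"
  shows "spoke t v u \<in> borel_measurable (sigma_edges E)"
proof (cases "u = []")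
  case True
  then show ?thesis unfolding spoke_def[abs_def] using assms by (simp add: wigner_entry_measurable_sigma)
next
  case False
  then have "entry t v (hd u) \<in> borel_measurable (sigma_edges E)" "entry t (last u) v \<in> borel_measurable (sigma_edges E)"
    using assms by (auto intro!: wigner_entry_measurable_sigma simp: edge_commute[of "last u"])
  then show ?thesis unfolding spoke_def[abs_def] if_not_P[OF False] by measurable
qed

lemma rim_measurable_sigma:
  assumes "set u \<subseteq> S"
  shows "rim t u \<in> borel_measurable (sigma_edges (edges_in S))"
  using path_weight_measurable_sigma[OF assms, of t] unfolding rim_def[abs_def]
  by (cases "2 \<le> length u") simp_all

lemma expectation_mult_indep:
  assumes "F1 \<in> borel_measurable (sigma_edges E1)" "F2 \<in> borel_measurable (sigma_edges E2)"
    "E1 \<inter> E2 = {}" "E1 \<subseteq> edges" "E2 \<subseteq> edges" "Lp F1" "Lp F2"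
  shows "(LINT \<omega>|M. F1 \<omega> * F2 \<omega>) = (LINT \<omega>|M. F1 \<omega>) * (LINT \<omega>|M. F2 \<omega>)"
  using integral_indep[OF assms(1-5) Lp_integrable Lp_integrable] assms by simp

lemma entry_measurable_single: "entry t i j \<in> borel_measurable (sigma_edges {edge i j})"
  by (rule wigner_entry_measurable_sigma) auto

text \<open>Three configurations: a loop at \<open>v\<close> is a centred diagonal entry; with two
  different neighbours the entries are independent and centred; with equal neighbours the product is
  a squared modulus of mean 1, which is the subtracted constant.\<close>

lemma expectation_spoke:
  assumes "v \<notin> set u"
  shows "(LINT \<omega>|M. spoke t v u \<omega>) = 0"
proof (cases "u = []")
  case True
  then show ?thesis by (simp add: spoke_def entry_mean)
next
  case False
  then have ne: "v \<noteq> hd u" "v \<noteq> last u" using assms by auto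
  show ?thesis
  proof (cases "hd u = last u")
    case True
    have "integrable M (\<lambda>\<omega>. entry t v (last u) \<omega> * entry t (last u) v \<omega>)"
      by (intro Lp_integrable Lp_mult Lp_entry)
    then show ?thesis using False True ne entry_second_moment[of v "last u" t]
      by (simp add: spoke_def prob_space)
  next
    case neq: False
    have "(LINT \<omega>|M. entry t v (hd u) \<omega> * entry t (last u) v \<omega>) =
      (LINT \<omega>|M. entry t v (hd u) \<omega>) * (LINT \<omega>|M. entry t (last u) v \<omega>)"
      using neq ne by (intro expectation_mult_indep[OF entry_measurable_single entry_measurable_single] Lp_entry)
        (auto simp: edge_eq_iff)
    then show ?thesis using False neq by (simp add: spoke_def entry_mean)
  qed
qed

text \<open>From three letters on the cyclic weight is itself \<open>spoke\<close> times
  \<open>rim\<close> and has mean zero. For two letters it is a squared modulus minus 2, with mean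
  -1, and centring turns the 2 into 1. For one letter it is a diagonal entry.\<close>

lemma ccyc_Cons:
  assumes "v \<notin> set u"
  shows "ccyc t (v # u) \<omega> = spoke t v u \<omega> * rim t u \<omega>"
proof (cases "2 \<le> length u")
  case True
  then have ne: "u \<noteq> []" by auto
  have cyc: "cyc t (v # u) \<omega> = spoke t v u \<omega> * rim t u \<omega>" for \<omega>
    using cycle_weight_fresh[OF assms True] True ne by (simp add: cyc_def spoke_def rim_def)
  have "(LINT \<omega>|M. spoke t v u \<omega> * rim t u \<omega>) = (LINT \<omega>|M. spoke t v u \<omega>) * (LINT \<omega>|M. rim t u \<omega>)"
    using ne assms
    by (intro expectation_mult_indep[where ?E1.0 = "star v" and ?E2.0 = "edges_in (set u)"]
        spoke_measurable_sigma rim_measurable_sigma star_disjoint Lp_spoke Lp_rim) (auto simp: star_def)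
  then show ?thesis using cyc expectation_spoke[OF assms] by (simp add: ccyc_def)
next
  case False
  show ?thesis
  proof (cases u)
    case Nil
    then show ?thesis by (simp add: ccyc_def cyc_def spoke_def rim_def entry_mean)
  next
    case (Cons x r)
    then have u: "u = [x]" using False by (cases r) auto
    then have ne: "v \<noteq> x" using assms by auto
    have "integrable M (\<lambda>\<omega>. entry t v x \<omega> * entry t x v \<omega>)" by (intro Lp_integrable Lp_mult Lp_entry)
    then have "(LINT \<omega>|M. entry t v x \<omega> * entry t x v \<omega> - 2) = -1"
      using entry_second_moment[OF ne] by (simp add: prob_space)
    then show ?thesis using u ne by (simp add: ccyc_def cyc_def cycle_weight_pair spoke_def rim_def)
  qed
qed

lemma rotate_to_single_visit:
  assumes "count_list w v = 1"
  obtains k u where "rotate k w = v # u" "v \<notin> set u"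
proof -
  have "v \<in> set w" using assms count_list_0_iff[of w v] by force
  then obtain x y where w: "w = x @ v # y" by (meson split_list)
  have "count_list x v + count_list y v = 0" using assms w by simp
  then have "v \<notin> set (y @ x)" by (simp add: count_list_0_iff)
  moreover have "rotate (length x) w = v # (y @ x)" using w by (simp add: rotate_append)
  ultimately show ?thesis using that by blast
qed

lemma ccyc_single_visit:
  assumes "count_list w v = 1"
  obtains u where "ccyc t w = (\<lambda>\<omega>. spoke t v u \<omega> * rim t u \<omega>)" "v \<notin> set u"
    "nbrs w v = (if u = [] then {v} else {hd u, last u})"
proof -
  obtain k u where u: "rotate k w = v # u" "v \<notin> set u" using rotate_to_single_visit[OF assms] .
  have "ccyc t w = ccyc t (v # u)" using ccyc_rotate[of t k w] u by simp
  also have "\<dots> = (\<lambda>\<omega>. spoke t v u \<omega> * rim t u \<omega>)" using ccyc_Cons[OF u(2)] by (simp add: fun_eq_iff)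
  finally have "ccyc t w = (\<lambda>\<omega>. spoke t v u \<omega> * rim t u \<omega>)" .
  moreover have "nbrs w v = nbrs (v # u) v" using nbrs_rotate[of k w v] u by simp
  ultimately show ?thesis using that[of u] u nbrs_fresh[OF u(2)] by (auto simp: nbrs_single)
qed

definition cycle_moment :: "('k \<Rightarrow> real) \<Rightarrow> ('k \<Rightarrow> nat list) \<Rightarrow> 'k set \<Rightarrow> complex" where
  "cycle_moment \<tau> W A = (LINT \<omega>|M. (\<Prod>a\<in>A. ccyc (\<tau> a) (W a) \<omega>))"

lemma spoke_star: "v \<notin> set u \<Longrightarrow> spoke t v u \<in> borel_measurable (sigma_edges (star v))"
  by (rule spoke_measurable_sigma) (auto simp: star_def)

lemma not_visited_subset: "count_list w v = 0 \<Longrightarrow> set w \<subseteq> - {v}"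
  by (auto simp: count_list_0_iff)

text \<open>Only one word meets \<open>v\<close>. Its spoke lives on edges at \<open>v\<close>,
  while its rim and all other words live on edges avoiding \<open>v\<close>, so the mean of the
  spoke splits off as a factor.\<close>

lemma cycle_moment_single_visit:
  assumes A: "finite A" and W: "\<And>a. a \<in> A \<Longrightarrow> W a \<noteq> []" and v: "visits A W v = 1"
  shows "cycle_moment \<tau> W A = 0"
proof -
  obtain a where a: "a \<in> A" "count_list (W a) v = 1" "\<And>b. b \<in> A \<Longrightarrow> a \<noteq> b \<Longrightarrow> count_list (W b) v = 0"
    using v sum_eq_1_iff[OF A, of "\<lambda>a. count_list (W a) v"] unfolding visits_def by auto
  obtain u where u: "ccyc (\<tau> a) (W a) = (\<lambda>\<omega>. spoke (\<tau> a) v u \<omega> * rim (\<tau> a) u \<omega>)" "v \<notin> set u"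
    by (rule ccyc_single_visit[OF a(2)])
  have others: "set (W b) \<subseteq> - {v}" if "b \<in> A - {a}" for b
    using a(3)[of b] not_visited_subset[of "W b" v] that by blast
  let ?R = "\<lambda>\<omega>. rim (\<tau> a) u \<omega> * (\<Prod>b\<in>A - {a}. ccyc (\<tau> b) (W b) \<omega>)"
  have "cycle_moment \<tau> W A = (LINT \<omega>|M. spoke (\<tau> a) v u \<omega> * ?R \<omega>)"
    unfolding cycle_moment_def using A a u(1) by (simp add: prod.remove mult.assoc)
  also have "\<dots> = (LINT \<omega>|M. spoke (\<tau> a) v u \<omega>) * (LINT \<omega>|M. ?R \<omega>)"
  proof (rule expectation_mult_indep)
    show "?R \<in> borel_measurable (sigma_edges (edges_in (- {v})))"
      using u others W
      by (intro borel_measurable_times rim_measurable_sigma prod_ccyc_measurable_sigma) auto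
    show "spoke (\<tau> a) v u \<in> borel_measurable (sigma_edges (star v))" by (rule spoke_star[OF u(2)])
    show "star v \<inter> edges_in (- {v}) = {}" by (rule star_disjoint) simp
    show "Lp ?R" using A by (intro Lp_mult Lp_rim Lp_prod Lp_ccyc) auto
  qed (auto intro: Lp_spoke)
  finally show ?thesis using expectation_spoke[OF u(2)] by simp
qed

text \<open>The edge from \<open>v\<close> to \<open>z\<close> is used by the first spoke only.
  Either the whole first spoke lives on that edge, or it contains exactly one entry from it; in both
  cases a centred factor is independent of everything else.\<close>

lemma expectation_two_spokes_aux:
  assumes u: "v \<notin> set u" "v \<notin> set u'"
    and z: "z \<in> (if u = [] then {v} else {hd u, last u})" "z \<notin> (if u' = [] then {v} else {hd u', last u'})"
  shows "(LINT \<omega>|M. spoke s v u \<omega> * spoke t v u' \<omega>) = 0"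
proof -
  have m: "spoke t v u' \<in> borel_measurable (sigma_edges (star v - {edge v z}))"
    using z(2) u by (intro spoke_measurable_sigma) (auto simp: star_def edge_eq_iff split: if_splits)
  have single: "{edge v z} \<inter> (star v - {edge v z}) = {}" "{edge v z} \<subseteq> edges" by auto
  show ?thesis
  proof (cases "u = [] \<or> hd u = last u")
    case True
    have "spoke s v u \<in> borel_measurable (sigma_edges {edge v z})"
      using z(1) True by (intro spoke_measurable_sigma) (auto split: if_splits)
    from expectation_mult_indep[OF this m single] show ?thesis
      using expectation_spoke[OF u(1)] by (simp add: Lp_spoke)
  next
    case False
    \<comment> \<open>\<open>y\<close> is the other neighbour; \<open>F\<close> is the entry on the
      edge to \<open>z\<close> and \<open>G\<close> the one on the edge to \<open>y\<close>, each in
      the orientation in which it occurs in the spoke.\<close>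
    define y where "y = (if z = hd u then last u else hd u)"
    have y: "y \<noteq> z" "y \<noteq> v" using False z u by (auto simp: y_def split: if_splits)
    define F where "F = (if z = hd u then entry s v z else entry s z v)"
    define G where "G = (if z = hd u then entry s y v else entry s v y)"
    have F: "F \<in> borel_measurable (sigma_edges {edge v z})"
      unfolding F_def by (auto intro!: wigner_entry_measurable_sigma simp: edge_commute)
    have "G \<in> borel_measurable (sigma_edges (star v - {edge v z}))"
      unfolding G_def using y
      by (auto intro!: wigner_entry_measurable_sigma simp: star_def edge_commute[of y v] edge_eq_iff)
    then have G: "(\<lambda>\<omega>. G \<omega> * spoke t v u' \<omega>) \<in> borel_measurable (sigma_edges (star v - {edge v z}))"
      using m by (rule borel_measurable_times)
    have LpFG: "Lp F" "Lp G" by (auto simp: F_def G_def Lp_entry)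
    have "(LINT \<omega>|M. spoke s v u \<omega> * spoke t v u' \<omega>) = (LINT \<omega>|M. F \<omega> * (G \<omega> * spoke t v u' \<omega>))"
      using False z by (intro Bochner_Integration.integral_cong) (auto simp: spoke_def F_def G_def y_def split: if_splits)
    also have "\<dots> = (LINT \<omega>|M. F \<omega>) * (LINT \<omega>|M. G \<omega> * spoke t v u' \<omega>)"
      using LpFG by (intro expectation_mult_indep[OF F G single]) (auto intro!: Lp_mult Lp_spoke)
    also have "(LINT \<omega>|M. F \<omega>) = 0" by (simp add: F_def entry_mean)
    finally show ?thesis by simp
  qed
qed

lemma expectation_two_spokes:
  assumes u: "v \<notin> set u" "v \<notin> set u'"
    and ne: "(if u = [] then {v} else {hd u, last u}) \<noteq> (if u' = [] then {v} else {hd u', last u'})"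
  shows "(LINT \<omega>|M. spoke s v u \<omega> * spoke t v u' \<omega>) = 0"
proof -
  let ?N = "\<lambda>u. if u = [] then {v} else {hd u, last u}"
  consider z where "z \<in> ?N u" "z \<notin> ?N u'" | z where "z \<in> ?N u'" "z \<notin> ?N u" using ne by blast
  then show ?thesis
  proof cases
    case 1
    then show ?thesis by (rule expectation_two_spokes_aux[OF u])
  next
    case 2
    have "(LINT \<omega>|M. spoke t v u' \<omega> * spoke s v u \<omega>) = 0"
      by (rule expectation_two_spokes_aux[OF u(2,1) 2])
    then show ?thesis by (simp add: mult.commute)
  qed
qed

text \<open>The words \<open>W a\<close> and \<open>W b\<close> are the only ones through
  \<open>v\<close>, so their two spokes together are independent of all remaining factors, and the
  product of the spokes has mean zero when the neighbour sets differ.\<close>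

lemma cycle_moment_nbrs_neq:
  assumes A: "finite A" and W: "\<And>a. a \<in> A \<Longrightarrow> W a \<noteq> []"
    and ab: "a \<in> A" "b \<in> A" "a \<noteq> b" and v: "count_list (W a) v = 1" "count_list (W b) v = 1" "visits A W v = 2"
    and ne: "nbrs (W a) v \<noteq> nbrs (W b) v"
  shows "cycle_moment \<tau> W A = 0"
proof -
  have "visits A W v = count_list (W a) v + (count_list (W b) v + (\<Sum>d\<in>A - {a} - {b}. count_list (W d) v))"
    unfolding visits_def using A ab by (subst sum.remove[of _ a], simp, simp, subst sum.remove[of _ b]) auto
  then have others: "count_list (W d) v = 0" if "d \<in> A - {a} - {b}" for d
    using that v A by simp
  obtain u where u: "ccyc (\<tau> a) (W a) = (\<lambda>\<omega>. spoke (\<tau> a) v u \<omega> * rim (\<tau> a) u \<omega>)" "v \<notin> set u"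
    "nbrs (W a) v = (if u = [] then {v} else {hd u, last u})"
    by (rule ccyc_single_visit[OF v(1)])
  obtain u' where u': "ccyc (\<tau> b) (W b) = (\<lambda>\<omega>. spoke (\<tau> b) v u' \<omega> * rim (\<tau> b) u' \<omega>)" "v \<notin> set u'"
    "nbrs (W b) v = (if u' = [] then {v} else {hd u', last u'})"
    by (rule ccyc_single_visit[OF v(2)])
  have others': "set (W d) \<subseteq> - {v}" if "d \<in> A - {a} - {b}" for d
    by (rule not_visited_subset[OF others[OF that]])
  let ?S = "\<lambda>\<omega>. spoke (\<tau> a) v u \<omega> * spoke (\<tau> b) v u' \<omega>"
  let ?R = "\<lambda>\<omega>. rim (\<tau> a) u \<omega> * rim (\<tau> b) u' \<omega> * (\<Prod>d\<in>A - {a} - {b}. ccyc (\<tau> d) (W d) \<omega>)"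
  have "(\<Prod>a\<in>A. ccyc (\<tau> a) (W a) \<omega>) = ccyc (\<tau> a) (W a) \<omega> * (ccyc (\<tau> b) (W b) \<omega> *
      (\<Prod>d\<in>A - {a} - {b}. ccyc (\<tau> d) (W d) \<omega>))" for \<omega>
    using A ab by (subst prod.remove[of _ a], simp, simp, subst prod.remove[of _ b]) auto
  then have "cycle_moment \<tau> W A = (LINT \<omega>|M. ?S \<omega> * ?R \<omega>)"
    unfolding cycle_moment_def using u(1) u'(1) by (simp add: mult_ac)
  also have "\<dots> = (LINT \<omega>|M. ?S \<omega>) * (LINT \<omega>|M. ?R \<omega>)"
  proof (rule expectation_mult_indep)
    show "?R \<in> borel_measurable (sigma_edges (edges_in (- {v})))"
      using u u' W others'
      by (intro borel_measurable_times rim_measurable_sigma prod_ccyc_measurable_sigma) auto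
    show "?S \<in> borel_measurable (sigma_edges (star v))"
      by (intro borel_measurable_times spoke_star u u')
    show "star v \<inter> edges_in (- {v}) = {}" by (rule star_disjoint) simp
    show "Lp ?R" using A by (intro Lp_mult Lp_rim Lp_prod Lp_ccyc) auto
    show "Lp ?S" by (intro Lp_mult Lp_spoke)
  qed auto
  also have "(LINT \<omega>|M. ?S \<omega>) = 0"
    using ne u(3) u'(3) by (intro expectation_two_spokes u(2) u'(2)) simp
  finally show ?thesis by simp
qed

lemma cycle_moment_union_disjoint:
  assumes A: "finite A" "finite B" "A \<inter> B = {}" and W: "\<And>a. a \<in> A \<union> B \<Longrightarrow> W a \<noteq> []"
    and disj: "\<And>a b. a \<in> A \<Longrightarrow> b \<in> B \<Longrightarrow> set (W a) \<inter> set (W b) = {}"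
  shows "cycle_moment \<tau> W (A \<union> B) = cycle_moment \<tau> W A * cycle_moment \<tau> W B"
proof -
  let ?V = "\<lambda>A. \<Union>a\<in>A. set (W a)"
  have "(\<Prod>a\<in>A \<union> B. ccyc (\<tau> a) (W a) \<omega>) = (\<Prod>a\<in>A. ccyc (\<tau> a) (W a) \<omega>) * (\<Prod>a\<in>B. ccyc (\<tau> a) (W a) \<omega>)" for \<omega>
    using A by (rule prod.union_disjoint)
  then have "cycle_moment \<tau> W (A \<union> B) =
      (LINT \<omega>|M. (\<Prod>a\<in>A. ccyc (\<tau> a) (W a) \<omega>) * (\<Prod>a\<in>B. ccyc (\<tau> a) (W a) \<omega>))"
    by (simp add: cycle_moment_def)
  also have "\<dots> = cycle_moment \<tau> W A * cycle_moment \<tau> W B"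
    unfolding cycle_moment_def
  proof (rule expectation_mult_indep)
    show "(\<lambda>\<omega>. \<Prod>a\<in>A. ccyc (\<tau> a) (W a) \<omega>) \<in> borel_measurable (sigma_edges (edges_in (?V A)))"
      using W by (intro prod_ccyc_measurable_sigma) auto
    show "(\<lambda>\<omega>. \<Prod>a\<in>B. ccyc (\<tau> a) (W a) \<omega>) \<in> borel_measurable (sigma_edges (edges_in (?V B)))"
      using W by (intro prod_ccyc_measurable_sigma) auto
    show "edges_in (?V A) \<inter> edges_in (?V B) = {}"
      using disj by (intro edges_in_disjoint) auto
  qed (use A in \<open>auto intro!: Lp_prod Lp_ccyc\<close>)
  finally show ?thesis .
qed

lemma cycle_moment_singleton: "cycle_moment \<tau> W {a} = 0"
  by (simp add: cycle_moment_def expectation_ccyc)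

section \<open>Wick's recursion for tuples of words\<close>

text \<open>The failure, for one tuple of words, of the recursive form of Wick's rule in which the
  fixed index \<open>a\<close> is paired with each partner \<open>b\<close> in turn.\<close>

definition moment_defect :: "('k \<Rightarrow> real) \<Rightarrow> ('k \<Rightarrow> nat list) \<Rightarrow> 'k \<Rightarrow> 'k set \<Rightarrow> complex" where
  "moment_defect \<tau> W a A = cycle_moment \<tau> W A -
    (\<Sum>b\<in>A - {a}. cycle_moment \<tau> W {a, b} * cycle_moment \<tau> W (A - {a, b}))"

lemma visits_split: "finite A \<Longrightarrow> B \<subseteq> A \<Longrightarrow> visits A W v = visits B W v + visits (A - B) W v"
  unfolding visits_def by (metis sum.subset_diff add.commute)

text \<open>If a vertex is visited once in total, then in each product one of the two blocks visits
  it once, and every term vanishes. Otherwise, if \<open>W a\<close> shares no vertex with the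
  others, it is independent and centred. If it shares a vertex with \<open>W b\<close>, the bound of
  two visits excludes all other partners; the two words either disagree about some neighbourhood,
  and both sides vanish, or they run over the same vertices and split off as an independent
  block.\<close>

lemma moment_defect_eq_0:
  assumes A: "finite A" "a \<in> A" and W: "\<And>b. b \<in> A \<Longrightarrow> W b \<noteq> []"
    and v: "(\<exists>v. visits A W v = 1) \<or> (\<forall>v. visits A W v \<le> 2)"
  shows "moment_defect \<tau> W a A = 0"
proof (cases "\<exists>v. visits A W v = 1")
  case True
  then obtain v where v: "visits A W v = 1" by (rule exE)
  have "cycle_moment \<tau> W {a, b} * cycle_moment \<tau> W (A - {a, b}) = 0" if b: "b \<in> A - {a}" for b
  proof -
    have "visits {a, b} W v + visits (A - {a, b}) W v = 1"
      using visits_split[OF A(1), of "{a, b}" W v] b A v by simp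
    then consider "visits {a, b} W v = 1" | "visits (A - {a, b}) W v = 1" by linarith
    then show ?thesis
    proof cases
      case 1
      then show ?thesis using cycle_moment_single_visit[of "{a, b}" W v \<tau>] W A b by auto
    next
      case 2
      then show ?thesis using cycle_moment_single_visit[of "A - {a, b}" W v \<tau>] W A by auto
    qed
  qed
  then have "(\<Sum>b\<in>A - {a}. cycle_moment \<tau> W {a, b} * cycle_moment \<tau> W (A - {a, b})) = 0"
    by (intro sum.neutral ballI)
  moreover have "cycle_moment \<tau> W A = 0" by (rule cycle_moment_single_visit[OF A(1) W v])
  ultimately show ?thesis unfolding moment_defect_def by simp
next
  case False
  then have le2: "visits A W v \<le> 2" for v using v by simp
  show ?thesis
  proof (cases "\<exists>b\<in>A - {a}. set (W a) \<inter> set (W b) \<noteq> {}")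
    case no: False
    have "cycle_moment \<tau> W ({a} \<union> (A - {a})) = cycle_moment \<tau> W {a} * cycle_moment \<tau> W (A - {a})"
      using A W no by (intro cycle_moment_union_disjoint) auto
    moreover have "{a} \<union> (A - {a}) = A" using A by auto
    moreover have "cycle_moment \<tau> W {a, b} = 0" if b: "b \<in> A - {a}" for b
    proof -
      have "cycle_moment \<tau> W ({a} \<union> {b}) = cycle_moment \<tau> W {a} * cycle_moment \<tau> W {b}"
        using A W no b by (intro cycle_moment_union_disjoint) auto
      moreover have "{a} \<union> {b} = {a, b}" by auto
      ultimately show ?thesis by (simp only: cycle_moment_singleton mult_zero_left)
    qed
    then have "(\<Sum>b\<in>A - {a}. cycle_moment \<tau> W {a, b} * cycle_moment \<tau> W (A - {a, b})) = 0"
      by (intro sum.neutral ballI) simp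
    ultimately show ?thesis unfolding moment_defect_def by (simp only: cycle_moment_singleton) simp
  next
    case True
    then obtain b where b: "b \<in> A - {a}" "set (W a) \<inter> set (W b) \<noteq> {}" by (rule bexE)
    then obtain v where v: "v \<in> set (W a)" "v \<in> set (W b)" by (meson disjoint_iff)
    have b: "b \<in> A" "b \<noteq> a" using b by simp_all
    \<comment> \<open>With at most two visits in all, two words meeting at \<open>x\<close> pass
      through it once each and leave no visit for any other word.\<close>
    have shared: "count_list (W a) x = 1 \<and> count_list (W b) x = 1 \<and> visits A W x = 2 \<and>
        visits (A - {a, b}) W x = 0" if x: "x \<in> set (W a)" "x \<in> set (W b)" for x
    proof -
      have "count_list (W a) x \<noteq> 0" "count_list (W b) x \<noteq> 0" using x by (simp_all add: count_list_0_iff)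
      moreover have "visits {a, b} W x = count_list (W a) x + count_list (W b) x"
        using b by (simp add: visits_def)
      then have "visits A W x = count_list (W a) x + count_list (W b) x + visits (A - {a, b}) W x"
        using visits_split[OF A(1), of "{a, b}" W x] b A by simp
      ultimately show ?thesis using le2[of x] by linarith
    qed
    \<comment> \<open>The word \<open>W d\<close> misses \<open>v\<close>, so the pair
      \<open>{a, d}\<close> visits \<open>v\<close> exactly once.\<close>
    have "cycle_moment \<tau> W {a, d} = 0" if d: "d \<in> A - {a} - {b}" for d
    proof (rule cycle_moment_single_visit)
      have "count_list (W d) v \<le> visits (A - {a, b}) W v"
        unfolding visits_def using A d by (intro member_le_sum) auto
      moreover have "a \<noteq> d" using d by auto
      ultimately show "visits {a, d} W v = 1" using shared[OF v] by (simp add: visits_def)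
    qed (use A W d in auto)
    then have zero: "(\<Sum>d\<in>A - {a} - {b}. cycle_moment \<tau> W {a, d} * cycle_moment \<tau> W (A - {a, d})) = 0"
      by (intro sum.neutral ballI) simp
    then have sum: "(\<Sum>d\<in>A - {a}. cycle_moment \<tau> W {a, d} * cycle_moment \<tau> W (A - {a, d})) =
        cycle_moment \<tau> W {a, b} * cycle_moment \<tau> W (A - {a, b})"
    proof -
      have "b \<in> A - {a}" "finite (A - {a})" using A b by simp_all
      then show ?thesis using zero
        by (simp only: sum.remove[of "A - {a}" b]) simp
    qed
    show ?thesis
    proof (cases "\<exists>x. x \<in> set (W a) \<and> x \<in> set (W b) \<and> nbrs (W a) x \<noteq> nbrs (W b) x")
      case True
      then obtain x where x: "x \<in> set (W a)" "x \<in> set (W b)" "nbrs (W a) x \<noteq> nbrs (W b) x" by blast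
      have "cycle_moment \<tau> W A = 0"
        using A W b x shared[OF x(1,2)] by (intro cycle_moment_nbrs_neq[of A W a b x]) auto
      moreover have "cycle_moment \<tau> W {a, b} = 0"
        using A W b x shared[OF x(1,2)] by (intro cycle_moment_nbrs_neq[of "{a, b}" W a b x]) (auto simp: visits_def)
      ultimately show ?thesis using sum unfolding moment_defect_def by simp
    next
      case False
      \<comment> \<open>Equal neighbourhoods at all shared vertices spread the sharing along both
        cycles, so the two words have the same vertices.\<close>
      have sub: "set (W a) \<subseteq> set (W b)" "set (W b) \<subseteq> set (W a)"
        using set_subset_if_nbrs_eq[OF v] set_subset_if_nbrs_eq[OF v(2,1)] False by blast+
      have "set (W x) \<inter> set (W d) = {}" if "x \<in> {a, b}" and d: "d \<in> A - {a, b}" for x d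
      proof -
        have "y \<notin> set (W d)" if y: "y \<in> set (W a)" for y
        proof -
          have "count_list (W d) y \<le> visits (A - {a, b}) W y"
            unfolding visits_def using A d by (intro member_le_sum) auto
          then have "count_list (W d) y = 0" using shared[OF y] sub y by auto
          then show ?thesis by (simp add: count_list_0_iff)
        qed
        then show ?thesis using sub that by auto
      qed
      then have "cycle_moment \<tau> W ({a, b} \<union> (A - {a, b})) = cycle_moment \<tau> W {a, b} * cycle_moment \<tau> W (A - {a, b})"
        using A W b by (intro cycle_moment_union_disjoint) auto
      moreover have "{a, b} \<union> (A - {a, b}) = A" using A b by auto
      ultimately show ?thesis using sum unfolding moment_defect_def by simp
    qed
  qed
qed

end

text \<open>A function on \<open>A\<close> is a function on \<open>B\<close> together with one on
  \<open>A - B\<close>, and each of \<open>F\<close> and \<open>G\<close> reads only its own block.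
  It merges the two blocks of a Wick pairing into one sum over all of \<open>A\<close>.\<close>

lemma sum_PiE_mult:
  fixes F G :: "('k \<Rightarrow> 'x) \<Rightarrow> complex"
  assumes A: "finite A" "B \<subseteq> A"
    and F: "\<And>x. F (restrict x B) = F x" and G: "\<And>x. G (restrict x (A - B)) = G x"
  shows "(\<Sum>x\<in>Pi\<^sub>E B J. F x) * (\<Sum>x\<in>Pi\<^sub>E (A - B) J. G x) = (\<Sum>x\<in>Pi\<^sub>E A J. F x * G x)"
proof -
  have "(\<Sum>x\<in>Pi\<^sub>E B J. F x) * (\<Sum>x\<in>Pi\<^sub>E (A - B) J. G x) =
      (\<Sum>(x, y)\<in>Pi\<^sub>E B J \<times> Pi\<^sub>E (A - B) J. F x * G y)"
    by (simp add: sum_product sum.cartesian_product)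
  also have "\<dots> = (\<Sum>x\<in>Pi\<^sub>E A J. F x * G x)"
  proof (rule sum.reindex_bij_witness[where
        i = "\<lambda>x. (restrict x B, restrict x (A - B))" and j = "\<lambda>(x, y). \<lambda>a\<in>A. if a \<in> B then x a else y a"])
    fix p assume "p \<in> Pi\<^sub>E B J \<times> Pi\<^sub>E (A - B) J"
    then obtain x y where p: "p = (x, y)" "x \<in> Pi\<^sub>E B J" "y \<in> Pi\<^sub>E (A - B) J" by auto
    let ?z = "\<lambda>a\<in>A. if a \<in> B then x a else y a"
    have 1: "restrict ?z B = x" "restrict ?z (A - B) = y"
      using p A(2) by (auto simp: fun_eq_iff PiE_def extensional_def)
    then show "(restrict ((\<lambda>(x, y). \<lambda>a\<in>A. if a \<in> B then x a else y a) p) B,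
        restrict ((\<lambda>(x, y). \<lambda>a\<in>A. if a \<in> B then x a else y a) p) (A - B)) = p"
      using p by simp
    show "(\<lambda>(x, y). \<lambda>a\<in>A. if a \<in> B then x a else y a) p \<in> Pi\<^sub>E A J"
      using p by (auto simp: PiE_def Pi_def)
    show "F ((\<lambda>(x, y). \<lambda>a\<in>A. if a \<in> B then x a else y a) p) * G ((\<lambda>(x, y). \<lambda>a\<in>A. if a \<in> B then x a else y a) p)
       = (case p of (x, y) \<Rightarrow> F x * G y)"
      using F[of ?z] G[of ?z] 1 p by simp
  next
    fix x assume x: "x \<in> Pi\<^sub>E A J"
    show "(\<lambda>(x, y). \<lambda>a\<in>A. if a \<in> B then x a else y a) (restrict x B, restrict x (A - B)) = x"
      using x A(2) by (auto simp: fun_eq_iff PiE_def extensional_def)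
    show "(restrict x B, restrict x (A - B)) \<in> Pi\<^sub>E B J \<times> Pi\<^sub>E (A - B) J"
      using x A(2) by (auto simp: PiE_def Pi_def)
  qed
  finally show ?thesis .
qed

section \<open>Power counting and Wick's rule for the scaled statistics\<close>

context time_dependent_wigner begin

abbreviation dim :: "real \<Rightarrow> real \<Rightarrow> nat" where
  "dim L y \<equiv> nat \<lfloor>L * y\<rfloor>"

abbreviation word_tuples :: "real \<Rightarrow> ('k \<Rightarrow> real) \<Rightarrow> ('k \<Rightarrow> nat) \<Rightarrow> 'k set \<Rightarrow> ('k \<Rightarrow> nat list) set" where
  "word_tuples L y r A \<equiv> \<Pi>\<^sub>E a\<in>A. words (dim L (y a)) (r a)"

text \<open>Up to the power of \<open>L\<close> this is the centred trace of the first-kind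
  Chebyshev polynomial of degree \<open>r\<close>, rescaled to the dimension of the corner. The sum
  over words serves as the definition because all estimates are made on words.\<close>

definition cheb_stat :: "real \<Rightarrow> real \<Rightarrow> real \<Rightarrow> nat \<Rightarrow> 'a \<Rightarrow> complex" where
  "cheb_stat L t y r \<omega> = complex_of_real (L powr (- real r / 2)) * (\<Sum>w\<in>words (dim L y) r. ccyc t w \<omega>)"

definition stat_moment :: "real \<Rightarrow> ('k \<Rightarrow> real) \<Rightarrow> ('k \<Rightarrow> real) \<Rightarrow> ('k \<Rightarrow> nat) \<Rightarrow> 'k set \<Rightarrow> complex" where
  "stat_moment L \<tau> y r A = (LINT \<omega>|M. (\<Prod>a\<in>A. cheb_stat L (\<tau> a) (y a) (r a) \<omega>))"

lemma Lp_sum: "finite A \<Longrightarrow> (\<And>a. a \<in> A \<Longrightarrow> Lp (F a)) \<Longrightarrow> Lp (\<lambda>\<omega>. \<Sum>a\<in>A. F a \<omega>)"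
proof (induction A rule: finite_induct)
  case empty
  then show ?case using Lp_const[of 0] by simp
next
  case (insert a A)
  have "Lp (\<lambda>\<omega>. F a \<omega> - (- 1) * (\<Sum>a\<in>A. F a \<omega>))"
    by (intro Lp_diff Lp_mult Lp_const) (use insert in auto)
  then show ?case using insert by simp
qed

lemma Lp_cheb_stat: "Lp (cheb_stat L t y r)"
  unfolding cheb_stat_def[abs_def] by (intro Lp_mult Lp_const Lp_sum Lp_ccyc finite_words)

lemma finite_word_tuples: "finite A \<Longrightarrow> finite (word_tuples L y r A)"
  by (intro finite_PiE) auto

lemma stat_moment_eq_sum:
  assumes A: "finite A" and L: "0 < L"
  shows "stat_moment L \<tau> y r A = complex_of_real (L powr (- real (sum r A) / 2)) *
    (\<Sum>W\<in>word_tuples L y r A. cycle_moment \<tau> W A)"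
proof -
  have pw: "(\<Prod>a\<in>A. L powr (- real (r a) / 2)) = L powr (- real (sum r A) / 2)"
    using A by (induction A rule: finite_induct)
      (use L in \<open>auto simp: powr_add[symmetric] field_simps\<close>)
  have "(\<Prod>a\<in>A. cheb_stat L (\<tau> a) (y a) (r a) \<omega>) = complex_of_real (L powr (- real (sum r A) / 2)) *
    (\<Sum>W\<in>word_tuples L y r A. \<Prod>a\<in>A. ccyc (\<tau> a) (W a) \<omega>)" for \<omega>
    unfolding cheb_stat_def prod.distrib pw[symmetric]
    by (subst prod_sum_PiE[OF A]) auto
  then show ?thesis
    unfolding stat_moment_def cycle_moment_def
    by (simp add: Bochner_Integration.integral_sum Lp_integrable Lp_prod A Lp_ccyc)
qed

lemma cycle_moment_bound:
  assumes A: "finite A"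
  shows "\<exists>C. \<forall>W. (\<forall>a\<in>A. length (W a) = r a) \<longrightarrow> cmod (cycle_moment \<tau> W A) \<le> C"
proof -
  let ?I = "{W. \<forall>a\<in>A. length (W a) = r a}"
  have "moment_bounded ?I (\<lambda>W \<omega>. \<Prod>a\<in>A. ccyc (\<tau> a) (W a) \<omega>)"
  proof (rule moment_bounded_prod[OF A])
    fix a assume a: "a \<in> A"
    have "moment_bounded ?I (\<lambda>W. (\<lambda>(t, w). ccyc t w) (\<tau> a, W a))"
      by (rule moment_bounded_reindex[OF moment_bounded_ccyc[of "r a"]]) (use a in auto)
    then show "moment_bounded ?I (\<lambda>W. ccyc (\<tau> a) (W a))" by simp
  qed
  from moment_bounded_integral_bound[OF this] show ?thesis
    unfolding cycle_moment_def by simp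
qed

text \<open>One constant has to serve all tuples with the given lengths and all sub-families at
  once; for this the bounds of the finitely many subsets of \<open>A\<close> are added up.\<close>

lemma moment_defect_bound:
  assumes A: "finite A" "a \<in> A"
  shows "\<exists>C\<ge>0. \<forall>W. (\<forall>a\<in>A. length (W a) = r a) \<longrightarrow> cmod (moment_defect \<tau> W a A) \<le> C"
proof -
  have "\<exists>C. \<forall>B W. B \<subseteq> A \<longrightarrow> (\<forall>a\<in>A. length (W a) = r a) \<longrightarrow> cmod (cycle_moment \<tau> W B) \<le> C"
  proof -
    have "\<exists>C. \<forall>W. (\<forall>a\<in>A. length (W a) = r a) \<longrightarrow> cmod (cycle_moment \<tau> W B) \<le> C" if "B \<subseteq> A" for B
      using cycle_moment_bound[of B r \<tau>] finite_subset[OF that A(1)] that by (meson subsetD)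
    then obtain C where C: "\<And>B W. B \<subseteq> A \<Longrightarrow> (\<forall>a\<in>A. length (W a) = r a) \<Longrightarrow> cmod (cycle_moment \<tau> W B) \<le> C B"
      by metis
    have "C B \<le> (\<Sum>B\<in>Pow A. \<bar>C B\<bar>)" if "B \<subseteq> A" for B
      using member_le_sum[of B "Pow A" "\<lambda>B. \<bar>C B\<bar>"] A that by force
    then show ?thesis using C by (meson order_trans)
  qed
  then obtain C where C: "\<And>B W. B \<subseteq> A \<Longrightarrow> (\<forall>a\<in>A. length (W a) = r a) \<Longrightarrow> cmod (cycle_moment \<tau> W B) \<le> C"
    by metis
  have C0: "0 \<le> C" using C[of A "\<lambda>a. replicate (r a) 0"] norm_ge_zero order_trans by (metis length_replicate order_refl)
  have "cmod (moment_defect \<tau> W a A) \<le> C + (\<Sum>b\<in>A - {a}. C * C)" if W: "\<forall>a\<in>A. length (W a) = r a" for W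
    unfolding moment_defect_def
  proof (rule order_trans[OF norm_triangle_ineq4 add_mono])
    show "cmod (cycle_moment \<tau> W A) \<le> C" using C[OF _ W] by simp
    show "cmod (\<Sum>b\<in>A - {a}. cycle_moment \<tau> W {a, b} * cycle_moment \<tau> W (A - {a, b})) \<le> (\<Sum>b\<in>A - {a}. C * C)"
    proof (rule sum_norm_le)
      fix b assume "b \<in> A - {a}"
      then have "{a, b} \<subseteq> A" "A - {a, b} \<subseteq> A" using A by auto
      from C[OF this(1) W] C[OF this(2) W]
      show "cmod (cycle_moment \<tau> W {a, b} * cycle_moment \<tau> W (A - {a, b})) \<le> C * C"
        unfolding norm_mult by (intro mult_mono) (use C0 in auto)
    qed
  qed
  moreover have "0 \<le> C + (\<Sum>b\<in>A - {a}. C * C)" using C0 by (simp add: sum_nonneg)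
  ultimately show ?thesis by blast
qed

text \<open>Power counting: only tuples with some vertex visited three times and none visited once
  survive. Their number is at most of order \<open>L ^ ((P - 1) div 2)\<close>, against the scaling
  \<open>L powr (- P / 2)\<close>. Both the Wick recursion and the covariances are estimated in this
  way.\<close>

lemma sum_few_vertices_bound:
  fixes F :: "('k \<Rightarrow> nat list) \<Rightarrow> complex"
  assumes A: "finite A" "A \<noteq> {}" and L: "1 \<le> L" and y: "\<And>a. a \<in> A \<Longrightarrow> y a \<le> K" "1 \<le> K"
    and r: "\<And>a. a \<in> A \<Longrightarrow> 1 \<le> r a" and C: "0 \<le> C"
    and bound: "\<And>W. W \<in> word_tuples L y r A \<Longrightarrow> cmod (F W) \<le> C"
    and zero: "\<And>W. W \<in> word_tuples L y r A \<Longrightarrow> (\<exists>v. visits A W v = 1) \<or> (\<forall>v. visits A W v \<le> 2) \<Longrightarrow> F W = 0"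
  shows "cmod (complex_of_real (L powr (- real (sum r A) / 2)) * (\<Sum>W\<in>word_tuples L y r A. F W))
    \<le> C * (K ^ sum r A * real (sum r A) ^ sum r A) * L powr (- 1 / 2)"
proof -
  define P where "P = sum r A"
  let ?N = "dim L K"
  let ?k = "(P - 1) div 2"
  let ?Bad = "{W \<in> word_tuples L y r A. (\<forall>v. visits A W v \<noteq> 1) \<and> (\<exists>v. 3 \<le> visits A W v)}"
  have P: "1 \<le> P"
  proof -
    obtain a where "a \<in> A" using A by auto
    then show ?thesis unfolding P_def using member_le_sum[of a A r] r[of a] A by simp
  qed
  have dimle: "dim L (y a) \<le> ?N" if "a \<in> A" for a
    using y(1)[OF that] L by (intro nat_mono floor_mono mult_left_mono) auto
  have N: "real ?N \<le> L * K" using L y by (simp add: floor_le_iff of_nat_floor)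
  have N': "real ?N ^ ?k \<le> L ^ ?k * K ^ P"
  proof -
    have "real ?N ^ ?k \<le> (L * K) ^ ?k" using N by (intro power_mono) auto
    also have "\<dots> = L ^ ?k * K ^ ?k" by (rule power_mult_distrib)
    also have "\<dots> \<le> L ^ ?k * K ^ P" using y(2) L by (intro mult_left_mono power_increasing) auto
    finally show ?thesis .
  qed
  have fin: "finite (word_tuples L y r A)" by (rule finite_word_tuples[OF A(1)])
  have notbad: "F W = 0" if "W \<in> word_tuples L y r A - ?Bad" for W
  proof (rule zero)
    show "(\<exists>v. visits A W v = 1) \<or> (\<forall>v. visits A W v \<le> 2)"
    proof (cases "\<exists>v. visits A W v = 1")
      case False
      then have "\<not> 3 \<le> visits A W v" for v using that by blast
      then show ?thesis by (auto simp: not_le less_eq_Suc_le eval_nat_numeral)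
    qed simp
  qed (use that in auto)
  have "(\<Sum>W\<in>word_tuples L y r A. F W) = (\<Sum>W\<in>?Bad. F W)"
    using fin notbad by (intro sum.mono_neutral_right) auto
  then have "cmod (\<Sum>W\<in>word_tuples L y r A. F W) \<le> (\<Sum>W\<in>?Bad. C)"
    using bound by (simp only:) (intro sum_norm_le, auto)
  also have "\<dots> = C * real (card ?Bad)" by simp
  also have "\<dots> \<le> C * (real ?N ^ ?k * real P ^ P)"
  proof (intro mult_left_mono C)
    have "card ?Bad \<le> ?N ^ ?k * P ^ P"
      unfolding P_def by (rule card_tuples_few_vertices[OF A(1) dimle r])
    then have "real (card ?Bad) \<le> real (?N ^ ?k * P ^ P)" by (rule of_nat_mono)
    then show "real (card ?Bad) \<le> real ?N ^ ?k * real P ^ P" by simp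
  qed
  also have "\<dots> \<le> C * ((L ^ ?k * K ^ P) * real P ^ P)"
    by (intro mult_left_mono mult_right_mono C N') auto
  finally have 1: "cmod (\<Sum>W\<in>word_tuples L y r A. F W) \<le> L ^ ?k * (C * (K ^ P * real P ^ P))"
    by (simp add: mult_ac)
  have "L powr (- real P / 2) * L ^ ?k = L powr (real ?k - real P / 2)"
    using L by (simp add: powr_realpow[symmetric] powr_add[symmetric])
  also have "\<dots> \<le> L powr (- 1 / 2)"
  proof (rule powr_mono[OF _ L])
    \<comment> \<open>The half power of \<open>L\<close> is gained here:
      \<open>(P - 1) div 2\<close> falls short of \<open>P / 2\<close> by at least one half.\<close>
    have "2 * ?k \<le> P - 1" by simp
    then have "2 * real ?k \<le> real P - 1" using P by linarith
    then show "real ?k - real P / 2 \<le> - 1 / 2" by simp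
  qed
  finally have 2: "L powr (- real P / 2) * L ^ ?k \<le> L powr (- 1 / 2)" .
  have K0: "0 \<le> C * (K ^ P * real P ^ P)" using C y(2) by simp
  have "cmod (complex_of_real (L powr (- real P / 2)) * (\<Sum>W\<in>word_tuples L y r A. F W)) =
      L powr (- real P / 2) * cmod (\<Sum>W\<in>word_tuples L y r A. F W)"
    by (simp add: norm_mult)
  also have "\<dots> \<le> L powr (- real P / 2) * (L ^ ?k * (C * (K ^ P * real P ^ P)))"
    by (intro mult_left_mono 1) simp
  also have "\<dots> = (L powr (- real P / 2) * L ^ ?k) * (C * (K ^ P * real P ^ P))" by simp
  also have "\<dots> \<le> L powr (- 1 / 2) * (C * (K ^ P * real P ^ P))"
    by (rule mult_right_mono[OF 2 K0])
  finally show ?thesis unfolding P_def by (simp only: mult_ac)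
qed

lemma powr_minus_half_tendsto_0: "((\<lambda>L::real. C * L powr (- 1 / 2)) \<longlongrightarrow> 0) at_top"
proof -
  have "((\<lambda>L::real. L powr (- 1 / 2)) \<longlongrightarrow> 0) at_top"
    by (rule tendsto_neg_powr) (auto intro: filterlim_ident)
  from tendsto_mult_left[OF this, of C] show ?thesis by simp
qed

lemma ex_common_bound:
  assumes "finite A"
  shows "\<exists>K\<ge>1. \<forall>a\<in>A. (y a :: real) \<le> K"
proof (intro exI[of _ "Max (insert 1 (y ` A))"] conjI ballI)
  show "1 \<le> Max (insert 1 (y ` A))" using assms by (intro Max_ge) auto
  show "y a \<le> Max (insert 1 (y ` A))" if "a \<in> A" for a using assms that by (intro Max_ge) auto
qed

lemma cycle_moment_cong: "(\<And>a. a \<in> B \<Longrightarrow> W a = W' a) \<Longrightarrow> cycle_moment \<tau> W B = cycle_moment \<tau> W' B"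
  unfolding cycle_moment_def by (intro Bochner_Integration.integral_cong refl prod.cong) auto

text \<open>Products of moments are again sums over tuples on the whole of \<open>A\<close>, with
  matching powers of \<open>L\<close>. So the defect of the statistics is the scaled sum of the
  defects of the tuples, to which power counting applies.\<close>

lemma stat_moment_defect:
  assumes A: "finite A" "a \<in> A" and r: "\<And>a. a \<in> A \<Longrightarrow> 1 \<le> r a"
  shows "((\<lambda>L. stat_moment L \<tau> y r A -
    (\<Sum>b\<in>A - {a}. stat_moment L \<tau> y r {a, b} * stat_moment L \<tau> y r (A - {a, b}))) \<longlongrightarrow> 0) at_top"
proof -
  obtain K where K: "1 \<le> K" "\<And>a. a \<in> A \<Longrightarrow> y a \<le> K" using ex_common_bound[OF A(1), of y] by blast
  obtain C where C: "0 \<le> C" "\<And>W. (\<forall>a\<in>A. length (W a) = r a) \<Longrightarrow> cmod (moment_defect \<tau> W a A) \<le> C"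
    using moment_defect_bound[OF A, of r \<tau>] by blast
  have eq: "stat_moment L \<tau> y r A - (\<Sum>b\<in>A - {a}. stat_moment L \<tau> y r {a, b} * stat_moment L \<tau> y r (A - {a, b})) =
      complex_of_real (L powr (- real (sum r A) / 2)) * (\<Sum>W\<in>word_tuples L y r A. moment_defect \<tau> W a A)"
    if L: "0 < L" for L
  proof -
    have "stat_moment L \<tau> y r {a, b} * stat_moment L \<tau> y r (A - {a, b}) =
        complex_of_real (L powr (- real (sum r A) / 2)) *
        (\<Sum>W\<in>word_tuples L y r A. cycle_moment \<tau> W {a, b} * cycle_moment \<tau> W (A - {a, b}))"
      if b: "b \<in> A - {a}" for b
    proof -
      have sub: "{a, b} \<subseteq> A" using b A by auto
      have "real (sum r A) = real (sum r {a, b}) + real (sum r (A - {a, b}))"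
        using sum.subset_diff[OF sub A(1), of r] by simp
      then have "- real (sum r A) / 2 = - real (sum r {a, b}) / 2 + - real (sum r (A - {a, b})) / 2"
        by argo
      then have p: "L powr (- real (sum r A) / 2) =
          L powr (- real (sum r {a, b}) / 2) * L powr (- real (sum r (A - {a, b})) / 2)"
        by (simp only: powr_add)
      have "(\<Sum>W\<in>word_tuples L y r {a, b}. cycle_moment \<tau> W {a, b}) *
          (\<Sum>W\<in>word_tuples L y r (A - {a, b}). cycle_moment \<tau> W (A - {a, b})) =
          (\<Sum>W\<in>word_tuples L y r A. cycle_moment \<tau> W {a, b} * cycle_moment \<tau> W (A - {a, b}))"
        by (rule sum_PiE_mult[OF A(1) sub]; rule cycle_moment_cong; simp only: restrict_apply if_True)
      then show ?thesis
        unfolding p stat_moment_eq_sum[OF finite_subset[OF sub A(1)] L]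
          stat_moment_eq_sum[OF finite_Diff[OF A(1)] L]
        by (simp add: mult_ac del: sum.insert)
    qed
    then have "(\<Sum>b\<in>A - {a}. stat_moment L \<tau> y r {a, b} * stat_moment L \<tau> y r (A - {a, b})) =
        (\<Sum>b\<in>A - {a}. complex_of_real (L powr (- real (sum r A) / 2)) *
        (\<Sum>W\<in>word_tuples L y r A. cycle_moment \<tau> W {a, b} * cycle_moment \<tau> W (A - {a, b})))"
      by (intro sum.cong refl)
    also have "\<dots> = complex_of_real (L powr (- real (sum r A) / 2)) *
        (\<Sum>W\<in>word_tuples L y r A. \<Sum>b\<in>A - {a}. cycle_moment \<tau> W {a, b} * cycle_moment \<tau> W (A - {a, b}))"
      by (subst sum.swap) (simp add: sum_distrib_left)
    finally show ?thesis
      unfolding stat_moment_eq_sum[OF A(1) L] moment_defect_def sum_subtractf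
      by (simp add: right_diff_distrib)
  qed
  have ne: "A \<noteq> {}" using A by auto
  have "cmod (stat_moment L \<tau> y r A - (\<Sum>b\<in>A - {a}. stat_moment L \<tau> y r {a, b} * stat_moment L \<tau> y r (A - {a, b})))
      \<le> C * (K ^ sum r A * real (sum r A) ^ sum r A) * L powr (- 1 / 2)" if L: "1 \<le> L" for L
  proof -
    have L0: "0 < L" using L by simp
    show ?thesis unfolding eq[OF L0]
    proof (rule sum_few_vertices_bound[OF A(1) ne L K(2,1) r C(1)])
      fix W assume W: "W \<in> word_tuples L y r A"
      have len: "length (W b) = r b" if "b \<in> A" for b using W that by (auto simp: PiE_iff)
      then show "cmod (moment_defect \<tau> W a A) \<le> C" by (intro C(2)) auto
      assume v: "(\<exists>v. visits A W v = 1) \<or> (\<forall>v. visits A W v \<le> 2)"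
      have "W b \<noteq> []" if "b \<in> A" for b using len[OF that] r[OF that] by auto
      then show "moment_defect \<tau> W a A = 0" by (rule moment_defect_eq_0[OF A _ v])
    qed
  qed
  then show ?thesis
    by (intro Lim_null_comparison[OF _ powr_minus_half_tendsto_0] eventually_mono[OF eventually_ge_at_top[of 1]])
qed

end

section \<open>Pairs of simple cycles\<close>

text \<open>Reversal exchanges the recursions at the two ends: the defining one for the transposed
  matrix and \<open>path_weight_snoc\<close> for the reversed word.\<close>

lemma path_weight_rev: "path_weight X (rev w) = path_weight (\<lambda>i j. X j i) w"
proof (induction w rule: induct_list012)
  case (3 a b w)
  then show ?case using path_weight_snoc[of X "rev (tl w)" "hd w" b a] by (cases w) auto
qed auto

lemma cycle_weight_rev: "cycle_weight X (rev w) = cycle_weight (\<lambda>i j. X j i) w"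
proof (cases w)
  case (Cons a u)
  have "rotate (length u) (rev u @ [a]) = a # rev u"
    using rotate_append[of "rev u" "[a]"] by simp
  then have "cycle_weight X (rev w) = cycle_weight X (a # rev u)"
    using Cons cycle_weight_rotate[of X "length u" "rev u @ [a]"] by simp
  also have "\<dots> = cycle_weight (\<lambda>i j. X j i) (a # u)"
  proof (cases "u = []")
    case False
    have 1: "path_weight X ((a # rev u) @ [a]) = path_weight (\<lambda>i j. X j i) ((a # u) @ [a])"
      using path_weight_rev[of X "a # u @ [a]"] by simp
    have "(a # rev u) ! 1 = last u" "last (a # rev u) = hd u" "(a # u) ! 1 = hd u" "last (a # u) = last u"
      using False by (simp_all add: hd_rev last_rev hd_conv_nth[symmetric])
    then show ?thesis unfolding cycle_weight_def using 1 path_weight_rev[of X u] by auto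
  qed (simp add: cycle_weight_def)
  finally show ?thesis using Cons by simp
qed (simp add: cycle_weight_def)

lemma path_weight_distinct:
  assumes "distinct w" "w \<noteq> []"
  shows "path_weight X w = (\<Prod>i<length w - 1. X (w ! i) (w ! Suc i))"
  using assms
proof (induction w rule: induct_list012)
  case (3 a b w)
  have "path_weight X (a # b # w) = X a b * path_weight X (b # w)"
    using 3 by (cases w) auto
  also have "path_weight X (b # w) = (\<Prod>i<length (b # w) - 1. X ((b # w) ! i) ((b # w) ! Suc i))"
    using 3 by simp
  finally show ?case by (simp add: prod.lessThan_Suc_shift del: prod.lessThan_Suc)
qed auto

text \<open>A cycle through three or more distinct vertices has no backtracks, so nothing is
  subtracted.\<close>

lemma cycle_weight_distinct:
  assumes w: "distinct w" "3 \<le> length w"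
  shows "cycle_weight X w = (\<Prod>i<length w. X (w ! i) (w ! (Suc i mod length w)))"
proof -
  obtain v u where vu: "w = v # u" "2 \<le> length u" "v \<notin> set u" "distinct u" using w by (cases w) auto
  have ne: "u \<noteq> []" using vu by auto
  have "u ! 0 \<noteq> u ! (length u - 1)" using vu by (subst nth_eq_iff_index_eq) auto
  then have neq: "hd u \<noteq> last u" using ne by (simp add: hd_conv_nth last_conv_nth)
  obtain q where q: "length u = Suc q" using ne by (cases u) auto
  have "cycle_weight X w = X v (hd u) * X (last u) v * (\<Prod>i<q. X (u ! i) (u ! Suc i))"
    using cycle_weight_fresh[OF vu(3,2), of X] neq path_weight_distinct[OF vu(4) ne, of X] vu(1) q by simp
  also have "(\<Prod>i<q. X (u ! i) (u ! Suc i)) = (\<Prod>i<q. X (w ! Suc i) (w ! (Suc (Suc i) mod length w)))"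
    using vu(1) q by (intro prod.cong) auto
  also have "X v (hd u) = X (w ! 0) (w ! (Suc 0 mod length w))"
    using vu(1) q ne by (simp add: hd_conv_nth)
  also have "X (last u) v = X (w ! Suc q) (w ! (Suc (Suc q) mod length w))"
    using vu(1) q ne by (simp add: last_conv_nth)
  finally show ?thesis
    using vu(1) q by (simp add: prod.lessThan_Suc_shift[of _ "Suc q"] del: prod.lessThan_Suc) (simp add: mult_ac)
qed

lemma count_list_distinct: "distinct w \<Longrightarrow> count_list w v = (if v \<in> set w then 1 else 0)"
  by (induction w) auto

lemma distinct_if_count_list: "(\<And>v. v \<in> set w \<Longrightarrow> count_list w v = 1) \<Longrightarrow> distinct w"
proof (induction w)
  case (Cons a w)
  have "a \<notin> set w"
    using Cons.prems[of a] count_list_0_iff[of w a] by simp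
  moreover have "count_list w v = 1" if "v \<in> set w" for v
    using Cons.prems[of v] that \<open>a \<notin> set w\<close> by (cases "v = a") auto
  ultimately show ?case using Cons.IH by simp
qed simp

text \<open>Distinctness of the edges makes the entries around the cycle independent. In the crossed
  case each of \<open>i\<close> and \<open>j\<close> would be the cyclic successor of the other,
  which is possible only for length at most 2.\<close>

lemma distinct_cycle_edges:
  assumes w: "distinct w" "3 \<le> length w" and ij: "i < length w" "j < length w"
    and eq: "{w ! i, w ! (Suc i mod length w)} = {w ! j, w ! (Suc j mod length w)}"
  shows "i = j"
proof -
  let ?p = "length w"
  have m: "Suc k mod ?p < ?p" for k using w(2) by (intro mod_less_divisor) linarith
  have neq: "w ! a = w ! b \<longleftrightarrow> a = b" if "a < ?p" "b < ?p" for a b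
    using w(1) that by (simp add: nth_eq_iff_index_eq)
  from eq consider "w ! i = w ! j" | "w ! i = w ! (Suc j mod ?p)" "w ! (Suc i mod ?p) = w ! j"
    unfolding doubleton_eq_iff by blast
  then show ?thesis
  proof cases
    case 1
    then show ?thesis using neq ij by simp
  next
    case 2
    then have *: "i = Suc j mod ?p" "Suc i mod ?p = j"
      using neq[OF ij(1) m] neq[OF m ij(2)] by simp_all
    have "j < ?p \<Longrightarrow> Suc j mod ?p = (if Suc j = ?p then 0 else Suc j)"
      "i < ?p \<Longrightarrow> Suc i mod ?p = (if Suc i = ?p then 0 else Suc i)"
      by (simp_all add: mod_less)
    then show ?thesis using * ij w(2) by (auto split: if_splits)
  qed
qed

context time_dependent_wigner begin

lemma expectation_prod_indep:
  assumes "finite I" "\<And>i. i \<in> I \<Longrightarrow> F i \<in> borel_measurable (sigma_edges {e i})"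
    "inj_on e I" "\<And>i. i \<in> I \<Longrightarrow> e i \<in> edges" "\<And>i. i \<in> I \<Longrightarrow> Lp (F i)"
  shows "(LINT \<omega>|M. (\<Prod>i\<in>I. F i \<omega>)) = (\<Prod>i\<in>I. LINT \<omega>|M. F i \<omega>)"
  using assms
proof (induction I rule: finite_induct)
  case empty
  then show ?case by (simp add: prob_space)
next
  case (insert i I)
  have "(LINT \<omega>|M. F i \<omega> * (\<Prod>i\<in>I. F i \<omega>)) = (LINT \<omega>|M. F i \<omega>) * (LINT \<omega>|M. (\<Prod>i\<in>I. F i \<omega>))"
  proof (rule expectation_mult_indep)
    show "F i \<in> borel_measurable (sigma_edges {e i})" using insert by simp
    show "(\<lambda>\<omega>. \<Prod>i\<in>I. F i \<omega>) \<in> borel_measurable (sigma_edges (e ` I))"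
    proof (rule borel_measurable_prod)
      fix k assume k: "k \<in> I"
      show "F k \<in> borel_measurable (sigma_edges (e ` I))"
        by (rule measurable_sigma_edges_mono[of _ "{e k}"]) (use insert.prems k in auto)
    qed
    show "{e i} \<inter> e ` I = {}" using insert by auto
    show "Lp (\<lambda>\<omega>. \<Prod>i\<in>I. F i \<omega>)" using insert by (intro Lp_prod) auto
  qed (use insert in auto)
  moreover have "(LINT \<omega>|M. (\<Prod>i\<in>I. F i \<omega>)) = (\<Prod>i\<in>I. LINT \<omega>|M. F i \<omega>)"
    by (rule insert.IH) (use insert.prems in auto)
  ultimately show ?case using insert by simp
qed

lemma ccyc_distinct:
  assumes w: "distinct w" "3 \<le> length w"
  shows "ccyc t w \<omega> = (\<Prod>i<length w. entry t (w ! i) (w ! (Suc i mod length w)) \<omega>)"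
proof -
  obtain v u where vu: "w = v # u" "2 \<le> length u" "v \<notin> set u" using w by (cases w) auto
  have "ccyc t w \<omega> = cyc t w \<omega>"
    unfolding vu(1) ccyc_Cons[OF vu(3)] cyc_def cycle_weight_fresh[OF vu(3,2)] spoke_def rim_def
    using vu(2) by auto
  also have "\<dots> = (\<Prod>i<length w. entry t (w ! i) (w ! (Suc i mod length w)) \<omega>)"
    unfolding cyc_def by (rule cycle_weight_distinct[OF w])
  finally show ?thesis .
qed

lemma ccyc_distinct_rev:
  assumes w: "distinct w" "3 \<le> length w"
  shows "ccyc t (rev w) \<omega> = (\<Prod>i<length w. entry t (w ! (Suc i mod length w)) (w ! i) \<omega>)"
proof -
  obtain v u where vu: "rev w = v # u" "2 \<le> length u" "v \<notin> set u"
  proof (cases "rev w")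
    case (Cons v u)
    have "distinct (v # u)" "length (v # u) = length w"
      using w(1) by (simp_all flip: Cons)
    then show ?thesis using that[OF Cons] w(2) by simp
  qed (use w in auto)
  have "ccyc t (rev w) \<omega> = cyc t (rev w) \<omega>"
    unfolding vu(1) ccyc_Cons[OF vu(3)] cyc_def cycle_weight_fresh[OF vu(3,2)] spoke_def rim_def
    using vu(2) by auto
  also have "\<dots> = cycle_weight (\<lambda>i j. entry t j i \<omega>) w"
    unfolding cyc_def by (rule cycle_weight_rev)
  also have "\<dots> = (\<Prod>i<length w. entry t (w ! (Suc i mod length w)) (w ! i) \<omega>)"
    by (rule cycle_weight_distinct[OF w])
  finally show ?thesis .
qed

text \<open>The edges of the cycle are independent, so the expectation is a product over edges of
  covariances, taken without conjugation for equal orientations and with conjugation for opposite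
  ones.\<close>

lemma expectation_cycle_pair:
  assumes w: "distinct w" "3 \<le> length w"
  shows "(LINT \<omega>|M. ccyc s w \<omega> * ccyc t w \<omega>) = (if \<beta> = 1 then complex_of_real (c s t) else 0) ^ length w"
    and "(LINT \<omega>|M. ccyc s w \<omega> * ccyc t (rev w) \<omega>) = complex_of_real (c s t) ^ length w"
proof -
  let ?p = "length w"
  define x where "x i = w ! i" for i
  define z where "z i = w ! (Suc i mod ?p)" for i
  have m: "Suc k mod ?p < ?p" for k using w(2) by (intro mod_less_divisor) linarith
  have ne: "x i \<noteq> z i" if "i < ?p" for i
  proof -
    have "i \<noteq> Suc i mod ?p" using that w(2) by (cases "Suc i = ?p") auto
    then show ?thesis unfolding x_def z_def using w(1) that m by (simp add: nth_eq_iff_index_eq)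
  qed
  have inj: "inj_on (\<lambda>i. edge (x i) (z i)) {..<?p}"
  proof
    fix i j assume ij: "i \<in> {..<?p}" "j \<in> {..<?p}" "edge (x i) (z i) = edge (x j) (z j)"
    then have "{x i, z i} = {x j, z j}" unfolding edge_eq_iff by auto
    then show "i = j" using distinct_cycle_edges[OF w, of i j] ij by (simp add: x_def z_def)
  qed
  have "(LINT \<omega>|M. ccyc s w \<omega> * ccyc t w \<omega>) =
      (LINT \<omega>|M. (\<Prod>i<?p. entry s (x i) (z i) \<omega> * entry t (x i) (z i) \<omega>))"
    unfolding ccyc_distinct[OF w] x_def z_def by (simp add: prod.distrib)
  also have "\<dots> = (\<Prod>i<?p. LINT \<omega>|M. entry s (x i) (z i) \<omega> * entry t (x i) (z i) \<omega>)"
    by (rule expectation_prod_indep[OF _ _ inj])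
      (auto intro!: borel_measurable_times entry_measurable_single Lp_mult Lp_entry)
  also have "\<dots> = (\<Prod>i<?p. if \<beta> = 1 then complex_of_real (c s t) else 0)"
    by (intro prod.cong refl entry_off_cov ne) auto
  finally show "(LINT \<omega>|M. ccyc s w \<omega> * ccyc t w \<omega>) = (if \<beta> = 1 then complex_of_real (c s t) else 0) ^ ?p"
    by simp
  have "(LINT \<omega>|M. ccyc s w \<omega> * ccyc t (rev w) \<omega>) =
      (LINT \<omega>|M. (\<Prod>i<?p. entry s (x i) (z i) \<omega> * entry t (z i) (x i) \<omega>))"
    unfolding ccyc_distinct[OF w] ccyc_distinct_rev[OF w] x_def z_def by (simp add: prod.distrib)
  also have "\<dots> = (\<Prod>i<?p. LINT \<omega>|M. entry s (x i) (z i) \<omega> * entry t (z i) (x i) \<omega>)"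
  proof (rule expectation_prod_indep[OF _ _ inj])
    fix i
    have "entry t (z i) (x i) \<in> borel_measurable (sigma_edges {edge (x i) (z i)})"
      using entry_measurable_single[of t "z i" "x i"] by (simp add: edge_commute)
    then show "(\<lambda>\<omega>. entry s (x i) (z i) \<omega> * entry t (z i) (x i) \<omega>) \<in> borel_measurable (sigma_edges {edge (x i) (z i)})"
      by (intro borel_measurable_times entry_measurable_single)
  qed (auto intro!: Lp_mult Lp_entry)
  also have "\<dots> = (\<Prod>i<?p. complex_of_real (c s t))"
    by (intro prod.cong refl entry_off_cov_cnj ne) auto
  finally show "(LINT \<omega>|M. ccyc s w \<omega> * ccyc t (rev w) \<omega>) = complex_of_real (c s t) ^ ?p"
    by simp
qed

text \<open>A pair of words is a family indexed by the Booleans, so the results on families apply to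
  it.\<close>

lemma cycle_moment_pair:
  "cycle_moment \<tau> W {False, True} = (LINT \<omega>|M. ccyc (\<tau> False) (W False) \<omega> * ccyc (\<tau> True) (W True) \<omega>)"
  by (simp add: cycle_moment_def mult.commute)

lemma expectation_pair_nbrs_neq:
  assumes w: "distinct w" "distinct u" "set u = set w" and v: "v \<in> set w" and ne: "nbrs w v \<noteq> nbrs u v"
  shows "(LINT \<omega>|M. ccyc s w \<omega> * ccyc t u \<omega>) = 0"
proof -
  let ?W = "\<lambda>b. if b then u else w" and ?t = "\<lambda>b. if b then t else s"
  have cnt: "count_list w v = 1" "count_list u v = 1"
    using w v by (simp_all add: count_list_distinct)
  have "cycle_moment ?t ?W {False, True} = 0"
    by (rule cycle_moment_nbrs_neq[of _ _ False True v]) (use cnt ne v w in \<open>auto simp: visits_def\<close>)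
  then show ?thesis unfolding cycle_moment_pair by simp
qed

text \<open>Three sources give one formula. Length 1 uses the diagonal covariance
  \<open>2 c / \<beta>\<close>. Length 2 has two orderings of equal weight, each contributing
  \<open>2 c^2 / \<beta>\<close>. From length 3 on there are \<open>p\<close> rotations in each
  orientation; the equal orientation counts only for \<open>\<beta> = 1\<close>, so the total is
  \<open>2 p c^p\<close> or \<open>p c^p\<close>.\<close>

lemma sum_pair_same_vertices:
  assumes w: "distinct w" "w \<noteq> []"
  shows "(\<Sum>u\<in>{u. distinct u \<and> set u = set w}. (LINT \<omega>|M. ccyc s w \<omega> * ccyc t u \<omega>)) =
    complex_of_real (2 / real \<beta> * real (length w) * c s t ^ length w)"
proof -
  consider x where "w = [x]" | x y where "w = [x, y]" "x \<noteq> y" | "3 \<le> length w"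
  proof -
    have "length w \<noteq> 0" using w(2) by simp
    then have "length w = 1 \<or> length w = 2 \<or> 3 \<le> length w" by arith
    then show ?thesis
    proof (elim disjE)
      assume "length w = 1"
      then obtain x where "w = [x]" by (auto simp: length_Suc_conv)
      then show ?thesis by (rule that(1))
    next
      assume "length w = 2"
      then obtain x y where "w = [x, y]" by (auto simp: length_Suc_conv numeral_2_eq_2)
      then show ?thesis using that(2)[of x y] w(1) by simp
    qed (rule that(3))
  qed
  then show ?thesis
  proof cases
    case 1
    have set: "{u. distinct u \<and> set u = {x}} = {[x]}"
    proof (intro equalityI subsetI)
      fix u assume "u \<in> {u. distinct u \<and> set u = {x}}"
      then have u: "distinct u" "set u = {x}" by auto
      have "length u = Suc 0" using distinct_card[OF u(1)] unfolding u(2) by simp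
      then obtain a where "u = [a]" by (auto simp: length_Suc_conv)
      then show "u \<in> {[x]}" using u(2) by simp
    next
      fix u assume "u \<in> {[x]}"
      then show "u \<in> {u. distinct u \<and> set u = {x}}" by simp
    qed
    have "ccyc t [x] = entry t x x" for t
      by (simp add: fun_eq_iff ccyc_Cons[of x "[]"] spoke_def rim_def)
    moreover have "{u. distinct u \<and> set u = set w} = {[x]}" using set 1 by simp
    ultimately have "(\<Sum>u\<in>{u. distinct u \<and> set u = set w}. (LINT \<omega>|M. ccyc s w \<omega> * ccyc t u \<omega>)) =
        (LINT \<omega>|M. entry s x x \<omega> * entry t x x \<omega>)"
      using 1 by simp
    then show ?thesis unfolding entry_diag_cov using 1 by simp
  next
    case 2
    have set: "{u. distinct u \<and> set u = {x, y}} = {[x, y], [y, x]}"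
    proof (intro equalityI subsetI)
      fix u assume "u \<in> {u. distinct u \<and> set u = {x, y}}"
      then have u: "distinct u" "set u = {x, y}" by auto
      have "length u = Suc (Suc 0)" using distinct_card[OF u(1)] 2(2) unfolding u(2) by simp
      then obtain a b where "u = [a, b]" by (auto simp: length_Suc_conv)
      then show "u \<in> {[x, y], [y, x]}" using u(2) by (simp add: doubleton_eq_iff)
    next
      fix u assume "u \<in> {[x, y], [y, x]}"
      then show "u \<in> {u. distinct u \<and> set u = {x, y}}" using 2(2) by auto
    qed
    have "ccyc t [y, x] = ccyc t [x, y]" for t using ccyc_rotate[of t 1 "[x, y]"] by simp
    moreover have "(LINT \<omega>|M. ccyc s [x, y] \<omega> * ccyc t [x, y] \<omega>) = complex_of_real (2 / \<beta> * (c s t)\<^sup>2)"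
      using entry_fourth[of x y s t] 2(2) by (simp add: ccyc_Cons[of x "[y]"] spoke_def rim_def)
    moreover have "{u. distinct u \<and> set u = set w} = {[x, y], [y, x]}" using set 2(1) by simp
    ultimately have "(\<Sum>u\<in>{u. distinct u \<and> set u = set w}. (LINT \<omega>|M. ccyc s w \<omega> * ccyc t u \<omega>)) =
        2 * complex_of_real (2 / \<beta> * (c s t)\<^sup>2)"
      using 2 by simp
    then show ?thesis using 2(1) by (simp add: power2_eq_square)
  next
    case 3
    have p: "w \<noteq> []" by (rule w(2))
    let ?f = "\<lambda>u. LINT \<omega>|M. ccyc s w \<omega> * ccyc t u \<omega>"
    have "(\<Sum>u\<in>{u. distinct u \<and> set u = set w}. ?f u) = of_nat (length w) * (?f w + ?f (rev w))"
    proof (rule sum_dihedral[OF w(1) 3])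
      show "?f (rotate k u) = ?f u" for k u by (simp add: ccyc_rotate)
      show "?f u = 0" if "distinct u" "set u = set w" "v \<in> set w" "nbrs u v \<noteq> nbrs w v" for u v
        by (rule expectation_pair_nbrs_neq[OF w(1) that(1-3) not_sym[OF that(4)]])
    qed
    also have "\<dots> = of_nat (length w) *
        ((if \<beta> = 1 then complex_of_real (c s t) else 0) ^ length w + complex_of_real (c s t) ^ length w)"
      by (simp only: expectation_cycle_pair[OF w(1) 3])
    also have "\<dots> = complex_of_real (2 / real \<beta> * real (length w) * c s t ^ length w)"
      by (cases rule: beta_cases) (simp_all add: p)
    finally show ?thesis .
  qed
qed

text \<open>The argument of \<open>moment_defect_eq_0\<close> for two words: disjoint words are
  independent, and intersecting ones with at most two visits everywhere either disagree at a shared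
  vertex or are simple cycles on the same vertices.\<close>

lemma expectation_pair_eq_0:
  assumes ne: "w \<noteq> []" "u \<noteq> []"
    and v: "\<And>v. count_list w v + count_list u v \<le> 2"
    and not_good: "\<not> (distinct w \<and> distinct u \<and> set u = set w)"
  shows "(LINT \<omega>|M. ccyc s w \<omega> * ccyc t u \<omega>) = 0"
proof -
  let ?W = "\<lambda>b. if b then u else w" and ?t = "\<lambda>b. if b then t else s"
  have "cycle_moment ?t ?W {False, True} = 0"
  proof (cases "set w \<inter> set u = {}")
    case True
    have "cycle_moment ?t ?W ({False} \<union> {True}) = cycle_moment ?t ?W {False} * cycle_moment ?t ?W {True}"
      using True ne by (intro cycle_moment_union_disjoint) auto
    moreover have "{False} \<union> {True} = {False, True}" by auto
    ultimately show ?thesis by (simp only: cycle_moment_singleton mult_zero_left)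
  next
    case False
    then obtain v where v': "v \<in> set w" "v \<in> set u" by auto
    have one: "count_list w x = 1 \<and> count_list u x = 1" if "x \<in> set w" "x \<in> set u" for x
    proof -
      have "count_list w x \<noteq> 0" "count_list u x \<noteq> 0" using that by (simp_all add: count_list_0_iff)
      then show ?thesis using v[of x] by linarith
    qed
    show ?thesis
    proof (cases "\<exists>x. x \<in> set w \<and> x \<in> set u \<and> nbrs w x \<noteq> nbrs u x")
      case True
      then obtain x where x: "x \<in> set w" "x \<in> set u" "nbrs w x \<noteq> nbrs u x" by blast
      show ?thesis
        by (rule cycle_moment_nbrs_neq[of _ _ False True x]) (use one[OF x(1,2)] x ne in \<open>auto simp: visits_def\<close>)
    next
      case False
      have "set w \<subseteq> set u" "set u \<subseteq> set w"
        using set_subset_if_nbrs_eq[OF v'] set_subset_if_nbrs_eq[OF v'(2,1)] False by metis+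
      moreover from this have "distinct w" "distinct u"
        using one by (auto intro!: distinct_if_count_list)
      ultimately show ?thesis using not_good by blast
    qed
  qed
  then show ?thesis unfolding cycle_moment_pair by simp
qed

end

section \<open>Asymptotic covariances\<close>

lemma dim_asymp: "((\<lambda>L. real (nat \<lfloor>L * y\<rfloor>) / L) \<longlongrightarrow> y) at_top" if "0 < y"
proof (rule tendsto_sandwich)
  show "\<forall>\<^sub>F L in at_top. y - 1 / L \<le> real (nat \<lfloor>L * y\<rfloor>) / L"
    using eventually_gt_at_top[of 0]
  proof eventually_elim
    case (elim L)
    have "L * y - 1 \<le> real (nat \<lfloor>L * y\<rfloor>)" by linarith
    then have "(L * y - 1) / L \<le> real (nat \<lfloor>L * y\<rfloor>) / L" using elim by (intro divide_right_mono) auto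
    then show ?case using elim by (simp add: diff_divide_distrib)
  qed
  show "\<forall>\<^sub>F L in at_top. real (nat \<lfloor>L * y\<rfloor>) / L \<le> y"
    using eventually_gt_at_top[of 0]
  proof eventually_elim
    case (elim L)
    have "real (nat \<lfloor>L * y\<rfloor>) \<le> L * y" using elim that by (intro of_nat_floor) auto
    then show ?case using elim by (simp add: field_simps)
  qed
  have "((\<lambda>L::real. 1 / L) \<longlongrightarrow> 0) at_top"
    by (intro tendsto_divide_0[OF tendsto_const] filterlim_at_top_imp_at_infinity filterlim_ident)
  from tendsto_diff[OF tendsto_const[of y] this] show "((\<lambda>L. y - 1 / L) \<longlongrightarrow> y) at_top" by simp
qed simp

lemma card_distinct_words_bounds:
  assumes "r \<le> n"
  shows "real (n - r) ^ r \<le> real (card {w. length w = r \<and> distinct w \<and> set w \<subseteq> {..<n}})"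
    and "real (card {w. length w = r \<and> distinct w \<and> set w \<subseteq> {..<n}}) \<le> real n ^ r"
proof -
  have eq: "card {w. length w = r \<and> distinct w \<and> set w \<subseteq> {..<n}} = \<Prod>{n - r + 1..n}"
    using card_lists_distinct_length_eq[of "{..<n}" r] assms by simp
  have c: "card {n - r + 1..n} = r" using assms by simp
  have "(\<Prod>k\<in>{n - r + 1..n}. n - r) \<le> \<Prod>{n - r + 1..n}" by (intro prod_mono) auto
  then show "real (n - r) ^ r \<le> real (card {w. length w = r \<and> distinct w \<and> set w \<subseteq> {..<n}})"
    unfolding eq prod_constant c by (metis of_nat_le_iff of_nat_power)
  have "\<Prod>{n - r + 1..n} \<le> (\<Prod>k\<in>{n - r + 1..n}. n)" by (intro prod_mono) auto
  then show "real (card {w. length w = r \<and> distinct w \<and> set w \<subseteq> {..<n}}) \<le> real n ^ r"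
    unfolding eq prod_constant c by (metis of_nat_le_iff of_nat_power)
qed

lemma card_distinct_words_asymp:
  assumes y: "0 < y"
  shows "((\<lambda>L. real (card {w. length w = r \<and> distinct w \<and> set w \<subseteq> {..<nat \<lfloor>L * y\<rfloor>}}) / L ^ r) \<longlongrightarrow> y ^ r) at_top"
proof (rule tendsto_sandwich)
  let ?n = "\<lambda>L. nat \<lfloor>L * y\<rfloor>"
  have big: "\<forall>\<^sub>F L in at_top. 0 < L \<and> r \<le> ?n L"
    using eventually_gt_at_top[of 0] eventually_ge_at_top[of "real r / y"]
  proof eventually_elim
    case (elim L)
    have "real r \<le> L * y" using elim y by (simp add: field_simps)
    then show ?case using elim by (simp add: le_nat_floor)
  qed
  show "\<forall>\<^sub>F L in at_top. (real (?n L) / L - real r / L) ^ r \<le>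
      real (card {w. length w = r \<and> distinct w \<and> set w \<subseteq> {..<?n L}}) / L ^ r"
    using big
  proof eventually_elim
    case (elim L)
    then have "(real (?n L) / L - real r / L) ^ r = real (?n L - r) ^ r / L ^ r"
      by (simp add: power_divide[symmetric] diff_divide_distrib of_nat_diff)
    then show ?case using card_distinct_words_bounds(1)[of r "?n L"] elim by (simp add: divide_right_mono)
  qed
  show "\<forall>\<^sub>F L in at_top. real (card {w. length w = r \<and> distinct w \<and> set w \<subseteq> {..<?n L}}) / L ^ r \<le>
      (real (?n L) / L) ^ r"
    using big
  proof eventually_elim
    case (elim L)
    then show ?case using card_distinct_words_bounds(2)[of r "?n L"] by (simp add: divide_right_mono power_divide)
  qed
  have "((\<lambda>L::real. real r / L) \<longlongrightarrow> 0) at_top"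
    by (intro tendsto_divide_0[OF tendsto_const] filterlim_at_top_imp_at_infinity filterlim_ident)
  from tendsto_power[OF tendsto_diff[OF dim_asymp[OF y] this], of r]
  show "((\<lambda>L. (real (?n L) / L - real r / L) ^ r) \<longlongrightarrow> y ^ r) at_top" by simp
  show "((\<lambda>L. (real (?n L) / L) ^ r) \<longlongrightarrow> y ^ r) at_top"
    by (intro tendsto_power dim_asymp y)
qed

lemma sum_PiE_bool:
  fixes f :: "'x \<Rightarrow> 'x \<Rightarrow> complex"
  shows "(\<Sum>W\<in>Pi\<^sub>E {False, True} J. f (W False) (W True)) = (\<Sum>w\<in>J False. \<Sum>u\<in>J True. f w u)"
proof -
  have "(\<Sum>W\<in>Pi\<^sub>E {False, True} J. f (W False) (W True)) = (\<Sum>(w, u)\<in>J False \<times> J True. f w u)"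
    by (rule sum.reindex_bij_witness[where j = "\<lambda>W. (W False, W True)" and i = "\<lambda>(w, u) b. if b then u else w"])
      (auto simp: PiE_def extensional_def Pi_def fun_eq_iff)
  then show ?thesis by (simp add: sum.cartesian_product)
qed

context time_dependent_wigner begin

lemma dim_min: "0 < L \<Longrightarrow> min (dim L y) (dim L y') = dim L (min y y')"
  by (cases "y \<le> y'") (auto simp: min_def intro!: antisym nat_mono floor_mono)

text \<open>The partners of a simple cycle \<open>w\<close> are the orderings of its own vertices,
  so they exist only if these vertices also lie below \<open>n'\<close>; hence the minimum of the
  two dimensions.\<close>

lemma sum_good_pairs:
  assumes r: "1 \<le> r"
  shows "(\<Sum>w\<in>words n r. \<Sum>u\<in>words n' r'. if distinct w \<and> distinct u \<and> set u = set w
      then (LINT \<omega>|M. ccyc s w \<omega> * ccyc t u \<omega>) else 0) =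
    (if r = r' then of_nat (card {w. length w = r \<and> distinct w \<and> set w \<subseteq> {..<min n n'}}) *
      complex_of_real (2 / real \<beta> * real r * c s t ^ r) else 0)"
proof -
  let ?E = "\<lambda>w u. LINT \<omega>|M. ccyc s w \<omega> * ccyc t u \<omega>"
  let ?K = "complex_of_real (2 / real \<beta> * real r * c s t ^ r)"
  have inner: "(\<Sum>u\<in>words n' r'. if distinct w \<and> distinct u \<and> set u = set w then ?E w u else 0) =
      (if r = r' \<and> distinct w \<and> set w \<subseteq> {..<n'} then ?K else 0)" if w: "w \<in> words n r" for w
  proof (cases "r = r' \<and> distinct w \<and> set w \<subseteq> {..<n'}")
    case True
    have sub: "u \<in> words n' r'" if "distinct u" "set u = set w" for u
      using that True w distinct_card[OF that(1)] distinct_card[of w] by auto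
    have "(\<Sum>u\<in>words n' r'. if distinct w \<and> distinct u \<and> set u = set w then ?E w u else 0) =
        (\<Sum>u\<in>{u \<in> words n' r'. distinct u \<and> set u = set w}. ?E w u)"
      using True by (subst sum.inter_filter) (auto intro!: sum.cong)
    also have "{u \<in> words n' r'. distinct u \<and> set u = set w} = {u. distinct u \<and> set u = set w}"
      using sub by blast
    also have "(\<Sum>u\<in>{u. distinct u \<and> set u = set w}. ?E w u) = ?K"
    proof -
      have "length w = r" using w by simp
      moreover from this have "w \<noteq> []" using r by auto
      ultimately show ?thesis using sum_pair_same_vertices[of w s t] True by simp
    qed
    finally show ?thesis using True by simp
  next
    case False
    have "\<not> (distinct w \<and> distinct u \<and> set u = set w)" if "u \<in> words n' r'" for u
      using that False w distinct_card[of u] distinct_card[of w] by auto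
    then have "(\<Sum>u\<in>words n' r'. if distinct w \<and> distinct u \<and> set u = set w then ?E w u else 0) = 0"
      by (intro sum.neutral ballI if_not_P)
    then show ?thesis using False by (simp only: if_False)
  qed
  have "(\<Sum>w\<in>words n r. \<Sum>u\<in>words n' r'. if distinct w \<and> distinct u \<and> set u = set w then ?E w u else 0) =
      (\<Sum>w\<in>words n r. if r = r' \<and> distinct w \<and> set w \<subseteq> {..<n'} then ?K else 0)"
    by (intro sum.cong refl inner)
  also have "\<dots> = (if r = r' then (\<Sum>w\<in>{w \<in> words n r. distinct w \<and> set w \<subseteq> {..<n'}}. ?K) else 0)"
    by (subst sum.inter_filter) (auto intro!: sum.cong)
  also have "{w \<in> words n r. distinct w \<and> set w \<subseteq> {..<n'}} =
      {w. length w = r \<and> distinct w \<and> set w \<subseteq> {..<min n n'}}"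
    by auto
  finally show ?thesis by simp
qed

text \<open>Pairs of simple cycles on the same vertices give the main term: about
  \<open>(L * min y y') ^ r\<close> words, each with the total correlation found in
  \<open>sum_pair_same_vertices\<close>. Every other pair vanishes or has a vertex visited at least
  three times and none visited once, so the rest is negligible.\<close>

lemma cheb_stat_cov:
  assumes y: "0 < y" "0 < y'" and r: "1 \<le> r" "1 \<le> r'"
  shows "((\<lambda>L. LINT \<omega>|M. cheb_stat L s y r \<omega> * cheb_stat L t y' r' \<omega>) \<longlongrightarrow>
    (if r = r' then complex_of_real (2 / real \<beta> * real r * (c s t * min y y') ^ r) else 0)) at_top"
proof -
  define \<tau> where "\<tau> b = (if b then t else s)" for b
  define Y' where "Y' b = (if b then y' else y)" for b
  define R where "R b = (if b then r' else r)" for b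
  let ?A = "{False, True}"
  let ?good = "\<lambda>w u. distinct w \<and> distinct u \<and> set u = set w"
  let ?E = "\<lambda>w u. LINT \<omega>|M. ccyc s w \<omega> * ccyc t u \<omega>"
  let ?K = "complex_of_real (2 / real \<beta> * real r * c s t ^ r)"
  \<comment> \<open>The pairs of simple cycles are taken out, so that the remainder satisfies the
    vanishing hypothesis of \<open>sum_few_vertices_bound\<close>.\<close>
  define F where "F W = (if ?good (W False) (W True) then 0 else cycle_moment \<tau> W ?A)" for W
  define n where "n L = dim L (min y y')" for L
  have sumR: "sum R ?A = r + r'" by (simp add: R_def)
  have E: "cycle_moment \<tau> W ?A = ?E (W False) (W True)" for W
    by (simp add: cycle_moment_pair \<tau>_def)
  obtain C where C: "\<And>W. (\<forall>a\<in>?A. length (W a) = R a) \<Longrightarrow> cmod (cycle_moment \<tau> W ?A) \<le> C"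
    using cycle_moment_bound[of ?A R \<tau>] by auto
  have C0: "0 \<le> C" using order_trans[OF norm_ge_zero C[of "\<lambda>a. replicate (R a) 0"]] by simp
  define K where "K = max 1 (max y y')"
  have small: "((\<lambda>L. complex_of_real (L powr (- real (sum R ?A) / 2)) * (\<Sum>W\<in>word_tuples L Y' R ?A. F W)) \<longlongrightarrow> 0) at_top"
  proof (rule Lim_null_comparison[OF _ powr_minus_half_tendsto_0])
    show "\<forall>\<^sub>F L in at_top. cmod (complex_of_real (L powr (- real (sum R ?A) / 2)) * (\<Sum>W\<in>word_tuples L Y' R ?A. F W))
      \<le> C * (K ^ sum R ?A * real (sum R ?A) ^ sum R ?A) * L powr (- 1 / 2)"
      using eventually_ge_at_top[of 1]
    proof eventually_elim
      case (elim L)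
      show ?case
      proof (rule sum_few_vertices_bound)
        fix W assume W: "W \<in> word_tuples L Y' R ?A"
        have len: "length (W a) = R a" for a using W by (cases a) (auto simp: PiE_iff)
        show "cmod (F W) \<le> C" using C[of W] len C0 by (simp add: F_def)
        have ne: "W a \<noteq> []" for a using len[of a] r by (cases a) (auto simp: R_def)
        assume v: "(\<exists>v. visits ?A W v = 1) \<or> (\<forall>v. visits ?A W v \<le> 2)"
        show "F W = 0"
        proof (cases "?good (W False) (W True)")
          case False
          from v have "cycle_moment \<tau> W ?A = 0"
          proof
            assume "\<exists>v. visits ?A W v = 1"
            then obtain v where "visits ?A W v = 1" by (rule exE)
            then show ?thesis by (intro cycle_moment_single_visit ne) auto
          next
            assume "\<forall>v. visits ?A W v \<le> 2"
            then have "count_list (W False) v + count_list (W True) v \<le> 2" for v by (simp add: visits_def)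
            then show ?thesis unfolding E using False by (intro expectation_pair_eq_0 ne) auto
          qed
          then show ?thesis by (simp add: F_def)
        qed (simp add: F_def)
      qed (use elim r C0 in \<open>auto simp: Y'_def R_def K_def\<close>)
    qed
  qed
  have eq: "(LINT \<omega>|M. cheb_stat L s y r \<omega> * cheb_stat L t y' r' \<omega>) =
      complex_of_real (L powr (- real (sum R ?A) / 2)) * (\<Sum>W\<in>word_tuples L Y' R ?A. F W) +
      (if r = r' then complex_of_real (real (card {w. length w = r \<and> distinct w \<and> set w \<subseteq> {..<n L}}) / L ^ r) * ?K else 0)"
    if L: "0 < L" for L
  proof -
    have "(LINT \<omega>|M. cheb_stat L s y r \<omega> * cheb_stat L t y' r' \<omega>) = stat_moment L \<tau> Y' R ?A"
      by (simp add: stat_moment_def \<tau>_def Y'_def R_def mult.commute)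
    also have "\<dots> = complex_of_real (L powr (- real (sum R ?A) / 2)) * (\<Sum>W\<in>word_tuples L Y' R ?A. cycle_moment \<tau> W ?A)"
      by (rule stat_moment_eq_sum[OF _ L]) simp
    also have "(\<Sum>W\<in>word_tuples L Y' R ?A. cycle_moment \<tau> W ?A) = (\<Sum>W\<in>word_tuples L Y' R ?A. F W) +
        (\<Sum>W\<in>word_tuples L Y' R ?A. if ?good (W False) (W True) then ?E (W False) (W True) else 0)"
      unfolding sum.distrib[symmetric] by (intro sum.cong refl) (auto simp: F_def E)
    also have "(\<Sum>W\<in>word_tuples L Y' R ?A. if ?good (W False) (W True) then ?E (W False) (W True) else 0) =
        (\<Sum>w\<in>words (dim L y) r. \<Sum>u\<in>words (dim L y') r'. if ?good w u then ?E w u else 0)"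
      using sum_PiE_bool[of "\<lambda>w u. if ?good w u then ?E w u else 0" "\<lambda>a. words (dim L (Y' a)) (R a)"]
      by (simp add: Y'_def R_def)
    also have "\<dots> = (if r = r' then of_nat (card {w. length w = r \<and> distinct w \<and> set w \<subseteq> {..<n L}}) * ?K else 0)"
      unfolding sum_good_pairs[OF r(1)] n_def dim_min[OF L] ..
    finally have *: "(LINT \<omega>|M. cheb_stat L s y r \<omega> * cheb_stat L t y' r' \<omega>) =
        complex_of_real (L powr (- real (sum R ?A) / 2)) * ((\<Sum>W\<in>word_tuples L Y' R ?A. F W) +
        (if r = r' then of_nat (card {w. length w = r \<and> distinct w \<and> set w \<subseteq> {..<n L}}) * ?K else 0))" .
    show ?thesis
    proof (cases "r = r'")
      case True
      have "- real (sum R ?A) / 2 = - real r" unfolding sumR True by simp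
      then have "L powr (- real (sum R ?A) / 2) = inverse (L ^ r)"
        by (simp only: powr_minus powr_realpow[OF L])
      then have p: "complex_of_real (L powr (- real (sum R ?A) / 2)) * of_nat k = complex_of_real (real k / L ^ r)" for k
        by (simp add: field_simps)
      show ?thesis unfolding * if_P[OF True] distrib_left mult.assoc[symmetric] p ..
    qed (simp only: * if_False add_0_right)
  qed
  have "((\<lambda>L. complex_of_real (L powr (- real (sum R ?A) / 2)) * (\<Sum>W\<in>word_tuples L Y' R ?A. F W) +
      (if r = r' then complex_of_real (real (card {w. length w = r \<and> distinct w \<and> set w \<subseteq> {..<n L}}) / L ^ r) * ?K else 0))
      \<longlongrightarrow> 0 + (if r = r' then complex_of_real ((min y y') ^ r) * ?K else 0)) at_top"
  proof (cases "r = r'")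
    case True
    have "0 < min y y'" using y by simp
    from card_distinct_words_asymp[OF this, of r]
    show ?thesis unfolding if_P[OF True] n_def
      by (intro tendsto_add[OF small] tendsto_mult tendsto_const tendsto_of_real)
  next
    case False
    then show ?thesis using small by simp
  qed
  then have "((\<lambda>L. LINT \<omega>|M. cheb_stat L s y r \<omega> * cheb_stat L t y' r' \<omega>) \<longlongrightarrow>
      0 + (if r = r' then complex_of_real ((min y y') ^ r) * ?K else 0)) at_top"
    by (rule Lim_transform_eventually) (use eventually_gt_at_top[of 0] in \<open>eventually_elim, simp add: eq\<close>)
  then show ?thesis by (simp add: power_mult_distrib mult_ac if_distrib cong: if_cong)
qed

end

section \<open>Moments of linear combinations of the statistics\<close>

text \<open>The moments of the centred normal law of variance \<open>v\<close>, in the recursive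
  form that Wick's rule yields; complex, because the statistics are.\<close>

fun gauss_moment :: "complex \<Rightarrow> nat \<Rightarrow> complex" where
  "gauss_moment v 0 = 1"
| "gauss_moment v (Suc 0) = 0"
| "gauss_moment v (Suc (Suc m)) = of_nat (m + 1) * v * gauss_moment v m"

context time_dependent_wigner begin

text \<open>The coefficients may depend on \<open>L\<close>, since powers are expanded in
  polynomials rescaled to the actual dimension \<open>dim L y\<close> while the statistics are
  scaled by \<open>L\<close>.\<close>

definition stat_comb ::
  "'b set \<Rightarrow> ('b \<Rightarrow> real) \<Rightarrow> ('b \<Rightarrow> real) \<Rightarrow> ('b \<Rightarrow> nat) \<Rightarrow> (real \<Rightarrow> 'b \<Rightarrow> real) \<Rightarrow> real \<Rightarrow> 'a \<Rightarrow> complex" where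
  "stat_comb B t y r \<xi> L \<omega> = (\<Sum>b\<in>B. complex_of_real (\<xi> L b) * cheb_stat L (t b) (y b) (r b) \<omega>)"

definition stat_cov :: "('b \<Rightarrow> real) \<Rightarrow> ('b \<Rightarrow> real) \<Rightarrow> ('b \<Rightarrow> nat) \<Rightarrow> 'b \<Rightarrow> 'b \<Rightarrow> real" where
  "stat_cov t y r b b' = (if r b = r b'
    then 2 / real \<beta> * real (r b) * (c (t b) (t b') * min (y b) (y b')) ^ r b else 0)"

lemma expectation_cheb_stat: "(LINT \<omega>|M. cheb_stat L t y r \<omega>) = 0"
  unfolding cheb_stat_def by (simp add: Bochner_Integration.integral_sum Lp_integrable Lp_ccyc expectation_ccyc)

lemma stat_moment_cong:
  "(\<And>a. a \<in> A \<Longrightarrow> \<tau> a = \<tau>' a \<and> y a = y' a \<and> r a = r' a) \<Longrightarrow> stat_moment L \<tau> y r A = stat_moment L \<tau>' y' r' A"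
  unfolding stat_moment_def by (intro Bochner_Integration.integral_cong refl prod.cong) auto

text \<open>The index set \<open>A\<close> of the factors may be any set of size \<open>m\<close>,
  so that the blocks \<open>{a, b}\<close> and \<open>A - {a, b}\<close> of a pairing can themselves
  serve as index sets.\<close>

lemma stat_comb_power:
  assumes A: "finite A" "card A = m" and B: "finite B"
  shows "(LINT \<omega>|M. stat_comb B t y r \<xi> L \<omega> ^ m) =
    (\<Sum>f\<in>Pi\<^sub>E A (\<lambda>_. B). (\<Prod>a\<in>A. complex_of_real (\<xi> L (f a))) *
      stat_moment L (\<lambda>a. t (f a)) (\<lambda>a. y (f a)) (\<lambda>a. r (f a)) A)"
proof -
  have "stat_comb B t y r \<xi> L \<omega> ^ m = (\<Prod>a\<in>A. \<Sum>b\<in>B. complex_of_real (\<xi> L b) * cheb_stat L (t b) (y b) (r b) \<omega>)" for \<omega>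
    using A by (simp add: stat_comb_def)
  also have "(\<Prod>a\<in>A. \<Sum>b\<in>B. complex_of_real (\<xi> L b) * cheb_stat L (t b) (y b) (r b) \<omega>) =
    (\<Sum>f\<in>Pi\<^sub>E A (\<lambda>_. B). (\<Prod>a\<in>A. complex_of_real (\<xi> L (f a))) *
      (\<Prod>a\<in>A. cheb_stat L (t (f a)) (y (f a)) (r (f a)) \<omega>))" for \<omega>
    unfolding prod.distrib[symmetric] by (rule prod_sum_PiE[OF A(1) B])
  finally show ?thesis
    unfolding stat_moment_def
    by (simp add: Bochner_Integration.integral_sum Lp_integrable Lp_prod A Lp_cheb_stat)
qed

lemma stat_comb_second_moment:
  assumes B: "finite B" "\<And>b. b \<in> B \<Longrightarrow> 0 < y b" "\<And>b. b \<in> B \<Longrightarrow> 1 \<le> r b"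
    and \<xi>: "\<And>b. b \<in> B \<Longrightarrow> ((\<lambda>L. \<xi> L b) \<longlongrightarrow> \<xi>' b) at_top"
  shows "((\<lambda>L. LINT \<omega>|M. stat_comb B t y r \<xi> L \<omega> ^ 2) \<longlongrightarrow>
    complex_of_real (\<Sum>b\<in>B. \<Sum>b'\<in>B. \<xi>' b * \<xi>' b' * stat_cov t y r b b')) at_top"
proof -
  have "(LINT \<omega>|M. stat_comb B t y r \<xi> L \<omega> ^ 2) = (\<Sum>b\<in>B. \<Sum>b'\<in>B. complex_of_real (\<xi> L b * \<xi> L b') *
      (LINT \<omega>|M. cheb_stat L (t b) (y b) (r b) \<omega> * cheb_stat L (t b') (y b') (r b') \<omega>))" for L
  proof -
    have "stat_comb B t y r \<xi> L \<omega> ^ 2 = (\<Sum>b\<in>B. \<Sum>b'\<in>B. complex_of_real (\<xi> L b * \<xi> L b') *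
        (cheb_stat L (t b) (y b) (r b) \<omega> * cheb_stat L (t b') (y b') (r b') \<omega>))" for \<omega>
      unfolding stat_comb_def power2_eq_square sum_product by (simp add: mult_ac)
    then show ?thesis
      by (simp add: Bochner_Integration.integral_sum Lp_integrable Lp_mult Lp_cheb_stat)
  qed
  moreover have "((\<lambda>L. \<Sum>b\<in>B. \<Sum>b'\<in>B. complex_of_real (\<xi> L b * \<xi> L b') *
      (LINT \<omega>|M. cheb_stat L (t b) (y b) (r b) \<omega> * cheb_stat L (t b') (y b') (r b') \<omega>)) \<longlongrightarrow>
    (\<Sum>b\<in>B. \<Sum>b'\<in>B. complex_of_real (\<xi>' b * \<xi>' b') * complex_of_real (stat_cov t y r b b'))) at_top"
  proof (intro tendsto_sum tendsto_mult tendsto_of_real \<xi>)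
    fix b b' assume b: "b \<in> B" "b' \<in> B"
    have "complex_of_real (stat_cov t y r b b') = (if r b = r b' then complex_of_real (2 / real \<beta> * real (r b) *
        (c (t b) (t b') * min (y b) (y b')) ^ r b) else 0)"
      by (simp add: stat_cov_def)
    then show "((\<lambda>L. LINT \<omega>|M. cheb_stat L (t b) (y b) (r b) \<omega> * cheb_stat L (t b') (y b') (r b') \<omega>) \<longlongrightarrow>
        complex_of_real (stat_cov t y r b b')) at_top"
      using cheb_stat_cov[OF B(2)[OF b(1)] B(2)[OF b(2)] B(3)[OF b(1)] B(3)[OF b(2)]] by (simp only:)
  qed
  ultimately show ?thesis by simp
qed

text \<open>Expanding over all assignments \<open>f\<close> of summands to factors turns
  \<open>stat_moment_defect\<close> into \<open>E S^m = (m - 1) E S^2 E S^(m-2)\<close> up to a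
  vanishing error, which is the recursion of \<open>gauss_moment\<close>.\<close>

lemma stat_comb_moment:
  assumes B: "finite B" "\<And>b. b \<in> B \<Longrightarrow> 0 < y b" "\<And>b. b \<in> B \<Longrightarrow> 1 \<le> r b"
    and \<xi>: "\<And>b. b \<in> B \<Longrightarrow> ((\<lambda>L. \<xi> L b) \<longlongrightarrow> \<xi>' b) at_top"
  shows "((\<lambda>L. LINT \<omega>|M. stat_comb B t y r \<xi> L \<omega> ^ m) \<longlongrightarrow>
    gauss_moment (complex_of_real (\<Sum>b\<in>B. \<Sum>b'\<in>B. \<xi>' b * \<xi>' b' * stat_cov t y r b b')) m) at_top"
proof (induction m rule: less_induct)
  case (less m)
  let ?v = "complex_of_real (\<Sum>b\<in>B. \<Sum>b'\<in>B. \<xi>' b * \<xi>' b' * stat_cov t y r b b')"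
  consider "m = 0" | "m = Suc 0" | k where "m = Suc (Suc k)" by (metis not0_implies_Suc)
  then show ?case
  proof cases
    case 1
    then show ?thesis by (simp add: prob_space)
  next
    case 2
    then show ?thesis
      by (simp add: stat_comb_def Bochner_Integration.integral_sum Lp_integrable Lp_cheb_stat expectation_cheb_stat)
  next
    case 3
    define A where "A = {..<m}"
    have A: "finite A" "0 \<in> A" "card A = m" by (auto simp: A_def 3)
    let ?S = "\<lambda>L m. LINT \<omega>|M. stat_comb B t y r \<xi> L \<omega> ^ m"
    let ?X = "\<lambda>L f A. \<Prod>a\<in>A. complex_of_real (\<xi> L (f a))"
    let ?SM = "\<lambda>L f A. stat_moment L (\<lambda>a. t (f a)) (\<lambda>a. y (f a)) (\<lambda>a. r (f a)) A"
    have eq: "?S L m - of_nat (k + 1) * (?S L 2 * ?S L k) = (\<Sum>f\<in>Pi\<^sub>E A (\<lambda>_. B). ?X L f A *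
        (?SM L f A - (\<Sum>b\<in>A - {0}. ?SM L f {0, b} * ?SM L f (A - {0, b}))))" for L
    proof -
      have prod: "?S L 2 * ?S L k = (\<Sum>f\<in>Pi\<^sub>E A (\<lambda>_. B). ?X L f A * (?SM L f {0, b} * ?SM L f (A - {0, b})))"
        if b: "b \<in> A - {0}" for b
      proof -
        have sub: "{0, b} \<subseteq> A" and card: "card {0, b} = 2" using A b by auto
        have card': "card (A - {0, b}) = k" using card_Diff_subset[of "{0, b}" A] sub card A(3) 3 by simp
        have "?S L 2 * ?S L k = (\<Sum>f\<in>Pi\<^sub>E {0, b} (\<lambda>_. B). ?X L f {0, b} * ?SM L f {0, b}) *
            (\<Sum>f\<in>Pi\<^sub>E (A - {0, b}) (\<lambda>_. B). ?X L f (A - {0, b}) * ?SM L f (A - {0, b}))"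
          using stat_comb_power[OF _ card B(1), of t y r \<xi> L]
            stat_comb_power[OF _ card' B(1), of t y r \<xi> L] A(1) by simp
        also have "\<dots> = (\<Sum>f\<in>Pi\<^sub>E A (\<lambda>_. B). (?X L f {0, b} * ?SM L f {0, b}) *
            (?X L f (A - {0, b}) * ?SM L f (A - {0, b})))"
        proof (rule sum_PiE_mult[OF A(1) sub])
          fix f :: "nat \<Rightarrow> 'b"
          have "?X L (restrict f A') A' = ?X L f A'" for A' by (intro prod.cong) auto
          moreover have "?SM L (restrict f A') A' = ?SM L f A'" for A' by (intro stat_moment_cong) auto
          ultimately show "?X L (restrict f {0, b}) {0, b} * ?SM L (restrict f {0, b}) {0, b} = ?X L f {0, b} * ?SM L f {0, b}"
            "?X L (restrict f (A - {0, b})) (A - {0, b}) * ?SM L (restrict f (A - {0, b})) (A - {0, b}) =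
              ?X L f (A - {0, b}) * ?SM L f (A - {0, b})"
            by (simp_all only:)
        qed
        also have "\<dots> = (\<Sum>f\<in>Pi\<^sub>E A (\<lambda>_. B). ?X L f A * (?SM L f {0, b} * ?SM L f (A - {0, b})))"
        proof (intro sum.cong refl)
          fix f
          have "?X L f A = ?X L f (A - {0, b}) * ?X L f {0, b}" by (rule prod.subset_diff[OF sub A(1)])
          then show "(?X L f {0, b} * ?SM L f {0, b}) * (?X L f (A - {0, b}) * ?SM L f (A - {0, b})) =
            ?X L f A * (?SM L f {0, b} * ?SM L f (A - {0, b}))"
            by (simp only: mult_ac)
        qed
        finally show ?thesis .
      qed
      \<comment> \<open>The distinguished factor 0 has \<open>k + 1\<close> partners, and each of
        them contributes the same product of moments.\<close>
      have "of_nat (k + 1) * (?S L 2 * ?S L k) = (\<Sum>b\<in>A - {0}. ?S L 2 * ?S L k)"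
        using A by (simp add: 3)
      also have "\<dots> = (\<Sum>b\<in>A - {0}. \<Sum>f\<in>Pi\<^sub>E A (\<lambda>_. B). ?X L f A * (?SM L f {0, b} * ?SM L f (A - {0, b})))"
        by (intro sum.cong refl prod)
      also have "\<dots> = (\<Sum>f\<in>Pi\<^sub>E A (\<lambda>_. B). ?X L f A * (\<Sum>b\<in>A - {0}. ?SM L f {0, b} * ?SM L f (A - {0, b})))"
        by (subst sum.swap) (simp only: sum_distrib_left)
      finally show ?thesis
        unfolding stat_comb_power[OF A(1,3) B(1)] by (simp only: right_diff_distrib sum_subtractf)
    qed
    have "((\<lambda>L. \<Sum>f\<in>Pi\<^sub>E A (\<lambda>_. B). ?X L f A *
        (?SM L f A - (\<Sum>b\<in>A - {0}. ?SM L f {0, b} * ?SM L f (A - {0, b})))) \<longlongrightarrow>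
        (\<Sum>f\<in>Pi\<^sub>E A (\<lambda>_. B). (\<Prod>a\<in>A. complex_of_real (\<xi>' (f a))) * 0)) at_top"
    proof (intro tendsto_sum tendsto_mult tendsto_prod tendsto_of_real)
      fix f assume f: "f \<in> Pi\<^sub>E A (\<lambda>_. B)"
      show "((\<lambda>L. \<xi> L (f a)) \<longlongrightarrow> \<xi>' (f a)) at_top" if "a \<in> A" for a
        using f that by (intro \<xi>) auto
      show "((\<lambda>L. ?SM L f A - (\<Sum>b\<in>A - {0}. ?SM L f {0, b} * ?SM L f (A - {0, b}))) \<longlongrightarrow> 0) at_top"
      proof (rule stat_moment_defect[OF A(1,2)])
        show "1 \<le> r (f a)" if "a \<in> A" for a using f that by (intro B(3)) auto
      qed
    qed
    then have "((\<lambda>L. ?S L m - of_nat (k + 1) * (?S L 2 * ?S L k)) \<longlongrightarrow> 0) at_top"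
      unfolding eq by (simp only: mult_zero_right sum.neutral_const)
    moreover have "((\<lambda>L. of_nat (k + 1) * (?S L 2 * ?S L k)) \<longlongrightarrow> of_nat (k + 1) * (?v * gauss_moment ?v k)) at_top"
      by (intro tendsto_mult tendsto_const stat_comb_second_moment B \<xi> less.IH) (simp_all add: 3)
    ultimately have "((\<lambda>L. (?S L m - of_nat (k + 1) * (?S L 2 * ?S L k)) + of_nat (k + 1) * (?S L 2 * ?S L k)) \<longlongrightarrow>
        0 + of_nat (k + 1) * (?v * gauss_moment ?v k)) at_top"
      by (rule tendsto_add)
    then show ?thesis by (simp add: 3 mult.assoc del: of_nat_Suc of_nat_add)
  qed
qed

end

section \<open>Chebyshev polynomials and the expansion of powers\<close>

fun cheb_u :: "complex \<Rightarrow> complex \<Rightarrow> nat \<Rightarrow> complex" where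
  "cheb_u n x 0 = 1"
| "cheb_u n x (Suc 0) = x"
| "cheb_u n x (Suc (Suc r)) = x * cheb_u n x (Suc r) - n * cheb_u n x r"

text \<open>Normalised by \<open>cheb_t s (2 s cos \<theta>) r = 2 s^r cos (r \<theta>)\<close>,
  hence the initial value 2; the relevant interval is \<open>[-2 s, 2 s]\<close>.\<close>

fun cheb_t :: "real \<Rightarrow> real \<Rightarrow> nat \<Rightarrow> real" where
  "cheb_t s x 0 = 2"
| "cheb_t s x (Suc 0) = x"
| "cheb_t s x (Suc (Suc r)) = x * cheb_t s x (Suc r) - s\<^sup>2 * cheb_t s x r"

lemma cheb_t_eq_u:
  "complex_of_real (cheb_t s x (Suc r)) = cheb_u (complex_of_real (s\<^sup>2)) (complex_of_real x) (Suc r) -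
    (if 1 \<le> r then complex_of_real (s\<^sup>2) * cheb_u (complex_of_real (s\<^sup>2)) (complex_of_real x) (r - 1) else 0)"
proof (induction r rule: less_induct)
  case (less r)
  define X where "X = complex_of_real x"
  define N where "N = complex_of_real (s\<^sup>2)"
  consider "r = 0" | "r = 1" | q where "r = Suc (Suc q)" by (metis One_nat_def not0_implies_Suc)
  then show ?case
  proof cases
    case 3
    \<comment> \<open>\<open>W\<close> is the lower term of the recursion, zero at its start, so
      that \<open>q = 0\<close> is covered along with the rest.\<close>
    define W where "W = (if 1 \<le> q then N * cheb_u N X (q - 1) else 0)"
    have rec: "X * T2 - N * T1 = (X * U2 - N * U1) - N * U1"
      if "T2 = U2 - N * U0" "T1 = U1 - W" "U1 = X * U0 - W" for T1 T2 U0 U1 U2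
      unfolding that by (simp add: algebra_simps)
    have "complex_of_real (cheb_t s x (Suc r)) =
        X * complex_of_real (cheb_t s x (Suc (Suc q))) - N * complex_of_real (cheb_t s x (Suc q))"
      unfolding 3 X_def N_def by (simp only: cheb_t.simps(3) of_real_diff of_real_mult)
    also have "\<dots> = (X * cheb_u N X (Suc (Suc q)) - N * cheb_u N X (Suc q)) - N * cheb_u N X (Suc q)"
    proof (rule rec)
      show "complex_of_real (cheb_t s x (Suc (Suc q))) = cheb_u N X (Suc (Suc q)) - N * cheb_u N X q"
        using less.IH[of "Suc q"] unfolding X_def[symmetric] N_def[symmetric] by (simp add: 3 del: cheb_t.simps cheb_u.simps)
      show "complex_of_real (cheb_t s x (Suc q)) = cheb_u N X (Suc q) - W"
        using less.IH[of q] unfolding X_def[symmetric] N_def[symmetric] W_def by (simp add: 3 del: cheb_t.simps cheb_u.simps)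
      show "cheb_u N X (Suc q) = X * cheb_u N X q - W"
        unfolding W_def by (cases q) simp_all
    qed
    finally show ?thesis
      unfolding X_def[symmetric] N_def[symmetric] by (simp add: 3)
  qed (simp_all add: algebra_simps)
qed

text \<open>The coefficient of the polynomial of degree \<open>r\<close> in \<open>x ^ p\<close> at
  scale 1, computed from \<open>x t_r = t_(r+1) + t_(r-1)\<close>. The initial value 1/2 and the
  factor 2 at \<open>r = 1\<close> both come from \<open>t_0 = 2\<close>.\<close>

fun cheb_coeff :: "nat \<Rightarrow> nat \<Rightarrow> real" where
  "cheb_coeff 0 r = (if r = 0 then 1 / 2 else 0)"
| "cheb_coeff (Suc p) r = (if r = 0 then 0 else (if r = 1 then 2 else 1) * cheb_coeff p (r - 1)) + cheb_coeff p (Suc r)"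

lemma cheb_coeff_eq_0: "p < r \<Longrightarrow> cheb_coeff p r = 0"
  by (induction p arbitrary: r) auto

text \<open>By homogeneity the scale \<open>s\<close> enters only through
  \<open>s ^ (p - r)\<close>; the coefficients do not depend on the dimension.\<close>

lemma power_eq_sum_cheb_t: "x ^ p = (\<Sum>r\<le>p. cheb_coeff p r * s ^ (p - r) * cheb_t s x r)"
proof (induction p)
  case (Suc p)
  let ?d = "\<lambda>r. (if r = 0 then 2 else 1) * cheb_coeff p r"
  have step: "x * cheb_t s x r = (if r = 0 then 2 else 1) * cheb_t s x (Suc r) + (if r = 0 then 0 else s\<^sup>2 * cheb_t s x (r - 1))" for r
    by (cases r) simp_all
  have "x ^ Suc p = (\<Sum>r\<le>p. cheb_coeff p r * s ^ (p - r) * (x * cheb_t s x r))"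
    unfolding power_Suc Suc.IH sum_distrib_left by (intro sum.cong refl) (simp only: mult_ac)
  also have "\<dots> = (\<Sum>r\<le>p. ?d r * s ^ (p - r) * cheb_t s x (Suc r)) +
      (\<Sum>r\<le>p. if r = 0 then 0 else cheb_coeff p r * s ^ (p - r) * (s\<^sup>2 * cheb_t s x (r - 1)))"
    unfolding sum.distrib[symmetric] step by (intro sum.cong refl) (simp add: distrib_left mult_ac)
  also have "(\<Sum>r\<le>p. ?d r * s ^ (p - r) * cheb_t s x (Suc r)) =
      (\<Sum>r\<le>Suc p. (if r = 0 then 0 else ?d (r - 1)) * s ^ (Suc p - r) * cheb_t s x r)"
    unfolding sum.atMost_Suc_shift by simp
  also have "(\<Sum>r\<le>p. if r = 0 then 0 else cheb_coeff p r * s ^ (p - r) * (s\<^sup>2 * cheb_t s x (r - 1))) =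
      (\<Sum>r\<le>Suc p. cheb_coeff p (Suc r) * s ^ (Suc p - r) * cheb_t s x r)"
  proof (cases p)
    case 0
    then show ?thesis by (simp add: atMost_Suc)
  next
    case (Suc q)
    have "(\<Sum>r\<le>p. if r = 0 then 0 else cheb_coeff p r * s ^ (p - r) * (s\<^sup>2 * cheb_t s x (r - 1))) =
        (\<Sum>r\<le>q. cheb_coeff p (Suc r) * s ^ (q - r) * (s\<^sup>2 * cheb_t s x r))"
      unfolding Suc sum.atMost_Suc_shift by simp
    also have "\<dots> = (\<Sum>r\<le>q. cheb_coeff p (Suc r) * s ^ (Suc p - r) * cheb_t s x r)"
    proof (intro sum.cong refl)
      fix r assume "r \<in> {..q}"
      then have "Suc p - r = (q - r) + 2" using Suc by simp
      then show "cheb_coeff p (Suc r) * s ^ (q - r) * (s\<^sup>2 * cheb_t s x r) =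
          cheb_coeff p (Suc r) * s ^ (Suc p - r) * cheb_t s x r"
        by (simp only: power_add mult_ac)
    qed
    also have "\<dots> = (\<Sum>r\<le>Suc p. cheb_coeff p (Suc r) * s ^ (Suc p - r) * cheb_t s x r)"
      using Suc by (simp add: cheb_coeff_eq_0 del: cheb_coeff.simps)
    finally show ?thesis .
  qed
  also have "(\<Sum>r\<le>Suc p. (if r = 0 then 0 else ?d (r - 1)) * s ^ (Suc p - r) * cheb_t s x r) +
      (\<Sum>r\<le>Suc p. cheb_coeff p (Suc r) * s ^ (Suc p - r) * cheb_t s x r) =
      (\<Sum>r\<le>Suc p. cheb_coeff (Suc p) r * s ^ (Suc p - r) * cheb_t s x r)"
    unfolding sum.distrib[symmetric] cheb_coeff.simps(2)
  proof (intro sum.cong refl)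
    fix r :: nat
    have "(if r = 0 then 0 else ?d (r - 1)) = (if r = 0 then 0 else (if r = 1 then 2 else 1) * cheb_coeff p (r - 1))"
      by (cases r) simp_all
    then show "(if r = 0 then 0 else ?d (r - 1)) * s ^ (Suc p - r) * cheb_t s x r + cheb_coeff p (Suc r) * s ^ (Suc p - r) * cheb_t s x r =
      ((if r = 0 then 0 else (if r = 1 then 2 else 1) * cheb_coeff p (r - 1)) + cheb_coeff p (Suc r)) * s ^ (Suc p - r) * cheb_t s x r"
      by (simp only: distrib_right)
  qed
  finally show ?case .
qed simp

section \<open>Spectra of Hermitian matrices\<close>

definition mat_trace :: "complex mat \<Rightarrow> complex" where
  "mat_trace A = (\<Sum>i<dim_row A. A $$ (i, i))"

lemma mat_trace_eq: "A \<in> carrier_mat n n \<Longrightarrow> mat_trace A = (\<Sum>i<n. A $$ (i, i))"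
  by (simp add: mat_trace_def)

lemma mat_mult_index:
  "A \<in> carrier_mat n n \<Longrightarrow> B \<in> carrier_mat n n \<Longrightarrow> i < n \<Longrightarrow> j < n \<Longrightarrow>
    (A * B) $$ (i, j) = (\<Sum>l<n. A $$ (i, l) * B $$ (l, j))" for A B :: "complex mat"
  by (simp add: scalar_prod_def atLeast0LessThan)

lemma mat_trace_mult:
  assumes "A \<in> carrier_mat n n" "B \<in> carrier_mat n n"
  shows "mat_trace (A * B) = mat_trace (B * A)"
proof -
  have "mat_trace (A * B) = (\<Sum>i<n. \<Sum>l<n. A $$ (i, l) * B $$ (l, i))"
    unfolding mat_trace_def using assms
    by (intro sum.cong) (auto simp: mat_mult_index[OF assms] simp del: index_mult_mat(1))
  also have "\<dots> = (\<Sum>l<n. \<Sum>i<n. B $$ (l, i) * A $$ (i, l))"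
    by (subst sum.swap) (simp add: mult.commute)
  also have "\<dots> = mat_trace (B * A)"
    unfolding mat_trace_def using assms
    by (intro sum.cong) (auto simp: mat_mult_index[OF assms(2,1)] simp del: index_mult_mat(1))
  finally show ?thesis .
qed

text \<open>The recursion of \<open>cheb_matrix\<close> on matrices with a carrier, where similarity
  and triangular form are available.\<close>

fun cheb_mat :: "nat \<Rightarrow> complex mat \<Rightarrow> nat \<Rightarrow> complex mat" where
  "cheb_mat n A 0 = 1\<^sub>m n"
| "cheb_mat n A (Suc 0) = A"
| "cheb_mat n A (Suc (Suc r)) = A * cheb_mat n A (Suc r) - of_nat n \<cdot>\<^sub>m cheb_mat n A r"

lemma cheb_mat_carrier [simp]: "A \<in> carrier_mat n n \<Longrightarrow> cheb_mat n A r \<in> carrier_mat n n"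
  by (induction n A r rule: cheb_mat.induct) auto

lemma cheb_mat_index:
  assumes A: "A \<in> carrier_mat n n" and X: "\<And>i j. i < n \<Longrightarrow> j < n \<Longrightarrow> A $$ (i, j) = X i j"
  shows "i < n \<Longrightarrow> j < n \<Longrightarrow> cheb_mat n A r $$ (i, j) = cheb_matrix X n r i j"
proof (induction r arbitrary: i j rule: less_induct)
  case (less r)
  consider "r = 0" | "r = 1" | q where "r = Suc (Suc q)" by (metis One_nat_def not0_implies_Suc)
  then show ?case
  proof cases
    case 3
    have c: "cheb_mat n A (Suc q) \<in> carrier_mat n n" "cheb_mat n A q \<in> carrier_mat n n" using A by simp_all
    have "cheb_mat n A r $$ (i, j) = (A * cheb_mat n A (Suc q)) $$ (i, j) - of_nat n * cheb_mat n A q $$ (i, j)"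
    proof -
      have "dim_row (cheb_mat n A q) = n" "dim_col (cheb_mat n A q) = n" using carrier_matD[OF c(2)] by blast+
      then show ?thesis unfolding 3 cheb_mat.simps using less.prems by (simp del: index_mult_mat(1))
    qed
    also have "(A * cheb_mat n A (Suc q)) $$ (i, j) = (\<Sum>l<n. A $$ (i, l) * cheb_mat n A (Suc q) $$ (l, j))"
      by (rule mat_mult_index[OF A c(1) less.prems])
    also have "\<dots> = (\<Sum>l<n. X i l * cheb_matrix X n (Suc q) l j)"
    proof (intro sum.cong refl)
      fix l assume "l \<in> {..<n}"
      then show "A $$ (i, l) * cheb_mat n A (Suc q) $$ (l, j) = X i l * cheb_matrix X n (Suc q) l j"
        using less.IH[of "Suc q" l j] X[of i l] less.prems 3 by simp
    qed
    also have "cheb_mat n A q $$ (i, j) = cheb_matrix X n q i j"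
      using less.IH[of q i j] less.prems 3 by simp
    finally show ?thesis unfolding 3 cheb_matrix.simps .
  qed (use less.prems X in auto)
qed

lemma conjugate_step:
  fixes U V B P Q :: "complex mat"
  assumes B: "B \<in> carrier_mat n n" and P: "P \<in> carrier_mat n n" and Q: "Q \<in> carrier_mat n n"
    and U: "U \<in> carrier_mat n n" and V: "V \<in> carrier_mat n n" and QP: "Q * P = 1\<^sub>m n"
  shows "P * B * Q * (P * U * Q) - k \<cdot>\<^sub>m (P * V * Q) = P * (B * U - k \<cdot>\<^sub>m V) * Q"
proof -
  note m = mult_carrier_mat[of _ n n _ n]
  have "P * B * Q * (P * U * Q) = P * B * (Q * (P * (U * Q)))"
    unfolding assoc_mult_mat[OF P U Q] by (rule assoc_mult_mat[OF m[OF P B] Q m[OF P m[OF U Q]]])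
  also have "Q * (P * (U * Q)) = (Q * P) * (U * Q)" by (rule assoc_mult_mat[OF Q P m[OF U Q], symmetric])
  also have "\<dots> = U * Q" unfolding QP by (rule left_mult_one_mat[OF m[OF U Q]])
  also have "P * B * (U * Q) = P * (B * U) * Q"
    unfolding assoc_mult_mat[OF P B m[OF U Q]] assoc_mult_mat[OF B U Q, symmetric]
    by (rule assoc_mult_mat[OF P m[OF B U] Q, symmetric])
  finally have 1: "P * B * Q * (P * U * Q) = P * (B * U) * Q" .
  have kV: "k \<cdot>\<^sub>m V \<in> carrier_mat n n" using V by simp
  have "k \<cdot>\<^sub>m (P * V * Q) = P * (k \<cdot>\<^sub>m V) * Q"
    unfolding mult_smult_distrib[OF P V] by (rule mult_smult_assoc_mat[OF m[OF P V] Q, symmetric])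
  moreover have "P * (B * U) * Q - P * (k \<cdot>\<^sub>m V) * Q = (P * (B * U) - P * (k \<cdot>\<^sub>m V)) * Q"
    by (rule minus_mult_distrib_mat[OF m[OF P m[OF B U]] m[OF P kV] Q, symmetric])
  moreover have "P * (B * U) - P * (k \<cdot>\<^sub>m V) = P * (B * U - k \<cdot>\<^sub>m V)"
    by (rule mult_minus_distrib_mat[OF P m[OF B U] kV, symmetric])
  ultimately show ?thesis unfolding 1 by simp
qed

lemma cheb_mat_similar:
  assumes B: "B \<in> carrier_mat n n" and P: "P \<in> carrier_mat n n" and Q: "Q \<in> carrier_mat n n"
    and PQ: "P * Q = 1\<^sub>m n" and QP: "Q * P = 1\<^sub>m n"
  shows "cheb_mat n (P * B * Q) r = P * cheb_mat n B r * Q"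
proof (induction r rule: less_induct)
  case (less r)
  consider "r = 0" | "r = 1" | q where "r = Suc (Suc q)" by (metis One_nat_def not0_implies_Suc)
  then show ?case
  proof cases
    case 3
    have IH: "cheb_mat n (P * B * Q) (Suc q) = P * cheb_mat n B (Suc q) * Q"
      "cheb_mat n (P * B * Q) q = P * cheb_mat n B q * Q"
      using less.IH[of "Suc q"] less.IH[of q] 3 by simp_all
    show ?thesis unfolding 3 cheb_mat.simps IH
      by (rule conjugate_step[OF B P Q cheb_mat_carrier[OF B] cheb_mat_carrier[OF B] QP])
  qed (use B P Q PQ in auto)
qed

text \<open>For an upper triangular matrix the diagonal of a polynomial is the polynomial of the
  diagonal. With the similarity invariance of the trace this expresses Chebyshev traces by the
  eigenvalues with algebraic multiplicity, from the Schur form alone.\<close>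

lemma cheb_mat_triangular:
  assumes B: "B \<in> carrier_mat n n" "upper_triangular B"
  shows "(\<forall>i<n. \<forall>j<i. cheb_mat n B r $$ (i, j) = 0) \<and>
    (\<forall>i<n. cheb_mat n B r $$ (i, i) = cheb_u (of_nat n) (B $$ (i, i)) r)"
proof (induction r rule: less_induct)
  case (less r)
  have low: "B $$ (i, j) = 0" if "i < n" "j < i" for i j using B that by (auto dest: upper_triangularD)
  consider "r = 0" | "r = 1" | q where "r = Suc (Suc q)" by (metis One_nat_def not0_implies_Suc)
  then show ?case
  proof cases
    case 3
    let ?U = "cheb_mat n B (Suc q)" and ?V = "cheb_mat n B q"
    have u: "?U \<in> carrier_mat n n" "?V \<in> carrier_mat n n" using cheb_mat_carrier[OF B(1)] by blast+
    have U: "\<And>i j. i < n \<Longrightarrow> j < i \<Longrightarrow> ?U $$ (i, j) = 0" "\<And>i. i < n \<Longrightarrow> ?U $$ (i, i) = cheb_u (of_nat n) (B $$ (i, i)) (Suc q)"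
      using less.IH[of "Suc q"] 3 by simp_all
    have V: "\<And>i j. i < n \<Longrightarrow> j < i \<Longrightarrow> ?V $$ (i, j) = 0" "\<And>i. i < n \<Longrightarrow> ?V $$ (i, i) = cheb_u (of_nat n) (B $$ (i, i)) q"
      using less.IH[of q] 3 by simp_all
    have idx: "cheb_mat n B r $$ (i, j) = (\<Sum>l<n. B $$ (i, l) * ?U $$ (l, j)) - of_nat n * ?V $$ (i, j)" if "i < n" "j < n" for i j
    proof -
      have "dim_row ?V = n" "dim_col ?V = n" using carrier_matD[OF u(2)] by blast+
      then show ?thesis unfolding 3 cheb_mat.simps mat_mult_index[OF B(1) u(1) that, symmetric]
        using that by (simp del: index_mult_mat(1))
    qed
    have "(\<Sum>l<n. B $$ (i, l) * ?U $$ (l, j)) = 0" if "i < n" "j < i" for i j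
    proof (intro sum.neutral ballI)
      fix l assume "l \<in> {..<n}"
      then show "B $$ (i, l) * ?U $$ (l, j) = 0" using low[of i l] U(1)[of l j] that by (cases "l < i") auto
    qed
    moreover have "(\<Sum>l<n. B $$ (i, l) * ?U $$ (l, i)) = B $$ (i, i) * ?U $$ (i, i)" if "i < n" for i
    proof -
      have "(\<Sum>l<n. B $$ (i, l) * ?U $$ (l, i)) = (\<Sum>l<n. if l = i then B $$ (i, i) * ?U $$ (i, i) else 0)"
      proof (intro sum.cong refl)
        fix l assume "l \<in> {..<n}"
        then show "B $$ (i, l) * ?U $$ (l, i) = (if l = i then B $$ (i, i) * ?U $$ (i, i) else 0)"
          using low[of i l] U(1)[of l i] that by (cases l i rule: linorder_cases) auto
      qed
      then show ?thesis using that by simp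
    qed
    ultimately show ?thesis using idx U(2) V unfolding 3 by simp
  qed (use B low in auto)
qed

lemma order_linear_factors:
  "Polynomial.order l (\<Prod>a\<leftarrow>as. [:- a, 1:]) = count_list as l" for l :: complex
proof (induction as)
  case Nil
  then show ?case by simp
next
  case (Cons a as)
  have nz: "(\<Prod>a\<leftarrow>as. [:- a, 1:]) \<noteq> 0" for as :: "complex list" by (induction as) (auto simp del: mult_pCons_left)
  have "Polynomial.order l [:- a, 1:] = (if a = l then 1 else 0)"
  proof (cases "a = l")
    case True
    then show ?thesis using order_power_n_n[of l 1] by simp
  next
    case False
    then show ?thesis by (simp add: order_0I)
  qed
  moreover have "[:- a, 1:] * (\<Prod>a\<leftarrow>as. [:- a, 1:]) \<noteq> 0" using nz[of as] by (simp del: mult_pCons_left)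
  ultimately show ?case
    using Cons by (simp add: order_mult del: mult_pCons_left)
qed

lemma hermitian_eigenvalue_real:
  assumes A: "A \<in> carrier_mat n n" and H: "\<And>i j. i < n \<Longrightarrow> j < n \<Longrightarrow> A $$ (j, i) = cnj (A $$ (i, j))"
    and ev: "eigenvalue A k"
  shows "k \<in> \<real>"
proof -
  obtain v where v: "v \<in> carrier_vec n" "v \<noteq> 0\<^sub>v n" "A *\<^sub>v v = k \<cdot>\<^sub>v v"
    using ev A unfolding eigenvalue_def eigenvector_def by auto
  have Av: "(\<Sum>j<n. A $$ (i, j) * v $ j) = k * v $ i" if i: "i < n" for i
  proof -
    have "(A *\<^sub>v v) $ i = (\<Sum>j<n. A $$ (i, j) * v $ j)"
      using A v(1) i by (simp add: scalar_prod_def atLeast0LessThan)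
    then show ?thesis using v i by simp
  qed
  define q where "q = (\<Sum>i<n. \<Sum>j<n. cnj (v $ i) * A $$ (i, j) * v $ j)"
  define s where "s = (\<Sum>i<n. (cmod (v $ i))\<^sup>2)"
  have "q = (\<Sum>i<n. cnj (v $ i) * (k * v $ i))"
    unfolding q_def by (intro sum.cong refl) (simp add: Av[symmetric] sum_distrib_left mult.assoc)
  also have "\<dots> = k * complex_of_real s"
    unfolding s_def by (simp add: sum_distrib_left complex_norm_square mult_ac del: of_real_power)
  finally have q: "q = k * complex_of_real s" .
  have "cnj q = (\<Sum>i<n. \<Sum>j<n. v $ i * A $$ (j, i) * cnj (v $ j))"
    unfolding q_def cnj_sum by (intro sum.cong refl) (simp add: H[symmetric])
  also have "\<dots> = q" unfolding q_def by (subst sum.swap) (simp add: mult_ac)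
  finally have "cnj k * complex_of_real s = k * complex_of_real s" using q by simp
  moreover have "s \<noteq> 0"
  proof
    assume "s = 0"
    then have "v $ i = 0" if "i < n" for i
      using sum_nonneg_eq_0_iff[of "{..<n}" "\<lambda>i. (cmod (v $ i))\<^sup>2"] that by (simp add: s_def)
    then show False using v(1,2) by (auto intro!: eq_vecI)
  qed
  ultimately show ?thesis by (simp add: Reals_cnj_iff)
qed

text \<open>One list of real eigenvalues has to serve both for counting and for traces; this is what
  links the height function to sums over words.\<close>

lemma hermitian_spectrum:
  assumes A: "A \<in> carrier_mat n n" and H: "\<And>i j. i < n \<Longrightarrow> j < n \<Longrightarrow> A $$ (j, i) = cnj (A $$ (i, j))"
    and X: "\<And>i j. i < n \<Longrightarrow> j < n \<Longrightarrow> A $$ (i, j) = X i j"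
  shows "\<exists>es :: real list. length es = n \<and> (\<forall>x. count_eigenvalues_ge A x = length (filter (\<lambda>a. x \<le> a) es)) \<and>
    (\<forall>r\<ge>1. (\<Sum>w\<in>words n r. cycle_weight X w) = complex_of_real (\<Sum>a\<leftarrow>es. cheb_t (sqrt (real n)) a r))"
proof -
  obtain as where as: "char_poly A = (\<Prod>a\<leftarrow>as. [:- a, 1:])" "length as = n"
    using char_poly_factorized[OF A] by auto
  have ev_iff: "eigenvalue A k \<longleftrightarrow> k \<in> set as" for k
  proof -
    have "eigenvalue A k \<longleftrightarrow> poly (\<Prod>a\<leftarrow>as. [:- a, 1:]) k = 0"
      unfolding eigenvalue_root_char_poly[OF A] as(1) ..
    also have "\<dots> \<longleftrightarrow> k \<in> set as" by (auto simp: poly_prod_list prod_list_zero_iff)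
    finally show ?thesis .
  qed
  have real: "a \<in> \<real>" if "a \<in> set as" for a
    by (rule hermitian_eigenvalue_real[OF A H]) (use that ev_iff in auto)
  define es where "es = map Re as"
  have as_es: "as = map complex_of_real es"
    unfolding es_def map_map by (rule sym, rule map_idI) (use real in \<open>auto simp: of_real_Re\<close>)
  have len: "length es = n" using as(2) by (simp add: es_def)
  have count: "count_eigenvalues_ge A x = length (filter (\<lambda>a. x \<le> a) es)" for x
  proof -
    have "{l. x \<le> l \<and> eigenvalue A (complex_of_real l)} = set (filter (\<lambda>a. x \<le> a) es)"
      unfolding ev_iff as_es by auto
    moreover have "Polynomial.order (complex_of_real l) (char_poly A) = count_list es l" for l
      unfolding as(1) order_linear_factors as_es
      by (induction es) auto
    ultimately have "count_eigenvalues_ge A x = (\<Sum>l\<in>set (filter (\<lambda>a. x \<le> a) es). count_list es l)"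
      unfolding count_eigenvalues_ge_def by (simp only:)
    also have "\<dots> = (\<Sum>l\<in>set (filter (\<lambda>a. x \<le> a) es). count_list (filter (\<lambda>a. x \<le> a) es) l)"
    proof (intro sum.cong refl)
      fix l assume "l \<in> set (filter (\<lambda>a. x \<le> a) es)"
      then have "x \<le> l" by simp
      then show "count_list es l = count_list (filter (\<lambda>a. x \<le> a) es) l" by (induction es) auto
    qed
    also have "\<dots> = length (filter (\<lambda>a. x \<le> a) es)" by (rule sum_count_set) auto
    finally show ?thesis .
  qed
  obtain B P Q where schur: "schur_decomposition A as = (B, P, Q)" by (cases "schur_decomposition A as") auto
  have sd: "similar_mat_wit A B P Q" "upper_triangular B" "diag_mat B = as"
    using schur_decomposition[OF A as(1) schur] by blast+
  have dimA: "n = dim_row A" using A by simp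
  note w = similar_mat_witD[OF dimA sd(1)]
  have tr: "(\<Sum>i<n. cheb_matrix X n r i i) = (\<Sum>a\<leftarrow>as. cheb_u (of_nat n) a r)" for r
  proof -
    note m = mult_carrier_mat[of _ n n _ n]
    have cB: "cheb_mat n B r \<in> carrier_mat n n" by (rule cheb_mat_carrier[OF w(5)])
    have sim: "cheb_mat n A r = P * (cheb_mat n B r * Q)"
      unfolding w(3) cheb_mat_similar[OF w(5,6,7,1,2)] by (rule assoc_mult_mat[OF w(6) cB w(7)])
    have "(\<Sum>i<n. cheb_matrix X n r i i) = mat_trace (cheb_mat n A r)"
      unfolding mat_trace_eq[OF cheb_mat_carrier[OF A]]
      by (intro sum.cong refl) (simp add: cheb_mat_index[OF A X])
    also have "\<dots> = mat_trace (cheb_mat n B r * Q * P)"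
      unfolding sim by (rule mat_trace_mult[OF w(6) m[OF cB w(7)]])
    also have "cheb_mat n B r * Q * P = cheb_mat n B r"
      unfolding assoc_mult_mat[OF cB w(7,6)] w(2) by (rule right_mult_one_mat[OF cB])
    also have "mat_trace (cheb_mat n B r) = (\<Sum>i<n. cheb_u (of_nat n) (B $$ (i, i)) r)"
      unfolding mat_trace_eq[OF cB] using cheb_mat_triangular[OF w(5) sd(2), of r] by (intro sum.cong) auto
    also have "\<dots> = (\<Sum>a\<leftarrow>diag_mat B. cheb_u (of_nat n) a r)"
    proof -
      have "dim_row B = n" using w(5) by blast
      then show ?thesis
        unfolding diag_mat_def by (simp add: interv_sum_list_conv_sum_set_nat atLeast0LessThan o_def)
    qed
    finally show ?thesis unfolding sd(3) .
  qed
  have "(\<Sum>w\<in>words n r. cycle_weight X w) = complex_of_real (\<Sum>a\<leftarrow>es. cheb_t (sqrt (real n)) a r)" if r: "1 \<le> r" for r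
  proof -
    obtain q where q: "r = Suc q" using r by (cases r) auto
    have s: "complex_of_real ((sqrt (real n))\<^sup>2) = of_nat n" by simp
    have "(\<Sum>w\<in>words n r. cycle_weight X w) = (\<Sum>a\<leftarrow>as. cheb_u (of_nat n) a r) -
        (if 2 \<le> r then of_nat n * (\<Sum>a\<leftarrow>as. cheb_u (of_nat n) a (r - 2)) else 0)"
      unfolding sum_cycle_weight[OF r] tr ..
    also have "\<dots> = (\<Sum>a\<leftarrow>as. cheb_u (of_nat n) a r - (if 1 \<le> q then of_nat n * cheb_u (of_nat n) a (q - 1) else 0))"
      unfolding q by (induction as) (auto simp: algebra_simps numeral_2_eq_2)
    also have "\<dots> = (\<Sum>a\<leftarrow>es. complex_of_real (cheb_t (sqrt (real n)) a r))"
      unfolding as_es map_map o_def q cheb_t_eq_u s ..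
    also have "\<dots> = complex_of_real (\<Sum>a\<leftarrow>es. cheb_t (sqrt (real n)) a r)"
      by (induction es) auto
    finally show ?thesis .
  qed
  then show ?thesis using len count by (intro exI[of _ es]) blast
qed

section \<open>Height moments as traces\<close>

lemma sum_list_sum_swap: "(\<Sum>a\<leftarrow>es. \<Sum>r\<in>A. f a r) = (\<Sum>r\<in>A. \<Sum>a\<leftarrow>es. f a r)" for f :: "'a \<Rightarrow> 'b \<Rightarrow> real"
  by (induction es) (simp_all add: sum.distrib)

text \<open>Polynomials are chosen because their sums over the eigenvalues are power sums and hence
  measurable, whereas the eigenvalues are selected pointwise. Pointwise convergence to the closed
  step then gives measurability of the counting function.\<close>

lemma step_function_approx:
  obtains P :: "nat \<Rightarrow> real \<Rightarrow> real" where "\<And>m. real_polynomial_function (P m)"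
    "\<And>u. (\<lambda>m. P m u) \<longlonglongrightarrow> indicator {0..} u"
proof -
  \<comment> \<open>For \<open>m > 0\<close> a ramp rising from 0 to 1 on \<open>[-1/m, 0]\<close>:
    it is 1 from 0 on and vanishes at each fixed negative point for large \<open>m\<close>, so the
    limit is the step that includes 0.\<close>
  define \<phi> where "\<phi> m u = max 0 (min 1 (1 + real m * u))" for m and u :: real
  have "\<exists>g. real_polynomial_function g \<and> (\<forall>u\<in>{- real m..real m}. \<bar>\<phi> m u - g u\<bar> < inverse (real (Suc m)))" for m
  proof -
    have "continuous_on {- real m..real m} (\<phi> m)" unfolding \<phi>_def[abs_def] by (intro continuous_intros)
    from Stone_Weierstrass_real_polynomial_function[OF compact_Icc this, of "inverse (real (Suc m))"]
    show ?thesis by (metis inverse_positive_iff_positive of_nat_0_less_iff zero_less_Suc)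
  qed
  then obtain P where P: "\<And>m. real_polynomial_function (P m)"
    "\<And>m u. u \<in> {- real m..real m} \<Longrightarrow> \<bar>\<phi> m u - P m u\<bar> < inverse (real (Suc m))" by metis
  have "(\<lambda>m. P m u) \<longlonglongrightarrow> indicator {0..} u" for u
  proof -
    have "(\<lambda>m. \<phi> m u) \<longlonglongrightarrow> indicator {0..} u"
    proof (rule tendsto_eventually)
      obtain m0 :: nat where m0: "1 / \<bar>u\<bar> \<le> real m0" using real_arch_simple by blast
      have "\<phi> m u = indicator {0..} u" if "m0 \<le> m" for m
      proof (cases "0 \<le> u")
        case False
        have "1 / \<bar>u\<bar> \<le> real m" using m0 that by linarith
        then have "1 / \<bar>u\<bar> * \<bar>u\<bar> \<le> real m * \<bar>u\<bar>" by (rule mult_right_mono) simp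
        then have "1 + real m * u \<le> 0" using False by simp
        then show ?thesis using False by (simp add: \<phi>_def)
      qed (simp add: \<phi>_def)
      then show "\<forall>\<^sub>F m in sequentially. \<phi> m u = indicator {0..} u" using eventually_sequentially by blast
    qed
    moreover have "(\<lambda>m. \<phi> m u - P m u) \<longlonglongrightarrow> 0"
    proof (rule Lim_null_comparison[OF _ LIMSEQ_inverse_real_of_nat])
      obtain m0 :: nat where m0: "\<bar>u\<bar> \<le> real m0" using real_arch_simple by blast
      have "norm (\<phi> m u - P m u) \<le> inverse (real (Suc m))" if "m0 \<le> m" for m
      proof -
        have "\<bar>u\<bar> \<le> real m" using m0 that by linarith
        then show ?thesis using P(2)[of u m] by (simp add: abs_le_iff less_imp_le)
      qed
      then show "\<forall>\<^sub>F m in sequentially. norm (\<phi> m u - P m u) \<le> inverse (real (Suc m))" using eventually_sequentially by blast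
    qed
    ultimately have "(\<lambda>m. \<phi> m u - (\<phi> m u - P m u)) \<longlonglongrightarrow> indicator {0..} u - 0" by (rule tendsto_diff)
    then show ?thesis by simp
  qed
  then show thesis using that P(1) by blast
qed

lemma has_bochner_integral_power:
  assumes "a \<le> b"
  shows "has_bochner_integral lborel (\<lambda>x. x ^ k * indicator {a..b} x) ((b ^ Suc k - a ^ Suc k) / real (Suc k))"
proof -
  have "set_integrable lborel {a..b} (\<lambda>x. x ^ k)" by (intro borel_integrable_atLeastAtMost' continuous_intros)
  then show ?thesis
    using integral_power[OF assms, of k] by (simp add: has_bochner_integral_iff set_integrable_def mult.commute)
qed

text \<open>Subtracting the fixed step at 0 makes the integrand vanish outside a bounded interval.
  The value has the same form for both signs of \<open>b\<close> because the difference of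
  indicators is negative for negative \<open>b\<close>.\<close>

lemma has_bochner_integral_power_step:
  "has_bochner_integral lborel (\<lambda>x. x ^ k * (indicator {..b} x - indicator {..0} x)) (b ^ Suc k / real (Suc k))" for b :: real
proof (cases "0 \<le> b")
  case True
  have "has_bochner_integral lborel (\<lambda>x. x ^ k * indicator {0..b} x) (b ^ Suc k / real (Suc k))"
    using has_bochner_integral_power[OF True, of k] by simp
  moreover have "AE x in lborel. x ^ k * indicator {0..b} x = x ^ k * (indicator {..b} x - indicator {..0} x)"
    using AE_lborel_singleton[of 0] by eventually_elim (use True in \<open>auto simp: indicator_def\<close>)
  ultimately show ?thesis by (subst (asm) has_bochner_integral_cong_AE) auto
next
  case False
  then have b: "b \<le> 0" by simp
  have "has_bochner_integral lborel (\<lambda>x. - (x ^ k * indicator {b..0} x)) (b ^ Suc k / real (Suc k))"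
    using has_bochner_integral_minus[OF has_bochner_integral_power[OF b, of k]] by simp
  moreover have "AE x in lborel. - (x ^ k * indicator {b..0} x) = x ^ k * (indicator {..b} x - indicator {..0} x)"
    using AE_lborel_singleton[of b] by eventually_elim (use False in \<open>auto simp: indicator_def\<close>)
  ultimately show ?thesis by (subst (asm) has_bochner_integral_cong_AE) auto
qed

lemma integral_abs_power_step_le:
  "(LINT x|lborel. \<bar>x ^ k * (indicator {..b} x - indicator {..0} x)\<bar>) \<le> 2 * \<bar>b\<bar> ^ Suc k" for b :: real
proof -
  have "(LINT x|lborel. \<bar>x ^ k * (indicator {..b} x - indicator {..0} x)\<bar>) \<le> (LINT x|lborel. \<bar>b\<bar> ^ k * indicator {-\<bar>b\<bar>..\<bar>b\<bar>} x)"
  proof (rule integral_mono)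
    show "integrable lborel (\<lambda>x. \<bar>x ^ k * (indicator {..b} x - indicator {..0} x)\<bar>)"
      using has_bochner_integral_power_step[of k b] unfolding has_bochner_integral_iff by (intro integrable_abs) blast
    show "\<bar>x ^ k * (indicator {..b} x - indicator {..0} x)\<bar> \<le> \<bar>b\<bar> ^ k * indicator {-\<bar>b\<bar>..\<bar>b\<bar>} x" for x
      using power_mono[of "\<bar>x\<bar>" "\<bar>b\<bar>" k] by (auto simp: indicator_def abs_mult power_abs)
  qed simp
  also have "\<dots> = 2 * \<bar>b\<bar> ^ Suc k" by simp
  finally show ?thesis .
qed

text \<open>The first claim turns counting into power sums. The second bounds the integral of the
  absolute value by a polynomial in the eigenvalues, via \<open>|t| <= 1 + t^2\<close>, whose
  expectation is finite; this is the integrability that Fubini's theorem asks for.\<close>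

lemma count_list_step:
  fixes es :: "real list"
  assumes s: "0 < s"
  shows "has_bochner_integral lborel (\<lambda>x. x ^ k * (real (length (filter (\<lambda>a. s * x \<le> a) es)) - real (length es) * indicator {..0} x))
      ((\<Sum>a\<leftarrow>es. a ^ Suc k) / (s ^ Suc k * real (Suc k)))" (is "has_bochner_integral _ (?h es) _")
    and "(LINT x|lborel. \<bar>x ^ k * (real (length (filter (\<lambda>a. s * x \<le> a) es)) - real (length es) * indicator {..0} x)\<bar>)
      \<le> (\<Sum>a\<leftarrow>es. 2 / s ^ Suc k * (1 + a ^ (2 * Suc k)))"
proof -
  let ?g = "\<lambda>a x. x ^ k * (indicator {..a / s} x - indicator {..0} x)"
  have step: "?h (a # es) = (\<lambda>x. ?g a x + ?h es x)" for a es
  proof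
    fix x show "?h (a # es) x = ?g a x + ?h es x"
      using s by (simp add: indicator_def field_simps)
  qed
  have 1: "has_bochner_integral lborel (?h es) ((\<Sum>a\<leftarrow>es. a ^ Suc k) / (s ^ Suc k * real (Suc k)))" for es
  proof (induction es)
    case (Cons a es)
    have "has_bochner_integral lborel (?h (a # es)) ((a / s) ^ Suc k / real (Suc k) + (\<Sum>a\<leftarrow>es. a ^ Suc k) / (s ^ Suc k * real (Suc k)))"
      unfolding step by (intro has_bochner_integral_add has_bochner_integral_power_step Cons)
    moreover have "(a / s) ^ Suc k / real (Suc k) + (\<Sum>a\<leftarrow>es. a ^ Suc k) / (s ^ Suc k * real (Suc k)) =
        (\<Sum>a\<leftarrow>a # es. a ^ Suc k) / (s ^ Suc k * real (Suc k))"
      by (simp add: power_divide add_divide_distrib del: power_Suc of_nat_Suc)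
    ultimately show ?case by (simp only:)
  qed (simp add: has_bochner_integral_zero)
  then show "has_bochner_integral lborel (?h es) ((\<Sum>a\<leftarrow>es. a ^ Suc k) / (s ^ Suc k * real (Suc k)))" .
  have int: "integrable lborel (?h es)" for es
    using 1[of es] by (simp add: has_bochner_integral_iff)
  have intg: "integrable lborel (?g a)" for a
    using has_bochner_integral_power_step[of k "a / s"] by (simp add: has_bochner_integral_iff)
  show "(LINT x|lborel. \<bar>?h es x\<bar>) \<le> (\<Sum>a\<leftarrow>es. 2 / s ^ Suc k * (1 + a ^ (2 * Suc k)))"
  proof (induction es)
    case (Cons a es)
    have "(LINT x|lborel. \<bar>?h (a # es) x\<bar>) \<le> (LINT x|lborel. \<bar>?g a x\<bar> + \<bar>?h es x\<bar>)"
    proof (rule integral_mono)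
      show "integrable lborel (\<lambda>x. \<bar>?h (a # es) x\<bar>)" by (rule integrable_abs[OF int])
      show "integrable lborel (\<lambda>x. \<bar>?g a x\<bar> + \<bar>?h es x\<bar>)"
        by (rule Bochner_Integration.integrable_add[OF integrable_abs[OF intg] integrable_abs[OF int]])
      show "\<bar>?h (a # es) x\<bar> \<le> \<bar>?g a x\<bar> + \<bar>?h es x\<bar>" for x
        unfolding fun_cong[OF step, of x] by (rule abs_triangle_ineq)
    qed
    also have "\<dots> = (LINT x|lborel. \<bar>?g a x\<bar>) + (LINT x|lborel. \<bar>?h es x\<bar>)"
      by (rule Bochner_Integration.integral_add[OF integrable_abs[OF intg] integrable_abs[OF int]])
    also have "(LINT x|lborel. \<bar>?g a x\<bar>) \<le> 2 / s ^ Suc k * (1 + a ^ (2 * Suc k))"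
    proof -
      have "(LINT x|lborel. \<bar>?g a x\<bar>) \<le> 2 * \<bar>a / s\<bar> ^ Suc k" by (rule integral_abs_power_step_le)
      also have "\<dots> = 2 / s ^ Suc k * \<bar>a ^ Suc k\<bar>" using s by (simp add: power_divide abs_divide power_abs abs_mult)
      also have "\<dots> \<le> 2 / s ^ Suc k * (1 + a ^ (2 * Suc k))"
      proof (rule mult_left_mono)
        have "a ^ (2 * Suc k) = \<bar>a ^ Suc k\<bar>\<^sup>2" by (simp only: power2_abs power_mult[symmetric] mult.commute)
        moreover have "\<bar>a ^ Suc k\<bar> \<le> 1 + \<bar>a ^ Suc k\<bar>\<^sup>2"
        proof -
          have "t \<le> 1 + t\<^sup>2" for t :: real using zero_le_power2[of "t - 1 / 2"] by (simp add: power2_eq_square algebra_simps)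
          then show ?thesis .
        qed
        ultimately show "\<bar>a ^ Suc k\<bar> \<le> 1 + a ^ (2 * Suc k)" by (simp only:)
      qed (use s in simp)
      finally show ?thesis .
    qed
    finally have "(LINT x|lborel. \<bar>?h (a # es) x\<bar>) \<le> 2 / s ^ Suc k * (1 + a ^ (2 * Suc k)) + (LINT x|lborel. \<bar>?h es x\<bar>)"
      by simp
    then show ?case using Cons unfolding list.map sum_list.Cons by linarith
  qed simp
qed

context time_dependent_wigner begin

definition spectrum_of :: "nat \<Rightarrow> real \<Rightarrow> 'a \<Rightarrow> real list \<Rightarrow> bool" where
  "spectrum_of n t \<omega> es \<longleftrightarrow> length es = n \<and>
    (\<forall>x. count_eigenvalues_ge (wigner_corner Z Y n t \<omega>) x = length (filter (\<lambda>a. x \<le> a) es)) \<and>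
    (\<forall>r\<ge>1. (\<Sum>w\<in>words n r. cyc t w \<omega>) = complex_of_real (\<Sum>a\<leftarrow>es. cheb_t (sqrt (real n)) a r))"

text \<open>An arbitrary pointwise choice. Only symmetric functions of the list, power sums and
  counts, are used as random variables.\<close>

definition eigs :: "nat \<Rightarrow> real \<Rightarrow> 'a \<Rightarrow> real list" where
  "eigs n t \<omega> = (SOME es. spectrum_of n t \<omega> es)"

lemma spectrum_of_eigs: "spectrum_of n t \<omega> (eigs n t \<omega>)"
proof -
  have "\<exists>es. spectrum_of n t \<omega> es"
    unfolding spectrum_of_def cyc_def
  proof (rule hermitian_spectrum)
    show A: "wigner_corner Z Y n t \<omega> \<in> carrier_mat n n" by (simp add: wigner_corner_def)
    show X: "wigner_corner Z Y n t \<omega> $$ (i, j) = entry t i j \<omega>" if "i < n" "j < n" for i j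
      using that by (simp add: wigner_corner_def entry_def)
    show "wigner_corner Z Y n t \<omega> $$ (j, i) = cnj (wigner_corner Z Y n t \<omega> $$ (i, j))" if "i < n" "j < n" for i j
      unfolding X[OF that] X[OF that(2,1)] by (rule entry_cnj)
  qed
  then show ?thesis unfolding eigs_def by (rule someI_ex)
qed

lemma length_eigs: "length (eigs n t \<omega>) = n"
  and count_eigs: "count_eigenvalues_ge (wigner_corner Z Y n t \<omega>) x = length (filter (\<lambda>a. x \<le> a) (eigs n t \<omega>))"
  and cheb_eigs: "1 \<le> r \<Longrightarrow> complex_of_real (\<Sum>a\<leftarrow>eigs n t \<omega>. cheb_t (sqrt (real n)) a r) = (\<Sum>w\<in>words n r. cyc t w \<omega>)"
  using spectrum_of_eigs[of n t \<omega>] unfolding spectrum_of_def by (blast, blast, simp)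

definition power_sum :: "nat \<Rightarrow> real \<Rightarrow> nat \<Rightarrow> 'a \<Rightarrow> real" where
  "power_sum n t p \<omega> = (\<Sum>a\<leftarrow>eigs n t \<omega>. a ^ p)"

text \<open>The right-hand side is a polynomial in the matrix entries, which gives measurability and
  integrability of \<open>power_sum\<close>. The term of degree 0 is deterministic because there are
  always \<open>n\<close> eigenvalues.\<close>

lemma power_sum_eq:
  "complex_of_real (power_sum n t p \<omega>) = of_real (cheb_coeff p 0 * sqrt (real n) ^ p * (2 * real n)) +
    (\<Sum>r\<in>{1..p}. of_real (cheb_coeff p r * sqrt (real n) ^ (p - r)) * (\<Sum>w\<in>words n r. cyc t w \<omega>))"
proof -
  let ?T = "\<lambda>r. \<Sum>a\<leftarrow>eigs n t \<omega>. cheb_t (sqrt (real n)) a r"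
  have "power_sum n t p \<omega> = (\<Sum>a\<leftarrow>eigs n t \<omega>. \<Sum>r\<le>p. cheb_coeff p r * sqrt (real n) ^ (p - r) * cheb_t (sqrt (real n)) a r)"
    unfolding power_sum_def power_eq_sum_cheb_t[where s = "sqrt (real n)", symmetric] ..
  also have "\<dots> = (\<Sum>r\<le>p. cheb_coeff p r * sqrt (real n) ^ (p - r) * ?T r)"
    unfolding sum_list_sum_swap by (simp add: sum_list_const_mult)
  also have "{..p} = insert 0 {1..p}" by auto
  also have "(\<Sum>r\<in>insert 0 {1..p}. cheb_coeff p r * sqrt (real n) ^ (p - r) * ?T r) =
      cheb_coeff p 0 * sqrt (real n) ^ p * ?T 0 + (\<Sum>r\<in>{1..p}. cheb_coeff p r * sqrt (real n) ^ (p - r) * ?T r)"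
    by (subst sum.insert) simp_all
  also have "?T 0 = 2 * real n" by (simp add: sum_list_triv length_eigs)
  finally have "complex_of_real (power_sum n t p \<omega>) = of_real (cheb_coeff p 0 * sqrt (real n) ^ p * (2 * real n)) +
      (\<Sum>r\<in>{1..p}. of_real (cheb_coeff p r * sqrt (real n) ^ (p - r)) * of_real (?T r))"
    by (simp only: of_real_add of_real_sum of_real_mult)
  also have "(\<Sum>r\<in>{1..p}. of_real (cheb_coeff p r * sqrt (real n) ^ (p - r)) * complex_of_real (?T r)) =
      (\<Sum>r\<in>{1..p}. of_real (cheb_coeff p r * sqrt (real n) ^ (p - r)) * (\<Sum>w\<in>words n r. cyc t w \<omega>))"
    by (intro sum.cong refl arg_cong2[where f = "(*)"] cheb_eigs) simp
  finally show ?thesis .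
qed

lemma Lp_add: "Lp F \<Longrightarrow> Lp G \<Longrightarrow> Lp (\<lambda>\<omega>. F \<omega> + G \<omega>)"
  using Lp_diff[of F "\<lambda>\<omega>. 0 - G \<omega>"] Lp_diff[OF Lp_const[of 0], of G] by simp

lemma Lp_power_sum: "Lp (\<lambda>\<omega>. complex_of_real (power_sum n t p \<omega>))"
  unfolding power_sum_eq by (intro Lp_add Lp_mult Lp_const Lp_sum Lp_cyc finite_words finite_atLeastAtMost)

lemma integrable_power_sum: "integrable M (power_sum n t p)"
  using integrable_Re[OF Lp_integrable[OF Lp_power_sum[of n t p]]] by simp

lemma power_sum_measurable [measurable]: "power_sum n t p \<in> borel_measurable M"
  by (rule borel_measurable_integrable[OF integrable_power_sum])

lemma power_sum_centered:
  "complex_of_real (power_sum n t p \<omega> - (LINT \<omega>|M. power_sum n t p \<omega>)) =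
    (\<Sum>r\<in>{1..p}. of_real (cheb_coeff p r * sqrt (real n) ^ (p - r)) * (\<Sum>w\<in>words n r. ccyc t w \<omega>))"
proof -
  have "complex_of_real (LINT \<omega>|M. power_sum n t p \<omega>) = (LINT \<omega>|M. complex_of_real (power_sum n t p \<omega>))"
    by (rule integral_complex_of_real[symmetric])
  also have "\<dots> = of_real (cheb_coeff p 0 * sqrt (real n) ^ p * (2 * real n)) +
    (\<Sum>r\<in>{1..p}. of_real (cheb_coeff p r * sqrt (real n) ^ (p - r)) * (\<Sum>w\<in>words n r. LINT \<omega>|M. cyc t w \<omega>))"
    unfolding power_sum_eq
    by (subst Bochner_Integration.integral_add)
      (auto simp: prob_space Bochner_Integration.integral_sum Lp_integrable Lp_cyc Lp_sum intro!: Bochner_Integration.integrable_sum simp del: of_real_mult)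
  finally have e: "complex_of_real (LINT \<omega>|M. power_sum n t p \<omega>) = of_real (cheb_coeff p 0 * sqrt (real n) ^ p * (2 * real n)) +
    (\<Sum>r\<in>{1..p}. of_real (cheb_coeff p r * sqrt (real n) ^ (p - r)) * (\<Sum>w\<in>words n r. LINT \<omega>|M. cyc t w \<omega>))" .
  show ?thesis
    unfolding of_real_diff e power_sum_eq ccyc_def sum_subtractf right_diff_distrib by simp
qed

definition count_ge :: "nat \<Rightarrow> real \<Rightarrow> 'a \<Rightarrow> real \<Rightarrow> real" where
  "count_ge n t \<omega> x = real (length (filter (\<lambda>a. x \<le> a) (eigs n t \<omega>)))"

lemma count_ge_bounds: "0 \<le> count_ge n t \<omega> x" "count_ge n t \<omega> x \<le> real n"
  using length_filter_le[of "\<lambda>a. x \<le> a" "eigs n t \<omega>"] by (simp_all add: count_ge_def length_eigs)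

text \<open>Joint measurability in \<open>\<omega>\<close> and \<open>x\<close> is needed to
  exchange integrals. The binomial expansion of a polynomial in \<open>a - x\<close> separates
  \<open>x\<close> from the power sums of the eigenvalues.\<close>

lemma count_ge_measurable: "(\<lambda>(\<omega>, x). count_ge n t \<omega> x) \<in> borel_measurable (M \<Otimes>\<^sub>M borel)"
proof -
  obtain P :: "nat \<Rightarrow> real \<Rightarrow> real" where P: "\<And>m. real_polynomial_function (P m)"
    "\<And>u. (\<lambda>m. P m u) \<longlonglongrightarrow> indicator {0..} u" by (rule step_function_approx) blast
  define S where "S m = (\<lambda>(\<omega>, x). \<Sum>a\<leftarrow>eigs n t \<omega>. P m (a - x))" for m
  have lim: "(\<lambda>m. S m z) \<longlonglongrightarrow> (case z of (\<omega>, x) \<Rightarrow> count_ge n t \<omega> x)" for z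
  proof -
    obtain \<omega> x where z: "z = (\<omega>, x)" by (cases z)
    have "(\<lambda>m. \<Sum>a\<leftarrow>es. P m (a - x)) \<longlonglongrightarrow> real (length (filter (\<lambda>a. x \<le> a) es))" for es
    proof (induction es)
      case (Cons a es)
      show ?case using tendsto_add[OF P(2)[of "a - x"] Cons] by (cases "x \<le> a") simp_all
    qed simp
    then show ?thesis unfolding z S_def count_ge_def by simp
  qed
  have "S m \<in> borel_measurable (M \<Otimes>\<^sub>M borel)" for m
  proof -
    obtain c d where c: "P m = (\<lambda>u. \<Sum>j\<le>d. c j * u ^ j)"
      using P(1)[of m] unfolding real_polynomial_function_iff_sum by blast
    have "P m (a - x) = (\<Sum>j\<le>d. \<Sum>i\<le>j. c j * real (j choose i) * (- x) ^ (j - i) * a ^ i)" for a x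
      unfolding c using binomial_ring[of a "- x"] by (simp add: sum_distrib_left mult_ac)
    then have "S m = (\<lambda>(\<omega>, x). \<Sum>j\<le>d. \<Sum>i\<le>j. c j * real (j choose i) * (- x) ^ (j - i) * power_sum n t i \<omega>)"
      unfolding S_def power_sum_def by (simp add: sum_list_sum_swap sum_list_const_mult)
    then show ?thesis by simp
  qed
  then show ?thesis using lim by (rule borel_measurable_LIMSEQ_real[rotated])
qed

lemma count_ge_measurable' [measurable]: "(\<lambda>\<omega>. count_ge n t \<omega> x) \<in> borel_measurable M"
  using measurable_compose[OF measurable_Pair[OF measurable_ident measurable_const] count_ge_measurable, of x] by simp

lemma height_eq: "height \<beta> Z Y x y t \<omega> = sqrt (real \<beta> * pi / 2) * count_ge (nat \<lfloor>y\<rfloor>) t \<omega> x"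
  by (simp add: height_def count_eigs count_ge_def)

text \<open>The deterministic step, \<open>n\<close> times the indicator of the negative half-line,
  cancels upon centring, but with it the integrals of the count and of its mean converge separately,
  so expectation and integration may be exchanged.\<close>

lemma height_moment_eq_power_sum:
  assumes L: "0 < L"
  shows "height_moment M \<beta> Z Y L (t, y, k) \<omega> = sqrt (real \<beta> * pi / 2) / (sqrt L ^ Suc k * real (Suc k)) *
    (power_sum (dim L y) t (Suc k) \<omega> - (LINT \<omega>|M. power_sum (dim L y) t (Suc k) \<omega>))"
proof -
  interpret P: pair_sigma_finite M lborel ..
  define n where "n = dim L y"
  define s where "s = sqrt L"
  have s: "0 < s" using L by (simp add: s_def)
  define h where "h \<omega> x = x ^ k * (count_ge n t \<omega> (s * x) - real n * indicator {..0} x)" for \<omega> and x :: real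
  define D where "D = s ^ Suc k * real (Suc k)"
  have h1: "has_bochner_integral lborel (h \<omega>) (power_sum n t (Suc k) \<omega> / D)" for \<omega>
    using count_list_step(1)[OF s, of k "eigs n t \<omega>"] unfolding h_def[abs_def] count_ge_def power_sum_def D_def length_eigs .
  have h2: "(LINT x|lborel. norm (h \<omega> x)) \<le> 2 / s ^ Suc k * (real n + power_sum n t (2 * Suc k) \<omega>)" for \<omega>
  proof -
    have "(LINT x|lborel. norm (h \<omega> x)) \<le> (\<Sum>a\<leftarrow>eigs n t \<omega>. 2 / s ^ Suc k * (1 + a ^ (2 * Suc k)))"
      using count_list_step(2)[OF s, of k "eigs n t \<omega>"] unfolding h_def count_ge_def length_eigs real_norm_def .
    also have "\<dots> = 2 / s ^ Suc k * (real n + power_sum n t (2 * Suc k) \<omega>)"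
      unfolding power_sum_def sum_list_const_mult sum_list_addf by (simp add: sum_list_triv length_eigs)
    finally show ?thesis .
  qed
  have [measurable]: "(\<lambda>z. count_ge n t (fst z) (s * snd z)) \<in> borel_measurable (M \<Otimes>\<^sub>M lborel)"
  proof -
    have "(\<lambda>z. (fst z, s * snd z)) \<in> M \<Otimes>\<^sub>M lborel \<rightarrow>\<^sub>M M \<Otimes>\<^sub>M borel" by measurable
    from measurable_compose[OF this count_ge_measurable[of n t]] show ?thesis by simp
  qed
  have hm[measurable]: "case_prod h \<in> borel_measurable (M \<Otimes>\<^sub>M lborel)"
    unfolding h_def case_prod_beta' by measurable
  have hint: "integrable (M \<Otimes>\<^sub>M lborel) (case_prod h)"
  proof (rule P.Fubini_integrable[OF hm])
    show "integrable M (\<lambda>\<omega>. LINT x|lborel. norm (case_prod h (\<omega>, x)))"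
    proof (rule Bochner_Integration.integrable_bound)
      show "integrable M (\<lambda>\<omega>. 2 / s ^ Suc k * (real n + power_sum n t (2 * Suc k) \<omega>))"
        by (intro integrable_mult_right Bochner_Integration.integrable_add integrable_const integrable_power_sum)
      show "(\<lambda>\<omega>. LINT x|lborel. norm (case_prod h (\<omega>, x))) \<in> borel_measurable M" by measurable
      show "AE \<omega> in M. norm (LINT x|lborel. norm (case_prod h (\<omega>, x))) \<le> norm (2 / s ^ Suc k * (real n + power_sum n t (2 * Suc k) \<omega>))"
      proof (rule AE_I2)
        fix \<omega>
        have "0 \<le> (LINT x|lborel. norm (h \<omega> x))" by simp
        then show "norm (LINT x|lborel. norm (case_prod h (\<omega>, x))) \<le> norm (2 / s ^ Suc k * (real n + power_sum n t (2 * Suc k) \<omega>))"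
          using h2[of \<omega>] unfolding real_norm_def prod.case by linarith
      qed
    qed
    show "AE \<omega> in M. integrable lborel (\<lambda>x. case_prod h (\<omega>, x))"
      using h1 unfolding has_bochner_integral_iff prod.case by blast
  qed
  define \<kappa> where "\<kappa> = sqrt (real \<beta> * pi / 2)"
  have int_count: "integrable M (\<lambda>\<omega>. count_ge n t \<omega> x)" for x
    by (rule integrable_const_bound[of _ "real n"]) (use count_ge_bounds in auto)
  have Eh: "(LINT \<omega>|M. h \<omega> x) = x ^ k * ((LINT \<omega>|M. count_ge n t \<omega> (s * x)) - real n * indicator {..0} x)" for x
  proof -
    have "(LINT \<omega>|M. h \<omega> x) = x ^ k * (LINT \<omega>|M. count_ge n t \<omega> (s * x) - real n * indicator {..0} x)"
      unfolding h_def by (rule integral_mult_right_zero)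
    then show ?thesis using int_count[of "s * x"] by (simp add: Bochner_Integration.integral_diff prob_space)
  qed
  have "x ^ k * (\<kappa> * count_ge n t \<omega> (s * x) - (LINT \<omega>|M. \<kappa> * count_ge n t \<omega> (s * x))) =
      \<kappa> * (h \<omega> x - (LINT \<omega>|M. h \<omega> x))" for x
    unfolding Eh integral_mult_right_zero by (simp add: h_def algebra_simps)
  then have "height_moment M \<beta> Z Y L (t, y, k) \<omega> = (LINT x|lborel. \<kappa> * (h \<omega> x - (LINT \<omega>|M. h \<omega> x)))"
    unfolding height_moment_def prod.case height_eq n_def[symmetric] s_def[symmetric] \<kappa>_def[symmetric] by simp
  also have "\<dots> = \<kappa> * ((LINT x|lborel. h \<omega> x) - (LINT x|lborel. LINT \<omega>|M. h \<omega> x))"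
  proof -
    have "integrable lborel (h \<omega>)" using h1[of \<omega>] by (simp add: has_bochner_integral_iff)
    then show ?thesis
      unfolding integral_mult_right_zero using P.integrable_snd[OF hint] by (subst Bochner_Integration.integral_diff) auto
  qed
  also have "(LINT x|lborel. LINT \<omega>|M. h \<omega> x) = (LINT \<omega>|M. LINT x|lborel. h \<omega> x)" by (rule P.Fubini_integral[OF hint])
  also have "(LINT \<omega>|M. LINT x|lborel. h \<omega> x) = (LINT \<omega>|M. power_sum n t (Suc k) \<omega>) / D"
    using has_bochner_integral_integral_eq[OF h1] by simp
  also have "(LINT x|lborel. h \<omega> x) = power_sum n t (Suc k) \<omega> / D" by (rule has_bochner_integral_integral_eq[OF h1])
  also have "\<kappa> * (power_sum n t (Suc k) \<omega> / D - (LINT \<omega>|M. power_sum n t (Suc k) \<omega>) / D) =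
      \<kappa> / D * (power_sum n t (Suc k) \<omega> - (LINT \<omega>|M. power_sum n t (Suc k) \<omega>))"
    by (simp only: diff_divide_distrib[symmetric] times_divide_eq_right times_divide_eq_left)
  finally show ?thesis unfolding D_def \<kappa>_def n_def s_def .
qed

text \<open>The quotient of square roots equals \<open>sqrt y\<close> when \<open>L * y\<close> is a
  positive integer and tends to it in general.\<close>

definition cheb_weight :: "real \<Rightarrow> real \<Rightarrow> nat \<Rightarrow> nat \<Rightarrow> real" where
  "cheb_weight L y p r = sqrt (real \<beta> * pi / 2) / real p * cheb_coeff p r * (sqrt (real (dim L y)) / sqrt L) ^ (p - r)"

lemma height_moment_eq:
  assumes L: "0 < L"
  shows "complex_of_real (height_moment M \<beta> Z Y L (t, y, k) \<omega>) =
    (\<Sum>r\<in>{1..Suc k}. of_real (cheb_weight L y (Suc k) r) * cheb_stat L t y r \<omega>)"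
proof -
  have pw: "L powr (- real r / 2) = 1 / sqrt L ^ r" for r
  proof -
    have "sqrt L ^ r = (L powr (1 / 2)) powr real r" using L by (simp add: powr_half_sqrt powr_realpow)
    then have "L powr (real r * (1 / 2)) = sqrt L ^ r" by (simp only: powr_powr mult.commute)
    moreover have "- real r / 2 = - (real r * (1 / 2))" by simp
    ultimately show ?thesis by (simp only: powr_minus inverse_eq_divide)
  qed
  have w: "sqrt (real \<beta> * pi / 2) / (sqrt L ^ Suc k * real (Suc k)) * cheb_coeff (Suc k) r * sqrt (real n) ^ (Suc k - r) =
      sqrt (real \<beta> * pi / 2) / real (Suc k) * cheb_coeff (Suc k) r * (sqrt (real n) / sqrt L) ^ (Suc k - r) * L powr (- real r / 2)"
    if "r \<in> {1..Suc k}" for r n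
  proof -
    have "sqrt L ^ Suc k = sqrt L ^ (Suc k - r) * sqrt L ^ r" using that by (simp flip: power_add del: power_Suc)
    then show ?thesis unfolding pw power_divide by (simp only: times_divide_eq_left times_divide_eq_right divide_divide_eq_left mult_1_right mult_ac)
  qed
  have "complex_of_real (height_moment M \<beta> Z Y L (t, y, k) \<omega>) =
      (\<Sum>r\<in>{1..Suc k}. complex_of_real (sqrt (real \<beta> * pi / 2) / (sqrt L ^ Suc k * real (Suc k))) *
        (complex_of_real (cheb_coeff (Suc k) r * sqrt (real (dim L y)) ^ (Suc k - r)) * (\<Sum>w\<in>words (dim L y) r. ccyc t w \<omega>)))"
    unfolding height_moment_eq_power_sum[OF L] of_real_mult[of "sqrt (real \<beta> * pi / 2) / _"] power_sum_centered by (rule sum_distrib_left)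
  also have "\<dots> = (\<Sum>r\<in>{1..Suc k}. of_real (cheb_weight L y (Suc k) r) * cheb_stat L t y r \<omega>)"
    unfolding cheb_stat_def
  proof (intro sum.cong refl)
    fix r assume r: "r \<in> {1..Suc k}"
    show "complex_of_real (sqrt (real \<beta> * pi / 2) / (sqrt L ^ Suc k * real (Suc k))) *
        (complex_of_real (cheb_coeff (Suc k) r * sqrt (real (dim L y)) ^ (Suc k - r)) * (\<Sum>w\<in>words (dim L y) r. ccyc t w \<omega>)) =
      complex_of_real (cheb_weight L y (Suc k) r) * (complex_of_real (L powr (- real r / 2)) * (\<Sum>w\<in>words (dim L y) r. ccyc t w \<omega>))"
      unfolding mult.assoc[symmetric] of_real_mult[symmetric] w[OF r] cheb_weight_def ..
  qed
  finally show ?thesis .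
qed

lemma Lp_height_moment: "0 < L \<Longrightarrow> Lp (\<lambda>\<omega>. complex_of_real (height_moment M \<beta> Z Y L i \<omega>))"
  by (cases i) (simp only: height_moment_eq, intro Lp_sum Lp_mult Lp_const Lp_cheb_stat finite_atLeastAtMost)

lemma height_moment_measurable: "0 < L \<Longrightarrow> height_moment M \<beta> Z Y L i \<in> borel_measurable M"
  using borel_measurable_integrable[OF integrable_Re[OF Lp_integrable[OF Lp_height_moment[of L i]]]] by simp

end

section \<open>Normal limits from moments\<close>

fun normal_moment :: "real \<Rightarrow> nat \<Rightarrow> real" where
  "normal_moment v 0 = 1"
| "normal_moment v (Suc 0) = 0"
| "normal_moment v (Suc (Suc m)) = real (m + 1) * v * normal_moment v m"

lemma normal_moment_odd: "normal_moment v (Suc (2 * m)) = 0"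
  by (induction m) auto

text \<open>The even moments are \<open>(2 m - 1)!! v^m\<close>; division by \<open>(2 m)!\<close>
  gives coefficients of an exponential series, which is how \<open>exp (- v / 2)\<close>
  arises.\<close>

lemma normal_moment_even: "normal_moment v (2 * m) / fact (2 * m) = (v / 2) ^ m / fact m"
proof (induction m)
  case (Suc m)
  have "normal_moment v (2 * Suc m) / fact (2 * Suc m) =
      real (2 * m + 1) * v * normal_moment v (2 * m) / (real (2 * m + 2) * (real (2 * m + 1) * fact (2 * m)))"
    by (simp add: algebra_simps)
  also have "\<dots> = v / real (2 * m + 2) * (normal_moment v (2 * m) / fact (2 * m))"
    by (simp add: divide_simps del: of_nat_add of_nat_mult) 
  also have "\<dots> = v / real (2 * m + 2) * ((v / 2) ^ m / fact m)" by (simp only: Suc.IH)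
  also have "\<dots> = (v / 2) ^ Suc m / fact (Suc m)" by (simp add: field_simps)
  finally show ?case .
qed simp

lemma sum_normal_moments:
  "(\<Sum>k\<le>2 * m. \<i> ^ k / fact k * complex_of_real (normal_moment v k)) =
    complex_of_real (\<Sum>j\<le>m. (- v / 2) ^ j / fact j)"
proof (induction m)
  case (Suc m)
  have 1: "\<i> ^ (2 * Suc m) / fact (2 * Suc m) * complex_of_real (normal_moment v (2 * Suc m)) =
    complex_of_real ((- v / 2) ^ Suc m / fact (Suc m))"
  proof -
    have "\<i> ^ (2 * Suc m) / fact (2 * Suc m) * complex_of_real (normal_moment v (2 * Suc m)) =
        complex_of_real ((- 1) ^ Suc m * (normal_moment v (2 * Suc m) / fact (2 * Suc m)))"
      by (simp only: power_mult i_squared) (simp del: power_Suc fact_Suc normal_moment.simps)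
    also have "\<dots> = complex_of_real ((- 1) ^ Suc m * ((v / 2) ^ Suc m / fact (Suc m)))"
      by (simp only: normal_moment_even)
    also have "(- 1) ^ Suc m * ((v / 2) ^ Suc m / fact (Suc m)) = (- v / 2) ^ Suc m / fact (Suc m)"
      by (simp only: times_divide_eq_right power_mult_distrib[symmetric]) simp
    finally show ?thesis .
  qed
  have split: "(\<Sum>k\<le>2 * Suc m. f k) = (\<Sum>k\<le>2 * m. f k) + f (Suc (2 * m)) + f (2 * Suc m)" for f :: "nat \<Rightarrow> complex"
    by simp
  show ?case
    unfolding split Suc.IH 1 normal_moment_odd sum.atMost_Suc by (simp only: of_real_0 mult_zero_right add_0_right of_real_add)
qed simp

lemma iexp_integrable:
  assumes "prob_space M" "f \<in> borel_measurable M"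
  shows "integrable M (\<lambda>\<omega>. iexp (f \<omega>))"
proof -
  interpret prob_space M by fact
  show ?thesis by (rule integrable_const_bound[of _ 1]) (use assms in auto)
qed

text \<open>Taylor's formula for \<open>iexp\<close> up to an even order \<open>2 m\<close> has a
  remainder of at most \<open>2 S^(2m) / (2m)!\<close>, whose expectation converges to twice a term
  of the exponential series. So one fixed \<open>m\<close>, chosen from the limit law only, controls
  the error for all large \<open>L\<close>.\<close>

lemma moments_imp_iexp:
  fixes S :: "real \<Rightarrow> 'a \<Rightarrow> real"
  assumes M: "prob_space M" and v: "0 \<le> v"
    and meas: "\<forall>\<^sub>F L in at_top. S L \<in> borel_measurable M"
    and int: "\<And>k. \<forall>\<^sub>F L in at_top. integrable M (\<lambda>\<omega>. S L \<omega> ^ k)"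
    and lim: "\<And>k. ((\<lambda>L. LINT \<omega>|M. S L \<omega> ^ k) \<longlongrightarrow> normal_moment v k) at_top"
  shows "((\<lambda>L. LINT \<omega>|M. iexp (S L \<omega>)) \<longlongrightarrow> complex_of_real (exp (- v / 2))) at_top"
proof (rule tendstoI)
  interpret prob_space M by fact
  fix e :: real assume e: "0 < e"
  have exp_sums: "(\<lambda>j. x ^ j / fact j) sums exp x" for x :: real
  proof -
    have "(\<lambda>j. x ^ j /\<^sub>R fact j) = (\<lambda>j. x ^ j / fact j)" by (simp add: fun_eq_iff divide_inverse_commute)
    then show ?thesis using exp_converges[of x] by (simp only:)
  qed
  have "(\<lambda>m. (v / 2) ^ m / fact m) \<longlonglongrightarrow> 0"
    by (rule summable_LIMSEQ_zero[OF sums_summable[OF exp_sums]])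
  from tendsto_mult[OF tendsto_const[of 2] this]
  have "(\<lambda>m. 2 * ((v / 2) ^ m / fact m)) \<longlonglongrightarrow> 0" by (simp only: mult_zero_right)
  then have ev1: "\<forall>\<^sub>F m in sequentially. 2 * ((v / 2) ^ m / fact m) < e / 3"
    using e by (intro order_tendstoD) auto
  have "(\<lambda>m. \<Sum>j<m. (- v / 2) ^ j / fact j) \<longlonglongrightarrow> exp (- v / 2)"
    using exp_sums[of "- v / 2"] unfolding sums_def .
  then have "(\<lambda>m. \<Sum>j<Suc m. (- v / 2) ^ j / fact j) \<longlonglongrightarrow> exp (- v / 2)"
    by (rule LIMSEQ_Suc)
  then have ev2: "\<forall>\<^sub>F m in sequentially. dist (\<Sum>j<Suc m. (- v / 2) ^ j / fact j) (exp (- v / 2)) < e / 3"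
    using e by (intro tendstoD) auto
  \<comment> \<open>One \<open>m\<close> for two purposes: the limit of the Taylor remainder and the
    tail of the exponential series are both below \<open>e / 3\<close>.\<close>
  obtain m where m1: "2 * ((v / 2) ^ m / fact m) < e / 3"
    and m2: "dist (\<Sum>j\<le>m. (- v / 2) ^ j / fact j) (exp (- v / 2)) < e / 3"
    using eventually_happens'[OF _ eventually_conj[OF ev1 ev2]] by (auto simp: lessThan_Suc_atMost)
  let ?n = "2 * m"
  let ?T = "\<lambda>L. \<Sum>k\<le>?n. \<i> ^ k / fact k * complex_of_real (LINT \<omega>|M. S L \<omega> ^ k)"
  have "((\<lambda>L. 2 * (LINT \<omega>|M. S L \<omega> ^ ?n) / fact ?n) \<longlongrightarrow> 2 * normal_moment v ?n / fact ?n) at_top"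
    by (intro tendsto_intros lim) simp
  then have 1: "\<forall>\<^sub>F L in at_top. 2 * (LINT \<omega>|M. S L \<omega> ^ ?n) / fact ?n < e / 3"
    using m1 normal_moment_even[of v m] by (intro order_tendstoD) (auto simp: mult.commute)
  have "(?T \<longlongrightarrow> (\<Sum>k\<le>?n. \<i> ^ k / fact k * complex_of_real (normal_moment v k))) at_top"
    by (intro tendsto_sum tendsto_mult tendsto_const tendsto_of_real lim)
  then have 2: "\<forall>\<^sub>F L in at_top. dist (?T L) (complex_of_real (\<Sum>j\<le>m. (- v / 2) ^ j / fact j)) < e / 3"
    unfolding sum_normal_moments using e by (intro tendstoD) auto
  have int': "\<forall>\<^sub>F L in at_top. \<forall>k\<in>{..?n}. integrable M (\<lambda>\<omega>. S L \<omega> ^ k)"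
    using int by (intro eventually_ball_finite) auto
  show "\<forall>\<^sub>F L in at_top. dist (LINT \<omega>|M. iexp (S L \<omega>)) (complex_of_real (exp (- v / 2))) < e"
    using 1 2 int' meas
  proof eventually_elim
    case (elim L)
    have i1: "integrable M (\<lambda>\<omega>. iexp (S L \<omega>))" by (rule iexp_integrable[OF M elim(4)])
    have pow: "(\<i> * complex_of_real x) ^ k / fact k = \<i> ^ k / fact k * complex_of_real (x ^ k)" for x k
      by (simp add: power_mult_distrib)
    have i2: "integrable M (\<lambda>\<omega>. \<Sum>k\<le>?n. \<i> ^ k / fact k * complex_of_real (S L \<omega> ^ k))"
    proof (rule Bochner_Integration.integrable_sum)
      fix k assume "k \<in> {..?n}"
      then have "integrable M (\<lambda>\<omega>. S L \<omega> ^ k)" using elim(3) by blast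
      then show "integrable M (\<lambda>\<omega>. \<i> ^ k / fact k * complex_of_real (S L \<omega> ^ k))"
        by (intro integrable_mult_right integrable_of_real)
    qed
    have T: "?T L = (LINT \<omega>|M. (\<Sum>k\<le>?n. \<i> ^ k / fact k * complex_of_real (S L \<omega> ^ k)))"
      using elim(3) by (subst Bochner_Integration.integral_sum) (auto simp: integrable_of_real simp del: of_real_power intro!: sum.cong)
    have "dist (LINT \<omega>|M. iexp (S L \<omega>)) (?T L) =
        cmod (LINT \<omega>|M. iexp (S L \<omega>) - (\<Sum>k\<le>?n. \<i> ^ k / fact k * complex_of_real (S L \<omega> ^ k)))"
      unfolding T dist_norm by (subst Bochner_Integration.integral_diff[OF i1 i2]) simp
    also have "\<dots> \<le> (LINT \<omega>|M. 2 * S L \<omega> ^ ?n / fact ?n)"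
    proof (rule order_trans[OF integral_norm_bound integral_mono])
      show "integrable M (\<lambda>\<omega>. cmod (iexp (S L \<omega>) - (\<Sum>k\<le>?n. \<i> ^ k / fact k * complex_of_real (S L \<omega> ^ k))))"
        by (intro integrable_norm Bochner_Integration.integrable_diff i1 i2)
      have "integrable M (\<lambda>\<omega>. S L \<omega> ^ ?n)" using elim(3) by simp
      then show "integrable M (\<lambda>\<omega>. 2 * S L \<omega> ^ ?n / fact ?n)" by simp
      fix \<omega>
      show "cmod (iexp (S L \<omega>) - (\<Sum>k\<le>?n. \<i> ^ k / fact k * complex_of_real (S L \<omega> ^ k))) \<le> 2 * S L \<omega> ^ ?n / fact ?n"
        using iexp_approx2[of "S L \<omega>" ?n] unfolding pow by (simp add: power_even_abs)
    qed
    also have "\<dots> = 2 * (LINT \<omega>|M. S L \<omega> ^ ?n) / fact ?n" by simp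
    finally have 3: "dist (LINT \<omega>|M. iexp (S L \<omega>)) (?T L) < e / 3" using elim(1) by linarith
    have 4: "dist (complex_of_real (\<Sum>j\<le>m. (- v / 2) ^ j / fact j)) (complex_of_real (exp (- v / 2))) < e / 3"
      using m2 by (simp only: dist_of_real)
    show ?case
      using 3 elim(2) 4
        dist_triangle[of "LINT \<omega>|M. iexp (S L \<omega>)" "complex_of_real (exp (- v / 2))" "?T L"]
        dist_triangle[of "?T L" "complex_of_real (exp (- v / 2))" "complex_of_real (\<Sum>j\<le>m. (- v / 2) ^ j / fact j)"]
      by linarith
  qed
qed

section \<open>Approximation by trigonometric polynomials\<close>

definition trig_poly :: "'i set \<Rightarrow> (complex \<times> ('i \<Rightarrow> real)) list \<Rightarrow> ('i \<Rightarrow> real) \<Rightarrow> complex" where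
  "trig_poly J qs x = (\<Sum>(k, \<theta>)\<leftarrow>qs. k * iexp (\<Sum>j\<in>J. \<theta> j * x j))"

lemma trig_poly_Nil [simp]: "trig_poly J [] x = 0"
  by (simp add: trig_poly_def)

lemma trig_poly_Cons [simp]: "trig_poly J ((k, \<theta>) # qs) x = k * iexp (\<Sum>j\<in>J. \<theta> j * x j) + trig_poly J qs x"
  by (simp add: trig_poly_def)

lemma trig_poly_append [simp]: "trig_poly J (ps @ qs) x = trig_poly J ps x + trig_poly J qs x"
  by (induction ps) auto

lemma trig_poly_mult: "\<exists>rs. \<forall>x. trig_poly J rs x = trig_poly J ps x * trig_poly J qs x"
proof -
  have one: "trig_poly J (map (\<lambda>(k', \<theta>'). (k * k', \<lambda>j. \<theta> j + \<theta>' j)) qs) x =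
      k * iexp (\<Sum>j\<in>J. \<theta> j * x j) * trig_poly J qs x" for k \<theta> x
  proof (induction qs)
    case (Cons q qs)
    obtain k' \<theta>' where q: "q = (k', \<theta>')" by (cases q)
    have "iexp (\<Sum>j\<in>J. (\<theta> j + \<theta>' j) * x j) = iexp (\<Sum>j\<in>J. \<theta> j * x j) * iexp (\<Sum>j\<in>J. \<theta>' j * x j)"
      by (simp only: distrib_right sum.distrib of_real_add distrib_left exp_add)
    then show ?case unfolding q list.map prod.case trig_poly_Cons Cons.IH by (simp only: distrib_left mult_ac)
  qed simp
  show ?thesis
  proof (induction ps)
    case Nil
    show ?case by (rule exI[of _ "[]"]) simp
  next
    case (Cons p ps)
    then obtain rs where rs: "\<And>x. trig_poly J rs x = trig_poly J ps x * trig_poly J qs x" by auto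
    obtain k \<theta> where p: "p = (k, \<theta>)" by (cases p)
    show ?case
      by (rule exI[of _ "map (\<lambda>(k', \<theta>'). (k * k', \<lambda>j. \<theta> j + \<theta>' j)) qs @ rs"])
        (simp only: p trig_poly_append one rs trig_poly_Cons distrib_right, simp)
  qed
qed

text \<open>The triangle wave of period \<open>4 R\<close> that agrees with the identity on
  \<open>[-R, R]\<close>, written as a continuous function of a sine.\<close>

definition tri_wave :: "real \<Rightarrow> real \<Rightarrow> real" where
  "tri_wave R x = 2 * R / pi * arcsin (sin (pi * x / (2 * R)))"

lemma tri_wave_eq: "\<bar>x\<bar> \<le> R \<Longrightarrow> 0 < R \<Longrightarrow> tri_wave R x = x"
proof -
  assume x: "\<bar>x\<bar> \<le> R" and R: "0 < R"
  have eq: "pi * x / (2 * R) = pi / 2 * (x / R)" by simp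
  have "- 1 \<le> x / R" "x / R \<le> 1" using x R by (simp_all add: field_simps abs_le_iff)
  then have "pi / 2 * (- 1) \<le> pi / 2 * (x / R)" "pi / 2 * (x / R) \<le> pi / 2 * 1"
    by (intro mult_left_mono; simp)+
  then have "arcsin (sin (pi * x / (2 * R))) = pi * x / (2 * R)"
    unfolding eq by (intro arcsin_sin) simp_all
  then show ?thesis using R by (simp add: tri_wave_def)
qed

text \<open>After the cut-off by \<open>tri_wave\<close>, \<open>f\<close> is a continuous function
  of the sines of the coordinates, which range over a compact cube. Polynomials in these sines are
  trigonometric polynomials, so the Stone-Weierstrass theorem gives an approximation that is uniform
  on the whole space.\<close>

lemma trig_poly_approx:
  fixes f :: "('i \<Rightarrow> real) \<Rightarrow> real"
  assumes J: "finite J" and f: "continuous_map (product_topology (\<lambda>_. euclideanreal) J) euclideanreal f"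
    and R: "0 < R" and e: "0 < e"
  shows "\<exists>qs. \<forall>x. cmod (complex_of_real (f (\<lambda>j\<in>J. tri_wave R (x j))) - trig_poly J qs x) < e"
proof -
  obtain h where h: "bij_betw h {..<card J} J"
    using ex_bij_betw_nat_finite[OF J] by (auto simp: atLeast0LessThan)
  define g where "g = inv_into {..<card J} h"
  have hJ: "h k \<in> J" if "k < card J" for k using h that by (auto simp: bij_betw_def)
  have gJ: "g j < card J" "h (g j) = j" if "j \<in> J" for j
    using h that inv_into_into[of j h "{..<card J}"] by (auto simp: g_def bij_betw_def f_inv_into_f)
  let ?s = "\<lambda>x :: 'i \<Rightarrow> real. \<lambda>k. if k < card J then sin (pi * x (h k) / (2 * R)) else 0"
  \<comment> \<open>The finite index set is carried to an initial segment of the natural numbers.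
    Surplus coordinates are pinned to 0, so that \<open>K\<close> is compact and its points are
    separated by the remaining coordinates.\<close>
  define K where "K = Pi\<^sub>E UNIV (\<lambda>k. if k < card J then {-1..1} else {0 :: real})"
  define F where "F u = f (\<lambda>j\<in>J. 2 * R / pi * arcsin (u (g j)))" for u
  define P where "P = {\<phi> :: (nat \<Rightarrow> real) \<Rightarrow> real. continuous_on K \<phi> \<and>
    (\<exists>qs. \<forall>x. complex_of_real (\<phi> (?s x)) = trig_poly J qs x)}"
  have P_I: "\<phi> \<in> P" if "continuous_on K \<phi>" "\<forall>x. complex_of_real (\<phi> (?s x)) = trig_poly J qs x" for \<phi> qs
    using that unfolding P_def by blast
  have K_zero: "w k = 0" if "w \<in> K" "\<not> k < card J" for w k
    using PiE_mem[of w UNIV "\<lambda>k. if k < card J then {-1..1} else {0 :: real}" k] that by (simp add: K_def)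
  have K_le: "- 1 \<le> w k \<and> w k \<le> 1" if "w \<in> K" "k < card J" for w k
    using PiE_mem[of w UNIV "\<lambda>k. if k < card J then {-1..1} else {0 :: real}" k] that by (simp add: K_def)
  have P_D: "continuous_on K \<phi>" if "\<phi> \<in> P" for \<phi>
    using that unfolding P_def by blast
  have sK: "?s x \<in> K" for x by (auto simp: K_def)
  have coord: "continuous_on S (\<lambda>u :: nat \<Rightarrow> real. u k)" for S k
    by (rule continuous_on_subset[OF continuous_on_product_coordinates]) simp
  interpret function_ring_on P K
  proof
    have "compactin (product_topology (\<lambda>_. euclideanreal) UNIV) K"
      unfolding K_def compactin_PiE by auto
    then show "compact K" by (simp add: euclidean_product_topology)
    show "continuous_on K \<phi>" if "\<phi> \<in> P" for \<phi> using that by (simp add: P_def)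
    show "(\<lambda>u. \<phi> u + \<psi> u) \<in> P" if "\<phi> \<in> P" "\<psi> \<in> P" for \<phi> \<psi>
    proof -
      obtain ps qs where "\<And>x. complex_of_real (\<phi> (?s x)) = trig_poly J ps x"
        "\<And>x. complex_of_real (\<psi> (?s x)) = trig_poly J qs x"
        using \<open>\<phi> \<in> P\<close> \<open>\<psi> \<in> P\<close> unfolding P_def by blast
      then have "\<forall>x. complex_of_real (\<phi> (?s x) + \<psi> (?s x)) = trig_poly J (ps @ qs) x"
        by (simp only: of_real_add trig_poly_append) simp
      then show ?thesis by (rule P_I[rotated]) (intro continuous_on_add P_D that)
    qed
    show "(\<lambda>u. \<phi> u * \<psi> u) \<in> P" if "\<phi> \<in> P" "\<psi> \<in> P" for \<phi> \<psi>
    proof -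
      obtain ps qs where *: "\<And>x. complex_of_real (\<phi> (?s x)) = trig_poly J ps x"
        "\<And>x. complex_of_real (\<psi> (?s x)) = trig_poly J qs x"
        using \<open>\<phi> \<in> P\<close> \<open>\<psi> \<in> P\<close> unfolding P_def by blast
      obtain rs where "\<And>x. trig_poly J rs x = trig_poly J ps x * trig_poly J qs x"
        using trig_poly_mult[of J ps qs] by blast
      then have "\<forall>x. complex_of_real (\<phi> (?s x) * \<psi> (?s x)) = trig_poly J rs x"
        using * by (simp only: of_real_mult) simp
      then show ?thesis by (rule P_I[rotated]) (intro continuous_on_mult P_D that)
    qed
    show "(\<lambda>_. k) \<in> P" for k
    proof -
      have "\<forall>x. complex_of_real k = trig_poly J [(complex_of_real k, \<lambda>_. 0)] x" by simp
      then show ?thesis by (rule P_I[rotated]) (rule continuous_on_const)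
    qed
    show "\<exists>\<phi>\<in>P. \<phi> u \<noteq> \<phi> v" if uv: "u \<in> K" "v \<in> K" "u \<noteq> v" for u v
    proof -
      obtain k where k: "u k \<noteq> v k" using uv(3) by auto
      have kJ: "k < card J"
      proof (rule ccontr)
        assume "\<not> k < card J"
        then have "u k = 0" "v k = 0" using K_zero uv by blast+
        then show False using k by simp
      qed
      define \<theta> where "\<theta> j = (if j = h k then pi / (2 * R) else 0)" for j
      have sum: "(\<Sum>j\<in>J. \<theta> j * x j) = pi * x (h k) / (2 * R)" for x
      proof -
        have "(\<Sum>j\<in>J. \<theta> j * x j) = (\<Sum>j\<in>J. if j = h k then pi / (2 * R) * x j else 0)"
          by (intro sum.cong) (simp_all add: \<theta>_def)
        also have "\<dots> = pi / (2 * R) * x (h k)" using J hJ[OF kJ] by (simp add: sum.delta)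
        finally show ?thesis by simp
      qed
      \<comment> \<open>A sine of one coordinate is a trigonometric polynomial with two opposite
        frequencies; so the coordinate function lies in the algebra and separates \<open>u\<close>
        from \<open>v\<close>.\<close>
      have "\<forall>x. complex_of_real (?s x k) = trig_poly J [(1 / (2 * \<i>), \<theta>), (- 1 / (2 * \<i>), \<lambda>j. - \<theta> j)] x"
      proof
        fix x
        have "complex_of_real (?s x k) = sin (complex_of_real (pi * x (h k) / (2 * R)))"
          using kJ by (simp only: if_True sin_of_real)
        also have "\<dots> = 1 / (2 * \<i>) * iexp (pi * x (h k) / (2 * R)) + (- 1 / (2 * \<i>)) * iexp (- (pi * x (h k) / (2 * R)))"
        proof -
          have "(a - b) / (2 * \<i>) = 1 / (2 * \<i>) * a + (- 1 / (2 * \<i>)) * b" for a b :: complex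
            unfolding diff_divide_distrib
            by (simp only: divide_minus_left mult_minus_left times_divide_eq_left mult_1_left diff_conv_add_uminus)
          then show ?thesis unfolding sin_exp_eq of_real_minus mult_minus_left mult_minus_right .
        qed
        also have "\<dots> = trig_poly J [(1 / (2 * \<i>), \<theta>), (- 1 / (2 * \<i>), \<lambda>j. - \<theta> j)] x"
        proof -
          have "(\<Sum>j\<in>J. - \<theta> j * x j) = - (pi * x (h k) / (2 * R))"
            by (simp only: mult_minus_left sum_negf sum[of x])
          then show ?thesis unfolding trig_poly_Cons trig_poly_Nil sum[of x] by (simp only: add_0_right)
        qed
        finally show "complex_of_real (?s x k) = trig_poly J [(1 / (2 * \<i>), \<theta>), (- 1 / (2 * \<i>), \<lambda>j. - \<theta> j)] x" .
      qed
      then have "(\<lambda>u. u k) \<in> P" by (rule P_I[OF coord])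
      then show ?thesis by (rule bexI[rotated]) (rule k)
    qed
  qed
  have "continuous_on K F"
  proof -
    have "continuous_map (top_of_set K) (product_topology (\<lambda>_. euclideanreal) J)
        (\<lambda>u. \<lambda>j\<in>J. 2 * R / pi * arcsin (u (g j)))"
      unfolding continuous_map_componentwise
    proof (intro conjI ballI)
      show "(\<lambda>u. \<lambda>j\<in>J. 2 * R / pi * arcsin (u (g j))) ` topspace (top_of_set K) \<subseteq> extensional J"
        by (intro image_subsetI restrict_extensional)
    next
      fix j assume j: "j \<in> J"
      have "continuous_on K (\<lambda>u. 2 * R / pi * arcsin (u (g j)))"
        using K_le[OF _ gJ(1)[OF j]]
        by (intro continuous_on_mult continuous_on_const continuous_on_arcsin coord ballI)
      then show "continuous_map (top_of_set K) euclideanreal (\<lambda>u. (\<lambda>j\<in>J. 2 * R / pi * arcsin (u (g j))) j)"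
        using j by simp
    qed
    from continuous_map_compose[OF this f] show ?thesis by (simp add: F_def[abs_def] o_def)
  qed
  from Stone_Weierstrass_basic[OF this e] obtain \<phi> where \<phi>: "\<phi> \<in> P" "\<And>u. u \<in> K \<Longrightarrow> \<bar>F u - \<phi> u\<bar> < e" by blast
  then obtain qs where qs: "\<And>x. complex_of_real (\<phi> (?s x)) = trig_poly J qs x" unfolding P_def by blast
  have "F (?s x) = f (\<lambda>j\<in>J. tri_wave R (x j))" for x
  proof -
    have "(\<lambda>j\<in>J. 2 * R / pi * arcsin (?s x (g j))) = (\<lambda>j\<in>J. tri_wave R (x j))"
      by (intro restrict_ext) (simp only: tri_wave_def gJ if_True)
    then show ?thesis by (simp only: F_def)
  qed
  note Fs = this
  have "cmod (complex_of_real (f (\<lambda>j\<in>J. tri_wave R (x j))) - trig_poly J qs x) < e" for x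
    using \<phi>(2)[OF sK[of x]] unfolding qs[symmetric] of_real_diff[symmetric] norm_of_real Fs .
  then show ?thesis by blast
qed

text \<open>With cut-off radius \<open>m + 1\<close>, the cut-off is eventually inactive at each
  fixed point. The limit serves to show that continuous functions of finitely many random variables
  are measurable.\<close>

lemma trig_poly_limit:
  fixes f :: "('i \<Rightarrow> real) \<Rightarrow> real"
  assumes J: "finite J" and f: "continuous_map (product_topology (\<lambda>_. euclideanreal) J) euclideanreal f"
  shows "\<exists>qs. \<forall>x. (\<lambda>m. trig_poly J (qs m) x) \<longlonglongrightarrow> complex_of_real (f (restrict x J))"
proof -
  have "\<exists>qs. \<forall>x. cmod (complex_of_real (f (\<lambda>j\<in>J. tri_wave (real (Suc m)) (x j))) - trig_poly J qs x) < 1 / real (Suc m)" for m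
    by (rule trig_poly_approx[OF J f]) simp_all
  then obtain qs where qs: "\<And>m x. cmod (complex_of_real (f (\<lambda>j\<in>J. tri_wave (real (Suc m)) (x j))) - trig_poly J (qs m) x) < 1 / real (Suc m)"
    by metis
  have "(\<lambda>m. trig_poly J (qs m) x) \<longlonglongrightarrow> complex_of_real (f (restrict x J))" for x
  proof (rule Lim_transform2)
    have "\<forall>\<^sub>F m in sequentially. \<forall>j\<in>J. \<bar>x j\<bar> \<le> real (Suc m)"
    proof (rule eventually_ball_finite[OF J], rule ballI)
      fix j
      show "\<forall>\<^sub>F m in sequentially. \<bar>x j\<bar> \<le> real (Suc m)"
        using eventually_ge_at_top[of "nat \<lceil>\<bar>x j\<bar>\<rceil>"] by eventually_elim linarith
    qed
    then have "\<forall>\<^sub>F m in sequentially. complex_of_real (f (\<lambda>j\<in>J. tri_wave (real (Suc m)) (x j))) = complex_of_real (f (restrict x J))"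
    proof eventually_elim
      case (elim m)
      then have "(\<lambda>j\<in>J. tri_wave (real (Suc m)) (x j)) = restrict x J"
        by (intro restrict_ext tri_wave_eq) auto
      then show ?case by (simp only:)
    qed
    then show "(\<lambda>m. complex_of_real (f (\<lambda>j\<in>J. tri_wave (real (Suc m)) (x j)))) \<longlonglongrightarrow> complex_of_real (f (restrict x J))"
      by (rule tendsto_eventually)
    show "(\<lambda>m. complex_of_real (f (\<lambda>j\<in>J. tri_wave (real (Suc m)) (x j))) - trig_poly J (qs m) x) \<longlonglongrightarrow> 0"
    proof (rule Lim_null_comparison[OF _ LIMSEQ_Suc[OF lim_inverse_n']])
      show "\<forall>\<^sub>F m in sequentially. cmod (complex_of_real (f (\<lambda>j\<in>J. tri_wave (real (Suc m)) (x j))) - trig_poly J (qs m) x)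
          \<le> 1 / real (Suc m)"
        by (intro always_eventually allI less_imp_le qs)
    qed
  qed
  then show ?thesis by blast
qed

lemma trig_poly_measurable:
  assumes "\<And>j. j \<in> J \<Longrightarrow> X j \<in> borel_measurable M"
  shows "(\<lambda>\<omega>. trig_poly J qs (\<lambda>j. X j \<omega>)) \<in> borel_measurable M"
proof (induction qs)
  case (Cons q qs)
  obtain k \<theta> where q: "q = (k, \<theta>)" by (cases q)
  have "(\<lambda>\<omega>. \<Sum>j\<in>J. \<theta> j * X j \<omega>) \<in> borel_measurable M"
    using assms by (intro borel_measurable_sum borel_measurable_times) auto
  then have "(\<lambda>\<omega>. iexp (\<Sum>j\<in>J. \<theta> j * X j \<omega>)) \<in> borel_measurable M" by measurable
  then show ?case unfolding q trig_poly_Cons using Cons by (intro borel_measurable_add borel_measurable_times) auto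
qed simp

lemma continuous_bounded_measurable:
  fixes f :: "('i \<Rightarrow> real) \<Rightarrow> real"
  assumes J: "finite J" and f: "continuous_map (product_topology (\<lambda>_. euclideanreal) J) euclideanreal f"
    and X: "\<And>j. j \<in> J \<Longrightarrow> X j \<in> borel_measurable M"
  shows "(\<lambda>\<omega>. f (\<lambda>j\<in>J. X j \<omega>)) \<in> borel_measurable M"
proof -
  obtain qs where qs: "\<And>x. (\<lambda>m. trig_poly J (qs m) x) \<longlonglongrightarrow> complex_of_real (f (restrict x J))"
    using trig_poly_limit[OF J f] by blast
  have "(\<lambda>\<omega>. complex_of_real (f (\<lambda>j\<in>J. X j \<omega>))) \<in> borel_measurable M"
    by (rule borel_measurable_LIMSEQ_metric[OF trig_poly_measurable[OF X] qs])
  then have "(\<lambda>\<omega>. Re (complex_of_real (f (\<lambda>j\<in>J. X j \<omega>)))) \<in> borel_measurable M" by measurable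
  then show ?thesis by simp
qed

lemma trig_poly_integral:
  assumes M: "prob_space M" and X: "\<And>j. j \<in> J \<Longrightarrow> X j \<in> borel_measurable M"
  shows "integrable M (\<lambda>\<omega>. trig_poly J qs (\<lambda>j. X j \<omega>))"
    and "(LINT \<omega>|M. trig_poly J qs (\<lambda>j. X j \<omega>)) = (\<Sum>(k, \<theta>)\<leftarrow>qs. k * (LINT \<omega>|M. iexp (\<Sum>j\<in>J. \<theta> j * X j \<omega>)))"
proof -
  have i: "integrable M (\<lambda>\<omega>. iexp (\<Sum>j\<in>J. \<theta> j * X j \<omega>))" for \<theta>
    using X by (intro iexp_integrable[OF M] borel_measurable_sum borel_measurable_times) auto
  have "integrable M (\<lambda>\<omega>. trig_poly J qs (\<lambda>j. X j \<omega>)) \<and>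
    (LINT \<omega>|M. trig_poly J qs (\<lambda>j. X j \<omega>)) = (\<Sum>(k, \<theta>)\<leftarrow>qs. k * (LINT \<omega>|M. iexp (\<Sum>j\<in>J. \<theta> j * X j \<omega>)))"
  proof (induction qs)
    case (Cons q qs)
    obtain k \<theta> where q: "q = (k, \<theta>)" by (cases q)
    have ik: "integrable M (\<lambda>\<omega>. k * iexp (\<Sum>j\<in>J. \<theta> j * X j \<omega>))" by (rule integrable_mult_right[OF i])
    show ?case
      unfolding q trig_poly_Cons using Cons ik Bochner_Integration.integrable_add[OF ik] i
      by (simp add: Bochner_Integration.integral_add)
  qed simp
  then show "integrable M (\<lambda>\<omega>. trig_poly J qs (\<lambda>j. X j \<omega>))"
    "(LINT \<omega>|M. trig_poly J qs (\<lambda>j. X j \<omega>)) = (\<Sum>(k, \<theta>)\<leftarrow>qs. k * (LINT \<omega>|M. iexp (\<Sum>j\<in>J. \<theta> j * X j \<omega>)))"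
    by blast+
qed

lemma trig_poly_integral_tendsto:
  assumes M: "prob_space M" "prob_space N"
    and V: "\<forall>\<^sub>F L in F. \<forall>j\<in>J. V L j \<in> borel_measurable M" and G: "\<And>j. j \<in> J \<Longrightarrow> G j \<in> borel_measurable N"
    and lim: "\<And>\<theta>. ((\<lambda>L. LINT \<omega>|M. iexp (\<Sum>j\<in>J. \<theta> j * V L j \<omega>)) \<longlongrightarrow> (LINT \<omega>|N. iexp (\<Sum>j\<in>J. \<theta> j * G j \<omega>))) F"
  shows "((\<lambda>L. LINT \<omega>|M. trig_poly J qs (\<lambda>j. V L j \<omega>)) \<longlongrightarrow> (LINT \<omega>|N. trig_poly J qs (\<lambda>j. G j \<omega>))) F"
proof -
  have "((\<lambda>L. \<Sum>(k, \<theta>)\<leftarrow>qs. k * (LINT \<omega>|M. iexp (\<Sum>j\<in>J. \<theta> j * V L j \<omega>))) \<longlongrightarrow>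
      (\<Sum>(k, \<theta>)\<leftarrow>qs. k * (LINT \<omega>|N. iexp (\<Sum>j\<in>J. \<theta> j * G j \<omega>)))) F"
  proof (induction qs)
    case (Cons q qs)
    obtain k \<theta> where q: "q = (k, \<theta>)" by (cases q)
    show ?case
      unfolding q list.map sum_list.Cons prod.case
      by (intro tendsto_add tendsto_mult tendsto_const lim Cons)
  qed simp
  then have "((\<lambda>L. \<Sum>(k, \<theta>)\<leftarrow>qs. k * (LINT \<omega>|M. iexp (\<Sum>j\<in>J. \<theta> j * V L j \<omega>))) \<longlongrightarrow>
      (LINT \<omega>|N. trig_poly J qs (\<lambda>j. G j \<omega>))) F"
    using trig_poly_integral(2)[OF M(2), of J G qs] G by simp
  then show ?thesis
  proof (rule Lim_transform_eventually)
    show "\<forall>\<^sub>F L in F. (\<Sum>(k, \<theta>)\<leftarrow>qs. k * (LINT \<omega>|M. iexp (\<Sum>j\<in>J. \<theta> j * V L j \<omega>))) =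
        (LINT \<omega>|M. trig_poly J qs (\<lambda>j. V L j \<omega>))"
      using V
    proof eventually_elim
      case (elim L)
      then show ?case by (intro trig_poly_integral(2)[OF M(1), symmetric]) auto
    qed
  qed
qed

text \<open>Where all coordinates are at most \<open>R\<close> the cut-off changes nothing;
  elsewhere the error of at most \<open>2 B\<close> is absorbed by \<open>2 B / R^2\<close> times
  the sum of squares, as in Chebyshev's inequality.\<close>

lemma trig_poly_close:
  fixes f :: "('i \<Rightarrow> real) \<Rightarrow> real"
  assumes M: "prob_space M" and J: "finite J"
    and f: "continuous_map (product_topology (\<lambda>_. euclideanreal) J) euclideanreal f"
    and B: "\<And>x. x \<in> (\<Pi>\<^sub>E i\<in>J. UNIV) \<Longrightarrow> \<bar>f x\<bar> \<le> B" and R: "0 < R" and D: "\<And>j. j \<in> J \<Longrightarrow> (LINT \<omega>|M. (X j \<omega>)\<^sup>2) \<le> D"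
    and X: "\<And>j. j \<in> J \<Longrightarrow> X j \<in> borel_measurable M" "\<And>j. j \<in> J \<Longrightarrow> integrable M (\<lambda>\<omega>. (X j \<omega>)\<^sup>2)"
    and qs: "\<And>x. cmod (complex_of_real (f (\<lambda>j\<in>J. tri_wave R (x j))) - trig_poly J qs x) < e"
  shows "cmod (complex_of_real (LINT \<omega>|M. f (\<lambda>j\<in>J. X j \<omega>)) - (LINT \<omega>|M. trig_poly J qs (\<lambda>j. X j \<omega>)))
    \<le> 2 * B * (real (card J) * D) / R\<^sup>2 + e"
proof -
  interpret prob_space M by fact
  have B0: "0 \<le> B" using B[of "\<lambda>j\<in>J. 0"] by force
  have fint: "integrable M (\<lambda>\<omega>. f (\<lambda>j\<in>J. X j \<omega>))"
    by (rule integrable_const_bound[of _ B]) (use B continuous_bounded_measurable[OF J f X(1)] in auto)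
  have pw: "cmod (complex_of_real (f (\<lambda>j\<in>J. x j)) - trig_poly J qs x) \<le> 2 * B * (\<Sum>j\<in>J. (x j)\<^sup>2) / R\<^sup>2 + e" for x
  proof -
    have "\<bar>f (\<lambda>j\<in>J. x j) - f (\<lambda>j\<in>J. tri_wave R (x j))\<bar> \<le> 2 * B * (\<Sum>j\<in>J. (x j)\<^sup>2) / R\<^sup>2"
    proof (cases "\<forall>j\<in>J. \<bar>x j\<bar> \<le> R")
      case True
      then have "(\<lambda>j\<in>J. tri_wave R (x j)) = (\<lambda>j\<in>J. x j)" using R by (intro restrict_ext tri_wave_eq) auto
      then show ?thesis using B0 by (simp add: sum_nonneg)
    next
      case False
      then obtain j where j: "j \<in> J" "R < \<bar>x j\<bar>" by force
      have "R\<^sup>2 \<le> (x j)\<^sup>2" using j R by (metis abs_le_square_iff abs_of_pos less_imp_le)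
      also have "\<dots> \<le> (\<Sum>j\<in>J. (x j)\<^sup>2)" using j J by (intro member_le_sum) auto
      finally have "1 \<le> (\<Sum>j\<in>J. (x j)\<^sup>2) / R\<^sup>2" using R by simp
      from mult_left_mono[OF this, of "2 * B"] have "2 * B \<le> 2 * B * (\<Sum>j\<in>J. (x j)\<^sup>2) / R\<^sup>2" using B0 by simp
      moreover have "\<bar>f (\<lambda>j\<in>J. x j)\<bar> \<le> B" "\<bar>f (\<lambda>j\<in>J. tri_wave R (x j))\<bar> \<le> B" by (intro B; simp)+
      ultimately show ?thesis by linarith
    qed
    then have 1: "cmod (complex_of_real (f (\<lambda>j\<in>J. x j)) - complex_of_real (f (\<lambda>j\<in>J. tri_wave R (x j)))) \<le>
        2 * B * (\<Sum>j\<in>J. (x j)\<^sup>2) / R\<^sup>2"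
      by (simp only: of_real_diff[symmetric] norm_of_real)
    show ?thesis
      using norm_triangle_mono[OF 1 less_imp_le[OF qs[of x]]] by (simp only: diff_add_cancel add_diff_eq) 
  qed
  have iX: "integrable M (\<lambda>\<omega>. \<Sum>j\<in>J. (X j \<omega>)\<^sup>2)" by (rule Bochner_Integration.integrable_sum[OF X(2)])
  have it: "integrable M (\<lambda>\<omega>. trig_poly J qs (\<lambda>j. X j \<omega>))" by (rule trig_poly_integral(1)[OF M X(1)])
  have ifc: "integrable M (\<lambda>\<omega>. complex_of_real (f (\<lambda>j\<in>J. X j \<omega>)))" by (rule integrable_of_real[OF fint])
  have "cmod (complex_of_real (LINT \<omega>|M. f (\<lambda>j\<in>J. X j \<omega>)) - (LINT \<omega>|M. trig_poly J qs (\<lambda>j. X j \<omega>))) =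
    cmod (LINT \<omega>|M. complex_of_real (f (\<lambda>j\<in>J. X j \<omega>)) - trig_poly J qs (\<lambda>j. X j \<omega>))"
    by (simp only: Bochner_Integration.integral_diff[OF ifc it] integral_complex_of_real)
  also have "\<dots> \<le> (LINT \<omega>|M. cmod (complex_of_real (f (\<lambda>j\<in>J. X j \<omega>)) - trig_poly J qs (\<lambda>j. X j \<omega>)))"
    by (rule integral_norm_bound)
  also have "\<dots> \<le> (LINT \<omega>|M. 2 * B / R\<^sup>2 * (\<Sum>j\<in>J. (X j \<omega>)\<^sup>2) + e)"
  proof (rule integral_mono)
    show "integrable M (\<lambda>\<omega>. cmod (complex_of_real (f (\<lambda>j\<in>J. X j \<omega>)) - trig_poly J qs (\<lambda>j. X j \<omega>)))"
      by (rule integrable_norm[OF Bochner_Integration.integrable_diff[OF ifc it]])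
    show "integrable M (\<lambda>\<omega>. 2 * B / R\<^sup>2 * (\<Sum>j\<in>J. (X j \<omega>)\<^sup>2) + e)"
      by (rule Bochner_Integration.integrable_add[OF integrable_mult_right[OF iX] integrable_const])
    show "cmod (complex_of_real (f (\<lambda>j\<in>J. X j \<omega>)) - trig_poly J qs (\<lambda>j. X j \<omega>)) \<le> 2 * B / R\<^sup>2 * (\<Sum>j\<in>J. (X j \<omega>)\<^sup>2) + e" for \<omega>
      using pw[of "\<lambda>j. X j \<omega>"] by simp
  qed
  also have "\<dots> = 2 * B / R\<^sup>2 * (\<Sum>j\<in>J. LINT \<omega>|M. (X j \<omega>)\<^sup>2) + e"
    using iX X(2) by (simp add: Bochner_Integration.integral_sum prob_space)
  also have "\<dots> \<le> 2 * B / R\<^sup>2 * (\<Sum>j\<in>J. D) + e"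
    using B0 D by (intro add_right_mono mult_left_mono sum_mono) auto
  finally show ?thesis by simp
qed

text \<open>Tightness comes from the bound on the second moments.\<close>

lemma iexp_tendsto_imp_weak:
  fixes f :: "('i \<Rightarrow> real) \<Rightarrow> real"
  assumes M: "prob_space M" "prob_space N" and J: "finite J"
    and V: "\<forall>\<^sub>F L in F. \<forall>j\<in>J. V L j \<in> borel_measurable M \<and> integrable M (\<lambda>\<omega>. (V L j \<omega>)\<^sup>2) \<and> (LINT \<omega>|M. (V L j \<omega>)\<^sup>2) \<le> D"
    and G: "\<And>j. j \<in> J \<Longrightarrow> G j \<in> borel_measurable N \<and> integrable N (\<lambda>\<omega>. (G j \<omega>)\<^sup>2) \<and> (LINT \<omega>|N. (G j \<omega>)\<^sup>2) \<le> D"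
    and lim: "\<And>\<theta>. ((\<lambda>L. LINT \<omega>|M. iexp (\<Sum>j\<in>J. \<theta> j * V L j \<omega>)) \<longlongrightarrow> (LINT \<omega>|N. iexp (\<Sum>j\<in>J. \<theta> j * G j \<omega>))) F"
    and f: "continuous_map (product_topology (\<lambda>_. euclideanreal) J) euclideanreal f"
    and B: "bounded (f ` (\<Pi>\<^sub>E i\<in>J. UNIV))"
  shows "((\<lambda>L. LINT \<omega>|M. f (\<lambda>j\<in>J. V L j \<omega>)) \<longlongrightarrow> (LINT \<omega>|N. f (\<lambda>j\<in>J. G j \<omega>))) F"
proof (rule tendstoI)
  fix e :: real assume e: "0 < e"
  obtain B where B: "\<And>x. x \<in> (\<Pi>\<^sub>E i\<in>J. UNIV) \<Longrightarrow> \<bar>f x\<bar> \<le> B"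
    using B unfolding bounded_iff by auto
  define Q where "Q = \<bar>2 * B * (real (card J) * D)\<bar>"
  \<comment> \<open>Makes the tail term at most \<open>e / 4\<close>. The total error is then twice
    \<open>e / 4 + e / 8\<close> for the two approximations plus \<open>e / 8\<close> for the
    convergence of the trigonometric polynomials.\<close>
  define R where "R = sqrt (1 + 4 * Q / e)"
  have Q0: "0 \<le> Q" by (simp add: Q_def)
  have R1: "0 < 1 + 4 * Q / e" using Q0 e by (intro add_pos_nonneg) auto
  have R: "0 < R" "R\<^sup>2 = 1 + 4 * Q / e" using R1 by (auto simp: R_def)
  have QR: "2 * B * (real (card J) * D) / R\<^sup>2 \<le> e / 4"
  proof -
    have "2 * B * (real (card J) * D) \<le> e / 4 * (1 + 4 * Q / e)" using e Q_def by (simp add: distrib_left)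
    then show ?thesis unfolding R(2) using R1 by (simp only: pos_divide_le_eq)
  qed
  obtain qs where qs: "\<And>x. cmod (complex_of_real (f (\<lambda>j\<in>J. tri_wave R (x j))) - trig_poly J qs x) < e / 8"
    using trig_poly_approx[OF J f R(1), of "e / 8"] e by auto
  have "((\<lambda>L. LINT \<omega>|M. trig_poly J qs (\<lambda>j. V L j \<omega>)) \<longlongrightarrow> (LINT \<omega>|N. trig_poly J qs (\<lambda>j. G j \<omega>))) F"
  proof (rule trig_poly_integral_tendsto[OF M _ _ lim])
    show "\<forall>\<^sub>F L in F. \<forall>j\<in>J. V L j \<in> borel_measurable M" using V by eventually_elim blast
    show "G j \<in> borel_measurable N" if "j \<in> J" for j using G[OF that] by blast
  qed
  from tendstoD[OF this, of "e / 8"] e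
  have "\<forall>\<^sub>F L in F. dist (LINT \<omega>|M. trig_poly J qs (\<lambda>j. V L j \<omega>)) (LINT \<omega>|N. trig_poly J qs (\<lambda>j. G j \<omega>)) < e / 8" by simp
  then show "\<forall>\<^sub>F L in F. dist (LINT \<omega>|M. f (\<lambda>j\<in>J. V L j \<omega>)) (LINT \<omega>|N. f (\<lambda>j\<in>J. G j \<omega>)) < e"
    using V
  proof eventually_elim
    case (elim L)
    let ?a = "complex_of_real (LINT \<omega>|M. f (\<lambda>j\<in>J. V L j \<omega>))" and ?b = "LINT \<omega>|M. trig_poly J qs (\<lambda>j. V L j \<omega>)"
    let ?d = "complex_of_real (LINT \<omega>|N. f (\<lambda>j\<in>J. G j \<omega>))" and ?c = "LINT \<omega>|N. trig_poly J qs (\<lambda>j. G j \<omega>)"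
    have 1: "dist ?a ?b \<le> e / 4 + e / 8"
      unfolding dist_norm
      by (rule order_trans[OF trig_poly_close[OF M(1) J f B R(1) _ _ _ qs] add_right_mono[OF QR]])
        (use elim(2) in auto)
    have 2: "dist ?d ?c \<le> e / 4 + e / 8"
      unfolding dist_norm
      by (rule order_trans[OF trig_poly_close[OF M(2) J f B R(1) _ _ _ qs] add_right_mono[OF QR]])
        (use G in auto)
    have "dist ?a ?d < e"
      using 1 2 elim(1) dist_triangle[of ?a ?d ?b] dist_triangle[of ?b ?d ?c] e by (simp add: dist_commute)
    then show ?case by (simp only: dist_of_real)
  qed
qed

section \<open>Gaussian processes\<close>

definition psd_on :: "'i set \<Rightarrow> ('i \<Rightarrow> 'i \<Rightarrow> real) \<Rightarrow> bool" where
  "psd_on J K \<longleftrightarrow> (\<forall>i\<in>J. \<forall>j\<in>J. K i j = K j i) \<and> (\<forall>a. 0 \<le> (\<Sum>i\<in>J. \<Sum>j\<in>J. a i * a j * K i j))"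

lemma quadratic_form_extend:
  fixes K :: "'i \<Rightarrow> 'i \<Rightarrow> real"
  assumes "J' \<subseteq> J" "finite J"
  shows "(\<Sum>i\<in>J. \<Sum>j\<in>J. (if i \<in> J' then a i else 0) * (if j \<in> J' then a j else 0) * K i j) =
    (\<Sum>i\<in>J'. \<Sum>j\<in>J'. a i * a j * K i j)"
proof -
  let ?b = "\<lambda>i. if i \<in> J' then a i else 0"
  have fin: "finite J'" using assms by (rule finite_subset)
  have "(\<Sum>j\<in>J. ?b i * ?b j * K i j) = (\<Sum>j\<in>J'. ?b i * a j * K i j)" for i
    using assms by (intro sum.mono_neutral_cong_right) auto
  then have "(\<Sum>i\<in>J. \<Sum>j\<in>J. ?b i * ?b j * K i j) = (\<Sum>i\<in>J. \<Sum>j\<in>J'. ?b i * a j * K i j)" by simp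
  also have "\<dots> = (\<Sum>i\<in>J'. \<Sum>j\<in>J'. a i * a j * K i j)"
    using assms fin by (intro sum.mono_neutral_cong_right) auto
  finally show ?thesis .
qed

lemma psd_on_subset:
  assumes "psd_on J K" "J' \<subseteq> J" "finite J"
  shows "psd_on J' K"
  unfolding psd_on_def
proof (intro conjI allI ballI)
  show "K i j = K j i" if "i \<in> J'" "j \<in> J'" for i j using assms that unfolding psd_on_def by blast
  fix a :: "'a \<Rightarrow> real"
  let ?b = "\<lambda>i. if i \<in> J' then a i else 0"
  have "0 \<le> (\<Sum>i\<in>J. \<Sum>j\<in>J. ?b i * ?b j * K i j)"
    using assms(1) unfolding psd_on_def by (elim conjE allE[of _ ?b])
  then show "0 \<le> (\<Sum>i\<in>J'. \<Sum>j\<in>J'. a i * a j * K i j)"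
    unfolding quadratic_form_extend[OF assms(2,3)] .
qed

lemma quadratic_form_insert:
  fixes K :: "'i \<Rightarrow> 'i \<Rightarrow> real"
  assumes "finite J" "p \<notin> J" "\<And>i. i \<in> J \<Longrightarrow> K p i = K i p"
  shows "(\<Sum>i\<in>insert p J. \<Sum>j\<in>insert p J. a i * a j * K i j) =
    a p * a p * K p p + 2 * a p * (\<Sum>i\<in>J. a i * K i p) + (\<Sum>i\<in>J. \<Sum>j\<in>J. a i * a j * K i j)"
proof -
  have "(\<Sum>j\<in>J. a p * a j * K p j) = a p * (\<Sum>i\<in>J. a i * K i p)"
    using assms(3) by (simp add: sum_distrib_left mult.assoc)
  moreover have "(\<Sum>i\<in>J. a i * a p * K i p) = a p * (\<Sum>i\<in>J. a i * K i p)"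
    by (simp add: sum_distrib_left mult_ac)
  ultimately show ?thesis using assms(1,2) by (simp add: sum.distrib)
qed

text \<open>Cholesky factorisation, by induction on the Schur complement.\<close>

lemma psd_on_factor:
  assumes "finite J" "psd_on J K"
  shows "\<exists>A. \<forall>i\<in>J. \<forall>j\<in>J. K i j = (\<Sum>l\<in>J. A i l * A j l :: real)"
  using assms
proof (induction J arbitrary: K rule: finite_induct)
  case (insert p J)
  have sym: "K i j = K j i" if "i \<in> insert p J" "j \<in> insert p J" for i j
    using insert.prems that unfolding psd_on_def by blast
  have nonneg: "0 \<le> a p * a p * K p p + 2 * a p * (\<Sum>i\<in>J. a i * K i p) + (\<Sum>i\<in>J. \<Sum>j\<in>J. a i * a j * K i j)" for a
  proof -
    have "0 \<le> (\<Sum>i\<in>insert p J. \<Sum>j\<in>insert p J. a i * a j * K i j)"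
      using insert.prems unfolding psd_on_def by (elim conjE allE[of _ a])
    moreover have "K p i = K i p" if "i \<in> J" for i using that by (intro sym) auto
    ultimately show ?thesis by (simp only: quadratic_form_insert[OF insert.hyps])
  qed
  have pp: "0 \<le> K p p"
  proof -
    let ?a = "\<lambda>i. if i = p then 1 else (0 :: real)"
    have "?a i = 0" if "i \<in> J" for i using that insert.hyps(2) by auto
    then have "(\<Sum>i\<in>J. ?a i * K i p) = 0" "(\<Sum>i\<in>J. \<Sum>j\<in>J. ?a i * ?a j * K i j) = 0"
      by (intro sum.neutral ballI; simp)+
    then show ?thesis using nonneg[of ?a] by simp
  qed
  show ?case
  proof (cases "K p p = 0")
    case True
    have zero: "K i p = 0" if i: "i \<in> J" for i
    proof (rule ccontr)
      assume ne: "K i p \<noteq> 0"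
      \<comment> \<open>Chosen so that the quadratic form takes the value
        \<open>2 t K i p + K i i = -1\<close>, contradicting non-negativity.\<close>
      define t where "t = - (K i i + 1) / (2 * K i p)"
      have ip: "i \<noteq> p" using i insert.hyps(2) by auto
      let ?a = "\<lambda>j. if j = p then t else if j = i then 1 else 0"
      have "(\<Sum>j\<in>J. ?a j * K j p) = (\<Sum>j\<in>J. if j = i then K i p else 0)"
        using insert.hyps(2) by (intro sum.cong) auto
      moreover have "(\<Sum>k\<in>J. \<Sum>j\<in>J. ?a k * ?a j * K k j) = (\<Sum>k\<in>J. if k = i then K i i else 0)"
      proof (intro sum.cong refl)
        fix k assume k: "k \<in> J"
        have "(\<Sum>j\<in>J. ?a k * ?a j * K k j) = (\<Sum>j\<in>J. if j = i then ?a k * K k i else 0)"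
          using insert.hyps(2) by (intro sum.cong) auto
        then show "(\<Sum>j\<in>J. ?a k * ?a j * K k j) = (if k = i then K i i else 0)"
          using i k insert.hyps by auto
      qed
      ultimately have "0 \<le> 2 * t * K i p + K i i"
        using nonneg[of ?a] True i insert.hyps(1) by simp
      moreover have "2 * t * K i p = - (K i i + 1)" using ne by (simp add: t_def field_simps)
      ultimately show False by simp
    qed
    have "psd_on J K" using psd_on_subset[OF insert.prems] insert.hyps(1) by auto
    then obtain A where A: "\<And>i j. i \<in> J \<Longrightarrow> j \<in> J \<Longrightarrow> K i j = (\<Sum>l\<in>J. A i l * A j l)"
      using insert.IH[of K] by auto
    let ?A = "\<lambda>i l. if i = p \<or> l = p then 0 else A i l"
    have "K i j = (\<Sum>l\<in>insert p J. ?A i l * ?A j l)" if ij: "i \<in> insert p J" "j \<in> insert p J" for i j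
    proof -
      have "(\<Sum>l\<in>insert p J. ?A i l * ?A j l) = (\<Sum>l\<in>J. ?A i l * ?A j l)"
        using insert.hyps by simp
      also have "\<dots> = (if i = p \<or> j = p then 0 else (\<Sum>l\<in>J. A i l * A j l))"
        using insert.hyps(2) by (auto intro!: sum.cong sum.neutral)
      also have "\<dots> = K i j"
        using ij A[of i j] zero sym[of p j] sym[of p i] True by auto
      finally show ?thesis by simp
    qed
    then show ?thesis by (intro exI[of _ ?A] ballI)
  next
    case False
    then have kp: "0 < K p p" using pp by simp
    \<comment> \<open>The Schur complement of the entry at \<open>p\<close>.\<close>
    define K' where "K' i j = K i j - K i p * K j p / K p p" for i j
    have "psd_on J K'"
      unfolding psd_on_def
    proof (intro conjI allI ballI)
      show "K' i j = K' j i" if "i \<in> J" "j \<in> J" for i j using sym[of i j] that by (simp add: K'_def)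
      fix a :: "'a \<Rightarrow> real"
      define s where "s = (\<Sum>i\<in>J. a i * K i p)"
      \<comment> \<open>The coefficient at \<open>p\<close> minimises the form for given
        coefficients on \<open>J\<close>; the minimum is the form of \<open>K'\<close>.\<close>
      define b where "b i = (if i = p then - s / K p p else a i)" for i
      have b1: "(\<Sum>i\<in>J. b i * K i p) = s"
        unfolding s_def using insert.hyps(2) by (intro sum.cong) (auto simp: b_def)
      have b2: "(\<Sum>i\<in>J. \<Sum>j\<in>J. b i * b j * K i j) = (\<Sum>i\<in>J. \<Sum>j\<in>J. a i * a j * K i j)"
        using insert.hyps(2) by (intro sum.cong refl) (auto simp: b_def)
      have "(\<Sum>i\<in>J. \<Sum>j\<in>J. a i * a j * (K i p * K j p / K p p)) = s * s / K p p"
        unfolding s_def sum_product sum_divide_distrib by (intro sum.cong refl) (simp add: mult_ac)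
      then have "(\<Sum>i\<in>J. \<Sum>j\<in>J. a i * a j * K' i j) = (\<Sum>i\<in>J. \<Sum>j\<in>J. a i * a j * K i j) - s * s / K p p"
        unfolding K'_def right_diff_distrib sum_subtractf by simp
      moreover have "b p * b p * K p p + 2 * b p * s = - (s * s / K p p)"
        using kp by (simp add: b_def field_simps)
      ultimately show "0 \<le> (\<Sum>i\<in>J. \<Sum>j\<in>J. a i * a j * K' i j)"
        using nonneg[of b] unfolding b1 b2 by simp
    qed
    then obtain A where A: "\<And>i j. i \<in> J \<Longrightarrow> j \<in> J \<Longrightarrow> K' i j = (\<Sum>l\<in>J. A i l * A j l)"
      using insert.IH[of K'] by auto
    let ?A = "\<lambda>i l. if l = p then K i p / sqrt (K p p) else if i = p then 0 else A i l"
    have "K i j = (\<Sum>l\<in>insert p J. ?A i l * ?A j l)" if ij: "i \<in> insert p J" "j \<in> insert p J" for i j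
    proof -
      have "(\<Sum>l\<in>insert p J. ?A i l * ?A j l) = K i p * K j p / K p p + (\<Sum>l\<in>J. ?A i l * ?A j l)"
        using insert.hyps kp by simp
      also have "(\<Sum>l\<in>J. ?A i l * ?A j l) = (if i = p \<or> j = p then 0 else (\<Sum>l\<in>J. A i l * A j l))"
        using insert.hyps(2) by (auto intro!: sum.cong sum.neutral)
      also have "K i p * K j p / K p p + \<dots> = K i j"
        using ij A[of i j] sym[of p j] kp by (auto simp: K'_def)
      finally show ?thesis by simp
    qed
    then show ?thesis by (intro exI[of _ ?A] ballI)
  qed
qed simp

text \<open>Levy's uniqueness theorem identifies the law. The degenerate case is separate because a
  point mass has no density.\<close>

lemma iexp_imp_normal:
  assumes N: "prob_space N" and V: "V \<in> borel_measurable N" and v: "0 \<le> v"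
    and char: "\<And>t. (LINT \<omega>|N. iexp (t * V \<omega>)) = complex_of_real (exp (- (t\<^sup>2 * v) / 2))"
  shows "(v = 0 \<longrightarrow> (AE \<omega> in N. V \<omega> = 0)) \<and> (0 < v \<longrightarrow> distributed N lborel V (normal_density 0 (sqrt v)))"
proof (intro conjI impI)
  interpret prob_space N by fact
  have char_distr: "char (distr N borel W) t = (LINT \<omega>|N. iexp (t * W \<omega>))" if "W \<in> borel_measurable N" for W t
    unfolding char_def using that by (subst integral_distr) auto
  {
    assume v0: "v = 0"
    have rd: "real_distribution (return borel (0 :: real))"
      by (auto simp: real_distribution_def real_distribution_axioms_def prob_space_return)
    have "distr N borel V = return borel 0"
    proof (rule Levy_uniqueness)
      show "real_distribution (distr N borel V)" using V by (rule real_distribution_distr)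
      show "real_distribution (return borel (0 :: real))" by (rule rd)
      have "char (return borel 0) t = 1" for t
        unfolding char_def by (subst integral_return) auto
      then show "char (distr N borel V) = char (return borel 0)"
        using char v0 char_distr[OF V] by (simp add: fun_eq_iff)
    qed
    then have "AE x in distr N borel V. x = 0" by (simp only:) (subst AE_return, auto)
    then show "AE \<omega> in N. V \<omega> = 0" using V by (subst (asm) AE_distr_iff) auto
  }
  {
    assume v1: "0 < v"
    let ?W = "\<lambda>\<omega>. V \<omega> / sqrt v"
    have W: "?W \<in> borel_measurable N" using V by measurable
    have "distr N borel ?W = std_normal_distribution"
    proof (rule Levy_uniqueness)
      show "real_distribution (distr N borel ?W)" using W by (rule real_distribution_distr)
      show "real_distribution std_normal_distribution" by (rule real_dist_normal_dist)
      have "(LINT \<omega>|N. iexp (t * ?W \<omega>)) = complex_of_real (exp (- t\<^sup>2 / 2))" for t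
        using char[of "t / sqrt v"] v1 by (simp add: power_divide)
      then show "char (distr N borel ?W) = char std_normal_distribution"
        unfolding char_std_normal_distribution using char_distr[OF W] by (simp add: fun_eq_iff)
    qed
    then have "distr N lborel ?W = density lborel std_normal_density"
      by (metis distr_cong sets_lborel)
    then have "distributed N lborel ?W std_normal_density"
      using W by (auto simp: distributed_def)
    from normal_density_affine[OF this, of "sqrt v" 0]
    show "distributed N lborel V (normal_density 0 (sqrt v))" using v1 by simp
  }
qed

lemma normal_second_moment:
  assumes N: "prob_space N" and V: "V \<in> borel_measurable N" and v: "0 \<le> v"
    and char: "\<And>t. (LINT \<omega>|N. iexp (t * V \<omega>)) = complex_of_real (exp (- (t\<^sup>2 * v) / 2))"
  shows "(LINT \<omega>|N. V \<omega>) = 0" "integrable N (\<lambda>\<omega>. (V \<omega>)\<^sup>2)" "(LINT \<omega>|N. (V \<omega>)\<^sup>2) = v"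
proof -
  interpret prob_space N by fact
  have *: "(LINT \<omega>|N. V \<omega>) = 0 \<and> integrable N (\<lambda>\<omega>. (V \<omega>)\<^sup>2) \<and> (LINT \<omega>|N. (V \<omega>)\<^sup>2) = v"
  proof (cases "v = 0")
    case True
    then have ae: "AE \<omega> in N. V \<omega> = 0" using iexp_imp_normal[OF assms] by simp
    then have ae2: "AE \<omega> in N. (V \<omega>)\<^sup>2 = 0" by eventually_elim simp
    have 1: "(LINT \<omega>|N. V \<omega>) = (LINT \<omega>|N. 0)" by (rule integral_cong_AE) (use ae V in auto)
    have 2: "(LINT \<omega>|N. (V \<omega>)\<^sup>2) = (LINT \<omega>|N. 0)" by (rule integral_cong_AE) (use ae2 V in auto)
    have 3: "integrable N (\<lambda>\<omega>. (V \<omega>)\<^sup>2) \<longleftrightarrow> integrable N (\<lambda>\<omega>. 0 :: real)"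
      by (rule integrable_cong_AE) (use ae2 V in auto)
    show ?thesis using 1 2 3 True by simp
  next
    case False
    then have d: "distributed N lborel V (normal_density 0 (sqrt v))" and s: "0 < sqrt v"
      using iexp_imp_normal[OF assms] v by auto
    have mean: "(LINT \<omega>|N. V \<omega>) = 0" by (rule normal_distributed_expectation[OF s d])
    have "variance V = (sqrt v)\<^sup>2" by (rule normal_distributed_variance[OF s d])
    then have var: "(LINT \<omega>|N. (V \<omega>)\<^sup>2) = v" using mean v by simp
    \<comment> \<open>An integral that does not exist has the value 0, while this one is
      \<open>v\<close>, which is not 0.\<close>
    moreover have "integrable N (\<lambda>\<omega>. (V \<omega>)\<^sup>2)"
      using not_integrable_integral_eq[of N "\<lambda>\<omega>. (V \<omega>)\<^sup>2"] var False by blast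
    ultimately show ?thesis using mean by blast
  qed
  then show "(LINT \<omega>|N. V \<omega>) = 0" "integrable N (\<lambda>\<omega>. (V \<omega>)\<^sup>2)" "(LINT \<omega>|N. (V \<omega>)\<^sup>2) = v" by blast+
qed

text \<open>The weak convergence criterion, applied to the constant sequence \<open>P\<close> with
  limit \<open>Q\<close>, shows that bounded continuous functions have equal integrals. These
  approximate indicators of closed boxes, a generator closed under intersections. The second moments
  enter through that criterion.\<close>

lemma PiM_eqI_iexp:
  fixes P Q :: "('i \<Rightarrow> real) measure"
  assumes J: "finite J" and P: "prob_space P" "sets P = sets (PiM J (\<lambda>_. borel))"
    and Q: "prob_space Q" "sets Q = sets (PiM J (\<lambda>_. borel))"
    and P2: "\<And>j. j \<in> J \<Longrightarrow> integrable P (\<lambda>x. (x j)\<^sup>2)" and Q2: "\<And>j. j \<in> J \<Longrightarrow> integrable Q (\<lambda>x. (x j)\<^sup>2)"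
    and char: "\<And>\<theta>. (LINT x|P. iexp (\<Sum>j\<in>J. \<theta> j * x j)) = (LINT x|Q. iexp (\<Sum>j\<in>J. \<theta> j * x j))"
  shows "P = Q"
proof -
  interpret P: prob_space P by fact
  interpret Q: prob_space Q by fact
  let ?Om = "\<Pi>\<^sub>E j\<in>J. (UNIV :: real set)"
  have spP: "space P = ?Om" "space Q = ?Om"
    using sets_eq_imp_space_eq[OF P(2)] sets_eq_imp_space_eq[OF Q(2)] by (simp_all add: space_PiM)
  have coordP: "(\<lambda>x. x j) \<in> borel_measurable P" "(\<lambda>x. x j) \<in> borel_measurable Q" if "j \<in> J" for j
    using measurable_component_singleton[OF that, of "\<lambda>_. borel"] P(2) Q(2) measurable_cong_sets by blast+
  have weak: "(LINT x|P. f x) = (LINT x|Q. f x)"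
    if f: "continuous_map (product_topology (\<lambda>_. euclideanreal) J) euclideanreal f"
      and B: "bounded (f ` (\<Pi>\<^sub>E i\<in>J. UNIV))" for f :: "('i \<Rightarrow> real) \<Rightarrow> real"
  proof -
    define D where "D = (\<Sum>j\<in>J. (LINT x|P. (x j)\<^sup>2) + (LINT x|Q. (x j)\<^sup>2))"
    have D: "(LINT x|P. (x j)\<^sup>2) \<le> D" "(LINT x|Q. (x j)\<^sup>2) \<le> D" if "j \<in> J" for j
    proof -
      have n: "0 \<le> (LINT x|P. (x j)\<^sup>2)" "0 \<le> (LINT x|Q. (x j)\<^sup>2)" for j by simp_all
      have "(LINT x|P. (x j)\<^sup>2) + (LINT x|Q. (x j)\<^sup>2) \<le> D"
        unfolding D_def using that J n by (intro member_le_sum) (auto intro: add_nonneg_nonneg)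
      then show "(LINT x|P. (x j)\<^sup>2) \<le> D" "(LINT x|Q. (x j)\<^sup>2) \<le> D" using n[of j] by linarith+
    qed
    have "((\<lambda>L :: nat. LINT x|P. f (\<lambda>j\<in>J. x j)) \<longlongrightarrow> (LINT x|Q. f (\<lambda>j\<in>J. x j))) sequentially"
    proof (rule iexp_tendsto_imp_weak[OF P(1) Q(1) J _ _ _ f B])
      show "\<forall>\<^sub>F L in sequentially. \<forall>j\<in>J. (\<lambda>x. x j) \<in> borel_measurable P \<and> integrable P (\<lambda>x. (x j)\<^sup>2) \<and> (LINT x|P. (x j)\<^sup>2) \<le> D"
        using coordP P2 D by (intro always_eventually) auto
      show "(\<lambda>x. x j) \<in> borel_measurable Q \<and> integrable Q (\<lambda>x. (x j)\<^sup>2) \<and> (LINT x|Q. (x j)\<^sup>2) \<le> D" if "j \<in> J" for j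
        using coordP Q2 D that by auto
      show "((\<lambda>L. LINT x|P. iexp (\<Sum>j\<in>J. \<theta> j * x j)) \<longlongrightarrow> (LINT x|Q. iexp (\<Sum>j\<in>J. \<theta> j * x j))) sequentially" for \<theta>
        unfolding char by (rule tendsto_const)
    qed
    then have eq: "(LINT x|P. f (\<lambda>j\<in>J. x j)) = (LINT x|Q. f (\<lambda>j\<in>J. x j))"
      by (rule LIMSEQ_unique[OF tendsto_const])
    have "(LINT x|P. f (\<lambda>j\<in>J. x j)) = (LINT x|P. f x)" "(LINT x|Q. f (\<lambda>j\<in>J. x j)) = (LINT x|Q. f x)"
      using spP by (auto intro!: Bochner_Integration.integral_cong)
    then show ?thesis using eq by simp
  qed
  have box: "emeasure P (Pi\<^sub>E J C) = emeasure Q (Pi\<^sub>E J C)" if C: "\<And>j. j \<in> J \<Longrightarrow> closed (C j)" for C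
  \<comment> \<open>An empty side is treated apart, since \<open>infdist\<close> to the empty set is
    0 and would not separate points from it.\<close>
  proof (cases "\<exists>j\<in>J. C j = {}")
    case True
    then have "Pi\<^sub>E J C = {}" by (auto simp: PiE_eq_empty_iff)
    then show ?thesis by simp
  next
    case False
    \<comment> \<open>A continuous bump that is 1 on \<open>C j\<close> and, for
      \<open>n > 0\<close>, vanishes at distance \<open>1 / n\<close> or more from it.\<close>
    define g where "g n j t = max 0 (1 - real n * infdist t (C j))" for n j t
    define f where "f n x = (\<Prod>j\<in>J. g n j (x j))" for n and x :: "'i \<Rightarrow> real"
    have g01: "0 \<le> g n j t" "g n j t \<le> 1" for n j t by (auto simp: g_def infdist_nonneg)
    have f01: "0 \<le> f n x" "f n x \<le> 1" for n x
      unfolding f_def using g01 by (auto intro!: prod_nonneg prod_le_1)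
    have cont: "continuous_map (product_topology (\<lambda>_. euclideanreal) J) euclideanreal (f n)" for n
    proof -
      have "continuous_map (product_topology (\<lambda>_. euclideanreal) J) euclideanreal (\<lambda>x. g n j (x j))" if "j \<in> J" for j
      proof -
        have 1: "continuous_map (product_topology (\<lambda>_. euclideanreal) J) euclideanreal (\<lambda>x. x j)"
          by (rule continuous_map_product_projection[OF that])
        have "continuous_on UNIV (g n j)" unfolding g_def by (intro continuous_intros)
        then have 2: "continuous_map euclideanreal euclideanreal (g n j)" by simp
        show ?thesis using continuous_map_compose[OF 1 2] by (simp add: o_def)
      qed
      then show ?thesis unfolding f_def by (intro continuous_map_prod J) auto
    qed
    have bdd: "bounded (f n ` (\<Pi>\<^sub>E i\<in>J. UNIV))" for n
      unfolding bounded_iff using f01 by (intro exI[of _ 1]) auto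
    have fm: "f n \<in> borel_measurable P" "f n \<in> borel_measurable Q" for n
    proof -
      have "(\<lambda>x. f n (\<lambda>j\<in>J. x j)) \<in> borel_measurable P" "(\<lambda>x. f n (\<lambda>j\<in>J. x j)) \<in> borel_measurable Q"
        by (intro continuous_bounded_measurable[OF J cont] coordP; assumption)+
      moreover have "f n (\<lambda>j\<in>J. x j) = f n x" for x unfolding f_def by (intro prod.cong) auto
      ultimately show "f n \<in> borel_measurable P" "f n \<in> borel_measurable Q" by simp_all
    qed
    have lim: "(\<lambda>n. f n x) \<longlonglongrightarrow> indicator (Pi\<^sub>E J C) x" if x: "x \<in> ?Om" for x
    proof -
      have g_lim: "(\<lambda>n. g n j (x j)) \<longlonglongrightarrow> indicator (C j) (x j)" if j: "j \<in> J" for j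
      proof (cases "x j \<in> C j")
        case True
        then show ?thesis by (simp add: g_def)
      next
        case xC: False
        have "0 < infdist (x j) (C j)"
          using infdist_pos_not_in_closed[OF C[OF j] _ xC] False j by auto
        then obtain n0 where n0: "1 < real n0 * infdist (x j) (C j)" using reals_Archimedean3 by blast
        have "\<forall>\<^sub>F n in sequentially. g n j (x j) = 0"
          using eventually_ge_at_top[of n0]
        proof eventually_elim
          case (elim n)
          have "real n0 * infdist (x j) (C j) \<le> real n * infdist (x j) (C j)"
            using elim by (intro mult_right_mono) (auto simp: infdist_nonneg)
          then show ?case using n0 by (simp add: g_def)
        qed
        then show ?thesis using xC by (simp add: tendsto_eventually)
      qed
      have "(\<lambda>n. f n x) \<longlonglongrightarrow> (\<Prod>j\<in>J. indicator (C j) (x j))"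
        unfolding f_def by (intro tendsto_prod g_lim)
      also have "(\<Prod>j\<in>J. indicator (C j) (x j) :: real) = indicator (Pi\<^sub>E J C) x"
      proof (cases "x \<in> Pi\<^sub>E J C")
        case True
        then show ?thesis by (auto simp: PiE_iff intro!: prod.neutral)
      next
        case False
        then obtain j where "j \<in> J" "x j \<notin> C j" using x by (auto simp: PiE_iff)
        then show ?thesis using J False by (auto intro!: prod_zero bexI[of _ j])
      qed
      finally show ?thesis .
    qed
    have bs: "Pi\<^sub>E J C \<in> sets P" "Pi\<^sub>E J C \<in> sets Q"
      unfolding P(2) Q(2) using C by (auto intro!: sets_PiM_I_finite J borel_closed)
    have "(\<lambda>n. LINT x|P. f n x) \<longlonglongrightarrow> (LINT x|P. indicator (Pi\<^sub>E J C) x)"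
      by (rule integral_dominated_convergence[where w = "\<lambda>_. 1"]) (use lim f01 fm bs spP in auto)
    moreover have "(\<lambda>n. LINT x|Q. f n x) \<longlonglongrightarrow> (LINT x|Q. indicator (Pi\<^sub>E J C) x)"
      by (rule integral_dominated_convergence[where w = "\<lambda>_. 1"]) (use lim f01 fm bs spP in auto)
    moreover have "(LINT x|P. f n x) = (LINT x|Q. f n x)" for n by (rule weak[OF cont bdd])
    ultimately have "(LINT x|P. indicator (Pi\<^sub>E J C) x :: real) = (LINT x|Q. indicator (Pi\<^sub>E J C) x)"
      using LIMSEQ_unique by auto
    then have "measure P (Pi\<^sub>E J C) = measure Q (Pi\<^sub>E J C)" using bs by simp
    then show ?thesis by (simp add: P.emeasure_eq_measure Q.emeasure_eq_measure)
  qed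
  define \<E> where "\<E> = {Pi\<^sub>E J C |C. \<forall>j\<in>J. closed (C j :: real set)}"
  show ?thesis
  proof (rule measure_eqI_generator_eq[where E = \<E> and \<Omega> = ?Om and A = "\<lambda>_. ?Om"])
    show "Int_stable \<E>"
    proof (rule Int_stableI)
      fix a b assume "a \<in> \<E>" "b \<in> \<E>"
      then obtain C D where "a = Pi\<^sub>E J C" "b = Pi\<^sub>E J D" "\<forall>j\<in>J. closed (C j)" "\<forall>j\<in>J. closed (D j)"
        unfolding \<E>_def by blast
      then have "a \<inter> b = Pi\<^sub>E J (\<lambda>j. C j \<inter> D j)" "\<forall>j\<in>J. closed (C j \<inter> D j)"
        by (auto simp: PiE_Int)
      then show "a \<inter> b \<in> \<E>" unfolding \<E>_def by blast
    qed
    show sub: "\<E> \<subseteq> Pow ?Om" by (auto simp: \<E>_def)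
    show "emeasure P X = emeasure Q X" if "X \<in> \<E>" for X using that box by (auto simp: \<E>_def)
    have S: "sets (PiM J (\<lambda>_. borel :: real measure)) = sigma_sets ?Om \<E>"
    proof -
      have "sets (PiM J (\<lambda>_. sigma (UNIV :: real set) (Collect closed))) =
        sets (sigma ?Om {{f \<in> ?Om. \<forall>i\<in>j. f i \<in> A i} |A j. j \<in> {J} \<and> A \<in> Pi j (\<lambda>_. Collect (closed :: real set \<Rightarrow> bool))})"
        by (rule sets_PiM_sigma) (use J in \<open>auto intro!: exI[of _ "{UNIV}"]\<close>)
      also have "{{f \<in> ?Om. \<forall>i\<in>j. f i \<in> A i} |A j. j \<in> {J} \<and> A \<in> Pi j (\<lambda>_. Collect (closed :: real set \<Rightarrow> bool))} = \<E>"
      proof -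
        have boxes: "{f \<in> ?Om. \<forall>i\<in>J. f i \<in> A i} = Pi\<^sub>E J A" for A
          unfolding set_eq_iff mem_Collect_eq PiE_iff by blast
        have "{{f \<in> ?Om. \<forall>i\<in>j. f i \<in> A i} |A j. j \<in> {J} \<and> A \<in> Pi j (\<lambda>_. Collect (closed :: real set \<Rightarrow> bool))} =
            {{f \<in> ?Om. \<forall>i\<in>J. f i \<in> A i} |A. \<forall>j\<in>J. closed (A j)}"
          by (simp add: Pi_def Ball_def)
        also have "\<dots> = \<E>" unfolding \<E>_def boxes ..
        finally show ?thesis .
      qed
      finally show ?thesis
        unfolding borel_eq_closed[symmetric] sets_measure_of[OF sub] .
    qed
    show "sets P = sigma_sets ?Om \<E>" "sets Q = sigma_sets ?Om \<E>" by (simp_all only: P(2) Q(2) S)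
    show "range (\<lambda>_ :: nat. ?Om) \<subseteq> \<E>" unfolding \<E>_def
      by (intro image_subsetI CollectI exI[of _ "\<lambda>_. UNIV"]) simp
    show "(\<Union>i :: nat. ?Om) = ?Om" by simp
    show "emeasure P ?Om \<noteq> \<infinity>" for i :: nat by simp
  qed
qed

lemma iexp_sum_prod: "iexp (\<Sum>l\<in>J. b l * x l) = (\<Prod>l\<in>J. iexp (b l * x l))" if "finite J"
  using that by (induction J rule: finite_induct) (auto simp: distrib_left exp_add)

lemma std_normal_iexp: "(LINT x|std_normal_distribution. iexp (t * x)) = complex_of_real (exp (- (t\<^sup>2) / 2))"
  using char_std_normal_distribution unfolding char_def by (simp add: fun_eq_iff)

text \<open>The image of independent standard normal variables under a factor of the covariance, as
  provided by \<open>psd_on_factor\<close>.\<close>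

lemma gaussian_vector_exists:
  assumes J: "finite J" and K: "psd_on J K"
  shows "\<exists>P :: ('i \<Rightarrow> real) measure. prob_space P \<and> sets P = sets (PiM J (\<lambda>_. borel)) \<and>
    (\<forall>\<theta>. (LINT x|P. iexp (\<Sum>j\<in>J. \<theta> j * x j)) =
      complex_of_real (exp (- (\<Sum>i\<in>J. \<Sum>j\<in>J. \<theta> i * \<theta> j * K i j) / 2)))"
proof -
  obtain A where A: "\<And>i j. i \<in> J \<Longrightarrow> j \<in> J \<Longrightarrow> K i j = (\<Sum>l\<in>J. A i l * A j l)"
    using psd_on_factor[OF J K] by auto
  interpret std: prob_space std_normal_distribution by (rule prob_space_normal_density) simp
  interpret product_prob_space "\<lambda>_ :: 'i. std_normal_distribution" J ..
  let ?S = "PiM J (\<lambda>_. std_normal_distribution)"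
  let ?T = "\<lambda>\<xi>. \<lambda>i\<in>J. \<Sum>l\<in>J. A i l * \<xi> l"
  have comp: "(\<lambda>\<xi>. \<xi> l) \<in> borel_measurable ?S" if "l \<in> J" for l
    using measurable_component_singleton[OF that, of "\<lambda>_. std_normal_distribution"] by simp
  have T: "?T \<in> ?S \<rightarrow>\<^sub>M PiM J (\<lambda>_. borel)"
    by (intro measurable_restrict borel_measurable_sum borel_measurable_times borel_measurable_const comp)
  let ?P = "distr ?S (PiM J (\<lambda>_. borel)) ?T"
  have char: "(LINT x|?P. iexp (\<Sum>j\<in>J. \<theta> j * x j)) =
      complex_of_real (exp (- (\<Sum>i\<in>J. \<Sum>j\<in>J. \<theta> i * \<theta> j * K i j) / 2))" for \<theta>
  proof -
    \<comment> \<open>The linear form pulled back to the independent variables: the transpose of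
      \<open>A\<close> applied to \<open>\<theta>\<close>.\<close>
    define b where "b l = (\<Sum>i\<in>J. \<theta> i * A i l)" for l
    have m: "(\<lambda>x. iexp (\<Sum>j\<in>J. \<theta> j * x j)) \<in> borel_measurable (PiM J (\<lambda>_. borel))"
    proof -
      have "(\<lambda>x. \<Sum>j\<in>J. \<theta> j * x j) \<in> borel_measurable (PiM J (\<lambda>_. borel))"
        by (intro borel_measurable_sum borel_measurable_times borel_measurable_const measurable_component_singleton)
      then show ?thesis by measurable
    qed
    have lin: "(\<Sum>j\<in>J. \<theta> j * ?T \<xi> j) = (\<Sum>l\<in>J. b l * \<xi> l)" for \<xi>
    proof -
      have "(\<Sum>j\<in>J. \<theta> j * ?T \<xi> j) = (\<Sum>j\<in>J. \<Sum>l\<in>J. \<theta> j * A j l * \<xi> l)"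
        by (intro sum.cong refl) (simp add: sum_distrib_left mult.assoc)
      also have "\<dots> = (\<Sum>l\<in>J. \<Sum>j\<in>J. \<theta> j * A j l * \<xi> l)" by (rule sum.swap)
      finally show ?thesis by (simp add: b_def sum_distrib_right)
    qed
    have "(LINT x|?P. iexp (\<Sum>j\<in>J. \<theta> j * x j)) = (LINT \<xi>|?S. (\<Prod>l\<in>J. iexp (b l * \<xi> l)))"
      by (subst integral_distr[OF T m]) (simp only: lin iexp_sum_prod[OF J])
    also have "\<dots> = (\<Prod>l\<in>J. LINT x|std_normal_distribution. iexp (b l * x))"
    proof (rule product_integral_prod[OF J])
      show "integrable std_normal_distribution (\<lambda>x. iexp (b l * x))" for l
        by (rule iexp_integrable[OF std.prob_space_axioms]) simp
    qed
    also have "\<dots> = complex_of_real (\<Prod>l\<in>J. exp (- (b l)\<^sup>2 / 2))"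
      by (simp only: std_normal_iexp of_real_prod)
    also have "(\<Prod>l\<in>J. exp (- (b l)\<^sup>2 / 2)) = exp (- (\<Sum>l\<in>J. (b l)\<^sup>2) / 2)"
      by (simp only: exp_sum[OF J, symmetric] sum_divide_distrib[symmetric] sum_negf)
    also have "(\<Sum>l\<in>J. (b l)\<^sup>2) = (\<Sum>i\<in>J. \<Sum>j\<in>J. \<theta> i * \<theta> j * K i j)"
    proof -
      have "(\<Sum>l\<in>J. (b l)\<^sup>2) = (\<Sum>l\<in>J. \<Sum>i\<in>J. \<Sum>j\<in>J. \<theta> i * \<theta> j * (A i l * A j l))"
        unfolding b_def power2_eq_square sum_product by (intro sum.cong refl) (simp add: mult_ac)
      also have "\<dots> = (\<Sum>i\<in>J. \<Sum>l\<in>J. \<Sum>j\<in>J. \<theta> i * \<theta> j * (A i l * A j l))" by (rule sum.swap)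
      also have "\<dots> = (\<Sum>i\<in>J. \<Sum>j\<in>J. \<Sum>l\<in>J. \<theta> i * \<theta> j * (A i l * A j l))"
        by (intro sum.cong refl sum.swap)
      also have "\<dots> = (\<Sum>i\<in>J. \<Sum>j\<in>J. \<theta> i * \<theta> j * K i j)"
        by (intro sum.cong refl) (simp only: A sum_distrib_left)
      finally show ?thesis .
    qed
    finally show ?thesis .
  qed
  have "prob_space ?P" by (rule prob_space.prob_space_distr[OF P.prob_space_axioms T])
  then show ?thesis using char by (intro exI[of _ ?P] conjI allI) auto
qed

text \<open>Kolmogorov's extension theorem. Consistency of the finite-dimensional laws is read off
  from characteristic functions: a marginal has the one belonging to the smaller index set, and
  \<open>PiM_eqI_iexp\<close> shows that it determines the law.\<close>

lemma gaussian_process_exists: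
  fixes K :: "'i \<Rightarrow> 'i \<Rightarrow> real"
  assumes K: "\<And>J. finite J \<Longrightarrow> J \<subseteq> I \<Longrightarrow> psd_on J K"
  shows "\<exists>N :: ('i \<Rightarrow> real) measure. prob_space N \<and> (\<forall>i\<in>I. (\<lambda>\<omega>. \<omega> i) \<in> borel_measurable N) \<and>
    (\<forall>J \<theta>. finite J \<and> J \<subseteq> I \<longrightarrow> (LINT \<omega>|N. iexp (\<Sum>j\<in>J. \<theta> j * \<omega> j)) =
      complex_of_real (exp (- (\<Sum>i\<in>J. \<Sum>j\<in>J. \<theta> i * \<theta> j * K i j) / 2)))"
proof -
  define gauss where "gauss J P \<longleftrightarrow> prob_space P \<and> sets P = sets (PiM J (\<lambda>_. borel :: real measure)) \<and>
    (\<forall>\<theta>. (LINT x|P. iexp (\<Sum>j\<in>J. \<theta> j * x j)) =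
      complex_of_real (exp (- (\<Sum>i\<in>J. \<Sum>j\<in>J. \<theta> i * \<theta> j * K i j) / 2)))" for J and P :: "('i \<Rightarrow> real) measure"
  define P where "P J = (SOME P. gauss J P)" for J
  have P: "gauss J (P J)" if "finite J" "J \<subseteq> I" for J
    unfolding P_def
  proof (rule someI_ex)
    show "\<exists>P. gauss J P" using gaussian_vector_exists[OF that(1) K[OF that]] unfolding gauss_def .
  qed
  have char: "(LINT x|P J. iexp (\<Sum>j\<in>J. \<theta> j * x j)) =
      complex_of_real (exp (- (\<Sum>i\<in>J. \<Sum>j\<in>J. \<theta> i * \<theta> j * K i j) / 2))"
    and probP: "prob_space (P J)" and setsP: "sets (P J) = sets (PiM J (\<lambda>_. borel :: real measure))"
    if "finite J" "J \<subseteq> I" for J \<theta>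
    using P[OF that] unfolding gauss_def by blast+
  have second: "integrable N (\<lambda>x. (x j)\<^sup>2)"
    if "prob_space N" "(\<lambda>x. x j) \<in> borel_measurable N" "j \<in> J" "finite J" "J \<subseteq> I"
      and c: "\<And>\<theta>. (LINT x|N. iexp (\<Sum>j\<in>J. \<theta> j * x j)) =
        complex_of_real (exp (- (\<Sum>i\<in>J. \<Sum>j\<in>J. \<theta> i * \<theta> j * K i j) / 2))" for N :: "('i \<Rightarrow> real) measure" and j J
  proof (rule normal_second_moment(2)[OF that(1,2)])
    have q: "(\<Sum>i\<in>J. \<Sum>k\<in>J. (if i = j then t else 0) * (if k = j then t else 0) * K i k) = t\<^sup>2 * K j j" for t
      using quadratic_form_extend[of "{j}" J "\<lambda>_. t" K] that by (simp add: power2_eq_square)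
    have "0 \<le> (\<Sum>i\<in>J. \<Sum>k\<in>J. (if i = j then 1 else 0) * (if k = j then 1 else 0) * K i k)"
      using K[OF that(4,5)] unfolding psd_on_def by (elim conjE allE[of _ "\<lambda>i. if i = j then 1 else 0"])
    then show "0 \<le> K j j" unfolding q by simp
    fix t
    have "(\<Sum>i\<in>J. (if i = j then t else 0) * x i) = (\<Sum>i\<in>J. if i = j then t * x j else 0)" for x :: "'i \<Rightarrow> real"
      by (intro sum.cong refl) simp
    then have "(\<Sum>i\<in>J. (if i = j then t else 0) * x i) = t * x j" for x :: "'i \<Rightarrow> real"
      using that(3,4) by (simp add: sum.delta)
    then show "(LINT x|N. iexp (t * x j)) = complex_of_real (exp (- (t\<^sup>2 * K j j) / 2))"
      using c[of "\<lambda>i. if i = j then t else 0"] by (simp only: q)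
  qed
  have restr_char: "(LINT x|distr N (PiM J (\<lambda>_. borel)) (\<lambda>f. restrict f J). iexp (\<Sum>j\<in>J. \<theta> j * x j)) =
      (LINT x|N. iexp (\<Sum>j\<in>J. \<theta> j * x j))"
    if "(\<lambda>f. restrict f J) \<in> N \<rightarrow>\<^sub>M PiM J (\<lambda>_. borel)" for N :: "('i \<Rightarrow> real) measure" and J \<theta>
  proof -
    have "(\<lambda>x. \<Sum>j\<in>J. \<theta> j * x j) \<in> borel_measurable (PiM J (\<lambda>_. borel))"
      by (intro borel_measurable_sum borel_measurable_times borel_measurable_const measurable_component_singleton)
    then have m: "(\<lambda>x. iexp (\<Sum>j\<in>J. \<theta> j * x j)) \<in> borel_measurable (PiM J (\<lambda>_. borel))" by measurable
    have "(\<Sum>j\<in>J. \<theta> j * restrict f J j) = (\<Sum>j\<in>J. \<theta> j * f j)" for f by (intro sum.cong) auto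
    then show ?thesis by (subst integral_distr[OF that m]) (simp only:)
  qed
  interpret F: projective_family I P "\<lambda>_. borel :: real measure"
  proof (rule projective_family.intro)
    fix J H assume JH: "J \<subseteq> H" "finite H" "H \<subseteq> I"
    have J: "finite J" "J \<subseteq> I" using JH finite_subset by auto
    have r: "(\<lambda>f. restrict f J) \<in> P H \<rightarrow>\<^sub>M PiM J (\<lambda>_. borel)"
      using measurable_restrict_subset[OF JH(1), of "\<lambda>_. borel"] setsP[OF JH(2,3)] measurable_cong_sets by blast
    let ?D = "distr (P H) (PiM J (\<lambda>_. borel)) (\<lambda>f. restrict f J)"
    have pD: "prob_space ?D" by (rule prob_space.prob_space_distr[OF probP[OF JH(2,3)] r])
    have cD: "(LINT x|?D. iexp (\<Sum>j\<in>J. \<theta> j * x j)) =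
        complex_of_real (exp (- (\<Sum>i\<in>J. \<Sum>j\<in>J. \<theta> i * \<theta> j * K i j) / 2))" for \<theta>
    proof -
      \<comment> \<open>A linear form on \<open>J\<close> is one on \<open>H\<close> with
        coefficients 0 outside \<open>J\<close>.\<close>
      let ?t = "\<lambda>j. if j \<in> J then \<theta> j else 0"
      have "(\<Sum>j\<in>J. \<theta> j * x j) = (\<Sum>j\<in>H. ?t j * x j)" for x :: "'i \<Rightarrow> real"
        using JH by (intro sum.mono_neutral_cong_left) auto
      then have "(LINT x|?D. iexp (\<Sum>j\<in>J. \<theta> j * x j)) = (LINT x|P H. iexp (\<Sum>j\<in>H. ?t j * x j))"
        unfolding restr_char[OF r] by (simp only:)
      then show ?thesis
        unfolding char[OF JH(2,3)] quadratic_form_extend[OF JH(1,2)] .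
    qed
    show "P J = ?D"
    proof (rule PiM_eqI_iexp[OF J(1) probP[OF J] setsP[OF J] pD])
      show "sets ?D = sets (PiM J (\<lambda>_. borel))" by simp
      fix j assume j: "j \<in> J"
      have comp: "(\<lambda>x. x j) \<in> borel_measurable (PiM J (\<lambda>_. borel :: real measure))"
        by (rule measurable_component_singleton[OF j])
      then have "(\<lambda>x. x j) \<in> borel_measurable (P J)" using setsP[OF J] measurable_cong_sets by blast
      then show "integrable (P J) (\<lambda>x. (x j)\<^sup>2)"
        by (rule second[OF probP[OF J] _ j J char[OF J]])
      have "(\<lambda>x. x j) \<in> borel_measurable ?D" using comp by simp
      then show "integrable ?D (\<lambda>x. (x j)\<^sup>2)" by (rule second[OF pD _ j J cD])
    next
      show "(LINT x|P J. iexp (\<Sum>j\<in>J. \<theta> j * x j)) = (LINT x|?D. iexp (\<Sum>j\<in>J. \<theta> j * x j))" for \<theta>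
        unfolding cD char[OF J] ..
    qed
  qed (rule probP)
  interpret F: polish_projective I P ..
  have lim_meas: "(\<lambda>f. restrict f J) \<in> F.lim \<rightarrow>\<^sub>M PiM J (\<lambda>_. borel)" if "J \<subseteq> I" for J
    using measurable_restrict_subset[OF that, of "\<lambda>_. borel"] F.sets_lim measurable_cong_sets by blast
  have distr_lim: "distr F.lim (PiM J (\<lambda>_. borel)) (\<lambda>f. restrict f J) = P J" if J: "finite J" "J \<subseteq> I" for J
  proof (rule measure_eqI)
    show "sets (distr F.lim (PiM J (\<lambda>_. borel)) (\<lambda>f. restrict f J)) = sets (P J)" using setsP[OF J] by simp
    fix A assume "A \<in> sets (distr F.lim (PiM J (\<lambda>_. borel)) (\<lambda>f. restrict f J))"
    then have A: "A \<in> sets (PiM J (\<lambda>_. borel))" by simp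
    have "emeasure (distr F.lim (PiM J (\<lambda>_. borel)) (\<lambda>f. restrict f J)) A = emeasure F.lim ((\<lambda>f. restrict f J) -` A \<inter> space F.lim)"
      by (rule emeasure_distr[OF lim_meas[OF J(2)] A])
    also have "(\<lambda>f. restrict f J) -` A \<inter> space F.lim = prod_emb I (\<lambda>_. borel) J A"
      by (simp add: prod_emb_def space_PiM)
    also have "emeasure F.lim \<dots> = emeasure (P J) A" by (rule F.emeasure_lim_emb[OF J(2,1) A])
    finally show "emeasure (distr F.lim (PiM J (\<lambda>_. borel)) (\<lambda>f. restrict f J)) A = emeasure (P J) A" .
  qed
  show ?thesis
  proof (intro exI[of _ F.lim] conjI allI ballI impI)
    show "prob_space F.lim" by (rule F.P.prob_space_axioms)
    show "(\<lambda>\<omega>. \<omega> i) \<in> borel_measurable F.lim" if "i \<in> I" for i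
      using measurable_component_singleton[OF that, of "\<lambda>_. borel"] F.sets_lim measurable_cong_sets by blast
    fix J \<theta> assume "finite J \<and> J \<subseteq> I"
    then have J: "finite J" "J \<subseteq> I" by auto
    show "(LINT \<omega>|F.lim. iexp (\<Sum>j\<in>J. \<theta> j * \<omega> j)) =
        complex_of_real (exp (- (\<Sum>i\<in>J. \<Sum>j\<in>J. \<theta> i * \<theta> j * K i j) / 2))"
      using restr_char[OF lim_meas[OF J(2)], of \<theta>] char[OF J, of \<theta>] unfolding distr_lim[OF J] by simp
  qed
qed

section \<open>The covariance of the limit\<close>

lemma cheb_t_cos: "cheb_t 1 (2 * cos \<theta>) r = 2 * cos (real r * \<theta>)"
proof (induction r rule: less_induct)
  case (less r)
  consider "r = 0" | "r = 1" | q where "r = Suc (Suc q)" by (metis One_nat_def not0_implies_Suc)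
  then show ?case
  proof cases
    case 3
    have "cos (real r * \<theta>) + cos (real q * \<theta>) = 2 * cos \<theta> * cos (real (Suc q) * \<theta>)"
      using cos_times_cos[of \<theta> "real (Suc q) * \<theta>"] cos_minus[of "real q * \<theta>"]
      by (simp add: 3 algebra_simps)
    then show ?thesis using less.IH[of q] less.IH[of "Suc q"] by (simp add: 3 algebra_simps del: of_nat_Suc)
  qed auto
qed

lemma power_cos_eq_sum: "(2 * cos \<theta>) ^ p = (\<Sum>r\<le>p. cheb_coeff p r * (2 * cos (real r * \<theta>)))"
  using power_eq_sum_cheb_t[of "2 * cos \<theta>" p 1] by (simp add: cheb_t_cos)

text \<open>\<open>(2 cos \<theta>)^k 2 sin \<theta>\<close> is minus the derivative of
  \<open>(2 cos \<theta>)^(k+1) / (k+1)\<close>. Integration by parts leaves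
  \<open>(2 cos \<theta>)^(k+1) cos (r \<theta>)\<close>, and orthogonality picks out the
  coefficient of degree \<open>r\<close>. The proof writes down the resulting
  antiderivative.\<close>

lemma integral_cos_power_sin:
  "((\<lambda>\<theta>. (2 * cos \<theta>) ^ k * sin (real r * \<theta>) * (2 * sin \<theta>)) has_integral
    real r / real (Suc k) * pi * cheb_coeff (Suc k) r) {0..pi}"
proof (cases "r = 0")
  case False
  \<comment> \<open>An antiderivative of \<open>2 cos (q \<theta>) cos (r \<theta>)\<close>; the
    resonant case \<open>q = r\<close> contributes the linear term and hence the factor
    \<open>pi\<close>.\<close>
  define S where "S q \<theta> = (if q = r then \<theta> else sin ((real q - real r) * \<theta>) / (real q - real r)) +
    sin ((real q + real r) * \<theta>) / (real q + real r)" for q \<theta>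
  have S: "(S q has_real_derivative 2 * cos (real q * \<theta>) * cos (real r * \<theta>)) (at \<theta>)" for q \<theta>
  proof -
    have "2 * cos (real q * \<theta>) * cos (real r * \<theta>) = cos ((real q - real r) * \<theta>) + cos ((real q + real r) * \<theta>)"
      by (simp add: cos_times_cos algebra_simps)
    moreover have "(S q has_real_derivative cos ((real q - real r) * \<theta>) + cos ((real q + real r) * \<theta>)) (at \<theta>)"
    proof -
      have d: "((\<lambda>\<theta>. sin (a * \<theta>) / a) has_real_derivative cos (a * \<theta>)) (at \<theta>)" if "a \<noteq> 0" for a
        using that by (auto intro!: derivative_eq_intros)
      have p: "real q + real r \<noteq> 0" using False by simp
      have "((\<lambda>\<theta>. if q = r then \<theta> else sin ((real q - real r) * \<theta>) / (real q - real r)) has_real_derivative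
          cos ((real q - real r) * \<theta>)) (at \<theta>)"
        using d[of "real q - real r"] by (cases "q = r") simp_all
      then show ?thesis unfolding S_def[abs_def] by (rule DERIV_add[OF _ d[OF p]])
    qed
    ultimately show ?thesis by simp
  qed
  define A where "A \<theta> = - (sin (real r * \<theta>) * (2 * cos \<theta>) ^ Suc k) / real (Suc k) +
    real r / real (Suc k) * (\<Sum>q\<le>Suc k. cheb_coeff (Suc k) q * S q \<theta>)" for \<theta>
  have "(A has_real_derivative (2 * cos \<theta>) ^ k * sin (real r * \<theta>) * (2 * sin \<theta>)) (at \<theta>)" for \<theta>
  proof -
    have 1: "((\<lambda>\<theta>. \<Sum>q\<le>Suc k. cheb_coeff (Suc k) q * S q \<theta>) has_real_derivative
        (\<Sum>q\<le>Suc k. cheb_coeff (Suc k) q * (2 * cos (real q * \<theta>) * cos (real r * \<theta>)))) (at \<theta>)"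
      by (intro DERIV_sum DERIV_cmult S)
    have "(\<Sum>q\<le>Suc k. cheb_coeff (Suc k) q * (2 * cos (real q * \<theta>) * cos (real r * \<theta>))) =
        (2 * cos \<theta>) ^ Suc k * cos (real r * \<theta>)"
      unfolding power_cos_eq_sum sum_distrib_right by (simp add: mult_ac)
    then have 2: "((\<lambda>\<theta>. real r / real (Suc k) * (\<Sum>q\<le>Suc k. cheb_coeff (Suc k) q * S q \<theta>)) has_real_derivative
        real r / real (Suc k) * ((2 * cos \<theta>) ^ Suc k * cos (real r * \<theta>))) (at \<theta>)"
      using DERIV_cmult[OF 1, of "real r / real (Suc k)"] by simp
    have 3: "((\<lambda>\<theta>. - (sin (real r * \<theta>) * (2 * cos \<theta>) ^ Suc k) / real (Suc k)) has_real_derivative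
        - (real r * cos (real r * \<theta>) * (2 * cos \<theta>) ^ Suc k +
          sin (real r * \<theta>) * (real (Suc k) * (2 * cos \<theta>) ^ k * (- 2 * sin \<theta>))) / real (Suc k)) (at \<theta>)"
      by (rule derivative_eq_intros refl | simp)+
    show ?thesis unfolding A_def[abs_def]
      by (rule DERIV_cong[OF DERIV_add[OF 3 2]]) (simp add: field_simps del: power_Suc of_nat_Suc)
  qed
  then have "((\<lambda>\<theta>. (2 * cos \<theta>) ^ k * sin (real r * \<theta>) * (2 * sin \<theta>)) has_integral (A pi - A 0)) {0..pi}"
    by (intro fundamental_theorem_of_calculus)
      (auto simp: has_real_derivative_iff_has_vector_derivative[symmetric] intro: has_field_derivative_at_within)
  moreover have "A pi - A 0 = real r / real (Suc k) * pi * cheb_coeff (Suc k) r"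
  proof -
    have "sin (real q * pi - real r * pi) = 0" "sin (real q * pi + real r * pi) = 0" for q
      by (simp_all add: sin_diff sin_add)
    then have "S q pi - S q 0 = (if q = r then pi else 0)" for q
      unfolding S_def by (simp add: left_diff_distrib distrib_right)
    then have "(\<Sum>q\<le>Suc k. cheb_coeff (Suc k) q * S q pi) - (\<Sum>q\<le>Suc k. cheb_coeff (Suc k) q * S q 0) =
        (\<Sum>q\<le>Suc k. if q = r then cheb_coeff (Suc k) q * pi else 0)"
      unfolding sum_subtractf[symmetric] right_diff_distrib[symmetric] by (intro sum.cong) auto
    also have "\<dots> = cheb_coeff (Suc k) r * pi"
      using cheb_coeff_eq_0[of "Suc k" r] by (simp del: cheb_coeff.simps)
    finally have d: "(\<Sum>q\<le>Suc k. cheb_coeff (Suc k) q * S q pi) - (\<Sum>q\<le>Suc k. cheb_coeff (Suc k) q * S q 0) =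
        cheb_coeff (Suc k) r * pi" .
    have "A pi - A 0 = real r / real (Suc k) * ((\<Sum>q\<le>Suc k. cheb_coeff (Suc k) q * S q pi) - (\<Sum>q\<le>Suc k. cheb_coeff (Suc k) q * S q 0))"
      unfolding A_def right_diff_distrib by simp
    then show ?thesis unfolding d by (simp add: mult_ac)
  qed
  ultimately show ?thesis by simp
qed simp

section \<open>Integration over semicircles in polar coordinates\<close>

abbreviation semicircle_point :: "real \<Rightarrow> real \<Rightarrow> complex" where
  "semicircle_point y x \<equiv> Complex (x / 2) (sqrt (y - x\<^sup>2 / 4))"

lemma semicircle_point_polar:
  assumes "0 < \<rho>" "\<theta> \<in> {0..pi}"
  shows "semicircle_point (\<rho>\<^sup>2) (2 * \<rho> * cos \<theta>) = of_real \<rho> * cis \<theta>"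
proof -
  have "\<rho>\<^sup>2 - (2 * \<rho> * cos \<theta>)\<^sup>2 / 4 = (\<rho> * sin \<theta>)\<^sup>2"
    by (simp add: power_mult_distrib sin_squared_eq algebra_simps)
  moreover have "0 \<le> \<rho> * sin \<theta>" using assms by (simp add: sin_ge_zero)
  ultimately show ?thesis by (simp add: complex_eq_iff real_sqrt_abs)
qed

lemma semicircle_point_cases:
  assumes "0 < \<rho>" "x \<in> {-2 * \<rho><..<2 * \<rho>}"
  obtains \<theta> where "0 < \<theta>" "\<theta> < pi" "semicircle_point (\<rho>\<^sup>2) x = of_real \<rho> * cis \<theta>" "x = 2 * \<rho> * cos \<theta>"
proof -
  define \<theta> where "\<theta> = arccos (x / (2 * \<rho>))"
  have b: "- 1 < x / (2 * \<rho>)" "x / (2 * \<rho>) < 1" using assms by (auto simp: field_simps)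
  have x: "x = 2 * \<rho> * cos \<theta>" using assms b by (simp add: \<theta>_def cos_arccos)
  have t: "0 < \<theta>" "\<theta> < pi" using arccos_lt_bounded[OF b] by (auto simp: \<theta>_def)
  have "semicircle_point (\<rho>\<^sup>2) x = of_real \<rho> * cis \<theta>"
    unfolding x by (rule semicircle_point_polar) (use assms t in auto)
  then show thesis using t x that by blast
qed

lemma semicircle_point_continuous: "continuous_on A (semicircle_point y)"
  unfolding Complex_eq by (intro continuous_intros) auto

lemma semicircle_continuous_on:
  assumes "0 < \<rho>" and f: "continuous_on {z. cmod z = \<rho> \<and> 0 \<le> Im z} f"
  shows "continuous_on {-2 * \<rho>..2 * \<rho>} (\<lambda>x. f (semicircle_point (\<rho>\<^sup>2) x))"
    and "continuous_on {0..pi} (\<lambda>\<theta>. f (of_real \<rho> * cis \<theta>))"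
proof -
  have "cmod (semicircle_point (\<rho>\<^sup>2) x) = \<rho> \<and> 0 \<le> Im (semicircle_point (\<rho>\<^sup>2) x)" if "x \<in> {-2 * \<rho>..2 * \<rho>}" for x
  proof -
    have "\<bar>x\<bar> \<le> \<bar>2 * \<rho>\<bar>" using that by auto
    then have "x\<^sup>2 \<le> (2 * \<rho>)\<^sup>2" by (simp only: abs_le_square_iff)
    then have "0 \<le> \<rho>\<^sup>2 - x\<^sup>2 / 4" by (simp add: power_mult_distrib)
    then show ?thesis using assms(1) by (simp add: cmod_def power_divide)
  qed
  then show "continuous_on {-2 * \<rho>..2 * \<rho>} (\<lambda>x. f (semicircle_point (\<rho>\<^sup>2) x))"
    by (intro continuous_on_compose2[OF f semicircle_point_continuous]) auto
  show "continuous_on {0..pi} (\<lambda>\<theta>. f (of_real \<rho> * cis \<theta>))"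
    by (intro continuous_on_compose2[OF f]) (auto intro!: continuous_intros simp: norm_mult assms sin_ge_zero less_imp_le)
qed

lemma semicircle_integrable:
  fixes f :: "complex \<Rightarrow> real"
  assumes "0 < \<rho>" "continuous_on {z. cmod z = \<rho> \<and> 0 \<le> Im z} f"
  shows "set_integrable lborel {-2 * \<rho><..<2 * \<rho>} (\<lambda>x. f (semicircle_point (\<rho>\<^sup>2) x))"
  by (rule set_integrable_subset[OF borel_integrable_atLeastAtMost'[OF semicircle_continuous_on(1)[OF assms]]]) auto

lemma semicircle_integral_eq_LBINT:
  "0 < \<rho> \<Longrightarrow> semicircle_integral (\<rho>\<^sup>2) f = (LBINT x:{-2 * \<rho><..<2 * \<rho>}. f (semicircle_point (\<rho>\<^sup>2) x))"
  by (simp add: semicircle_integral_def)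

text \<open>The substitution rule asks for a non-negative derivative, so the arc is parametrised by
  \<open>x = - 2 \<rho> cos \<theta>\<close> and the angle is reflected to
  \<open>pi - \<theta>\<close> afterwards.\<close>

lemma semicircle_integral_polar:
  assumes \<rho>: "0 < \<rho>" and f: "continuous_on {z. cmod z = \<rho> \<and> 0 \<le> Im z} f"
  shows "semicircle_integral (\<rho>\<^sup>2) f = integral {0..pi} (\<lambda>\<theta>. f (of_real \<rho> * cis \<theta>) * (2 * \<rho> * sin \<theta>))"
proof -
  let ?F = "\<lambda>x. f (semicircle_point (\<rho>\<^sup>2) x)" and ?g = "\<lambda>\<theta>. - 2 * \<rho> * cos \<theta>"
  let ?h = "\<lambda>\<theta>. f (of_real \<rho> * cis \<theta>) * (2 * \<rho> * sin \<theta>)"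
  have "semicircle_integral (\<rho>\<^sup>2) f = (LBINT x. ?F x * indicator {?g 0..?g pi} x)"
    unfolding semicircle_integral_eq_LBINT[OF \<rho>] set_lebesgue_integral_def
  proof (rule integral_cong_AE)
    have "set_integrable lborel {-2 * \<rho>..2 * \<rho>} ?F"
      by (rule borel_integrable_atLeastAtMost'[OF semicircle_continuous_on(1)[OF assms]])
    then have "(\<lambda>x. indicator {-2 * \<rho>..2 * \<rho>} x *\<^sub>R ?F x) \<in> borel_measurable lborel"
      unfolding set_integrable_def by (rule borel_measurable_integrable)
    then show "(\<lambda>x. ?F x * indicator {?g 0..?g pi} x) \<in> borel_measurable lborel" by (simp add: mult.commute)
    show "(\<lambda>x. indicator {-2 * \<rho><..<2 * \<rho>} x *\<^sub>R ?F x) \<in> borel_measurable lborel"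
      using borel_measurable_integrable[OF semicircle_integrable[OF assms, unfolded set_integrable_def]] .
    show "AE x in lborel. indicator {-2 * \<rho><..<2 * \<rho>} x *\<^sub>R ?F x = ?F x * indicator {?g 0..?g pi} x"
      using AE_lborel_singleton[of "- 2 * \<rho>"] AE_lborel_singleton[of "2 * \<rho>"]
      by eventually_elim (auto simp: indicator_def)
  qed
  also have "\<dots> = (LBINT \<theta>. ?F (?g \<theta>) * (2 * \<rho> * sin \<theta>) * indicator {0..pi} \<theta>)"
  proof (rule integral_substitution(2))
    show "set_integrable lborel {?g 0..?g pi} ?F"
      using borel_integrable_atLeastAtMost'[OF semicircle_continuous_on(1)[OF assms]] by simp
    show "(?g has_real_derivative 2 * \<rho> * sin \<theta>) (at \<theta>)" for \<theta> by (auto intro!: derivative_eq_intros)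
    show "0 \<le> 2 * \<rho> * sin \<theta>" if "\<theta> \<in> {0..pi}" for \<theta> using that \<rho> by (simp add: sin_ge_zero)
  qed (auto intro!: continuous_intros)
  also have "\<dots> = (LBINT \<theta>. indicator {0..pi} (pi + (-1) * \<theta>) *\<^sub>R ?h (pi + (-1) * \<theta>))"
  proof (rule Bochner_Integration.integral_cong[OF refl])
    fix \<theta> :: real
    show "?F (?g \<theta>) * (2 * \<rho> * sin \<theta>) * indicator {0..pi} \<theta> =
        indicator {0..pi} (pi + (-1) * \<theta>) *\<^sub>R ?h (pi + (-1) * \<theta>)"
    proof (cases "\<theta> \<in> {0..pi}")
      case True
      have "?F (?g \<theta>) = f (of_real \<rho> * cis (pi - \<theta>))"
        using semicircle_point_polar[OF \<rho>, of "pi - \<theta>"] True by simp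
      then show ?thesis using True by simp
    qed (auto simp: indicator_def)
  qed
  also have "\<dots> = (LBINT \<theta>. indicator {0..pi} \<theta> *\<^sub>R ?h \<theta>)"
    using lborel_integral_real_affine[of "-1" "\<lambda>\<theta>. indicator {0..pi} \<theta> *\<^sub>R ?h \<theta>" pi] by simp
  also have "\<dots> = integral {0..pi} ?h"
  proof -
    have "continuous_on {0..pi} ?h" by (intro continuous_intros semicircle_continuous_on(2)[OF assms])
    then show ?thesis
      using set_borel_integral_eq_integral(2)[OF borel_integrable_atLeastAtMost'[of 0 pi ?h]]
      unfolding set_lebesgue_integral_def by simp
  qed
  finally show ?thesis .
qed

section \<open>Expansion and integration of the logarithmic kernel\<close>

lemma log_kernel_polar:
  assumes "0 < \<rho>\<^sub>1" "0 < \<rho>\<^sub>2" and a: "a = c * min (\<rho>\<^sub>1\<^sup>2) (\<rho>\<^sub>2\<^sup>2) / (\<rho>\<^sub>1 * \<rho>\<^sub>2)"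
  shows "log_kernel c (of_real \<rho>\<^sub>1 * cis \<theta>) (of_real \<rho>\<^sub>2 * cis \<phi>) =
    1 / (2 * pi) * ln (cmod (of_real a - cis (\<theta> + \<phi>)) / cmod (of_real a - cis (\<theta> - \<phi>)))"
proof -
  have m: "c * min (\<rho>\<^sub>1\<^sup>2) (\<rho>\<^sub>2\<^sup>2) = \<rho>\<^sub>1 * \<rho>\<^sub>2 * a" using assms by (simp add: a)
  have n: "cmod (of_real \<rho>\<^sub>1 * cis \<theta>) = \<rho>\<^sub>1" "cmod (of_real \<rho>\<^sub>2 * cis \<phi>) = \<rho>\<^sub>2"
    using assms by (simp_all add: norm_mult)
  have "of_real (\<rho>\<^sub>1 * \<rho>\<^sub>2 * a) - of_real \<rho>\<^sub>1 * cis \<theta> * (of_real \<rho>\<^sub>2 * cis \<phi>) =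
      of_real (\<rho>\<^sub>1 * \<rho>\<^sub>2) * (of_real a - cis (\<theta> + \<phi>))"
    by (simp add: algebra_simps cis_mult[symmetric])
  moreover have "of_real (\<rho>\<^sub>1 * \<rho>\<^sub>2 * a) - of_real \<rho>\<^sub>1 * cis \<theta> * cnj (of_real \<rho>\<^sub>2 * cis \<phi>) =
      of_real (\<rho>\<^sub>1 * \<rho>\<^sub>2) * (of_real a - cis (\<theta> - \<phi>))"
    by (simp add: algebra_simps cis_mult[symmetric] cis_cnj diff_conv_add_uminus del: add_uminus_conv_diff)
  ultimately show ?thesis
    unfolding log_kernel_def n m using assms by (simp add: norm_divide norm_mult)
qed

text \<open>The modulus equals \<open>|1 - a e^(-i \<alpha>)|\<close>, and its logarithm is the real
  part of the complex logarithm series. The summand at \<open>n = 0\<close> is 0 because division by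
  zero yields 0.\<close>

lemma ln_cmod_series:
  assumes "0 \<le> a" "a < 1"
  shows "(\<lambda>n. - (a ^ n / real n * cos (real n * \<alpha>))) sums ln (cmod (of_real a - cis \<alpha>))"
proof -
  let ?u = "of_real a * cis (- \<alpha>)"
  have u: "cmod (- ?u) < 1" using assms by (simp add: norm_mult)
  have "(\<lambda>n. Re (- ((- (- ?u)) ^ n) / of_nat n)) sums Re (ln (1 + - ?u))"
    by (rule sums_Re[OF Ln_series'[OF u]])
  moreover have "Re (- ((- (- ?u)) ^ n) / of_nat n) = - (a ^ n / real n * cos (real n * \<alpha>))" for n
  proof -
    have "?u ^ n = of_real (a ^ n) * cis (real n * - \<alpha>)" by (simp only: power_mult_distrib Complex.DeMoivre of_real_power)
    then have "Re (?u ^ n) = a ^ n * cos (real n * \<alpha>)" by (simp del: of_real_power)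
    then show ?thesis by simp
  qed
  moreover have "Re (ln (1 + - ?u)) = ln (cmod (of_real a - cis \<alpha>))"
  proof -
    have "1 + - ?u \<noteq> 0" using u by (metis add_eq_0_iff2 minus_minus norm_one less_irrefl norm_minus_cancel)
    moreover have "of_real a - cis \<alpha> = - (cis \<alpha> * (1 + - ?u))"
      by (simp add: algebra_simps cis_mult)
    then have "cmod (of_real a - cis \<alpha>) = cmod (1 + - ?u)" by (simp only: norm_minus_cancel norm_mult norm_cis mult_1)
    ultimately show ?thesis using Re_Ln[of "1 + - ?u"] by (simp only: not_False_eq_True)
  qed
  ultimately show ?thesis by (simp only:)
qed

lemma of_real_minus_cis_nonzero: "0 \<le> a \<Longrightarrow> a < 1 \<Longrightarrow> of_real a - cis \<alpha> \<noteq> 0"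
  by (metis abs_of_nonneg eq_iff_diff_eq_0 less_irrefl norm_cis norm_of_real)

text \<open>The difference of two cosine series, at the sum and at the difference of the angles,
  becomes a product of sines.\<close>

lemma log_kernel_series:
  assumes \<rho>: "0 < \<rho>\<^sub>1" "0 < \<rho>\<^sub>2" and a: "a = c * min (\<rho>\<^sub>1\<^sup>2) (\<rho>\<^sub>2\<^sup>2) / (\<rho>\<^sub>1 * \<rho>\<^sub>2)" "0 \<le> a" "a < 1"
  shows "(\<lambda>n. 1 / pi * (a ^ n / real n * sin (real n * \<theta>) * sin (real n * \<phi>))) sums
    log_kernel c (of_real \<rho>\<^sub>1 * cis \<theta>) (of_real \<rho>\<^sub>2 * cis \<phi>)"
proof -
  have "(\<lambda>n. 1 / (2 * pi) * (- (a ^ n / real n * cos (real n * (\<theta> + \<phi>))) - - (a ^ n / real n * cos (real n * (\<theta> - \<phi>))))) sums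
      (1 / (2 * pi) * (ln (cmod (of_real a - cis (\<theta> + \<phi>))) - ln (cmod (of_real a - cis (\<theta> - \<phi>)))))"
    by (intro sums_mult sums_diff ln_cmod_series a)
  moreover have "1 / (2 * pi) * (- (a ^ n / real n * cos (real n * (\<theta> + \<phi>))) - - (a ^ n / real n * cos (real n * (\<theta> - \<phi>)))) =
      1 / pi * (a ^ n / real n * sin (real n * \<theta>) * sin (real n * \<phi>))" for n
  proof -
    have "cos (real n * (\<theta> - \<phi>)) - cos (real n * (\<theta> + \<phi>)) = 2 * (sin (real n * \<theta>) * sin (real n * \<phi>))"
      by (simp add: right_diff_distrib distrib_left cos_add cos_diff)
    then have "- (a ^ n / real n * cos (real n * (\<theta> + \<phi>))) - - (a ^ n / real n * cos (real n * (\<theta> - \<phi>))) =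
        a ^ n / real n * (2 * (sin (real n * \<theta>) * sin (real n * \<phi>)))"
      by (simp add: right_diff_distrib[symmetric] del: times_divide_eq_left)
    then show ?thesis by (simp add: field_simps)
  qed
  moreover have "ln (cmod (of_real a - cis (\<theta> + \<phi>)) / cmod (of_real a - cis (\<theta> - \<phi>))) =
      ln (cmod (of_real a - cis (\<theta> + \<phi>))) - ln (cmod (of_real a - cis (\<theta> - \<phi>)))"
    using of_real_minus_cis_nonzero[OF a(2,3)] by (simp add: ln_div)
  ultimately show ?thesis unfolding log_kernel_polar[OF \<rho> a(1)] by simp
qed

text \<open>On the closed half circle, real points included, numerator and denominator have no zero,
  since the real number in front has smaller modulus than the product subtracted from it.\<close>

lemma log_kernel_continuous:
  assumes \<rho>: "0 < \<rho>\<^sub>1" "0 < \<rho>\<^sub>2" and c: "0 \<le> c" "c * min (\<rho>\<^sub>1\<^sup>2) (\<rho>\<^sub>2\<^sup>2) < \<rho>\<^sub>1 * \<rho>\<^sub>2" and z: "cmod z = \<rho>\<^sub>1"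
  shows "continuous_on {w. cmod w = \<rho>\<^sub>2 \<and> 0 \<le> Im w} (log_kernel c z)"
proof -
  have nz: "complex_of_real (c * min ((cmod z)\<^sup>2) ((cmod w)\<^sup>2)) \<noteq> v" if "cmod w = \<rho>\<^sub>2" "cmod v = \<rho>\<^sub>1 * \<rho>\<^sub>2" for w v
  proof
    assume "complex_of_real (c * min ((cmod z)\<^sup>2) ((cmod w)\<^sup>2)) = v"
    then have "cmod (complex_of_real (c * min (\<rho>\<^sub>1\<^sup>2) (\<rho>\<^sub>2\<^sup>2))) = \<rho>\<^sub>1 * \<rho>\<^sub>2" using that z by simp
    moreover have "cmod (complex_of_real (c * min (\<rho>\<^sub>1\<^sup>2) (\<rho>\<^sub>2\<^sup>2))) = c * min (\<rho>\<^sub>1\<^sup>2) (\<rho>\<^sub>2\<^sup>2)"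
      unfolding norm_of_real using c(1) by (intro abs_of_nonneg) (simp add: min_def)
    ultimately show False using c(2) by simp
  qed
  let ?A = "{w. cmod w = \<rho>\<^sub>2 \<and> 0 \<le> Im w}"
  let ?m = "\<lambda>w. complex_of_real (c * min ((cmod z)\<^sup>2) ((cmod w)\<^sup>2))"
  have N: "?m w - z * w \<noteq> 0" if "w \<in> ?A" for w
    using nz[of w "z * w"] that unfolding right_minus_eq by (simp only: mem_Collect_eq norm_mult z simp_thms)
  have D: "?m w - z * cnj w \<noteq> 0" if "w \<in> ?A" for w
    using nz[of w "z * cnj w"] that unfolding right_minus_eq by (simp only: mem_Collect_eq norm_mult complex_mod_cnj z simp_thms)
  have "continuous_on ?A (\<lambda>w. cmod ((?m w - z * w) / (?m w - z * cnj w)))"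
    using D by (intro continuous_on_norm continuous_on_divide) (auto intro!: continuous_intros simp del: of_real_mult)
  then show ?thesis
    unfolding log_kernel_def[abs_def]
    by (intro continuous_on_mult_left continuous_on_ln) (use N D in \<open>auto simp del: of_real_mult\<close>)
qed

text \<open>The sine series is integrated term by term, dominated by a geometric series. By
  \<open>integral_cos_power_sin\<close> the terms of degree above \<open>k + 1\<close> vanish, which
  leaves a finite sum.\<close>

lemma semicircle_integral_log_kernel_less:
  assumes \<rho>: "0 < \<rho>\<^sub>1" "0 < \<rho>\<^sub>2" and a: "a = c * min (\<rho>\<^sub>1\<^sup>2) (\<rho>\<^sub>2\<^sup>2) / (\<rho>\<^sub>1 * \<rho>\<^sub>2)" "0 \<le> c" "a < 1"
  shows "semicircle_integral (\<rho>\<^sub>2\<^sup>2) (\<lambda>w. (2 * Re w) ^ k * log_kernel c (of_real \<rho>\<^sub>1 * cis \<theta>) w) =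
    \<rho>\<^sub>2 ^ Suc k / real (Suc k) * (\<Sum>r\<in>{1..Suc k}. a ^ r * cheb_coeff (Suc k) r * sin (real r * \<theta>))"
proof -
  let ?z = "of_real \<rho>\<^sub>1 * cis \<theta>"
  have a0: "0 \<le> a" unfolding a(1) using \<rho> a(2) by (simp add: min_def)
  have z: "cmod ?z = \<rho>\<^sub>1" using \<rho> by (simp add: norm_mult)
  have "c * min (\<rho>\<^sub>1\<^sup>2) (\<rho>\<^sub>2\<^sup>2) < \<rho>\<^sub>1 * \<rho>\<^sub>2" 
  proof -
    have "c * min (\<rho>\<^sub>1\<^sup>2) (\<rho>\<^sub>2\<^sup>2) / (\<rho>\<^sub>1 * \<rho>\<^sub>2) < 1" using a by simp
    then show ?thesis using \<rho> by (simp add: pos_divide_less_eq)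
  qed
  then have cont: "continuous_on {w. cmod w = \<rho>\<^sub>2 \<and> 0 \<le> Im w} (\<lambda>w. (2 * Re w) ^ k * log_kernel c ?z w)"
    by (intro continuous_intros log_kernel_continuous[OF \<rho> a(2) _ z])
  define t where "t r = 1 / pi * (a ^ r / real r * sin (real r * \<theta>)) * \<rho>\<^sub>2 ^ Suc k" for r
  define f where "f N \<phi> = (\<Sum>r<N. t r * ((2 * cos \<phi>) ^ k * sin (real r * \<phi>) * (2 * sin \<phi>)))" for N \<phi>
  define e where "e r = t r * (real r / real (Suc k) * pi * cheb_coeff (Suc k) r)" for r
  define I where "I = (\<Sum>r<Suc (Suc k). e r)"
  have "((\<lambda>\<phi>. (2 * Re (of_real \<rho>\<^sub>2 * cis \<phi>)) ^ k * log_kernel c ?z (of_real \<rho>\<^sub>2 * cis \<phi>) * (2 * \<rho>\<^sub>2 * sin \<phi>)) has_integral I) {0..pi}"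
  proof (rule has_integral_dominated_convergence[where f = f and h = "\<lambda>_. \<rho>\<^sub>2 ^ Suc k * 2 ^ k * 2 * (1 / (1 - a))" and y = "\<lambda>N. \<Sum>r<N. e r"])
    show "(f N has_integral (\<Sum>r<N. e r)) {0..pi}" for N
      unfolding f_def[abs_def] e_def by (intro has_integral_sum has_integral_mult_right integral_cos_power_sin) auto
    show "(\<lambda>_. \<rho>\<^sub>2 ^ Suc k * 2 ^ k * 2 * (1 / (1 - a))) integrable_on {0..pi}" by (rule integrable_const_ivl)
    show "(\<lambda>N. \<Sum>r<N. e r) \<longlonglongrightarrow> I"
    proof (rule tendsto_eventually)
      have "(\<Sum>r<N. e r) = I" if "Suc (Suc k) \<le> N" for N
        unfolding I_def using that by (intro sum.mono_neutral_right) (auto simp: e_def cheb_coeff_eq_0 simp del: cheb_coeff.simps)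
      then show "\<forall>\<^sub>F N in sequentially. (\<Sum>r<N. e r) = I" using eventually_sequentially by blast
    qed
    show "\<forall>\<phi>\<in>{0..pi}. norm (f N \<phi>) \<le> \<rho>\<^sub>2 ^ Suc k * 2 ^ k * 2 * (1 / (1 - a))" for N
    proof
      fix \<phi> :: real
      have tb: "\<bar>t r\<bar> \<le> \<rho>\<^sub>2 ^ Suc k * a ^ r" for r
      proof -
        have "a ^ r / real r \<le> a ^ r" 
          using a0 divide_left_mono[of 1 "real r" "a ^ r"] by (cases "r = 0") auto
        then have "\<bar>a ^ r / real r * sin (real r * \<theta>)\<bar> \<le> a ^ r * 1"
          unfolding abs_mult using a0 by (intro mult_mono) auto
        moreover have "\<bar>1 / pi\<bar> \<le> 1" using pi_gt3 by simp
        ultimately have "\<bar>1 / pi\<bar> * \<bar>a ^ r / real r * sin (real r * \<theta>)\<bar> \<le> 1 * (a ^ r * 1)"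
          by (intro mult_mono) auto
        then have "\<bar>1 / pi\<bar> * \<bar>a ^ r / real r * sin (real r * \<theta>)\<bar> * \<rho>\<^sub>2 ^ Suc k \<le> 1 * (a ^ r * 1) * \<rho>\<^sub>2 ^ Suc k"
          using \<rho> by (intro mult_right_mono) auto
        moreover have "\<bar>t r\<bar> = \<bar>1 / pi\<bar> * \<bar>a ^ r / real r * sin (real r * \<theta>)\<bar> * \<rho>\<^sub>2 ^ Suc k"
          using \<rho> unfolding t_def abs_mult by (simp add: abs_mult power_abs)
        ultimately show ?thesis by (simp add: mult.commute)
      qed
      have gb: "\<bar>(2 * cos \<phi>) ^ k * sin (real r * \<phi>) * (2 * sin \<phi>)\<bar> \<le> 2 ^ k * 1 * 2" for r
      proof -
        have "\<bar>2 * cos \<phi>\<bar> \<le> 2" using abs_cos_le_one[of \<phi>] by (simp add: abs_mult)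
        then have "\<bar>2 * cos \<phi>\<bar> ^ k \<le> 2 ^ k" by (intro power_mono) auto
        moreover have "\<bar>2 * sin \<phi>\<bar> \<le> 2" using abs_sin_le_one[of \<phi>] by (simp add: abs_mult)
        ultimately show ?thesis unfolding abs_mult[of _ "2 * sin \<phi>"] abs_mult[of _ "sin (real r * \<phi>)"] power_abs
          by (intro mult_mono) auto
      qed
      have "norm (f N \<phi>) \<le> (\<Sum>r<N. \<rho>\<^sub>2 ^ Suc k * a ^ r * (2 ^ k * 1 * 2))"
        unfolding f_def real_norm_def
        by (intro order_trans[OF sum_abs] sum_mono, subst abs_mult, intro mult_mono tb gb) (use a0 \<rho> in auto)
      also have "\<dots> = \<rho>\<^sub>2 ^ Suc k * 2 ^ k * 2 * (\<Sum>r<N. a ^ r)" 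
        unfolding sum_distrib_left by (intro sum.cong refl) (simp only: mult_ac mult_1_right)
      also have "\<dots> \<le> \<rho>\<^sub>2 ^ Suc k * 2 ^ k * 2 * (1 / (1 - a))"
      proof (rule mult_left_mono)
        have "(\<Sum>r<N. a ^ r) \<le> (\<Sum>r. a ^ r)" using a0 a(3) by (intro sum_le_suminf summable_geometric) auto
        then show "(\<Sum>r<N. a ^ r) \<le> 1 / (1 - a)" using a0 a(3) by (simp add: suminf_geometric)
      qed (use \<rho> in auto)
      finally show "norm (f N \<phi>) \<le> \<rho>\<^sub>2 ^ Suc k * 2 ^ k * 2 * (1 / (1 - a))" .
    qed
    show "\<forall>\<phi>\<in>{0..pi}. (\<lambda>N. f N \<phi>) \<longlonglongrightarrow>
        (2 * Re (of_real \<rho>\<^sub>2 * cis \<phi>)) ^ k * log_kernel c ?z (of_real \<rho>\<^sub>2 * cis \<phi>) * (2 * \<rho>\<^sub>2 * sin \<phi>)"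
    proof
      fix \<phi> :: real
      have "(\<lambda>r. (2 * \<rho>\<^sub>2 * cos \<phi>) ^ k * (1 / pi * (a ^ r / real r * sin (real r * \<theta>) * sin (real r * \<phi>))) * (2 * \<rho>\<^sub>2 * sin \<phi>)) sums
          ((2 * \<rho>\<^sub>2 * cos \<phi>) ^ k * log_kernel c ?z (of_real \<rho>\<^sub>2 * cis \<phi>) * (2 * \<rho>\<^sub>2 * sin \<phi>))"
        by (intro sums_mult sums_mult2 log_kernel_series[OF \<rho> a(1) a0 a(3)])
      moreover have "(2 * \<rho>\<^sub>2 * cos \<phi>) ^ k * (1 / pi * (a ^ r / real r * sin (real r * \<theta>) * sin (real r * \<phi>))) * (2 * \<rho>\<^sub>2 * sin \<phi>) =
          t r * ((2 * cos \<phi>) ^ k * sin (real r * \<phi>) * (2 * sin \<phi>))" for r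
      proof -
        have "(2 * \<rho>\<^sub>2 * cos \<phi>) ^ k = \<rho>\<^sub>2 ^ k * (2 * cos \<phi>) ^ k" by (simp add: power_mult_distrib)
        then show ?thesis unfolding t_def power_Suc by (simp only: mult_ac)
      qed
      ultimately have "(\<lambda>r. t r * ((2 * cos \<phi>) ^ k * sin (real r * \<phi>) * (2 * sin \<phi>))) sums
          ((2 * \<rho>\<^sub>2 * cos \<phi>) ^ k * log_kernel c ?z (of_real \<rho>\<^sub>2 * cis \<phi>) * (2 * \<rho>\<^sub>2 * sin \<phi>))" by simp
      then show "(\<lambda>N. f N \<phi>) \<longlonglongrightarrow>
          (2 * Re (of_real \<rho>\<^sub>2 * cis \<phi>)) ^ k * log_kernel c ?z (of_real \<rho>\<^sub>2 * cis \<phi>) * (2 * \<rho>\<^sub>2 * sin \<phi>)"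
        unfolding sums_def f_def by (simp add: mult_ac)
    qed
  qed
  then have "semicircle_integral (\<rho>\<^sub>2\<^sup>2) (\<lambda>w. (2 * Re w) ^ k * log_kernel c ?z w) = I"
    unfolding semicircle_integral_polar[OF \<rho>(2) cont] by (rule integral_unique)
  also have "I = (\<Sum>r\<in>{1..Suc k}. e r)"
    unfolding I_def by (intro sum.mono_neutral_right) (auto simp: e_def)
  also have "\<dots> = \<rho>\<^sub>2 ^ Suc k / real (Suc k) * (\<Sum>r\<in>{1..Suc k}. a ^ r * cheb_coeff (Suc k) r * sin (real r * \<theta>))"
    unfolding sum_distrib_left e_def t_def by (intro sum.cong refl) (auto simp del: cheb_coeff.simps power_Suc of_nat_Suc)
  finally show ?thesis .
qed

lemma cmod_of_real_minus_cis: "(cmod (of_real a - cis \<alpha>))\<^sup>2 = 1 - 2 * a * cos \<alpha> + a\<^sup>2"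
proof -
  have "(cmod (of_real a - cis \<alpha>))\<^sup>2 = (a - cos \<alpha>)\<^sup>2 + (sin \<alpha>)\<^sup>2" by (simp add: cmod_power2)
  then show ?thesis by (simp add: sin_squared_eq power2_eq_square algebra_simps)
qed

lemma of_real_minus_cis_nonzero':
  assumes "0 \<le> a" "a \<le> 1" "cos \<alpha> < 1"
  shows "of_real a - cis \<alpha> \<noteq> 0"
proof
  assume "of_real a - cis \<alpha> = 0"
  then have "a = cos \<alpha>" "sin \<alpha> = 0" by (auto simp: complex_eq_iff)
  then have "(cos \<alpha>)\<^sup>2 = 1" using sin_cos_squared_add[of \<alpha>] by simp
  then show False using assms \<open>a = cos \<alpha>\<close> by (simp add: power2_eq_1_iff)
qed

lemma cos_less_one: "0 < \<alpha> \<Longrightarrow> \<alpha> < 2 * pi \<Longrightarrow> cos \<alpha> < 1" for \<alpha> :: real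
proof -
  assume "0 < \<alpha>" "\<alpha> < 2 * pi"
  then have "0 < sin (\<alpha> / 2)" by (intro sin_gt_zero) auto
  then have "0 < (sin (\<alpha> / 2))\<^sup>2" by simp
  then show ?thesis using cos_double_sin[of "\<alpha> / 2"] by simp
qed

lemma cos_sum_diff_less_one:
  assumes "0 < \<theta>" "\<theta> < pi" "0 < \<phi>" "\<phi> < pi" "\<theta> \<noteq> \<phi>"
  shows "cos (\<theta> + \<phi>) < 1" "cos (\<theta> - \<phi>) < 1"
proof -
  show "cos (\<theta> + \<phi>) < 1" using assms by (intro cos_less_one) auto
  have "cos \<bar>\<theta> - \<phi>\<bar> < 1" using assms by (intro cos_less_one) auto
  then show "cos (\<theta> - \<phi>) < 1" by simp
qed

text \<open>In terms of the distances \<open>P\<close> and \<open>Q\<close> the claim is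
  \<open>P c * Q d <= P d * Q c\<close>; after squaring, the difference is
  \<open>2 \<delta> (d - c) (1 - c d)\<close> with
  \<open>\<delta> = 2 sin \<theta> sin \<phi>\<close>.\<close>

lemma log_kernel_mono:
  assumes \<rho>: "0 < \<rho>" and c: "0 \<le> c" "c \<le> d" "d \<le> 1"
    and t: "0 < \<theta>" "\<theta> < pi" "0 < \<phi>" "\<phi> < pi" "\<theta> \<noteq> \<phi>"
  shows "log_kernel c (of_real \<rho> * cis \<theta>) (of_real \<rho> * cis \<phi>) \<le> log_kernel d (of_real \<rho> * cis \<theta>) (of_real \<rho> * cis \<phi>)"
proof -
  define P Q where "P a = cmod (of_real a - cis (\<theta> + \<phi>))" and "Q a = cmod (of_real a - cis (\<theta> - \<phi>))" for a
  have pos: "0 < P a" "0 < Q a" if "0 \<le> a" "a \<le> 1" for a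
    using of_real_minus_cis_nonzero'[OF that] cos_sum_diff_less_one[OF t] by (simp_all add: P_def Q_def)
  have k: "log_kernel a (of_real \<rho> * cis \<theta>) (of_real \<rho> * cis \<phi>) = 1 / (2 * pi) * ln (P a / Q a)" for a
    unfolding P_def Q_def by (rule log_kernel_polar) (use \<rho> in \<open>auto simp: power2_eq_square\<close>)
  let ?\<delta> = "cos (\<theta> - \<phi>) - cos (\<theta> + \<phi>)"
  have \<delta>: "0 \<le> ?\<delta>" using t sin_gt_zero[of \<theta>] sin_gt_zero[of \<phi>] by (simp add: cos_add cos_diff)
  have "0 \<le> 2 * ?\<delta> * ((d - c) * (1 - c * d))"
    using \<delta> c by (intro mult_nonneg_nonneg) (auto intro: mult_le_one)
  moreover have "(P d * Q c)\<^sup>2 - (P c * Q d)\<^sup>2 = 2 * ?\<delta> * ((d - c) * (1 - c * d))"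
    unfolding power_mult_distrib P_def Q_def cmod_of_real_minus_cis by (simp add: power2_eq_square algebra_simps)
  ultimately have "(P c * Q d)\<^sup>2 \<le> (P d * Q c)\<^sup>2" by linarith
  then have "P c * Q d \<le> P d * Q c" by (rule power2_le_imp_le) (simp add: P_def Q_def)
  then have "P c / Q c \<le> P d / Q d" using pos[of c] pos[of d] c by (simp add: field_simps)
  then have "ln (P c / Q c) \<le> ln (P d / Q d)" using pos[of c] pos[of d] c by (subst ln_le_cancel_iff) auto
  then show ?thesis unfolding k by (intro mult_left_mono) auto
qed

lemma log_kernel_zero:
  assumes "0 < \<rho>" shows "log_kernel 0 (of_real \<rho> * cis \<theta>) (of_real \<rho> * cis \<phi>) = 0"
  using log_kernel_polar[OF assms assms refl, of 0] by simp

lemma log_kernel_tendsto: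
  assumes \<rho>: "0 < \<rho>" and c: "c \<longlonglongrightarrow> 1"
    and t: "0 < \<theta>" "\<theta> < pi" "0 < \<phi>" "\<phi> < pi" "\<theta> \<noteq> \<phi>"
  shows "(\<lambda>n :: nat. log_kernel (c n) (of_real \<rho> * cis \<theta>) (of_real \<rho> * cis \<phi>)) \<longlonglongrightarrow>
    log_kernel 1 (of_real \<rho> * cis \<theta>) (of_real \<rho> * cis \<phi>)"
proof -
  have k: "log_kernel a (of_real \<rho> * cis \<theta>) (of_real \<rho> * cis \<phi>) =
      1 / (2 * pi) * ln (cmod (of_real a - cis (\<theta> + \<phi>)) / cmod (of_real a - cis (\<theta> - \<phi>)))" for a
    by (rule log_kernel_polar) (use \<rho> in \<open>auto simp: power2_eq_square\<close>)
  have nz: "of_real 1 - cis (\<theta> + \<phi>) \<noteq> 0" "of_real 1 - cis (\<theta> - \<phi>) \<noteq> 0"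
    by (rule of_real_minus_cis_nonzero', simp, simp, rule cos_sum_diff_less_one[OF t])+
  have "(\<lambda>n. cmod (of_real (c n) - cis (\<theta> + \<phi>)) / cmod (of_real (c n) - cis (\<theta> - \<phi>))) \<longlonglongrightarrow>
      cmod (of_real 1 - cis (\<theta> + \<phi>)) / cmod (of_real 1 - cis (\<theta> - \<phi>))"
    using nz by (intro tendsto_intros c) simp
  then show ?thesis unfolding k using nz by (intro tendsto_mult_left tendsto_ln) auto
qed

text \<open>The kernel now has a logarithmic singularity at \<open>w = z\<close>. It is approached
  by kernels with \<open>c < 1\<close>: monotone convergence for \<open>k = 0\<close> gives
  integrability of the singular kernel, which then dominates the approximations for general
  \<open>k\<close>.\<close>

lemma semicircle_integral_log_kernel_one:
  assumes \<rho>: "0 < \<rho>" and t: "0 < \<theta>" "\<theta> < pi"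
  shows "semicircle_integral (\<rho>\<^sup>2) (\<lambda>w. (2 * Re w) ^ k * log_kernel 1 (of_real \<rho> * cis \<theta>) w) =
    \<rho> ^ Suc k / real (Suc k) * (\<Sum>r\<in>{1..Suc k}. cheb_coeff (Suc k) r * sin (real r * \<theta>))"
proof -
  let ?z = "of_real \<rho> * cis \<theta>" and ?S = "{-2 * \<rho><..<2 * \<rho>}" and ?W = "semicircle_point (\<rho>\<^sup>2)"
  define c where "c n = 1 - inverse (real (Suc n))" for n
  have c: "0 \<le> c n" "c n < 1" for n by (simp_all add: c_def field_simps)
  have c_lim: "c \<longlonglongrightarrow> 1" using tendsto_diff[OF tendsto_const[of 1] LIMSEQ_inverse_real_of_nat] by (simp add: c_def[abs_def])
  have c_mono: "c m \<le> c n" if "m \<le> n" for m n unfolding c_def using that by (simp add: le_imp_inverse_le)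
  have c1: "c n = c n * min (\<rho>\<^sup>2) (\<rho>\<^sup>2) / (\<rho> * \<rho>)" for n using \<rho> by (simp add: power2_eq_square)
  define K where "K a x = log_kernel a ?z (?W x)" for a x
  \<comment> \<open>The singular point is excluded throughout as a null set.\<close>
  have ne: "AE x in lborel. x \<noteq> 2 * \<rho> * cos \<theta>" by (rule AE_lborel_singleton)
  have K: "K a x \<le> K b x" "K 0 x = 0" "(\<lambda>n. K (c n) x) \<longlonglongrightarrow> K 1 x"
    if x: "x \<in> ?S" "x \<noteq> 2 * \<rho> * cos \<theta>" "0 \<le> a" "a \<le> b" "b \<le> 1" for a b x
  proof -
    obtain \<phi> where \<phi>: "0 < \<phi>" "\<phi> < pi" "?W x = of_real \<rho> * cis \<phi>" "x = 2 * \<rho> * cos \<phi>"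
      using semicircle_point_cases[OF \<rho> x(1)] by blast
    then have ne: "\<theta> \<noteq> \<phi>" using x by auto
    show "K a x \<le> K b x" "K 0 x = 0" "(\<lambda>n. K (c n) x) \<longlonglongrightarrow> K 1 x"
      unfolding K_def \<phi>(3)
      by (rule log_kernel_mono[OF \<rho> x(3-5) t \<phi>(1,2) ne] log_kernel_zero[OF \<rho>] log_kernel_tendsto[OF \<rho> c_lim t \<phi>(1,2) ne])+
  qed
  have lim_rhs: "(\<lambda>n. \<rho> ^ Suc j / real (Suc j) * (\<Sum>r\<in>{1..Suc j}. c n ^ r * cheb_coeff (Suc j) r * sin (real r * \<theta>))) \<longlonglongrightarrow>
      \<rho> ^ Suc j / real (Suc j) * (\<Sum>r\<in>{1..Suc j}. 1 ^ r * cheb_coeff (Suc j) r * sin (real r * \<theta>))" for j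
    by (intro tendsto_intros c_lim)
  have lhs: "(LBINT x. indicator ?S x *\<^sub>R ((2 * Re (?W x)) ^ j * K (c n) x)) =
      \<rho> ^ Suc j / real (Suc j) * (\<Sum>r\<in>{1..Suc j}. c n ^ r * cheb_coeff (Suc j) r * sin (real r * \<theta>))" for n j
    using semicircle_integral_log_kernel_less[OF \<rho> \<rho> c1[of n] c(1) c(2), where k = j and \<theta> = \<theta>]
    unfolding semicircle_integral_eq_LBINT[OF \<rho>] set_lebesgue_integral_def K_def .
  have int: "integrable lborel (\<lambda>x. indicator ?S x *\<^sub>R ((2 * Re (?W x)) ^ j * K (c n) x))" for n j
  proof -
    have "continuous_on {w. cmod w = \<rho> \<and> 0 \<le> Im w} (\<lambda>w. (2 * Re w) ^ j * log_kernel (c n) ?z w)"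
      using c[of n] \<rho> by (intro continuous_intros log_kernel_continuous[of \<rho>]) (auto simp: norm_mult power2_eq_square)
    from semicircle_integrable[OF \<rho> this] show ?thesis unfolding set_integrable_def K_def .
  qed
  have W: "?W \<in> borel_measurable borel" "(\<lambda>x. cnj (?W x)) \<in> borel_measurable borel"
    by (intro borel_measurable_continuous_onI continuous_on_cnj semicircle_point_continuous)+
  note W[measurable]
  have [measurable]: "K 1 \<in> borel_measurable borel" unfolding K_def[abs_def] log_kernel_def by measurable
  have K1: "integrable lborel (\<lambda>x. indicator ?S x *\<^sub>R K 1 x)"
  proof (rule integrable_monotone_convergence[where f = "\<lambda>n x. indicator ?S x *\<^sub>R K (c n) x"])
    show "integrable lborel (\<lambda>x. indicator ?S x *\<^sub>R K (c n) x)" for n using int[of 0 n] by simp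
    show "AE x in lborel. mono (\<lambda>n. indicator ?S x *\<^sub>R K (c n) x)"
      using ne
    proof eventually_elim
      case (elim x)
      show ?case using K(1)[of x "c m" "c n" for m n] elim c c_mono
        by (auto simp: mono_def indicator_def less_imp_le)
    qed
    show "AE x in lborel. (\<lambda>n. indicator ?S x *\<^sub>R K (c n) x) \<longlonglongrightarrow> indicator ?S x *\<^sub>R K 1 x"
      using ne
    proof eventually_elim
      case (elim x)
      show ?case using K(3)[of x 0 0] elim by (auto simp: indicator_def)
    qed
    show "(\<lambda>n. LBINT x. indicator ?S x *\<^sub>R K (c n) x) \<longlonglongrightarrow>
        \<rho> ^ Suc 0 / real (Suc 0) * (\<Sum>r\<in>{1..Suc 0}. 1 ^ r * cheb_coeff (Suc 0) r * sin (real r * \<theta>))"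
      using lim_rhs[of 0] unfolding lhs[symmetric] by simp
  qed measurable
  have "(\<lambda>n. LBINT x. indicator ?S x *\<^sub>R ((2 * Re (?W x)) ^ k * K (c n) x)) \<longlonglongrightarrow>
      (LBINT x. indicator ?S x *\<^sub>R ((2 * Re (?W x)) ^ k * K 1 x))"
  proof (rule integral_dominated_convergence[where w = "\<lambda>x. (2 * \<rho>) ^ k * (indicator ?S x *\<^sub>R K 1 x)"])
    show "integrable lborel (\<lambda>x. (2 * \<rho>) ^ k * (indicator ?S x *\<^sub>R K 1 x))" using K1 by (rule integrable_mult_right)
    show "(\<lambda>x. indicator ?S x *\<^sub>R ((2 * Re (?W x)) ^ k * K (c n) x)) \<in> borel_measurable lborel" for n
      using int by (rule borel_measurable_integrable)
    show "(\<lambda>x. indicator ?S x *\<^sub>R ((2 * Re (?W x)) ^ k * K 1 x)) \<in> borel_measurable lborel" by measurable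
    show "AE x in lborel. (\<lambda>n. indicator ?S x *\<^sub>R ((2 * Re (?W x)) ^ k * K (c n) x)) \<longlonglongrightarrow>
        indicator ?S x *\<^sub>R ((2 * Re (?W x)) ^ k * K 1 x)"
      using ne
    proof eventually_elim
      case (elim x)
      show ?case
        by (cases "x \<in> ?S") (auto intro!: tendsto_mult_left K(3)[of x 0 0] simp: elim)
    qed
    show "AE x in lborel. norm (indicator ?S x *\<^sub>R ((2 * Re (?W x)) ^ k * K (c n) x)) \<le> (2 * \<rho>) ^ k * (indicator ?S x *\<^sub>R K 1 x)" for n
      using ne
    proof eventually_elim
      case (elim x)
      show ?case
      proof (cases "x \<in> ?S")
        case True
        have "0 \<le> K (c n) x" "K (c n) x \<le> K 1 x"
          using K(1)[OF True elim, of 0 "c n"] K(2)[OF True elim, of 0 0] K(1)[OF True elim, of "c n" 1] c[of n] by auto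
        moreover have "\<bar>x\<bar> ^ k \<le> (2 * \<rho>) ^ k" using True by (intro power_mono) auto
        ultimately have "\<bar>x\<bar> ^ k * K (c n) x \<le> (2 * \<rho>) ^ k * K 1 x" using \<rho> by (intro mult_mono) auto
        then show ?thesis using True \<open>0 \<le> K (c n) x\<close> by (simp add: abs_mult power_abs)
      qed simp
    qed
  qed
  then have "(LBINT x. indicator ?S x *\<^sub>R ((2 * Re (?W x)) ^ k * K 1 x)) =
      \<rho> ^ Suc k / real (Suc k) * (\<Sum>r\<in>{1..Suc k}. 1 ^ r * cheb_coeff (Suc k) r * sin (real r * \<theta>))"
    unfolding lhs by (rule LIMSEQ_unique) (rule lim_rhs)
  then show ?thesis
    unfolding semicircle_integral_eq_LBINT[OF \<rho>] set_lebesgue_integral_def K_def by simp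
qed

text \<open>The ratio \<open>a\<close> reaches 1 only if \<open>c = 1\<close> and the radii agree,
  since for different radii the smaller square is below the product.\<close>

lemma semicircle_integral_log_kernel:
  assumes \<rho>: "0 < \<rho>\<^sub>1" "0 < \<rho>\<^sub>2" and a: "a = c * min (\<rho>\<^sub>1\<^sup>2) (\<rho>\<^sub>2\<^sup>2) / (\<rho>\<^sub>1 * \<rho>\<^sub>2)" and c: "0 \<le> c" "c \<le> 1"
    and t: "0 < \<theta>" "\<theta> < pi"
  shows "semicircle_integral (\<rho>\<^sub>2\<^sup>2) (\<lambda>w. (2 * Re w) ^ k * log_kernel c (of_real \<rho>\<^sub>1 * cis \<theta>) w) =
    \<rho>\<^sub>2 ^ Suc k / real (Suc k) * (\<Sum>r\<in>{1..Suc k}. a ^ r * cheb_coeff (Suc k) r * sin (real r * \<theta>))"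
proof (cases "a < 1")
  case True
  then show ?thesis using semicircle_integral_log_kernel_less[OF \<rho> a c(1)] by blast
next
  case False
  have le: "min (\<rho>\<^sub>1\<^sup>2) (\<rho>\<^sub>2\<^sup>2) \<le> \<rho>\<^sub>1 * \<rho>\<^sub>2" "\<rho>\<^sub>1 \<noteq> \<rho>\<^sub>2 \<Longrightarrow> min (\<rho>\<^sub>1\<^sup>2) (\<rho>\<^sub>2\<^sup>2) < \<rho>\<^sub>1 * \<rho>\<^sub>2"
  proof -
    have lt: "min (\<rho>\<^sub>1\<^sup>2) (\<rho>\<^sub>2\<^sup>2) < \<rho>\<^sub>1 * \<rho>\<^sub>2" if "\<rho>\<^sub>1 \<noteq> \<rho>\<^sub>2"
    proof (cases "\<rho>\<^sub>1 < \<rho>\<^sub>2")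
      case True
      then have "\<rho>\<^sub>1\<^sup>2 < \<rho>\<^sub>1 * \<rho>\<^sub>2" using \<rho> unfolding power2_eq_square by (intro mult_strict_left_mono)
      then show ?thesis by (rule min.strict_coboundedI1)
    next
      case False
      then have "\<rho>\<^sub>2\<^sup>2 < \<rho>\<^sub>1 * \<rho>\<^sub>2" using \<rho> that unfolding power2_eq_square by (intro mult_strict_right_mono) auto
      then show ?thesis by (rule min.strict_coboundedI2)
    qed
    then show "\<rho>\<^sub>1 \<noteq> \<rho>\<^sub>2 \<Longrightarrow> min (\<rho>\<^sub>1\<^sup>2) (\<rho>\<^sub>2\<^sup>2) < \<rho>\<^sub>1 * \<rho>\<^sub>2" .
    show "min (\<rho>\<^sub>1\<^sup>2) (\<rho>\<^sub>2\<^sup>2) \<le> \<rho>\<^sub>1 * \<rho>\<^sub>2"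
    proof (cases "\<rho>\<^sub>1 = \<rho>\<^sub>2")
      case True
      then show ?thesis by (simp add: power2_eq_square)
    qed (rule less_imp_le[OF lt])
  qed
  have m0: "0 < min (\<rho>\<^sub>1\<^sup>2) (\<rho>\<^sub>2\<^sup>2)" using \<rho> by simp
  have "\<rho>\<^sub>1 * \<rho>\<^sub>2 \<le> c * min (\<rho>\<^sub>1\<^sup>2) (\<rho>\<^sub>2\<^sup>2)"
  proof -
    have "1 \<le> c * min (\<rho>\<^sub>1\<^sup>2) (\<rho>\<^sub>2\<^sup>2) / (\<rho>\<^sub>1 * \<rho>\<^sub>2)" using False a by simp
    then show ?thesis using \<rho> by (simp add: pos_le_divide_eq)
  qed
  moreover have "c * min (\<rho>\<^sub>1\<^sup>2) (\<rho>\<^sub>2\<^sup>2) \<le> 1 * min (\<rho>\<^sub>1\<^sup>2) (\<rho>\<^sub>2\<^sup>2)" using c m0 by (intro mult_right_mono) auto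
  ultimately have eq: "\<rho>\<^sub>1 = \<rho>\<^sub>2" and "min (\<rho>\<^sub>1\<^sup>2) (\<rho>\<^sub>2\<^sup>2) \<le> c * min (\<rho>\<^sub>1\<^sup>2) (\<rho>\<^sub>2\<^sup>2)" using le by linarith+
  then have "c = 1" using m0 c mult_le_cancel_right1[of "min (\<rho>\<^sub>1\<^sup>2) (\<rho>\<^sub>2\<^sup>2)" c] by auto
  moreover from this have "a = 1" using a eq \<rho> by (simp add: power2_eq_square)
  ultimately show ?thesis using semicircle_integral_log_kernel_one[OF \<rho>(2) t] eq by simp
qed

lemma semicircle_integral_cong:
  assumes "0 < \<rho>" "\<And>\<theta>. 0 < \<theta> \<Longrightarrow> \<theta> < pi \<Longrightarrow> f (of_real \<rho> * cis \<theta>) = g (of_real \<rho> * cis \<theta>)"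
  shows "semicircle_integral (\<rho>\<^sup>2) f = semicircle_integral (\<rho>\<^sup>2) g"
  unfolding semicircle_integral_eq_LBINT[OF assms(1)]
proof (rule set_lebesgue_integral_cong)
  show "\<forall>x. x \<in> {-2 * \<rho><..<2 * \<rho>} \<longrightarrow> f (semicircle_point (\<rho>\<^sup>2) x) = g (semicircle_point (\<rho>\<^sup>2) x)"
    using semicircle_point_cases[OF assms(1)] assms(2) by metis
qed simp

lemma semicircle_integral_cmult: "semicircle_integral y (\<lambda>w. k * f w) = k * semicircle_integral y f"
proof -
  have "indicator A x *\<^sub>R (k * f w) = k * (indicator A x *\<^sub>R f w)" for A :: "real set" and x w by simp
  then show ?thesis unfolding semicircle_integral_def set_lebesgue_integral_def by (simp only: integral_mult_right_zero)
qed

text \<open>The inner integral is a trigonometric polynomial in the angle of \<open>z\<close>, so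
  the outer one is again given by \<open>integral_cos_power_sin\<close>, degree by degree.\<close>

lemma moment_cov_eq:
  assumes y: "0 < y\<^sub>1" "0 < y\<^sub>2" and c: "0 \<le> c \<tau>\<^sub>1 \<tau>\<^sub>2" "c \<tau>\<^sub>1 \<tau>\<^sub>2 \<le> 1"
  shows "moment_cov c (\<tau>\<^sub>1, y\<^sub>1, k\<^sub>1) (\<tau>\<^sub>2, y\<^sub>2, k\<^sub>2) =
    (\<Sum>r\<in>{1..Suc k\<^sub>2}. pi / (real (Suc k\<^sub>1) * real (Suc k\<^sub>2)) * (real r * cheb_coeff (Suc k\<^sub>1) r * cheb_coeff (Suc k\<^sub>2) r *
      sqrt y\<^sub>1 ^ (Suc k\<^sub>1 - r) * sqrt y\<^sub>2 ^ (Suc k\<^sub>2 - r) * (c \<tau>\<^sub>1 \<tau>\<^sub>2 * min y\<^sub>1 y\<^sub>2) ^ r))"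
proof -
  define \<rho>\<^sub>1 \<rho>\<^sub>2 where r: "\<rho>\<^sub>1 = sqrt y\<^sub>1" "\<rho>\<^sub>2 = sqrt y\<^sub>2"
  have \<rho>: "0 < \<rho>\<^sub>1" "0 < \<rho>\<^sub>2" using y by (simp_all add: r)
  have yr: "y\<^sub>1 = \<rho>\<^sub>1\<^sup>2" "y\<^sub>2 = \<rho>\<^sub>2\<^sup>2" using y by (simp_all add: r)
  define a where "a = c \<tau>\<^sub>1 \<tau>\<^sub>2 * min (\<rho>\<^sub>1\<^sup>2) (\<rho>\<^sub>2\<^sup>2) / (\<rho>\<^sub>1 * \<rho>\<^sub>2)"
  define C where "C = \<rho>\<^sub>2 ^ Suc k\<^sub>2 / real (Suc k\<^sub>2)"
  \<comment> \<open>\<open>Im (z ^ r) / \<rho>\<^sub>1 ^ r\<close> is the sine of \<open>r\<close>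
    times the angle, written so that the integrand is a continuous function of
    \<open>z\<close>.\<close>
  define g where "g z = (2 * Re z) ^ k\<^sub>1 * (C * (\<Sum>r\<in>{1..Suc k\<^sub>2}. a ^ r * cheb_coeff (Suc k\<^sub>2) r * (Im (z ^ r) / \<rho>\<^sub>1 ^ r)))" for z
  have Im_pow: "Im ((of_real \<rho>\<^sub>1 * cis \<theta>) ^ n) / \<rho>\<^sub>1 ^ n = sin (real n * \<theta>)" for \<theta> n
  proof -
    have "(of_real \<rho>\<^sub>1 * cis \<theta>) ^ n = of_real (\<rho>\<^sub>1 ^ n) * cis (real n * \<theta>)" by (simp only: power_mult_distrib Complex.DeMoivre of_real_power)
    then show ?thesis using \<rho> by (simp del: of_real_power)
  qed
  have "moment_cov c (\<tau>\<^sub>1, y\<^sub>1, k\<^sub>1) (\<tau>\<^sub>2, y\<^sub>2, k\<^sub>2) = semicircle_integral (\<rho>\<^sub>1\<^sup>2) (\<lambda>z. (2 * Re z) ^ k\<^sub>1 *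
      semicircle_integral (\<rho>\<^sub>2\<^sup>2) (\<lambda>w. (2 * Re w) ^ k\<^sub>2 * log_kernel (c \<tau>\<^sub>1 \<tau>\<^sub>2) z w))"
    unfolding moment_cov_def yr prod.case mult.assoc semicircle_integral_cmult ..
  also have "\<dots> = semicircle_integral (\<rho>\<^sub>1\<^sup>2) g"
    by (rule semicircle_integral_cong[OF \<rho>(1)])
      (simp only: g_def C_def Im_pow semicircle_integral_log_kernel[OF \<rho> a_def c])
  also have "\<dots> = integral {0..pi} (\<lambda>\<theta>. g (of_real \<rho>\<^sub>1 * cis \<theta>) * (2 * \<rho>\<^sub>1 * sin \<theta>))"
    by (rule semicircle_integral_polar[OF \<rho>(1)]) (use \<rho>(1) in \<open>auto simp: g_def[abs_def] intro!: continuous_intros\<close>)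
  also have "\<dots> = (\<Sum>r\<in>{1..Suc k\<^sub>2}. \<rho>\<^sub>1 ^ Suc k\<^sub>1 * C * (a ^ r * cheb_coeff (Suc k\<^sub>2) r) *
      (real r / real (Suc k\<^sub>1) * pi * cheb_coeff (Suc k\<^sub>1) r))"
  proof (rule integral_unique)
    have "((\<lambda>\<theta>. \<Sum>r\<in>{1..Suc k\<^sub>2}. \<rho>\<^sub>1 ^ Suc k\<^sub>1 * C * (a ^ r * cheb_coeff (Suc k\<^sub>2) r) *
        ((2 * cos \<theta>) ^ k\<^sub>1 * sin (real r * \<theta>) * (2 * sin \<theta>))) has_integral
      (\<Sum>r\<in>{1..Suc k\<^sub>2}. \<rho>\<^sub>1 ^ Suc k\<^sub>1 * C * (a ^ r * cheb_coeff (Suc k\<^sub>2) r) *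
      (real r / real (Suc k\<^sub>1) * pi * cheb_coeff (Suc k\<^sub>1) r))) {0..pi}"
      by (intro has_integral_sum has_integral_mult_right integral_cos_power_sin finite_atLeastAtMost)
    moreover have "(\<Sum>r\<in>{1..Suc k\<^sub>2}. \<rho>\<^sub>1 ^ Suc k\<^sub>1 * C * (a ^ r * cheb_coeff (Suc k\<^sub>2) r) *
        ((2 * cos \<theta>) ^ k\<^sub>1 * sin (real r * \<theta>) * (2 * sin \<theta>))) = g (of_real \<rho>\<^sub>1 * cis \<theta>) * (2 * \<rho>\<^sub>1 * sin \<theta>)" for \<theta>
    proof -
      have "(2 * Re (of_real \<rho>\<^sub>1 * cis \<theta>)) ^ k\<^sub>1 = \<rho>\<^sub>1 ^ k\<^sub>1 * (2 * cos \<theta>) ^ k\<^sub>1" by (simp add: power_mult_distrib)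
      then show ?thesis unfolding g_def Im_pow sum_distrib_left sum_distrib_right
        by (intro sum.cong refl) (simp only: power_Suc mult_ac)
    qed
    ultimately show "((\<lambda>\<theta>. g (of_real \<rho>\<^sub>1 * cis \<theta>) * (2 * \<rho>\<^sub>1 * sin \<theta>)) has_integral
      (\<Sum>r\<in>{1..Suc k\<^sub>2}. \<rho>\<^sub>1 ^ Suc k\<^sub>1 * C * (a ^ r * cheb_coeff (Suc k\<^sub>2) r) *
      (real r / real (Suc k\<^sub>1) * pi * cheb_coeff (Suc k\<^sub>1) r))) {0..pi}" by simp
  qed
  also have "\<dots> = (\<Sum>r\<in>{1..Suc k\<^sub>2}. pi / (real (Suc k\<^sub>1) * real (Suc k\<^sub>2)) * (real r * cheb_coeff (Suc k\<^sub>1) r * cheb_coeff (Suc k\<^sub>2) r *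
      sqrt y\<^sub>1 ^ (Suc k\<^sub>1 - r) * sqrt y\<^sub>2 ^ (Suc k\<^sub>2 - r) * (c \<tau>\<^sub>1 \<tau>\<^sub>2 * min y\<^sub>1 y\<^sub>2) ^ r))"
  proof (intro sum.cong refl)
    fix n assume n: "n \<in> {1..Suc k\<^sub>2}"
    show "\<rho>\<^sub>1 ^ Suc k\<^sub>1 * C * (a ^ n * cheb_coeff (Suc k\<^sub>2) n) * (real n / real (Suc k\<^sub>1) * pi * cheb_coeff (Suc k\<^sub>1) n) =
      pi / (real (Suc k\<^sub>1) * real (Suc k\<^sub>2)) * (real n * cheb_coeff (Suc k\<^sub>1) n * cheb_coeff (Suc k\<^sub>2) n *
      sqrt y\<^sub>1 ^ (Suc k\<^sub>1 - n) * sqrt y\<^sub>2 ^ (Suc k\<^sub>2 - n) * (c \<tau>\<^sub>1 \<tau>\<^sub>2 * min y\<^sub>1 y\<^sub>2) ^ n)"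
    \<comment> \<open>Above degree \<open>Suc k\<^sub>1\<close> the coefficient is 0, which also
      disposes of the truncated exponent.\<close>
    proof (cases "Suc k\<^sub>1 < n")
      case False
      define b where "b = (c \<tau>\<^sub>1 \<tau>\<^sub>2 * min y\<^sub>1 y\<^sub>2) ^ n"
      have an: "a ^ n = b / (\<rho>\<^sub>1 ^ n * \<rho>\<^sub>2 ^ n)" by (simp only: a_def b_def yr power_divide power_mult_distrib)
      have p: "\<rho>\<^sub>1 ^ Suc k\<^sub>1 = \<rho>\<^sub>1 ^ (Suc k\<^sub>1 - n) * \<rho>\<^sub>1 ^ n" "\<rho>\<^sub>2 ^ Suc k\<^sub>2 = \<rho>\<^sub>2 ^ (Suc k\<^sub>2 - n) * \<rho>\<^sub>2 ^ n"
        using False n by (simp_all flip: power_add del: power_Suc)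
      have nz: "\<rho>\<^sub>1 ^ n \<noteq> 0" "\<rho>\<^sub>2 ^ n \<noteq> 0" using \<rho> by simp_all
      have alg: "u1 * v1 * (u2 * v2 / q) * (b / (v1 * v2) * e2) * (x / p * pi * e1) =
          pi / (p * q) * (x * e1 * e2 * u1 * u2 * b)" if "v1 \<noteq> 0" "v2 \<noteq> 0" for u1 u2 v1 v2 q e1 e2 x p :: real
        using that by (simp add: field_simps)
      show ?thesis unfolding C_def an p b_def[symmetric] r[symmetric] by (rule alg[OF nz])
    qed (simp add: cheb_coeff_eq_0 del: cheb_coeff.simps)
  qed
  finally show ?thesis .
qed

section \<open>Convergence of the height moments\<close>

lemma gauss_moment_of_real: "gauss_moment (complex_of_real v) m = complex_of_real (normal_moment v m)"
  by (induction v m rule: normal_moment.induct) simp_all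

lemma sqrt_floor_ratio_tendsto:
  assumes "0 < y"
  shows "((\<lambda>L. sqrt (real (nat \<lfloor>L * y\<rfloor>)) / sqrt L) \<longlongrightarrow> sqrt y) at_top"
proof -
  have "((\<lambda>L. real (nat \<lfloor>L * y\<rfloor>) / L) \<longlongrightarrow> y) at_top"
  proof (rule tendsto_sandwich)
    show "((\<lambda>L. y - 1 / L) \<longlongrightarrow> y) at_top" by (rule tendsto_eq_rhs[OF tendsto_diff[OF tendsto_const tendsto_divide_0[OF tendsto_const filterlim_at_top_imp_at_infinity[OF filterlim_ident]]]]) simp
    show "((\<lambda>_. y) \<longlongrightarrow> y) at_top" by simp
    show "\<forall>\<^sub>F L in at_top. y - 1 / L \<le> real (nat \<lfloor>L * y\<rfloor>) / L"
      using eventually_gt_at_top[of 0]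
    proof eventually_elim
      case (elim L)
      have "L * y - 1 \<le> real (nat \<lfloor>L * y\<rfloor>)" by linarith
      then have "(L * y - 1) / L \<le> real (nat \<lfloor>L * y\<rfloor>) / L" using elim by (intro divide_right_mono) auto
      then show ?case using elim by (simp add: diff_divide_distrib)
    qed
    show "\<forall>\<^sub>F L in at_top. real (nat \<lfloor>L * y\<rfloor>) / L \<le> y"
      using eventually_gt_at_top[of 0]
    proof eventually_elim
      case (elim L)
      have "0 < L * y" using elim assms by simp
      then have "real (nat \<lfloor>L * y\<rfloor>) \<le> L * y" by linarith
      then show ?case using elim by (simp add: pos_divide_le_eq mult.commute)
    qed
  qed
  from tendsto_real_sqrt[OF this] show ?thesis by (simp only: real_sqrt_divide)
qed

context time_dependent_wigner begin

text \<open>Expand the non-negative expectation of \<open>(Y 1 s - Y 1 t)^2\<close> and use that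
  \<open>c\<close> is 1 on the diagonal. The bound keeps the kernel in the range where it has been
  integrated.\<close>

lemma c_le_one: "c s t \<le> 1"
proof -
  have Y: "Y 1 s \<omega> = Re (entry s 0 0 \<omega>)" for s \<omega> by (simp add: entry_diag)
  have int: "integrable M (\<lambda>\<omega>. Y 1 s \<omega> * Y 1 t \<omega>)" for s t
  proof -
    have "integrable M (\<lambda>\<omega>. Re (entry s 0 0 \<omega> * entry t 0 0 \<omega>))" by (intro integrable_Re Lp_integrable Lp_mult Lp_entry)
    then show ?thesis by (simp add: entry_diag)
  qed
  have "0 \<le> (LINT \<omega>|M. (Y 1 s \<omega> - Y 1 t \<omega>)\<^sup>2)" by (rule Bochner_Integration.integral_nonneg) simp
  also have "\<dots> = (LINT \<omega>|M. Y 1 s \<omega> * Y 1 s \<omega> + Y 1 t \<omega> * Y 1 t \<omega> - (Y 1 s \<omega> * Y 1 t \<omega> + Y 1 s \<omega> * Y 1 t \<omega>))"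
    by (intro Bochner_Integration.integral_cong refl) (simp add: power2_eq_square algebra_simps)
  also have "\<dots> = (LINT \<omega>|M. Y 1 s \<omega> * Y 1 s \<omega>) + (LINT \<omega>|M. Y 1 t \<omega> * Y 1 t \<omega>) -
      ((LINT \<omega>|M. Y 1 s \<omega> * Y 1 t \<omega>) + (LINT \<omega>|M. Y 1 s \<omega> * Y 1 t \<omega>))"
    using int by simp
  finally have "0 \<le> real \<beta> / 2 * ((LINT \<omega>|M. Y 1 s \<omega> * Y 1 s \<omega>) + (LINT \<omega>|M. Y 1 t \<omega> * Y 1 t \<omega>) -
      ((LINT \<omega>|M. Y 1 s \<omega> * Y 1 t \<omega>) + (LINT \<omega>|M. Y 1 s \<omega> * Y 1 t \<omega>)))"
    by (rule mult_nonneg_nonneg[rotated]) simp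
  then have "0 \<le> c s s + c t t - (c s t + c s t)"
    unfolding wigner_cov_def by (simp only: right_diff_distrib distrib_left)
  then show ?thesis using cov_diag by simp
qed

definition limit_weight :: "real \<times> real \<times> nat \<Rightarrow> nat \<Rightarrow> real" where
  "limit_weight = (\<lambda>(t, y, k) r. sqrt (real \<beta> * pi / 2) / real (Suc k) * cheb_coeff (Suc k) r * sqrt y ^ (Suc k - r))"

abbreviation idx_time :: "(real \<times> real \<times> nat) \<times> nat \<Rightarrow> real" where "idx_time b \<equiv> fst (fst b)"
abbreviation idx_level :: "(real \<times> real \<times> nat) \<times> nat \<Rightarrow> real" where "idx_level b \<equiv> fst (snd (fst b))"
abbreviation idx_degree :: "real \<times> real \<times> nat \<Rightarrow> nat" where "idx_degree i \<equiv> Suc (snd (snd i))"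

lemma cheb_weight_tendsto:
  "0 < fst (snd i) \<Longrightarrow> ((\<lambda>L. cheb_weight L (fst (snd i)) (idx_degree i) r) \<longlongrightarrow> limit_weight i r) at_top"
  unfolding cheb_weight_def limit_weight_def case_prod_beta'
  by (intro tendsto_intros sqrt_floor_ratio_tendsto)

text \<open>Two normalising constants \<open>sqrt (\<beta> pi / 2)\<close> times the factor
  \<open>2 / \<beta>\<close> of the covariances give \<open>pi\<close>, the constant produced by the
  kernel; this is why the limit depends on \<open>\<beta>\<close> through \<open>c\<close>
  only.\<close>

lemma moment_cov_eq_sum:
  assumes "0 < fst (snd i)" "0 < fst (snd j)"
  shows "moment_cov c i j = (\<Sum>r\<in>{1..idx_degree i}. \<Sum>q\<in>{1..idx_degree j}.
    limit_weight i r * limit_weight j q * stat_cov idx_time idx_level snd (i, r) (j, q))"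
proof -
  obtain \<tau>\<^sub>1 y\<^sub>1 k\<^sub>1 \<tau>\<^sub>2 y\<^sub>2 k\<^sub>2 where ij: "i = (\<tau>\<^sub>1, y\<^sub>1, k\<^sub>1)" "j = (\<tau>\<^sub>2, y\<^sub>2, k\<^sub>2)" by (metis prod_cases3)
  have y: "0 < y\<^sub>1" "0 < y\<^sub>2" using assms by (simp_all add: ij)
  let ?w = "\<lambda>r q. limit_weight i r * limit_weight j q * stat_cov idx_time idx_level snd (i, r) (j, q)"
  have \<beta>: "0 < real \<beta>" using beta by auto
  have "(\<Sum>r\<in>{1..idx_degree i}. \<Sum>q\<in>{1..idx_degree j}. ?w r q) = (\<Sum>q\<in>{1..Suc k\<^sub>2}. \<Sum>r\<in>{1..Suc k\<^sub>1}. ?w r q)"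
    by (subst sum.swap) (simp add: ij)
  also have "\<dots> = (\<Sum>q\<in>{1..Suc k\<^sub>2}. pi / (real (Suc k\<^sub>1) * real (Suc k\<^sub>2)) * (real q * cheb_coeff (Suc k\<^sub>1) q * cheb_coeff (Suc k\<^sub>2) q *
      sqrt y\<^sub>1 ^ (Suc k\<^sub>1 - q) * sqrt y\<^sub>2 ^ (Suc k\<^sub>2 - q) * (c \<tau>\<^sub>1 \<tau>\<^sub>2 * min y\<^sub>1 y\<^sub>2) ^ q))"
  proof (rule sum.cong[OF refl])
    fix q assume q: "q \<in> {1..Suc k\<^sub>2}"
    define b where "b = (c \<tau>\<^sub>1 \<tau>\<^sub>2 * min y\<^sub>1 y\<^sub>2) ^ q"
    have "(\<Sum>r\<in>{1..Suc k\<^sub>1}. ?w r q) = (\<Sum>r\<in>{1..Suc k\<^sub>1}. if r = q then ?w q q else 0)"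
      by (intro sum.cong refl) (auto simp: stat_cov_def)
    also have "\<dots> = (if q \<in> {1..Suc k\<^sub>1} then ?w q q else 0)" by (rule sum.delta) simp
    also have "\<dots> = ?w q q"
      using q by (auto simp: limit_weight_def ij cheb_coeff_eq_0 simp del: cheb_coeff.simps)
    also have "\<dots> = (sqrt (real \<beta> * pi / 2) / real (Suc k\<^sub>1) * cheb_coeff (Suc k\<^sub>1) q * sqrt y\<^sub>1 ^ (Suc k\<^sub>1 - q)) *
        (sqrt (real \<beta> * pi / 2) / real (Suc k\<^sub>2) * cheb_coeff (Suc k\<^sub>2) q * sqrt y\<^sub>2 ^ (Suc k\<^sub>2 - q)) * (2 / real \<beta> * real q * b)"
      by (simp only: limit_weight_def stat_cov_def ij b_def prod.case fst_conv snd_conv if_True refl)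
    also have "\<dots> = pi / (real (Suc k\<^sub>1) * real (Suc k\<^sub>2)) * (real q * cheb_coeff (Suc k\<^sub>1) q * cheb_coeff (Suc k\<^sub>2) q *
      sqrt y\<^sub>1 ^ (Suc k\<^sub>1 - q) * sqrt y\<^sub>2 ^ (Suc k\<^sub>2 - q) * b)"
    proof -
      have alg: "(s / p * e1 * u1) * (s / p' * e2 * u2) * (2 / real \<beta> * x * b) = pi / (p * p') * (x * e1 * e2 * u1 * u2 * b)"
        if "s * s = real \<beta> * pi / 2" for s p p' e1 e2 u1 u2 x :: real
      proof -
        have "(s / p * e1 * u1) * (s / p' * e2 * u2) * (2 / real \<beta> * x * b) = (s * s) * (2 / real \<beta>) / (p * p') * (x * e1 * e2 * u1 * u2 * b)"
          by (simp add: mult_ac)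
        also have "(s * s) * (2 / real \<beta>) = pi" unfolding that using \<beta> by simp
        finally show ?thesis .
      qed
      show ?thesis by (rule alg) (use \<beta> in simp)
    qed
    finally show "(\<Sum>r\<in>{1..Suc k\<^sub>1}. ?w r q) = pi / (real (Suc k\<^sub>1) * real (Suc k\<^sub>2)) * (real q * cheb_coeff (Suc k\<^sub>1) q * cheb_coeff (Suc k\<^sub>2) q *
      sqrt y\<^sub>1 ^ (Suc k\<^sub>1 - q) * sqrt y\<^sub>2 ^ (Suc k\<^sub>2 - q) * (c \<tau>\<^sub>1 \<tau>\<^sub>2 * min y\<^sub>1 y\<^sub>2) ^ q)" unfolding b_def .
  qed
  also have "\<dots> = moment_cov c i j"
    unfolding ij by (rule moment_cov_eq[where c = c, OF y cov_nonneg c_le_one, symmetric])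
  finally show ?thesis ..
qed

lemma moment_cov_commute:
  assumes "0 < fst (snd i)" "0 < fst (snd j)"
  shows "moment_cov c i j = moment_cov c j i"
  unfolding moment_cov_eq_sum[OF assms] moment_cov_eq_sum[OF assms(2,1)]
  by (subst sum.swap) (intro sum.cong refl, simp add: stat_cov_def c_commute min.commute mult_ac)

abbreviation moment_indices :: "(real \<times> real \<times> nat) set" where
  "moment_indices \<equiv> {(\<tau>, y, k). 0 < y}"

abbreviation height_comb :: "(real \<times> real \<times> nat) set \<Rightarrow> (real \<times> real \<times> nat \<Rightarrow> real) \<Rightarrow> real \<Rightarrow> 'a \<Rightarrow> real" where
  "height_comb J \<theta> L \<omega> \<equiv> \<Sum>i\<in>J. \<theta> i * height_moment M \<beta> Z Y L i \<omega>"

abbreviation limit_form :: "(real \<times> real \<times> nat) set \<Rightarrow> (real \<times> real \<times> nat \<Rightarrow> real) \<Rightarrow> real" where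
  "limit_form J \<theta> \<equiv> \<Sum>i\<in>J. \<Sum>j\<in>J. \<theta> i * \<theta> j * moment_cov c i j"

lemma height_comb_eq_stat_comb:
  assumes J: "finite J" and L: "0 < L"
  shows "complex_of_real (height_comb J \<theta> L \<omega>) =
    stat_comb (Sigma J (\<lambda>i. {1..idx_degree i})) idx_time idx_level snd
      (\<lambda>L b. \<theta> (fst b) * cheb_weight L (idx_level b) (idx_degree (fst b)) (snd b)) L \<omega>"
proof -
  have "complex_of_real (height_moment M \<beta> Z Y L i \<omega>) =
      (\<Sum>r\<in>{1..idx_degree i}. of_real (cheb_weight L (fst (snd i)) (idx_degree i) r) * cheb_stat L (fst i) (fst (snd i)) r \<omega>)" for i
    using height_moment_eq[OF L, of "fst i" "fst (snd i)" "snd (snd i)" \<omega>] by simp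
  then have "complex_of_real (height_comb J \<theta> L \<omega>) = (\<Sum>i\<in>J. \<Sum>r\<in>{1..idx_degree i}.
      of_real (\<theta> i * cheb_weight L (fst (snd i)) (idx_degree i) r) * cheb_stat L (fst i) (fst (snd i)) r \<omega>)"
    by (simp only: of_real_sum of_real_mult sum_distrib_left mult.assoc)
  also have "\<dots> = (\<Sum>(i, r)\<in>Sigma J (\<lambda>i. {1..idx_degree i}).
      of_real (\<theta> i * cheb_weight L (fst (snd i)) (idx_degree i) r) * cheb_stat L (fst i) (fst (snd i)) r \<omega>)"
    by (rule sum.Sigma) (use J in auto)
  finally show ?thesis unfolding stat_comb_def case_prod_beta' .
qed

text \<open>Pairs of an index and a degree enumerate the summands of one linear combination of
  statistics, to which \<open>stat_comb_moment\<close> applies; its coefficients converge by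
  \<open>cheb_weight_tendsto\<close>.\<close>

lemma height_comb_moment_tendsto:
  assumes J: "finite J" "J \<subseteq> moment_indices"
  shows "((\<lambda>L. LINT \<omega>|M. height_comb J \<theta> L \<omega> ^ m) \<longlongrightarrow> normal_moment (limit_form J \<theta>) m) at_top"
proof -
  let ?B = "Sigma J (\<lambda>i. {1..idx_degree i})"
  let ?\<xi> = "\<lambda>L b. \<theta> (fst b) * cheb_weight L (idx_level b) (idx_degree (fst b)) (snd b)"
  let ?\<xi>' = "\<lambda>b. \<theta> (fst b) * limit_weight (fst b) (snd b)"
  have pos: "0 < fst (snd i)" if "i \<in> J" for i using J(2) that by auto
  have "(\<Sum>b\<in>?B. \<Sum>b'\<in>?B. ?\<xi>' b * ?\<xi>' b' * stat_cov idx_time idx_level snd b b') = limit_form J \<theta>"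
  proof -
    have fin: "finite J" "\<forall>i\<in>J. finite {1..idx_degree i}" using J by auto
    have S: "(\<Sum>b\<in>?B. f b) = (\<Sum>i\<in>J. \<Sum>r\<in>{1..idx_degree i}. f (i, r))" for f :: "_ \<Rightarrow> real"
      using sum.Sigma[OF fin, of "\<lambda>i r. f (i, r)"] by (simp add: case_prod_beta')
    have "(\<Sum>b\<in>?B. \<Sum>b'\<in>?B. ?\<xi>' b * ?\<xi>' b' * stat_cov idx_time idx_level snd b b') =
        (\<Sum>i\<in>J. \<Sum>r\<in>{1..idx_degree i}. \<Sum>j\<in>J. \<Sum>q\<in>{1..idx_degree j}.
          \<theta> i * limit_weight i r * (\<theta> j * limit_weight j q) * stat_cov idx_time idx_level snd (i, r) (j, q))"
      unfolding S by simp
    also have "\<dots> = (\<Sum>i\<in>J. \<Sum>j\<in>J. \<Sum>r\<in>{1..idx_degree i}. \<Sum>q\<in>{1..idx_degree j}.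
          \<theta> i * limit_weight i r * (\<theta> j * limit_weight j q) * stat_cov idx_time idx_level snd (i, r) (j, q))"
      by (intro sum.cong refl sum.swap)
    also have "\<dots> = limit_form J \<theta>"
    proof (intro sum.cong refl)
      fix i j assume ij: "i \<in> J" "j \<in> J"
      show "(\<Sum>r\<in>{1..idx_degree i}. \<Sum>q\<in>{1..idx_degree j}.
          \<theta> i * limit_weight i r * (\<theta> j * limit_weight j q) * stat_cov idx_time idx_level snd (i, r) (j, q)) = \<theta> i * \<theta> j * moment_cov c i j"
        unfolding moment_cov_eq_sum[OF pos[OF ij(1)] pos[OF ij(2)]] sum_distrib_left
        by (intro sum.cong refl) (simp only: mult_ac)
    qed
    finally show ?thesis .
  qed
  moreover have "((\<lambda>L. LINT \<omega>|M. stat_comb ?B idx_time idx_level snd ?\<xi> L \<omega> ^ m) \<longlongrightarrow>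
      gauss_moment (complex_of_real (\<Sum>b\<in>?B. \<Sum>b'\<in>?B. ?\<xi>' b * ?\<xi>' b' * stat_cov idx_time idx_level snd b b')) m) at_top"
  proof (rule stat_comb_moment)
    show "finite ?B" using J by auto
    show "0 < idx_level b" if "b \<in> ?B" for b using that pos by auto
    show "1 \<le> snd b" if "b \<in> ?B" for b using that by auto
    show "((\<lambda>L. ?\<xi> L b) \<longlongrightarrow> ?\<xi>' b) at_top" if "b \<in> ?B" for b
      using that pos by (intro tendsto_mult_left cheb_weight_tendsto) auto
  qed
  ultimately have lim: "((\<lambda>L. LINT \<omega>|M. stat_comb ?B idx_time idx_level snd ?\<xi> L \<omega> ^ m) \<longlongrightarrow>
      complex_of_real (normal_moment (limit_form J \<theta>) m)) at_top" by (simp only: gauss_moment_of_real)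
  have ev: "\<forall>\<^sub>F L in at_top. Re (LINT \<omega>|M. stat_comb ?B idx_time idx_level snd ?\<xi> L \<omega> ^ m) = (LINT \<omega>|M. height_comb J \<theta> L \<omega> ^ m)"
    using eventually_gt_at_top[of 0]
  proof eventually_elim
    case (elim L)
    show ?case
      unfolding height_comb_eq_stat_comb[OF J(1) elim, symmetric] of_real_power[symmetric] integral_complex_of_real by simp
  qed
  show ?thesis using Lim_transform_eventually[OF tendsto_Re[OF lim] ev] by (simp only: Re_complex_of_real)
qed

lemma Lp_height_comb: "finite J \<Longrightarrow> 0 < L \<Longrightarrow> Lp (\<lambda>\<omega>. complex_of_real (height_comb J \<theta> L \<omega>))"
  unfolding of_real_sum of_real_mult by (intro Lp_sum Lp_mult Lp_const Lp_height_moment)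

lemma height_comb_integrable_power:
  assumes "finite J" "0 < L"
  shows "integrable M (\<lambda>\<omega>. height_comb J \<theta> L \<omega> ^ m)"
proof -
  have "Lp (\<lambda>\<omega>. \<Prod>a\<in>{..<m}. complex_of_real (height_comb J \<theta> L \<omega>))"
    by (intro Lp_prod finite_lessThan Lp_height_comb assms)
  from integrable_Re[OF Lp_integrable[OF this]] show ?thesis
    by (simp add: prod_constant flip: of_real_power del: of_real_sum)
qed

text \<open>The form is a limit of second moments. This yields the positive semidefiniteness on
  which the construction of the Gaussian family rests.\<close>

lemma limit_form_nonneg:
  assumes "finite J" "J \<subseteq> moment_indices"
  shows "0 \<le> limit_form J \<theta>"
proof (rule tendsto_lowerbound)
  show "((\<lambda>L. LINT \<omega>|M. height_comb J \<theta> L \<omega> ^ 2) \<longlongrightarrow> limit_form J \<theta>) at_top"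
    using height_comb_moment_tendsto[OF assms, of \<theta> 2] by (simp add: numeral_2_eq_2)
qed auto

lemma psd_on_moment_cov:
  assumes "finite J" "J \<subseteq> moment_indices"
  shows "psd_on J (moment_cov c)"
  unfolding psd_on_def
proof (intro conjI ballI allI)
  show "moment_cov c i j = moment_cov c j i" if "i \<in> J" "j \<in> J" for i j
    by (rule moment_cov_commute) (use that assms in auto)
qed (rule limit_form_nonneg[OF assms])

lemma height_comb_iexp_tendsto:
  assumes J: "finite J" "J \<subseteq> moment_indices"
  shows "((\<lambda>L. LINT \<omega>|M. iexp (height_comb J \<theta> L \<omega>)) \<longlongrightarrow> complex_of_real (exp (- limit_form J \<theta> / 2))) at_top"
proof (rule moments_imp_iexp)
  show "prob_space M" by unfold_locales
  show "0 \<le> limit_form J \<theta>" by (rule limit_form_nonneg[OF J])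
  have ev: "\<forall>\<^sub>F L :: real in at_top. 0 < L" by (rule eventually_gt_at_top)
  show "\<forall>\<^sub>F L in at_top. height_comb J \<theta> L \<in> borel_measurable M"
    using ev by eventually_elim (intro borel_measurable_sum borel_measurable_times borel_measurable_const height_moment_measurable)
  show "\<forall>\<^sub>F L in at_top. integrable M (\<lambda>\<omega>. height_comb J \<theta> L \<omega> ^ k)" for k
    using ev by eventually_elim (rule height_comb_integrable_power[OF J(1)])
qed (rule height_comb_moment_tendsto[OF J])

end

text \<open>Covariances come from polarisation: the second moment of \<open>G i + G j\<close> is
  known because this sum is again normal with known characteristic function.\<close>

lemma centered_gaussian_familyI:
  assumes N: "prob_space N" and G: "\<And>i. i \<in> I \<Longrightarrow> G i \<in> borel_measurable N"
    and K: "\<And>J. finite J \<Longrightarrow> J \<subseteq> I \<Longrightarrow> psd_on J K"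
    and char: "\<And>J \<theta>. finite J \<Longrightarrow> J \<subseteq> I \<Longrightarrow> (LINT \<omega>|N. iexp (\<Sum>j\<in>J. \<theta> j * G j \<omega>)) =
      complex_of_real (exp (- (\<Sum>i\<in>J. \<Sum>j\<in>J. \<theta> i * \<theta> j * K i j) / 2))"
  shows "centered_gaussian_family N I G K"
    and "\<And>i. i \<in> I \<Longrightarrow> integrable N (\<lambda>\<omega>. (G i \<omega>)\<^sup>2) \<and> (LINT \<omega>|N. (G i \<omega>)\<^sup>2) = K i i"
proof -
  interpret prob_space N by fact
  define V where "V J a \<omega> = (\<Sum>i\<in>J. a i * G i \<omega>)" for J a \<omega>
  define q where "q J a = (\<Sum>i\<in>J. \<Sum>j\<in>J. a i * a j * K i j)" for J a
  have meas: "V J a \<in> borel_measurable N" if "J \<subseteq> I" for J a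
    unfolding V_def[abs_def] by (intro borel_measurable_sum borel_measurable_times borel_measurable_const G) (use that in auto)
  have q0: "0 \<le> q J a" if "finite J" "J \<subseteq> I" for J a using K[OF that] unfolding psd_on_def q_def by blast
  have ch: "(LINT \<omega>|N. iexp (t * V J a \<omega>)) = complex_of_real (exp (- (t\<^sup>2 * q J a) / 2))" if "finite J" "J \<subseteq> I" for J a t
  proof -
    have "t * V J a \<omega> = (\<Sum>j\<in>J. (t * a j) * G j \<omega>)" for \<omega> by (simp add: V_def sum_distrib_left mult.assoc)
    moreover have "(\<Sum>i\<in>J. \<Sum>j\<in>J. (t * a i) * (t * a j) * K i j) = t\<^sup>2 * q J a"
      unfolding q_def sum_distrib_left by (intro sum.cong refl) (simp add: power2_eq_square mult_ac)
    ultimately show ?thesis using char[OF that, of "\<lambda>j. t * a j"] by (simp only:)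
  qed
  note normal = iexp_imp_normal[OF N meas q0 ch] and second = normal_second_moment[OF N meas q0 ch]
  have single: "V {i} (\<lambda>_. 1) = G i" "q {i} (\<lambda>_. 1) = K i i" for i by (auto simp: V_def q_def)
  have m: "(LINT \<omega>|N. G i \<omega>) = 0" "integrable N (\<lambda>\<omega>. (G i \<omega>)\<^sup>2)" "(LINT \<omega>|N. (G i \<omega>)\<^sup>2) = K i i" if "i \<in> I" for i
    using second[of "{i}" "\<lambda>_. 1"] that unfolding single by simp_all
  show "integrable N (\<lambda>\<omega>. (G i \<omega>)\<^sup>2) \<and> (LINT \<omega>|N. (G i \<omega>)\<^sup>2) = K i i" if "i \<in> I" for i
    using m[OF that] by blast
  show "centered_gaussian_family N I G K"
    unfolding centered_gaussian_family_def
  proof (intro conjI allI ballI impI)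
    fix J a assume J: "finite J \<and> J \<subseteq> I"
    show "gaussian_variable N (\<lambda>\<omega>. \<Sum>i\<in>J. a i * G i \<omega>)"
      using normal[of J a] meas[of J a] q0[of J a] J
      unfolding gaussian_variable_def V_def[symmetric] by (metis order_le_less real_sqrt_gt_0_iff)
  next
    fix i j assume ij: "i \<in> I" "j \<in> I"
    show "(LINT \<omega>|N. G i \<omega> * G j \<omega>) = K i j"
    proof (cases "i = j")
      case True
      then show ?thesis using m(3)[OF ij(1)] by (simp add: power2_eq_square)
    next
      case False
      have V2: "V {i, j} (\<lambda>_. 1) = (\<lambda>\<omega>. G i \<omega> + G j \<omega>)" "q {i, j} (\<lambda>_. 1) = K i i + K i j + K j i + K j j"
        using False by (auto simp: V_def q_def)
      have "psd_on {i, j} K" by (rule K) (use ij in auto)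
      then have sym: "K j i = K i j" unfolding psd_on_def by blast
      have s: "integrable N (\<lambda>\<omega>. (G i \<omega> + G j \<omega>)\<^sup>2)" "(LINT \<omega>|N. (G i \<omega> + G j \<omega>)\<^sup>2) = K i i + K i j + K j i + K j j"
        using second(2,3)[of "{i, j}" "\<lambda>_. 1"] ij unfolding V2 by simp_all
      have "G i \<omega> * G j \<omega> = ((G i \<omega> + G j \<omega>)\<^sup>2 - (G i \<omega>)\<^sup>2 - (G j \<omega>)\<^sup>2) / 2" for \<omega>
        by (simp add: power2_eq_square algebra_simps)
      then have "(LINT \<omega>|N. G i \<omega> * G j \<omega>) = (LINT \<omega>|N. ((G i \<omega> + G j \<omega>)\<^sup>2 - (G i \<omega>)\<^sup>2 - (G j \<omega>)\<^sup>2) / 2)"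
        by (simp only:)
      also have "\<dots> = ((LINT \<omega>|N. (G i \<omega> + G j \<omega>)\<^sup>2) - (LINT \<omega>|N. (G i \<omega>)\<^sup>2) - (LINT \<omega>|N. (G j \<omega>)\<^sup>2)) / 2"
        using s(1) m(2)[OF ij(1)] m(2)[OF ij(2)] by simp
      finally show ?thesis unfolding s(2) m(3)[OF ij(1)] m(3)[OF ij(2)] sym by simp
    qed
  qed (use N m in auto)
qed

theorem theorem2:
  fixes M :: "'a measure" and \<beta> :: nat
    and Z :: "nat \<Rightarrow> nat \<Rightarrow> real \<Rightarrow> 'a \<Rightarrow> complex"
    and Y :: "nat \<Rightarrow> real \<Rightarrow> 'a \<Rightarrow> real"
  assumes "time_dependent_wigner M \<beta> Z Y"
  shows "\<exists>(N :: (real \<times> real \<times> nat \<Rightarrow> real) measure) G.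
    centered_gaussian_family N {(\<tau>, y, k). 0 < y} G (moment_cov (wigner_cov M \<beta> Y)) \<and>
    fdd_converges M {(\<tau>, y, k). 0 < y} (height_moment M \<beta> Z Y) N G"
proof -
  interpret time_dependent_wigner M \<beta> Z Y by fact
  obtain N :: "(real \<times> real \<times> nat \<Rightarrow> real) measure" where N: "prob_space N"
    and coord: "\<And>i. i \<in> moment_indices \<Longrightarrow> (\<lambda>\<omega>. \<omega> i) \<in> borel_measurable N"
    and char: "\<And>J \<theta>. finite J \<Longrightarrow> J \<subseteq> moment_indices \<Longrightarrow> (LINT \<omega>|N. iexp (\<Sum>j\<in>J. \<theta> j * \<omega> j)) =
      complex_of_real (exp (- limit_form J \<theta> / 2))"
    using gaussian_process_exists[of moment_indices "moment_cov c", OF psd_on_moment_cov] by auto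
  have gauss: "centered_gaussian_family N moment_indices (\<lambda>i \<omega>. \<omega> i) (moment_cov c)"
    by (rule centered_gaussian_familyI(1)[OF N], erule coord, erule (1) psd_on_moment_cov, erule (1) char)
  have second: "integrable N (\<lambda>\<omega>. (\<omega> i)\<^sup>2) \<and> (LINT \<omega>|N. (\<omega> i)\<^sup>2) = moment_cov c i i" if "i \<in> moment_indices" for i
    by (rule centered_gaussian_familyI(2)[where I = moment_indices and G = "\<lambda>i \<omega>. \<omega> i" and K = "moment_cov c", OF N],
      erule coord, erule (1) psd_on_moment_cov, erule (1) char, rule that)
  have ev: "\<forall>\<^sub>F L :: real in at_top. 0 < L" by (rule eventually_gt_at_top)
  have fdd: "fdd_converges M moment_indices (height_moment M \<beta> Z Y) N (\<lambda>i \<omega>. \<omega> i)"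
    unfolding fdd_converges_def
  proof (intro conjI ballI allI impI)
    show "\<forall>\<^sub>F L in at_top. height_moment M \<beta> Z Y L i \<in> borel_measurable M" for i
      using ev by eventually_elim (rule height_moment_measurable)
    show "(\<lambda>\<omega>. \<omega> i) \<in> borel_measurable N" if "i \<in> moment_indices" for i using coord[OF that] .
    fix J and f :: "(real \<times> real \<times> nat \<Rightarrow> real) \<Rightarrow> real"
    assume *: "finite J \<and> J \<subseteq> moment_indices \<and>
      continuous_map (product_topology (\<lambda>_. euclideanreal) J) euclideanreal f \<and> bounded (f ` (\<Pi>\<^sub>E i\<in>J. UNIV))"
    then have J: "finite J" "J \<subseteq> moment_indices" by blast+
    \<comment> \<open>The limiting variances plus a margin of 1, so that the second moments stay
      below \<open>D\<close> for all large \<open>L\<close>.\<close>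
    define D where "D = (\<Sum>i\<in>J. \<bar>moment_cov c i i\<bar> + 1)"
    have D: "moment_cov c i i + 1 \<le> D" if "i \<in> J" for i
    proof -
      have "\<bar>moment_cov c i i\<bar> + 1 \<le> D" unfolding D_def using that J by (intro member_le_sum) auto
      then show ?thesis by linarith
    qed
    show "((\<lambda>L. LINT \<omega>|M. f (\<lambda>i\<in>J. height_moment M \<beta> Z Y L i \<omega>)) \<longlongrightarrow> (LINT \<omega>|N. f (\<lambda>i\<in>J. \<omega> i))) at_top"
    proof (rule iexp_tendsto_imp_weak[where D = D, OF prob_space_axioms N J(1)])
      have "\<forall>\<^sub>F L in at_top. (LINT \<omega>|M. (height_moment M \<beta> Z Y L j \<omega>)\<^sup>2) \<le> D" if j: "j \<in> J" for j
      proof -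
        have "((\<lambda>L. LINT \<omega>|M. (height_moment M \<beta> Z Y L j \<omega>)\<^sup>2) \<longlongrightarrow> moment_cov c j j) at_top"
          using height_comb_moment_tendsto[of "{j}" "\<lambda>_. 1" 2] J j by (auto simp: numeral_2_eq_2)
        from order_tendstoD(2)[OF this, of D] show ?thesis
          using D[OF j] by (auto elim: eventually_mono)
      qed
      then have "\<forall>\<^sub>F L in at_top. \<forall>j\<in>J. (LINT \<omega>|M. (height_moment M \<beta> Z Y L j \<omega>)\<^sup>2) \<le> D"
        using J(1) by (simp add: eventually_ball_finite_distrib)
      then show "\<forall>\<^sub>F L in at_top. \<forall>j\<in>J. height_moment M \<beta> Z Y L j \<in> borel_measurable M \<and>
          integrable M (\<lambda>\<omega>. (height_moment M \<beta> Z Y L j \<omega>)\<^sup>2) \<and> (LINT \<omega>|M. (height_moment M \<beta> Z Y L j \<omega>)\<^sup>2) \<le> D"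
        using ev
      proof eventually_elim
        case (elim L)
        then show ?case
          using height_moment_measurable[of L] height_comb_integrable_power[of "{_}" L "\<lambda>_. 1" 2] by simp
      qed
      show "(\<lambda>\<omega>. \<omega> j) \<in> borel_measurable N \<and> integrable N (\<lambda>\<omega>. (\<omega> j)\<^sup>2) \<and> (LINT \<omega>|N. (\<omega> j)\<^sup>2) \<le> D" if "j \<in> J" for j
      proof -
        have j: "j \<in> moment_indices" using that J(2) by blast
        show ?thesis using coord[OF j] second[OF j] D[OF that] by simp
      qed
      show "((\<lambda>L. LINT \<omega>|M. iexp (\<Sum>j\<in>J. \<theta> j * height_moment M \<beta> Z Y L j \<omega>)) \<longlongrightarrow>
          (LINT \<omega>|N. iexp (\<Sum>j\<in>J. \<theta> j * \<omega> j))) at_top" for \<theta>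
        unfolding char[OF J] by (rule height_comb_iexp_tendsto[OF J])
    qed (use * in blast)+
  qed
  show ?thesis by (rule exI[of _ N], rule exI[of _ "\<lambda>i \<omega>. \<omega> i"], rule conjI[OF gauss fdd])
qed

end
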